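(* Assume A1, A2 and A3 (and the standing fractional-linear assumption). Then there is a constant $c\in(0,\infty)$ such that, as $n\to\infty$, $$\mathbf{P}(T=n+1)\sim c\,n^{-3/2},$$ and the conditional laws $\mathcal{L}(Z_n\mid T=n+1)$ converge weakly to the law of a non-degenerate random variable $Y$ with $\mathbf{P}(Y<\infty)=1$.
   Context: Let $\mathcal{M}$ be the space of probability measures on $\mathbb{N}_0=\{0,1,2,\dots\}$, $Q$ a random element of $\mathcal{M}$, and $Q_1,Q_2,\dots$ i.i.d. copies of $Q$ (the random environment $\Pi=(Q_1,Q_2,\dots)$). A branching process in random environment (BPRE) $(Z_n)_{n\ge0}$ with $Z_0=1$ is defined by: given $\Pi$, $Z_n=\sum_{i=1}^{Z_{n-1}}\xi_{ni}$, where, conditionally on $\Pi$, the $\xi_{ni}$ are independent and $\xi_{ni}$ has law $Q_n$. $\mathbf{P}$ denotes the underlying (annealed) probability. Let $f_n(s)=\sum_{i\ge0}s^iQ_n(\{i\})$ and $f(s)=\sum_i s^iQ(\{i\})$ be the offspring generating functions, $X_n=\ln f_n'(1)$, $\eta_n=f_n''(1)/(2(f_n'(1))^2)$, and $(f,X,\eta)$ distributed as $(f_1,X_1,\eta_1)$. The associated random walk is $S_0=0$, $S_n=X_1+\dots+X_n$. Standing assumption: the offspring laws are fractional-linear, i.e. a.s. for all $n$ and $s\in[0,1)$, $\frac{1}{1-f_n(s)}=\frac{e^{-X_n}}{1-s}+\eta_n$. $T=\min\{k\ge0: Z_k=0\}$ is the extinction time. A1: there is $\chi\in(0,1/2)$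 with $\chi\le f(0)\le 1-\chi$ and $\eta\ge\chi$ a.s. A2: $X$ has mean zero, finite positive variance $\sigma^2$, and non-lattice distribution. A3: with $m(Q)=\sum_y yQ(\{y\})$ and $\zeta(a)=\sum_{y\ge a}y^2Q(\{y\})/m(Q)^2$, there exist $\varepsilon>0$ and $a\in\mathbb{N}$ with $\mathbf{E}[(\log^+\zeta(a))^{2+\varepsilon}]<\infty$, where $\log^+x=\log\max\{x,1\}$. *)

theory Defs
  imports "HOL-Probability.Probability" "HOL-Library.Landau_Symbols"
begin

text \<open>An offspring law (probability measure on the nonnegative integers) is represented
  by its weight sequence q :: nat => real, q k = Q({k}).\<close>

definition gf :: "(nat \<Rightarrow> real) \<Rightarrow> real \<Rightarrow> real" where
  "gf q s = (\<Sum>k. q k * s ^ k)"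

definition off_mean :: "(nat \<Rightarrow> real) \<Rightarrow> real" where
  "off_mean q = (\<Sum>k. real k * q k)"

definition off_fm2 :: "(nat \<Rightarrow> real) \<Rightarrow> real" where
  "off_fm2 q = (\<Sum>k. real k * (real k - 1) * q k)"

definition off_X :: "(nat \<Rightarrow> real) \<Rightarrow> real" where
  "off_X q = ln (off_mean q)"

definition off_eta :: "(nat \<Rightarrow> real) \<Rightarrow> real" where
  "off_eta q = off_fm2 q / (2 * (off_mean q)\<^sup>2)"

definition is_offspring_law :: "(nat \<Rightarrow> real) \<Rightarrow> bool" where
  "is_offspring_law q \<longleftrightarrow> (\<forall>k. 0 \<le> q k) \<and> q sums 1"

definition fractional_linear :: "(nat \<Rightarrow> real) \<Rightarrow> bool" where
  "fractional_linear q \<longleftrightarrow>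
     summable (\<lambda>k. real k * q k) \<and> summable (\<lambda>k. real k * (real k - 1) * q k) \<and>
     (\<forall>s. 0 \<le> s \<and> s < 1 \<longrightarrow> 1 / (1 - gf q s) = exp (- off_X q) / (1 - s) + off_eta q)"

definition zeta :: "nat \<Rightarrow> (nat \<Rightarrow> real) \<Rightarrow> real" where
  "zeta a q = (\<Sum>y. if a \<le> y then (real y)\<^sup>2 * q y else 0) / (off_mean q)\<^sup>2"

definition log_plus :: "real \<Rightarrow> real" where
  "log_plus x = ln (max x 1)"

definition lattice_rv :: "'a measure \<Rightarrow> ('a \<Rightarrow> real) \<Rightarrow> bool" where
  "lattice_rv M X \<longleftrightarrow> (\<exists>a h. h > 0 \<and> (AE \<omega> in M. \<exists>k::int. X \<omega> = a + h * of_int k))"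

definition extinction_time :: "(nat \<Rightarrow> 'a \<Rightarrow> nat) \<Rightarrow> 'a \<Rightarrow> enat" where
  "extinction_time Z \<omega> = (if \<exists>k. Z k \<omega> = 0 then enat (LEAST k. Z k \<omega> = 0) else \<infinity>)"

end

(*
  Given the environment, Z_n has the fractional-linear law
  P(Z_n = i + 1) = a b^i / (a + b)^(i + 2), with a = exp(-S_n) and
  b = sum_{k<n} eta_{k+1} exp(-S_k), and Q_{n+1} is independent of it. So
  P(T = n + 1, Z_n = i + 1) is a constant times u_i(n) = E[a b^i / (a + b)^(i + 2)],
  and everything follows from n^(3/2) u_i(n) -> p_i in (0, oo) with bounds uniform
  in i. Since b is at least a constant times exp(-min_k S_k), the integrand is at most
  a multiple of exp(L_n - (S_n - L_n)) with L_n the running minimum. Spitzer's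
  identity turns the expectations of exp(alpha L_n - beta (S_n - L_n)) into an
  exponential recursion whose coefficients are controlled by the local limit theorem;
  this gives the rate n^(-3/2) for all alpha, beta > 0 and, by Weierstrass
  approximation, the limit for all continuous functionals of (L_n, S_n - L_n).
  Finally b is approximated by its first K and last K summands.
*)
theory Submission
  imports Defs "HOL-Library.Poly_Mapping"
    "HOL-Real_Asymp.Real_Asymp" "HOL-Complex_Analysis.Complex_Analysis"
begin

section \<open>A local limit theorem\<close>

text \<open>The exponent 3/2 is produced by the recursion n b_n = sum_k c_k b_(n-k): each c_k is the
  mean of an exponentially decaying function of S_k, so it is of order k^(-1/2); then b is summable
  and b_n is of order n^(-1) n^(-1/2). The obstacle is that Spitzer's identity sees only L_n and S_n
  - L_n, whereas b depends on the whole path. Under the relevant weight the walk is low only near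
  the two ends of time, so the middle terms exp(-S_k) are negligible. Proving this takes bounds for
  walks started at an arbitrary level z >= 0, growing at most linearly in z; these come from
  association, martingale and time-reversal arguments. Fractional linearity makes 1/(1 - f(s))
  affine in 1/(1 - s), so compositions stay explicit. At s = 0 it combines with A1 to exp(-X) + eta
  <= 1/chi: the steps are bounded below, and no jump to a new minimum can spoil the lower bound for
  b. Averaging over Q_(n+1) contributes E f(0)^(i+1) <= (1 - chi)^(i+1), which makes the sum over i
  uniform in n.\<close>

definition tent :: "real \<Rightarrow> real" where "tent t = max 0 (1 - \<bar>t\<bar>)"

definition fejer :: "real \<Rightarrow> real" where
  "fejer x = (if x = 0 then 1 else 2 * (1 - cos x) / x\<^sup>2)"

lemma tent_measurable [measurable]: "tent \<in> borel_measurable borel"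
  unfolding tent_def by measurable

lemma fejer_measurable [measurable]: "fejer \<in> borel_measurable borel"
  unfolding fejer_def by measurable

lemma tent_nonneg: "0 \<le> tent t" and tent_le_1: "tent t \<le> 1"
  by (auto simp: tent_def)

lemma tent_eq_0: "\<bar>t\<bar> > 1 \<Longrightarrow> tent t = 0" by (simp add: tent_def)

lemma continuous_tent: "isCont tent t"
  unfolding tent_def by (intro continuous_intros)

text \<open>The transform of \<open>fejer\<close> has compact support, so smoothing with
  \<open>fejer\<close> brings in a characteristic function only on a bounded interval, where it can
  be estimated.\<close>

lemma tent_fourier:
  "has_bochner_integral lborel (\<lambda>t. complex_of_real (tent t) * iexp (t * x)) (complex_of_real (fejer x))"
proof (cases "x = 0")
  case True
  have 1: "has_bochner_integral lborel (\<lambda>t. indicator {-1..0} t *\<^sub>R complex_of_real (1 + t)) (complex_of_real (0 + 0\<^sup>2/2) - complex_of_real (-1 + (-1)\<^sup>2/2))"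
    by (rule has_bochner_integral_FTC_Icc[where F = "\<lambda>t. complex_of_real (t + t\<^sup>2/2)"])
       (auto intro!: derivative_eq_intros has_vector_derivative_of_real continuous_intros simp del: of_real_add of_real_diff of_real_divide of_real_power)
  have 2: "has_bochner_integral lborel (\<lambda>t. indicator {0..1} t *\<^sub>R complex_of_real (1 - t)) (complex_of_real (1 - 1\<^sup>2/2) - complex_of_real (0 - 0\<^sup>2/2))"
    by (rule has_bochner_integral_FTC_Icc[where F = "\<lambda>t. complex_of_real (t - t\<^sup>2/2)"])
       (auto intro!: derivative_eq_intros has_vector_derivative_of_real continuous_intros simp del: of_real_add of_real_diff of_real_divide of_real_power)
  have "has_bochner_integral lborel (\<lambda>t. complex_of_real (tent t) * iexp (t * x)) ((complex_of_real (0 + 0\<^sup>2/2) - complex_of_real (-1 + (-1)\<^sup>2/2)) + (complex_of_real (1 - 1\<^sup>2/2) - complex_of_real (0 - 0\<^sup>2/2)))"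
    by (rule iffD1[OF has_bochner_integral_cong_AE has_bochner_integral_add[OF 1 2]])
       (use AE_lborel_singleton[of 0] in \<open>auto elim!: eventually_mono simp: True tent_def indicator_def\<close>)
  thus ?thesis by (simp add: True fejer_def)
next
  case False
  define a where "a = 1 / (\<i> * complex_of_real x)"
  define b where "b = 1 / (complex_of_real x)\<^sup>2"
  have a: "\<i> * x * a = 1" and b: "\<i> * x * b = - a" using False by (auto simp: a_def b_def power2_eq_square field_simps)
  \<comment> \<open>Antiderivatives of the two linear halves of the tent times iexp, from
    integration by parts: the identities \<open>a\<close> * ix = 1 and \<open>b\<close> * ix =
    -\<open>a\<close> are what cancels the extra terms.\<close>
  define F1 where "F1 t = iexp (t * x) * ((1 + complex_of_real t) * a + b)" for t :: real
  define F2 where "F2 t = iexp (t * x) * ((1 - complex_of_real t) * a - b)" for t :: real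
  have d1: "(F1 has_vector_derivative complex_of_real (1 + t) * iexp (t * x)) (at t within S)" for t S
  proof -
    have "((\<lambda>z. exp (\<i> * (z * x)) * ((1 + z) * a + b)) has_field_derivative exp (\<i> * (t * x)) * (\<i> * x) * ((1 + t) * a + b) + exp (\<i> * (t * x)) * a) (at (complex_of_real t))"
      by (rule derivative_eq_intros refl | simp)+
    moreover have "exp (\<i> * (t * x)) * (\<i> * x) * ((1 + t) * a + b) + exp (\<i> * (t * x)) * a = complex_of_real (1 + t) * iexp (t * x)"
    proof -
      have "exp (\<i> * (t * x)) * (\<i> * x) * ((1 + t) * a + b) + exp (\<i> * (t * x)) * a = exp (\<i> * (t * x)) * ((1 + t) * (\<i> * x * a) + (\<i> * x * b) + a)"
        by (simp add: algebra_simps)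
      thus ?thesis unfolding a b by simp
    qed
    ultimately have "((\<lambda>z. exp (\<i> * (z * x)) * ((1 + z) * a + b)) has_field_derivative complex_of_real (1 + t) * iexp (t * x)) (at (complex_of_real t))" by simp
    from has_vector_derivative_real_field[OF this, of S] show ?thesis unfolding F1_def by simp
  qed
  have d2: "(F2 has_vector_derivative complex_of_real (1 - t) * iexp (t * x)) (at t within S)" for t S
  proof -
    have "((\<lambda>z. exp (\<i> * (z * x)) * ((1 - z) * a - b)) has_field_derivative exp (\<i> * (t * x)) * (\<i> * x) * ((1 - t) * a - b) + exp (\<i> * (t * x)) * (- a)) (at (complex_of_real t))"
      by (rule derivative_eq_intros refl | simp)+
    moreover have "exp (\<i> * (t * x)) * (\<i> * x) * ((1 - t) * a - b) + exp (\<i> * (t * x)) * (- a) = complex_of_real (1 - t) * iexp (t * x)"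
    proof -
      have "exp (\<i> * (t * x)) * (\<i> * x) * ((1 - t) * a - b) + exp (\<i> * (t * x)) * (- a) = exp (\<i> * (t * x)) * ((1 - t) * (\<i> * x * a) - (\<i> * x * b) - a)"
        by (simp add: algebra_simps)
      thus ?thesis unfolding a b by simp
    qed
    ultimately have "((\<lambda>z. exp (\<i> * (z * x)) * ((1 - z) * a - b)) has_field_derivative complex_of_real (1 - t) * iexp (t * x)) (at (complex_of_real t))" by simp
    from has_vector_derivative_real_field[OF this, of S] show ?thesis unfolding F2_def by simp
  qed
  have 1: "has_bochner_integral lborel (\<lambda>t. indicator {-1..0} t *\<^sub>R (complex_of_real (1 + t) * iexp (t * x))) (F1 0 - F1 (-1))"
    by (rule has_bochner_integral_FTC_Icc[OF _ d1]) (auto intro!: continuous_intros)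
  have 2: "has_bochner_integral lborel (\<lambda>t. indicator {0..1} t *\<^sub>R (complex_of_real (1 - t) * iexp (t * x))) (F2 1 - F2 0)"
    by (rule has_bochner_integral_FTC_Icc[OF _ d2]) (auto intro!: continuous_intros)
  have "has_bochner_integral lborel (\<lambda>t. complex_of_real (tent t) * iexp (t * x)) ((F1 0 - F1 (-1)) + (F2 1 - F2 0))"
    by (rule iffD1[OF has_bochner_integral_cong_AE has_bochner_integral_add[OF 1 2]])
       (use AE_lborel_singleton[of 0] in \<open>auto elim!: eventually_mono simp: tent_def indicator_def\<close>)
  moreover have "(F1 0 - F1 (-1)) + (F2 1 - F2 0) = complex_of_real (fejer x)"
  proof -
    have e: "iexp (-1 * x) + iexp (1 * x) = complex_of_real (2 * cos x)"
      by (simp add: complex_eq_iff Re_exp Im_exp)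
    have "(F1 0 - F1 (-1)) + (F2 1 - F2 0) = b * (2 - (iexp (-1 * x) + iexp (1 * x)))" unfolding F1_def F2_def by (simp add: algebra_simps)
    thus ?thesis unfolding e using False by (simp add: fejer_def b_def)
  qed
  ultimately show ?thesis by simp
qed

lemma fejer_nonneg: "0 \<le> fejer x" by (simp add: fejer_def)

text \<open>A Fourier transform of a nonnegative function is bounded by its total mass, which is the
  value of the transform at 0.\<close>

lemma fejer_le_1: "fejer x \<le> 1"
proof -
  have "cmod (complex_of_real (fejer x)) \<le> (\<integral>t. norm (complex_of_real (tent t) * iexp (t * x)) \<partial>lborel)"
    using integral_norm_bound[of lborel "\<lambda>t. complex_of_real (tent t) * iexp (t * x)"]
      has_bochner_integral_integral_eq[OF tent_fourier[of x]] by (metis)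
  also have "\<dots> = (\<integral>t. tent t \<partial>lborel)" using tent_nonneg by (simp add: norm_mult)
  also have "\<dots> = 1"
  proof -
    have "complex_of_real (\<integral>t. tent t \<partial>lborel) = complex_of_real 1"
      using has_bochner_integral_integral_eq[OF tent_fourier[of 0]] by (simp add: fejer_def)
    thus ?thesis by (simp only: of_real_eq_iff)
  qed
  finally show ?thesis using fejer_nonneg by simp
qed

lemma isCont_fejer: "isCont fejer x"
proof (cases "x = 0")
  case False
  have ev: "eventually (\<lambda>y. fejer y = 2 * (1 - cos y) / y\<^sup>2) (nhds x)"
    using t1_space_nhds[OF False] by (auto elim!: eventually_mono simp: fejer_def)
  have "isCont (\<lambda>y. 2 * (1 - cos y) / y\<^sup>2) x" using False by (intro continuous_intros) auto
  thus ?thesis using isCont_cong[OF ev] by simp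
next
  case True
  have "((\<lambda>y::real. 2 * (1 - cos y) / y\<^sup>2) \<longlongrightarrow> 1) (at 0)" by real_asymp
  hence "(fejer \<longlongrightarrow> 1) (at 0)"
    by (rule Lim_transform_eventually) (auto simp: fejer_def eventually_at_filter)
  thus ?thesis unfolding isCont_def True by (simp add: fejer_def)
qed

text \<open>The Fejer kernel vanishes at the nonzero multiples of \<open>2\<pi>\<close>; the unit shift removes the zeros, so that
  domination by a multiple of the kernel is available everywhere.\<close>
definition fker :: "real \<Rightarrow> real" where "fker x = fejer x + fejer (x + 1)"

lemma fker_measurable [measurable]: "fker \<in> borel_measurable borel" unfolding fker_def by measurable

lemma isCont_fker: "isCont fker x"
  unfolding fker_def by (intro continuous_intros isCont_fejer isCont_o2[OF _ isCont_fejer])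

lemma fker_le_2: "fker x \<le> 2" using fejer_le_1[of x] fejer_le_1[of "x+1"] by (simp add: fker_def)

lemma fejer_upper: "fejer x \<le> 8 / (1 + x\<^sup>2)"
proof (cases "\<bar>x\<bar> \<le> 1")
  case True
  hence "x\<^sup>2 \<le> 1" by (simp add: abs_square_le_1)
  hence "1 \<le> 8 / (1 + x\<^sup>2)" by (subst le_divide_eq) (auto simp: add_pos_nonneg)
  thus ?thesis using fejer_le_1[of x] by linarith
next
  case False
  hence "1\<^sup>2 < \<bar>x\<bar>\<^sup>2" by (intro power_strict_mono) auto
  hence x: "x\<^sup>2 > 1" by simp
  have c: "1 - cos x \<le> 2" using cos_ge_minus_one[of x] by linarith
  have "(1 + x\<^sup>2) * (1 - cos x) \<le> (2 * x\<^sup>2) * 2" using x c by (intro mult_mono) auto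
  hence "2 * (1 - cos x) * (1 + x\<^sup>2) \<le> 8 * x\<^sup>2" by (simp add: algebra_simps)
  hence "2 * (1 - cos x) / x\<^sup>2 \<le> 8 / (1 + x\<^sup>2)" using x by (intro iffD2[OF frac_le_eq] iffD2[OF divide_le_0_iff]) (auto simp: add_pos_nonneg)
  thus ?thesis using x by (auto simp: fejer_def)
qed

text \<open>The numerators add up to a multiple of 2 - cos x - cos (x + 1) = 2 - 2 cos (x + 1/2) cos
  (1/2), which stays above 2 - 2 cos (1/2) > 0; both denominators are at most (1 + |x|)^2.\<close>

lemma fker_lower: "\<exists>c>0. \<forall>x. fker x \<ge> c / (1 + x\<^sup>2)"
proof -
  define d where "d = 2 * (1 - cos (1/2 :: real))"
  have d: "d > 0" unfolding d_def using cos_monotone_0_pi[of 0 "1/2"] pi_gt3 by simp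
  have fl: "fejer x \<ge> 2 * (1 - cos x) / (1 + \<bar>y\<bar>)\<^sup>2" if "\<bar>x\<bar> \<le> 1 + \<bar>y\<bar>" for x y :: real
  proof (cases "x = 0")
    case False
    have "x\<^sup>2 \<le> (1 + \<bar>y\<bar>)\<^sup>2" using that abs_le_square_iff[of x "1 + \<bar>y\<bar>"] by simp
    thus ?thesis using False by (auto simp: fejer_def intro!: divide_left_mono mult_pos_pos)
  qed (simp add: fejer_def)
  have "fker x \<ge> d / (1 + x\<^sup>2)" for x
  proof -
    have sq: "(1 + \<bar>x\<bar>)\<^sup>2 \<le> 2 * (1 + x\<^sup>2)"
    proof -
      have "0 \<le> (1 - \<bar>x\<bar>)\<^sup>2" by simp
      thus ?thesis by (simp add: power2_diff power2_sum)
    qed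
    have c: "cos x + cos (x + 1) \<le> 2 * cos (1/2)"
    proof -
      have "cos x + cos (x + 1) = 2 * cos (x + 1/2) * cos (1/2)"
        using cos_plus_cos[of "x + 1" x] by (simp add: add.commute add_divide_distrib)
      also have "\<dots> \<le> 2 * 1 * cos (1/2)" using cos_gt_zero[of "1/2"] pi_gt3 by (intro mult_right_mono) auto
      finally show ?thesis by simp
    qed
    have "d / (1 + x\<^sup>2) = 2 * d / (2 * (1 + x\<^sup>2))" by (subst mult_divide_mult_cancel_left) auto
    also have "\<dots> \<le> 2 * d / (1 + \<bar>x\<bar>)\<^sup>2"
      using sq d by (intro divide_left_mono mult_pos_pos) (auto simp: add_nonneg_pos add_pos_nonneg)
    also have "\<dots> \<le> (2 * (1 - cos x) + 2 * (1 - cos (x + 1))) / (1 + \<bar>x\<bar>)\<^sup>2"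
      using c unfolding d_def by (intro divide_right_mono) auto
    also have "\<dots> = 2 * (1 - cos x) / (1 + \<bar>x\<bar>)\<^sup>2 + 2 * (1 - cos (x + 1)) / (1 + \<bar>x\<bar>)\<^sup>2" by (rule add_divide_distrib)
    also have "\<dots> \<le> fker x" unfolding fker_def by (intro add_mono fl) auto
    finally show ?thesis .
  qed
  thus ?thesis using d by blast
qed

lemma fker_pos: "0 < fker x"
proof -
  obtain c where "c > 0" "fker x \<ge> c / (1 + x\<^sup>2)" using fker_lower by blast
  moreover have "c / (1 + x\<^sup>2) > 0" using \<open>c > 0\<close> by (simp add: add_pos_nonneg)
  ultimately show ?thesis by linarith
qed

lemma integrable_one_over_1_plus_square: "integrable lborel (\<lambda>x::real. 1 / (1 + x\<^sup>2))"
proof -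
  have "set_integrable lborel (einterval (-\<infinity>) \<infinity>) (\<lambda>x::real. inverse (1 + x^2))" by (rule integrable_inverse_1_plus_square)
  moreover have "einterval (-\<infinity>) \<infinity> = UNIV" by (auto simp: einterval_def)
  ultimately show ?thesis by (simp add: set_integrable_def inverse_eq_divide)
qed

lemma integrable_fker: "integrable lborel fker"
proof -
  have f: "integrable lborel fejer"
    by (rule Bochner_Integration.integrable_bound[OF integrable_mult_right[OF integrable_one_over_1_plus_square, of 8]])
       (use fejer_upper fejer_nonneg in auto)
  have "integrable lborel (\<lambda>x. fejer (1 + 1 * x))" by (rule lborel_integrable_real_affine[OF f]) simp
  thus ?thesis unfolding fker_def[abs_def] using f by (simp add: add.commute)
qed

text \<open>Fubini. The shift \<open>s\<close> accommodates the second summand of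
  \<open>fker\<close>; the frequency \<theta> is there because the law reweighted by the kernel will
  itself be studied through its characteristic function.\<close>

lemma (in real_distribution) fejer_transform:
  "(\<integral>x. complex_of_real (fejer (x + s)) * iexp (\<theta> * x) \<partial>M) = (\<integral>t. complex_of_real (tent t) * iexp (t * s) * char M (t + \<theta>) \<partial>lborel)"
proof -
  interpret pair_sigma_finite M lborel ..
  have int: "integrable (M \<Otimes>\<^sub>M lborel) (\<lambda>(x, t). complex_of_real (tent t) * iexp (t * (x + s)) * iexp (\<theta> * x))"
  proof (rule Fubini_integrable)
    have "(\<lambda>x. LINT y|lborel. norm (case (x, y) of (x, t) \<Rightarrow> complex_of_real (tent t) * iexp (t * (x + s)) * iexp (\<theta> * x))) = (\<lambda>x. LINT t|lborel. tent t)"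
      using tent_nonneg by (simp add: norm_mult)
    thus "integrable M (\<lambda>x. LINT y|lborel. norm (case (x, y) of (x, t) \<Rightarrow> complex_of_real (tent t) * iexp (t * (x + s)) * iexp (\<theta> * x)))" by simp
    show "AE x in M. integrable lborel (\<lambda>y. case (x, y) of (x, t) \<Rightarrow> complex_of_real (tent t) * iexp (t * (x + s)) * iexp (\<theta> * x))"
      by (intro always_eventually allI, simp only: prod.case) (rule integrable_mult_left[OF integrable.intros[OF tent_fourier]])
  qed simp
  have "(\<integral>x. complex_of_real (fejer (x + s)) * iexp (\<theta> * x) \<partial>M) = (\<integral>x. (\<integral>t. complex_of_real (tent t) * iexp (t * (x + s)) * iexp (\<theta> * x) \<partial>lborel) \<partial>M)"
    by (simp only: integral_mult_left_zero has_bochner_integral_integral_eq[OF tent_fourier])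
  also have "\<dots> = (\<integral>t. (\<integral>x. complex_of_real (tent t) * iexp (t * (x + s)) * iexp (\<theta> * x) \<partial>M) \<partial>lborel)"
    using Fubini_integral[OF int] by simp
  also have "\<dots> = (\<integral>t. (\<integral>x. complex_of_real (tent t) * iexp (t * s) * iexp ((t + \<theta>) * x) \<partial>M) \<partial>lborel)"
    by (intro Bochner_Integration.integral_cong refl) (simp add: algebra_simps exp_add)
  also have "\<dots> = (\<integral>t. complex_of_real (tent t) * iexp (t * s) * char M (t + \<theta>) \<partial>lborel)"
    by (simp add: char_def)
  finally show ?thesis .
qed

lemma integrable_gauss: "c > 0 \<Longrightarrow> integrable lborel (\<lambda>u::real. exp (- (c * u\<^sup>2)))"
proof -
  assume c: "c > 0"
  define s where "s = sqrt (1 / (2 * c))"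
  have s: "s > 0" "s\<^sup>2 = 1 / (2 * c)" using c by (auto simp: s_def)
  have "integrable lborel (normal_density 0 s)" using s by (simp add: integrable_normal_density)
  hence "integrable lborel (\<lambda>u. sqrt (2 * pi * s\<^sup>2) * normal_density 0 s u)" by simp
  moreover have "sqrt (2 * pi * s\<^sup>2) * normal_density 0 s u = exp (- (c * u\<^sup>2))" for u
    using s c by (simp add: normal_density_def)
  ultimately show ?thesis by simp
qed

text \<open>In the transformed integral the substitution t + \<theta> = u / sqrt n magnifies the
  neighbourhood of 0 where the characteristic function lives. Where the tent is nonzero, |t +
  \<theta>| is at most 1 + |\<theta>|, so one constant \<open>c\<close> gives a Gaussian majorant.
  The limit is left as an integral over u: it depends on the laws only through
  \<open>s2\<close>.\<close>

lemma fejer_local_limit: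
  assumes rd: "\<And>n. real_distribution (\<nu> n)"
    and conv: "\<And>u. (\<lambda>n. char (\<nu> n) (u / sqrt (real n))) \<longlonglongrightarrow> complex_of_real (exp (- (s2 * u\<^sup>2 / 2)))"
    and dom: "\<And>A. \<exists>c>0. \<forall>n t. \<bar>t\<bar> \<le> A \<longrightarrow> cmod (char (\<nu> n) t) \<le> exp (- (c * real n * t\<^sup>2))"
  shows "(\<lambda>n. complex_of_real (sqrt (real n)) * (\<integral>x. complex_of_real (fejer (x + s)) * iexp (\<theta> * x) \<partial>\<nu> n))
     \<longlonglongrightarrow> (\<integral>u. complex_of_real (tent (- \<theta>)) * iexp (- \<theta> * s) * complex_of_real (exp (- (s2 * u\<^sup>2 / 2))) \<partial>lborel)"
proof -
  obtain c where c: "c > 0" "\<And>n t. \<bar>t\<bar> \<le> 1 + \<bar>\<theta>\<bar> \<Longrightarrow> cmod (char (\<nu> n) t) \<le> exp (- (c * real n * t\<^sup>2))"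
    using dom[of "1 + \<bar>\<theta>\<bar>"] by blast
  define g where "g n u = complex_of_real (tent (- \<theta> + u / sqrt (real n))) * iexp ((- \<theta> + u / sqrt (real n)) * s) * char (\<nu> n) (u / sqrt (real n))" for n u
  have chm [measurable]: "char (\<nu> n) \<in> borel_measurable borel" for n
    using real_distribution.char_measurable[OF rd] .
  have L: "(\<lambda>n. \<integral>u. g n u \<partial>lborel) \<longlonglongrightarrow> (\<integral>u. complex_of_real (tent (- \<theta>)) * iexp (- \<theta> * s) * complex_of_real (exp (- (s2 * u\<^sup>2 / 2))) \<partial>lborel)"
  \<comment> \<open>At index 0 the quotient u / sqrt 0 is 0 and the Gaussian majorant can fail, so
    the domination is run from index 1.\<close>
  proof (rule LIMSEQ_imp_Suc, rule integral_dominated_convergence[where w = "\<lambda>u. exp (- (c * u\<^sup>2))"])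
    show "integrable lborel (\<lambda>u. exp (- (c * u\<^sup>2)))" by (rule integrable_gauss[OF c(1)])
    show "AE u in lborel. (\<lambda>n. g (Suc n) u) \<longlonglongrightarrow> complex_of_real (tent (- \<theta>)) * iexp (- \<theta> * s) * complex_of_real (exp (- (s2 * u\<^sup>2 / 2)))"
    proof (intro always_eventually allI LIMSEQ_Suc)
      fix u
      have z: "(\<lambda>n. - \<theta> + u / sqrt (real n)) \<longlonglongrightarrow> - \<theta> + 0"
        by (intro tendsto_add tendsto_const real_tendsto_divide_at_top[OF tendsto_const] filterlim_compose[OF sqrt_at_top] filterlim_real_sequentially)
      hence z: "(\<lambda>n. - \<theta> + u / sqrt (real n)) \<longlonglongrightarrow> - \<theta>" by simp
      show "(\<lambda>n. g n u) \<longlonglongrightarrow> complex_of_real (tent (- \<theta>)) * iexp (- \<theta> * s) * complex_of_real (exp (- (s2 * u\<^sup>2 / 2)))"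
        unfolding g_def by (intro tendsto_mult conv tendsto_of_real isCont_tendsto_compose[OF continuous_tent z] tendsto_exp tendsto_const z)
    qed
    show "AE u in lborel. norm (g (Suc n) u) \<le> exp (- (c * u\<^sup>2))" for n
    proof (intro always_eventually allI)
      fix u
      show "norm (g (Suc n) u) \<le> exp (- (c * u\<^sup>2))"
      proof (cases "\<bar>- \<theta> + u / sqrt (real (Suc n))\<bar> \<le> 1")
        case True
        hence "\<bar>u / sqrt (real (Suc n))\<bar> \<le> 1 + \<bar>\<theta>\<bar>" by linarith
        from c(2)[OF this, of "Suc n"] have "cmod (char (\<nu> (Suc n)) (u / sqrt (real (Suc n)))) \<le> exp (- (c * u\<^sup>2))"
          by (simp add: power_divide del: of_nat_Suc)
        hence "norm (g (Suc n) u) \<le> 1 * exp (- (c * u\<^sup>2))" unfolding g_def norm_mult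
          using tent_nonneg tent_le_1 by (intro mult_mono) (auto simp del: of_nat_Suc)
        thus ?thesis by simp
      next
        case False
        thus ?thesis unfolding g_def using tent_eq_0[of "- \<theta> + u / sqrt (real (Suc n))"] by simp
      qed
    qed
  qed (auto simp: g_def)
  have "complex_of_real (sqrt (real n)) * (\<integral>x. complex_of_real (fejer (x + s)) * iexp (\<theta> * x) \<partial>\<nu> n) = (\<integral>u. g n u \<partial>lborel)" if n: "n \<ge> 1" for n
  proof -
    have "(\<integral>x. complex_of_real (fejer (x + s)) * iexp (\<theta> * x) \<partial>\<nu> n) = (\<integral>t. complex_of_real (tent t) * iexp (t * s) * char (\<nu> n) (t + \<theta>) \<partial>lborel)"
      by (rule real_distribution.fejer_transform[OF rd])
    also have "\<dots> = \<bar>1 / sqrt (real n)\<bar> *\<^sub>R (\<integral>u. complex_of_real (tent (- \<theta> + 1 / sqrt (real n) * u)) * iexp ((- \<theta> + 1 / sqrt (real n) * u) * s) * char (\<nu> n) ((- \<theta> + 1 / sqrt (real n) * u) + \<theta>) \<partial>lborel)"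
      by (rule lborel_integral_real_affine) (use n in simp)
    also have "\<dots> = (1 / sqrt (real n)) *\<^sub>R (\<integral>u. g n u \<partial>lborel)" by (simp add: g_def)
    finally show ?thesis using n by (simp add: scaleR_conv_of_real)
  qed
  thus ?thesis
    by (intro Lim_transform_eventually[OF L]) (auto simp: eventually_at_top_linorder intro!: exI[of _ 1])
qed


text \<open>For Gaussian laws the local limit is read off the density: after rescaling, it converges
  pointwise to its value at 0. This case serves to evaluate the limit for all other laws.\<close>

lemma gauss_local_limit:
  fixes f :: "real \<Rightarrow> complex"
  assumes s2: "s2 > 0" and f: "integrable lborel f"
  shows "(\<lambda>n. complex_of_real (sqrt (real n)) * (\<integral>x. f x \<partial>distr std_normal_distribution borel (\<lambda>x. sqrt (s2 * real n) * x)))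
    \<longlonglongrightarrow> complex_of_real (1 / sqrt (2 * pi * s2)) * (\<integral>x. f x \<partial>lborel)"
proof -
  have fm [measurable]: "f \<in> borel_measurable borel" using f by auto
  define g where "g n y = complex_of_real (std_normal_density (y / sqrt (s2 * real n))) * f y" for n y
  have L: "(\<lambda>n. \<integral>y. g n y \<partial>lborel) \<longlonglongrightarrow> (\<integral>y. complex_of_real (std_normal_density 0) * f y \<partial>lborel)"
  proof (rule integral_dominated_convergence[where w = "\<lambda>y. norm (f y)"])
    show "AE y in lborel. (\<lambda>n. g n y) \<longlonglongrightarrow> complex_of_real (std_normal_density 0) * f y"
    proof (intro always_eventually allI)
      fix y
      have "(\<lambda>n. y / sqrt (s2 * real n)) \<longlonglongrightarrow> 0"
        using s2 by (intro real_tendsto_divide_at_top[OF tendsto_const] filterlim_compose[OF sqrt_at_top]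
            filterlim_tendsto_pos_mult_at_top[OF tendsto_const] filterlim_real_sequentially)
      moreover have "isCont std_normal_density 0" unfolding normal_density_def by (intro continuous_intros) auto
      ultimately show "(\<lambda>n. g n y) \<longlonglongrightarrow> complex_of_real (std_normal_density 0) * f y"
        unfolding g_def by (intro tendsto_mult tendsto_of_real tendsto_const isCont_tendsto_compose[of 0 std_normal_density])
    qed
    show "AE y in lborel. norm (g n y) \<le> norm (f y)" for n
    proof (intro always_eventually allI)
      fix y
      have "std_normal_density z \<le> 1" for z
      proof -
        have "1 \<le> sqrt (2 * pi)" using pi_gt3 by (intro real_le_rsqrt) auto
        hence "1 / sqrt (2 * pi) * exp (- z\<^sup>2 / 2) \<le> 1 * 1" by (intro mult_mono) auto
        thus ?thesis by (simp add: std_normal_density_def)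
      qed
      thus "norm (g n y) \<le> norm (f y)" unfolding g_def norm_mult
        by (intro mult_left_le_one_le) auto
    qed
    show "integrable lborel (\<lambda>y. norm (f y))" using f by simp
  qed (auto simp: g_def)
  have "complex_of_real (1 / sqrt s2) * (\<integral>y. g n y \<partial>lborel) = complex_of_real (sqrt (real n)) * (\<integral>x. f x \<partial>distr std_normal_distribution borel (\<lambda>x. sqrt (s2 * real n) * x))"
    if n: "n \<ge> 1" for n
  proof -
    have "(\<integral>x. f x \<partial>distr std_normal_distribution borel (\<lambda>x. sqrt (s2 * real n) * x)) = (\<integral>x. f (sqrt (s2 * real n) * x) \<partial>std_normal_distribution)"
      by (rule integral_distr) auto
    also have "\<dots> = (\<integral>x. std_normal_density x *\<^sub>R f (sqrt (s2 * real n) * x) \<partial>lborel)"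
      by (rule integral_density) auto
    finally have 1: "(\<integral>x. f x \<partial>distr std_normal_distribution borel (\<lambda>x. sqrt (s2 * real n) * x)) = (\<integral>x. std_normal_density x *\<^sub>R f (sqrt (s2 * real n) * x) \<partial>lborel)" .
    have "(\<integral>y. g n y \<partial>lborel) = \<bar>sqrt (s2 * real n)\<bar> *\<^sub>R (\<integral>x. g n (0 + sqrt (s2 * real n) * x) \<partial>lborel)"
      by (rule lborel_integral_real_affine) (use n s2 in auto)
    also have "(\<lambda>x. g n (0 + sqrt (s2 * real n) * x)) = (\<lambda>x. std_normal_density x *\<^sub>R f (sqrt (s2 * real n) * x))"
      using n s2 by (auto simp: g_def scaleR_conv_of_real)
    finally show ?thesis unfolding 1 using s2 by (simp add: scaleR_conv_of_real real_sqrt_mult)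
  qed
  hence ev: "\<forall>\<^sub>F n in sequentially. complex_of_real (1 / sqrt s2) * (\<integral>y. g n y \<partial>lborel) = complex_of_real (sqrt (real n)) * (\<integral>x. f x \<partial>distr std_normal_distribution borel (\<lambda>x. sqrt (s2 * real n) * x))"
    unfolding eventually_at_top_linorder by blast
  have L2: "(\<lambda>n. complex_of_real (1 / sqrt s2) * (\<integral>y. g n y \<partial>lborel)) \<longlonglongrightarrow> complex_of_real (1 / sqrt s2) * (\<integral>y. complex_of_real (std_normal_density 0) * f y \<partial>lborel)"
    by (intro tendsto_mult tendsto_const L)
  have e: "complex_of_real (1 / sqrt s2) * (\<integral>y. complex_of_real (std_normal_density 0) * f y \<partial>lborel) = complex_of_real (1 / sqrt (2 * pi * s2)) * (\<integral>x. f x \<partial>lborel)"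
    by (simp add: std_normal_density_def real_sqrt_mult)
  show ?thesis by (rule Lim_transform_eventually[OF L2[unfolded e] ev])
qed

text \<open>The limit in \<open>fejer_local_limit\<close> is the same for every sequence with the
  same \<open>s2\<close>. Applied to the centred normal laws of variance \<open>s2\<close> n it must
  agree with \<open>gauss_local_limit\<close>, and uniqueness of limits evaluates it without Fourier
  inversion.\<close>

lemma fker_local_limit:
  assumes rd: "\<And>n. real_distribution (\<nu> n)" and s2: "s2 > 0"
    and conv: "\<And>u. (\<lambda>n. char (\<nu> n) (u / sqrt (real n))) \<longlonglongrightarrow> complex_of_real (exp (- (s2 * u\<^sup>2 / 2)))"
    and dom: "\<And>A. \<exists>c>0. \<forall>n t. \<bar>t\<bar> \<le> A \<longrightarrow> cmod (char (\<nu> n) t) \<le> exp (- (c * real n * t\<^sup>2))"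
  shows "(\<lambda>n. complex_of_real (sqrt (real n)) * (\<integral>x. complex_of_real (fker x) * iexp (\<theta> * x) \<partial>\<nu> n))
     \<longlonglongrightarrow> complex_of_real (1 / sqrt (2 * pi * s2)) * (\<integral>x. complex_of_real (fker x) * iexp (\<theta> * x) \<partial>lborel)"
proof -
  define G where "G n = distr std_normal_distribution borel (\<lambda>x. sqrt (s2 * real n) * x)" for n
  interpret N: real_distribution std_normal_distribution by (rule real_dist_normal_dist)
  have Grd: "real_distribution (G n)" for n unfolding G_def by (rule N.real_distribution_distr) auto
  have Gch: "char (G n) t = complex_of_real (exp (- (s2 * real n * t\<^sup>2 / 2)))" for n t
  proof -
    have "char (G n) t = char std_normal_distribution (t * sqrt (s2 * real n))"
      unfolding char_def G_def by (subst integral_distr) (auto simp: algebra_simps)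
    thus ?thesis using s2 by (simp add: char_std_normal_distribution power_mult_distrib algebra_simps)
  qed
  have Gconv: "(\<lambda>n. char (G n) (u / sqrt (real n))) \<longlonglongrightarrow> complex_of_real (exp (- (s2 * u\<^sup>2 / 2)))" for u
    by (rule Lim_transform_eventually[OF tendsto_const])
       (auto simp: Gch power_divide eventually_at_top_linorder intro!: exI[of _ 1])
  have Gdom: "\<exists>c>0. \<forall>n t. \<bar>t\<bar> \<le> A \<longrightarrow> cmod (char (G n) t) \<le> exp (- (c * real n * t\<^sup>2))" for A
    by (rule exI[of _ "s2/2"]) (use s2 in \<open>auto simp: Gch\<close>)
  have fs: "integrable lborel (\<lambda>x. complex_of_real (fejer (x + s)) * iexp (\<theta> * x))" for s
  proof (rule Bochner_Integration.integrable_bound)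
    have f: "integrable lborel fejer"
      by (rule Bochner_Integration.integrable_bound[OF integrable_mult_right[OF integrable_one_over_1_plus_square, of 8]])
         (use fejer_upper fejer_nonneg in auto)
    have "integrable lborel (\<lambda>x. fejer (s + 1 * x))" by (rule lborel_integrable_real_affine[OF f]) simp
    thus "integrable lborel (\<lambda>x. fejer (x + s))" by (simp add: add.commute)
  qed (auto simp: norm_mult)
  have step: "(\<lambda>n. complex_of_real (sqrt (real n)) * (\<integral>x. complex_of_real (fejer (x + s)) * iexp (\<theta> * x) \<partial>\<nu> n))
     \<longlonglongrightarrow> complex_of_real (1 / sqrt (2 * pi * s2)) * (\<integral>x. complex_of_real (fejer (x + s)) * iexp (\<theta> * x) \<partial>lborel)" for s
  proof -
    note e = LIMSEQ_unique[OF fejer_local_limit[OF Grd Gconv Gdom, of s \<theta>] gauss_local_limit[OF s2 fs, of s, folded G_def]]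
    show ?thesis by (rule fejer_local_limit[OF rd conv dom, of s \<theta>, unfolded e])
  qed
  have ifs: "integrable (\<nu> n) (\<lambda>x. complex_of_real (fejer (x + s)) * iexp (\<theta> * x))" for s n
  proof -
    interpret real_distribution "\<nu> n" by (rule rd)
    show ?thesis by (rule integrable_const_bound[where B = 1]) (use fejer_le_1 fejer_nonneg in \<open>auto simp: norm_mult\<close>)
  qed
  have sp: "complex_of_real (fker x) * iexp (\<theta> * x) = complex_of_real (fejer (x + 0)) * iexp (\<theta> * x) + complex_of_real (fejer (x + 1)) * iexp (\<theta> * x)" for x
    by (simp add: fker_def algebra_simps)
  have e1: "(\<integral>x. complex_of_real (fker x) * iexp (\<theta> * x) \<partial>\<nu> n) = (\<integral>x. complex_of_real (fejer (x + 0)) * iexp (\<theta> * x) \<partial>\<nu> n) + (\<integral>x. complex_of_real (fejer (x + 1)) * iexp (\<theta> * x) \<partial>\<nu> n)" for n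
    unfolding sp by (rule Bochner_Integration.integral_add[OF ifs ifs])
  have e2: "(\<integral>x. complex_of_real (fker x) * iexp (\<theta> * x) \<partial>lborel) = (\<integral>x. complex_of_real (fejer (x + 0)) * iexp (\<theta> * x) \<partial>lborel) + (\<integral>x. complex_of_real (fejer (x + 1)) * iexp (\<theta> * x) \<partial>lborel)"
    unfolding sp by (rule Bochner_Integration.integral_add[OF fs fs])
  show ?thesis
    unfolding e1 e2 distrib_left by (rule tendsto_add[OF step step])
qed

text \<open>Reweight each law by \<open>fker\<close> and normalise. By
  \<open>fker_local_limit\<close> the characteristic functions of these probability measures
  converge, so Levy's theorem gives weak convergence. The quotient \<phi> / \<open>fker\<close> is a
  bounded continuous test function, since \<phi> decays at least as fast as the lower bound of
  \<open>fker\<close>; the normalising constants restore the factor sqrt n.\<close>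

theorem local_limit_theorem:
  fixes \<phi> :: "real \<Rightarrow> real"
  assumes rd: "\<And>n. real_distribution (\<nu> n)" and s2: "s2 > 0"
    and conv: "\<And>u. (\<lambda>n. char (\<nu> n) (u / sqrt (real n))) \<longlonglongrightarrow> complex_of_real (exp (- (s2 * u\<^sup>2 / 2)))"
    and dom: "\<And>A. \<exists>c>0. \<forall>n t. \<bar>t\<bar> \<le> A \<longrightarrow> cmod (char (\<nu> n) t) \<le> exp (- (c * real n * t\<^sup>2))"
    and cont: "\<And>x. isCont \<phi> x" and bd: "\<And>x. \<bar>\<phi> x\<bar> \<le> C / (1 + x\<^sup>2)"
  shows "(\<lambda>n. sqrt (real n) * (\<integral>x. \<phi> x \<partial>\<nu> n)) \<longlonglongrightarrow> (\<integral>x. \<phi> x \<partial>lborel) / sqrt (2 * pi * s2)"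
proof -
  have [measurable]: "\<phi> \<in> borel_measurable borel"
    by (rule borel_measurable_continuous_onI) (use cont in \<open>simp add: continuous_on_eq_continuous_at\<close>)
  have C0: "C \<ge> 0" using bd[of 0] by simp
  obtain c where c: "c > 0" "\<And>x. fker x \<ge> c / (1 + x\<^sup>2)" using fker_lower by blast
  define k0 where "k0 = 1 / sqrt (2 * pi * s2)"
  have k0: "k0 > 0" using s2 by (simp add: k0_def)
  define Z where "Z n = (\<integral>x. fker x \<partial>\<nu> n)" for n
  define Z' where "Z' = (\<integral>x. fker x \<partial>lborel)"
  have set_nu [measurable_cong]: "sets (\<nu> n) = sets borel" for n using real_distribution.events_eq_borel[OF rd] .
  have if1: "integrable (\<nu> n) fker" for n
  proof -
    interpret real_distribution "\<nu> n" by (rule rd)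
    show ?thesis by (rule integrable_const_bound[where B = 2]) (use fker_le_2 fker_pos in \<open>auto simp: less_imp_le\<close>)
  qed
  have Zpos: "Z n > 0" for n
  proof -
    interpret real_distribution "\<nu> n" by (rule rd)
    have "Z n \<noteq> 0"
    proof
      assume "Z n = 0"
      hence "AE x in \<nu> n. fker x = 0" unfolding Z_def
        using integral_nonneg_eq_0_iff_AE[OF if1] fker_pos by (auto simp: less_imp_le)
      hence "AE x in \<nu> n. False" by eventually_elim (use fker_pos in \<open>auto simp: less_le\<close>)
      thus False by simp
    qed
    moreover have "Z n \<ge> 0" unfolding Z_def using fker_pos by (intro integral_nonneg_AE) (auto simp: less_imp_le)
    ultimately show ?thesis by simp
  qed
  have Z'pos: "Z' > 0"
  proof -
    have "Z' \<noteq> 0"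
    proof
      assume "Z' = 0"
      hence "AE x in lborel. fker x = 0" unfolding Z'_def
        using integral_nonneg_eq_0_iff_AE[OF integrable_fker] fker_pos by (auto simp: less_imp_le)
      hence "AE x in (lborel :: real measure). False" by eventually_elim (use fker_pos in \<open>auto simp: less_le\<close>)
      thus False by (simp add: AE_iff_measurable[OF _ refl] ae_filter_eq_bot_iff)
    qed
    moreover have "Z' \<ge> 0" unfolding Z'_def using fker_pos by (intro integral_nonneg_AE) (auto simp: less_imp_le)
    ultimately show ?thesis by simp
  qed
  have Zlim: "(\<lambda>n. sqrt (real n) * Z n) \<longlonglongrightarrow> k0 * Z'"
  proof -
    have "(\<lambda>n. complex_of_real (sqrt (real n)) * complex_of_real (Z n)) \<longlonglongrightarrow> complex_of_real k0 * complex_of_real Z'"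
      using fker_local_limit[OF rd s2 conv dom, of 0] by (simp add: Z_def Z'_def k0_def)
    thus ?thesis by (simp only: of_real_mult[symmetric] tendsto_of_real_iff)
  qed
  define m where "m n = density (\<nu> n) (\<lambda>x. ennreal (fker x / Z n))" for n
  define m' where "m' = density lborel (\<lambda>x. ennreal (fker x / Z'))"
  have rdm: "real_distribution (m n)" for n
  proof -
    have "emeasure (m n) (space (m n)) = (\<integral>\<^sup>+x. ennreal (fker x / Z n) \<partial>\<nu> n)" unfolding m_def
      by (subst emeasure_density) (auto intro!: nn_integral_cong simp: indicator_def)
    also have "\<dots> = ennreal (\<integral>x. fker x / Z n \<partial>\<nu> n)"
      using if1 Zpos fker_pos by (intro nn_integral_eq_integral) (auto simp: less_imp_le)
    also have "\<dots> = 1" using Zpos[of n] by (simp add: Z_def[symmetric])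
    finally show ?thesis unfolding real_distribution_def real_distribution_axioms_def
      by (auto intro!: prob_spaceI simp: m_def set_nu real_distribution.space_eq_univ[OF rd])
  qed
  have rdm': "real_distribution m'"
  proof -
    have "emeasure m' (space m') = (\<integral>\<^sup>+x. ennreal (fker x / Z') \<partial>lborel)" unfolding m'_def
      by (subst emeasure_density) (auto intro!: nn_integral_cong simp: indicator_def)
    also have "\<dots> = ennreal (\<integral>x. fker x / Z' \<partial>lborel)"
      using integrable_fker Z'pos fker_pos by (intro nn_integral_eq_integral) (auto simp: less_imp_le)
    also have "\<dots> = 1" using Z'pos by (simp add: Z'_def[symmetric])
    finally show ?thesis unfolding real_distribution_def real_distribution_axioms_def
      by (auto intro!: prob_spaceI simp: m'_def)
  qed
  have im: "(\<integral>x. f x \<partial>m n) = (\<integral>x. complex_of_real (fker x) * f x \<partial>\<nu> n) / complex_of_real (Z n)" if [measurable]: "f \<in> borel_measurable borel" for f :: "real \<Rightarrow> complex" and n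
  proof -
    have "(\<integral>x. f x \<partial>m n) = (\<integral>x. (fker x / Z n) *\<^sub>R f x \<partial>\<nu> n)" unfolding m_def
      using Zpos fker_pos by (intro integral_density) (auto simp: less_imp_le)
    thus ?thesis by (simp add: scaleR_conv_of_real)
  qed
  have im': "(\<integral>x. f x \<partial>m') = (\<integral>x. complex_of_real (fker x) * f x \<partial>lborel) / complex_of_real Z'" if [measurable]: "f \<in> borel_measurable borel" for f :: "real \<Rightarrow> complex"
  proof -
    have "(\<integral>x. f x \<partial>m') = (\<integral>x. (fker x / Z') *\<^sub>R f x \<partial>lborel)" unfolding m'_def
      using Z'pos fker_pos by (intro integral_density) (auto simp: less_imp_le)
    thus ?thesis by (simp add: scaleR_conv_of_real)
  qed
  have rm: "(\<integral>x. f x \<partial>m n) = (\<integral>x. fker x * f x \<partial>\<nu> n) / Z n" if [measurable]: "f \<in> borel_measurable borel" for f :: "real \<Rightarrow> real" and n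
  proof -
    have "(\<integral>x. f x \<partial>m n) = (\<integral>x. (fker x / Z n) *\<^sub>R f x \<partial>\<nu> n)" unfolding m_def
      using Zpos fker_pos by (intro integral_density) (auto simp: less_imp_le)
    thus ?thesis by simp
  qed
  have rm': "(\<integral>x. f x \<partial>m') = (\<integral>x. fker x * f x \<partial>lborel) / Z'" if [measurable]: "f \<in> borel_measurable borel" for f :: "real \<Rightarrow> real"
  proof -
    have "(\<integral>x. f x \<partial>m') = (\<integral>x. (fker x / Z') *\<^sub>R f x \<partial>lborel)" unfolding m'_def
      using Z'pos fker_pos by (intro integral_density) (auto simp: less_imp_le)
    thus ?thesis by simp
  qed
  have wc: "weak_conv_m m m'"
  proof (rule levy_continuity[OF rdm rdm'])
    fix t
    have "(\<lambda>n. (complex_of_real (sqrt (real n)) * (\<integral>x. complex_of_real (fker x) * iexp (t * x) \<partial>\<nu> n)) / complex_of_real (sqrt (real n) * Z n)) \<longlonglongrightarrow>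
        (complex_of_real k0 * (\<integral>x. complex_of_real (fker x) * iexp (t * x) \<partial>lborel)) / complex_of_real (k0 * Z')"
      unfolding k0_def by (intro tendsto_divide fker_local_limit[OF rd s2 conv dom] tendsto_of_real Zlim[unfolded k0_def]) (use Z'pos s2 in auto)
    moreover have "(complex_of_real k0 * (\<integral>x. complex_of_real (fker x) * iexp (t * x) \<partial>lborel)) / complex_of_real (k0 * Z') = char m' t"
      unfolding char_def using k0 by (subst im') auto
    moreover have "\<forall>\<^sub>F n in sequentially. (complex_of_real (sqrt (real n)) * (\<integral>x. complex_of_real (fker x) * iexp (t * x) \<partial>\<nu> n)) / complex_of_real (sqrt (real n) * Z n) = char (m n) t"
      unfolding char_def using eventually_gt_at_top[of 0]
      by eventually_elim (subst im, auto)
    ultimately show "(\<lambda>n. char (m n) t) \<longlonglongrightarrow> char m' t" by (simp add: Lim_transform_eventually)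
  qed
  have "(\<lambda>n. \<integral>x. \<phi> x / fker x \<partial>m n) \<longlonglongrightarrow> (\<integral>x. \<phi> x / fker x \<partial>m')"
  proof (rule weak_conv_imp_integral_bdd_continuous_conv[OF rdm rdm' wc])
    show "isCont (\<lambda>x. \<phi> x / fker x) x" for x
      using fker_pos[of x] by (intro continuous_intros cont isCont_fker) auto
    show "norm (\<phi> x / fker x) \<le> C / c" for x
    proof -
      have p: "1 + x\<^sup>2 > 0" by (simp add: add_pos_nonneg)
      have "\<bar>\<phi> x\<bar> / fker x \<le> (C / (1 + x\<^sup>2)) / (c / (1 + x\<^sup>2))"
        using bd[of x] c p C0 by (intro frac_le) auto
      also have "\<dots> = C / c" using p by simp
      finally show ?thesis using fker_pos[of x] by simp
    qed
  qed
  hence "(\<lambda>n. (\<integral>x. \<phi> x \<partial>\<nu> n) / Z n) \<longlonglongrightarrow> (\<integral>x. \<phi> x \<partial>lborel) / Z'"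
    using fker_pos by (simp add: rm rm' less_imp_neq[symmetric])
  from tendsto_mult[OF Zlim this] have "(\<lambda>n. sqrt (real n) * (\<integral>x. \<phi> x \<partial>\<nu> n)) \<longlonglongrightarrow> k0 * (\<integral>x. \<phi> x \<partial>lborel)"
    using Zpos Z'pos by (simp add: less_imp_neq[symmetric])
  thus ?thesis by (simp add: k0_def)
qed


text \<open>The shift enters the transformed integral only through a factor of modulus 1, which
  makes the bound uniform in \<open>s\<close>.\<close>

lemma fejer_sup_bound:
  assumes rd: "\<And>n. real_distribution (\<nu> n)"
    and dom: "\<And>A. \<exists>c>0. \<forall>n t. \<bar>t\<bar> \<le> A \<longrightarrow> cmod (char (\<nu> n) t) \<le> exp (- (c * real n * t\<^sup>2))"
  shows "\<exists>C. \<forall>n\<ge>1. \<forall>s. (\<integral>x. fejer (x + s) \<partial>\<nu> n) \<le> C / sqrt (real n)"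
proof -
  obtain c where c: "c > 0" "\<And>n t. \<bar>t\<bar> \<le> 1 \<Longrightarrow> cmod (char (\<nu> n) t) \<le> exp (- (c * real n * t\<^sup>2))"
    using dom[of 1] by blast
  have chm [measurable]: "char (\<nu> n) \<in> borel_measurable borel" for n
    using real_distribution.char_measurable[OF rd] .
  have "(\<integral>x. fejer (x + s) \<partial>\<nu> n) \<le> (\<integral>u. exp (- (c * u\<^sup>2)) \<partial>lborel) / sqrt (real n)" if n: "n \<ge> 1" for n s
  proof -
    have ig: "integrable lborel (\<lambda>t. exp (- (c * real n * t\<^sup>2)))" using integrable_gauss[of "c * real n"] c n by simp
    have "complex_of_real (\<integral>x. fejer (x + s) \<partial>\<nu> n) = (\<integral>t. complex_of_real (tent t) * iexp (t * s) * char (\<nu> n) (t + 0) \<partial>lborel)"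
      using real_distribution.fejer_transform[OF rd, of n s 0] by simp
    hence "\<bar>\<integral>x. fejer (x + s) \<partial>\<nu> n\<bar> = cmod (\<integral>t. complex_of_real (tent t) * iexp (t * s) * char (\<nu> n) (t + 0) \<partial>lborel)"
      by (metis norm_of_real)
    also have "\<dots> \<le> (\<integral>t. norm (complex_of_real (tent t) * iexp (t * s) * char (\<nu> n) (t + 0)) \<partial>lborel)" by (rule integral_norm_bound)
    also have "\<dots> \<le> (\<integral>t. exp (- (c * real n * t\<^sup>2)) \<partial>lborel)"
    proof (rule integral_mono')
      fix t
      show "norm (complex_of_real (tent t) * iexp (t * s) * char (\<nu> n) (t + 0)) \<le> exp (- (c * real n * t\<^sup>2))"
      proof (cases "\<bar>t\<bar> \<le> 1")
        case True
        hence "norm (complex_of_real (tent t) * iexp (t * s) * char (\<nu> n) (t + 0)) \<le> 1 * exp (- (c * real n * t\<^sup>2))"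
          unfolding norm_mult using c(2)[OF True, of n] tent_nonneg tent_le_1 by (intro mult_mono) auto
        thus ?thesis by simp
      qed (simp add: tent_eq_0)
    qed (auto intro: ig)
    also have "\<dots> = \<bar>1 / sqrt (real n)\<bar> *\<^sub>R (\<integral>u. exp (- (c * real n * (0 + 1 / sqrt (real n) * u)\<^sup>2)) \<partial>lborel)"
      by (rule lborel_integral_real_affine) (use n in simp)
    also have "\<dots> = (\<integral>u. exp (- (c * u\<^sup>2)) \<partial>lborel) / sqrt (real n)"
      using n by (simp add: power_divide)
    finally show ?thesis by simp
  qed
  thus ?thesis by blast
qed

lemma exp_abs_le_inverse_square:
  fixes b y :: real assumes "b > 0"
  shows "exp (- (b * \<bar>y\<bar>)) \<le> (1 + 2 / b\<^sup>2) / (1 + y\<^sup>2)"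
proof -
  define z where "z = b * \<bar>y\<bar>"
  have z: "z \<ge> 0" using assms by (simp add: z_def)
  have e1: "exp z \<ge> 1" using z by simp
  have e2: "z\<^sup>2 \<le> 2 * exp z" using exp_lower_Taylor_quadratic[OF z] z by linarith
  have "y\<^sup>2 = z\<^sup>2 / b\<^sup>2" using assms by (simp add: z_def power_mult_distrib)
  also have "\<dots> \<le> 2 * exp z / b\<^sup>2" using e2 by (intro divide_right_mono) auto
  finally have y2: "y\<^sup>2 \<le> 2 * exp z / b\<^sup>2" .
  have "1 + y\<^sup>2 \<le> exp z + 2 * exp z / b\<^sup>2" by (intro add_mono e1 y2)
  hence "1 + y\<^sup>2 \<le> (1 + 2 / b\<^sup>2) * exp z" by (simp add: algebra_simps)
  thus ?thesis by (simp add: z_def exp_minus divide_simps add_pos_nonneg)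
qed

text \<open>Meant for pieces of a path whose starting level is unknown; the exponential is dominated
  by a multiple of \<open>fker\<close>, which is positive everywhere.\<close>

lemma exp_sup_bound:
  assumes rd: "\<And>n. real_distribution (\<nu> n)" and b: "b > 0"
    and dom: "\<And>A. \<exists>c>0. \<forall>n t. \<bar>t\<bar> \<le> A \<longrightarrow> cmod (char (\<nu> n) t) \<le> exp (- (c * real n * t\<^sup>2))"
  shows "\<exists>C. \<forall>n\<ge>1. \<forall>s. (\<integral>x. exp (- (b * \<bar>x + s\<bar>)) \<partial>\<nu> n) \<le> C / sqrt (real n)"
proof -
  obtain C where C: "\<And>n s. n \<ge> 1 \<Longrightarrow> (\<integral>x. fejer (x + s) \<partial>\<nu> n) \<le> C / sqrt (real n)"
    using fejer_sup_bound[OF rd dom] by blast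
  obtain c where c: "c > 0" "\<And>x. fker x \<ge> c / (1 + x\<^sup>2)" using fker_lower by blast
  define B where "B = (1 + 2 / b\<^sup>2) / c"
  have B: "B \<ge> 0" unfolding B_def using c by (intro divide_nonneg_nonneg add_nonneg_nonneg) auto
  have le: "exp (- (b * \<bar>y\<bar>)) \<le> B * fker y" for y
  proof -
    have "exp (- (b * \<bar>y\<bar>)) \<le> (1 + 2 / b\<^sup>2) / (1 + y\<^sup>2)" by (rule exp_abs_le_inverse_square[OF b])
    also have "\<dots> = B * (c / (1 + y\<^sup>2))" using less_imp_neq[OF c(1), symmetric] by (simp only: B_def times_divide_eq_left times_divide_eq_right nonzero_mult_div_cancel_right mult.commute[of c] not_False_eq_True)
    also have "\<dots> \<le> B * fker y" by (intro mult_left_mono c B)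
    finally show ?thesis .
  qed
  have "(\<integral>x. exp (- (b * \<bar>x + s\<bar>)) \<partial>\<nu> n) \<le> (B * (2 * C)) / sqrt (real n)" if n: "n \<ge> 1" for n s
  proof -
    interpret real_distribution "\<nu> n" by (rule rd)
    have i: "integrable (\<nu> n) (\<lambda>x. fejer (x + s))" for s
      by (rule integrable_const_bound[where B = 1]) (use fejer_le_1 fejer_nonneg in auto)
    have "(\<integral>x. exp (- (b * \<bar>x + s\<bar>)) \<partial>\<nu> n) \<le> (\<integral>x. B * (fejer (x + s) + fejer (x + (s + 1))) \<partial>\<nu> n)"
    proof (rule integral_mono')
      show "integrable (\<nu> n) (\<lambda>x. B * (fejer (x + s) + fejer (x + (s + 1))))" using i by (intro integrable_mult_right Bochner_Integration.integrable_add)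
      show "exp (- (b * \<bar>x + s\<bar>)) \<le> B * (fejer (x + s) + fejer (x + (s + 1)))" for x
        using le[of "x + s"] by (simp add: fker_def add.assoc)
    qed (use fejer_nonneg B in auto)
    also have "\<dots> = B * ((\<integral>x. fejer (x + s) \<partial>\<nu> n) + (\<integral>x. fejer (x + (s + 1)) \<partial>\<nu> n))" using i by simp
    also have "\<dots> \<le> B * (C / sqrt (real n) + C / sqrt (real n))" by (intro mult_left_mono add_mono C n B)
    finally show ?thesis by simp
  qed
  thus ?thesis by blast
qed

section \<open>Powers of a characteristic function\<close>

lemma (in real_distribution) char_quadratic:
  assumes i1: "integrable M (\<lambda>x. x)" and m0: "(\<integral>x. x \<partial>M) = 0" and i2: "integrable M (\<lambda>x. x\<^sup>2)" and s2: "(\<integral>x. x\<^sup>2 \<partial>M) = s2" "s2 > 0"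
  defines "R t \<equiv> (\<integral>x. min (6 * x\<^sup>2) (\<bar>t\<bar> * \<bar>x\<bar> ^ 3) \<partial>M)"
  shows "cmod (char M t - complex_of_real (1 - t\<^sup>2 * s2 / 2)) \<le> t\<^sup>2 / 6 * R t" "(R \<longlongrightarrow> 0) (at 0)"
proof -
  show "cmod (char M t - complex_of_real (1 - t\<^sup>2 * s2 / 2)) \<le> t\<^sup>2 / 6 * R t"
    unfolding R_def by (rule char_approx3[OF i1 m0 i2]) (simp add: m0 s2)
  show "(R \<longlongrightarrow> 0) (at 0)"
  proof (rule iffD1[OF LIMSEQ_SEQ_conv])
    show "\<forall>S. (\<forall>n. S n \<noteq> (0::real)) \<and> S \<longlonglongrightarrow> 0 \<longrightarrow> (\<lambda>n. R (S n)) \<longlonglongrightarrow> 0"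
    proof (intro allI impI)
      fix T :: "nat \<Rightarrow> real" assume T: "(\<forall>n. T n \<noteq> 0) \<and> T \<longlonglongrightarrow> 0"
      have "(\<lambda>n. \<integral>x. min (6 * x\<^sup>2) (\<bar>T n\<bar> * \<bar>x\<bar> ^ 3) \<partial>M) \<longlonglongrightarrow> (\<integral>x. 0 \<partial>M)"
      proof (rule integral_dominated_convergence[where w = "\<lambda>x. 6 * x\<^sup>2"])
        show "AE x in M. (\<lambda>n. min (6 * x\<^sup>2) (\<bar>T n\<bar> * \<bar>x\<bar> ^ 3)) \<longlonglongrightarrow> 0"
        proof (intro always_eventually allI)
          fix x
          have "(\<lambda>n. min (6 * x\<^sup>2) (\<bar>T n\<bar> * \<bar>x\<bar> ^ 3)) \<longlonglongrightarrow> min (6 * x\<^sup>2) (\<bar>0\<bar> * \<bar>x\<bar> ^ 3)"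
            using T by (intro tendsto_intros) auto
          thus "(\<lambda>n. min (6 * x\<^sup>2) (\<bar>T n\<bar> * \<bar>x\<bar> ^ 3)) \<longlonglongrightarrow> 0" by simp
        qed
      qed (use i2 in auto)
      thus "(\<lambda>n. R (T n)) \<longlonglongrightarrow> 0" by (simp add: R_def)
    qed
  qed
qed

lemma (in real_distribution) char_power_limit:
  assumes i1: "integrable M (\<lambda>x. x)" and m0: "(\<integral>x. x \<partial>M) = 0" and i2: "integrable M (\<lambda>x. x\<^sup>2)" and s2: "(\<integral>x. x\<^sup>2 \<partial>M) = s2" "s2 > 0"
  shows "(\<lambda>n. char M (u / sqrt (real n)) ^ n) \<longlonglongrightarrow> complex_of_real (exp (- (s2 * u\<^sup>2 / 2)))"
proof (cases "u = 0")
  case True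
  thus ?thesis using char_zero by simp
next
  case False
  define R where "R t = (\<integral>x. min (6 * x\<^sup>2) (\<bar>t\<bar> * \<bar>x\<bar> ^ 3) \<partial>M)" for t
  note q = char_quadratic[OF i1 m0 i2 s2, folded R_def]
  have z: "filterlim (\<lambda>n. u / sqrt (real n)) (at 0) sequentially"
  proof (rule filterlim_atI)
    show "(\<lambda>n. u / sqrt (real n)) \<longlonglongrightarrow> 0"
      by (intro real_tendsto_divide_at_top[OF tendsto_const] filterlim_compose[OF sqrt_at_top] filterlim_real_sequentially)
    show "\<forall>\<^sub>F n in sequentially. u / sqrt (real n) \<noteq> 0" using eventually_gt_at_top[of 0] by eventually_elim (use False in auto)
  qed
  have Rl: "(\<lambda>n. u\<^sup>2 / 6 * R (u / sqrt (real n))) \<longlonglongrightarrow> u\<^sup>2 / 6 * 0"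
    by (intro tendsto_mult tendsto_const filterlim_compose[OF q(2) z])
  have main: "\<forall>\<^sub>F n in sequentially. cmod (char M (u / sqrt (real n)) ^ n - complex_of_real ((1 + (- (s2 * u\<^sup>2 / 2)) / real n) ^ n)) \<le> u\<^sup>2 / 6 * R (u / sqrt (real n))"
  proof -
    \<comment> \<open>The inequality |z^n - w^n| <= n |z - w| is available only for numbers of
      modulus at most 1; from \<open>n0\<close> on, the base 1 - s2 u^2 / (2 n) lies in
      [1/2, 1].\<close>
    obtain n0 :: nat where n0: "s2 * u\<^sup>2 \<le> real n0" using real_arch_simple by blast
    show ?thesis using eventually_ge_at_top[of "max 1 n0"]
    proof eventually_elim
      case (elim n)
      have n: "real n \<ge> 1" "s2 * u\<^sup>2 \<le> real n" using elim n0 by auto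
      define z where "z = s2 * u\<^sup>2 / real n"
      have "z \<le> 1" "0 \<le> z" unfolding z_def using n s2 by (auto simp: field_simps)
      moreover have "1 + (- (s2 * u\<^sup>2 / 2)) / real n = 1 - z / 2" by (simp add: z_def)
      ultimately have le1: "cmod (complex_of_real (1 + (- (s2 * u\<^sup>2 / 2)) / real n)) \<le> 1" unfolding norm_of_real by simp
      have "cmod (char M (u / sqrt (real n)) ^ n - complex_of_real ((1 + (- (s2 * u\<^sup>2 / 2)) / real n) ^ n)) \<le> real n * cmod (char M (u / sqrt (real n)) - complex_of_real (1 + (- (s2 * u\<^sup>2 / 2)) / real n))"
        unfolding of_real_power by (rule norm_power_diff[OF cmod_char_le_1 le1])
      also have "real n * cmod (char M (u / sqrt (real n)) - complex_of_real (1 + (- (s2 * u\<^sup>2 / 2)) / real n)) = real n * cmod (char M (u / sqrt (real n)) - complex_of_real (1 - (u / sqrt (real n))\<^sup>2 * s2 / 2))"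
        using n by (simp add: power_divide mult.commute)
      also have "\<dots> \<le> real n * ((u / sqrt (real n))\<^sup>2 / 6 * R (u / sqrt (real n)))"
        by (intro mult_left_mono q(1)) auto
      also have "\<dots> = u\<^sup>2 / 6 * R (u / sqrt (real n))" using n by (simp add: power_divide)
      finally show ?case .
    qed
  qed
  have L: "(\<lambda>n. complex_of_real ((1 + (- (s2 * u\<^sup>2 / 2)) / real n) ^ n)) \<longlonglongrightarrow> complex_of_real (exp (- (s2 * u\<^sup>2 / 2)))"
    by (rule tendsto_of_real[OF tendsto_exp_limit_sequentially])
  show ?thesis
    by (rule Lim_transform[OF L]) (rule Lim_null_comparison[OF main Rl[unfolded mult_zero_right]])
qed

text \<open>Near 0 the quadratic expansion gives Gaussian decay. On the remaining compact set the
  modulus is continuous and below 1, because the law is non-lattice, and hence is bounded away from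
  1.\<close>

lemma (in real_distribution) char_power_bound:
  assumes i1: "integrable M (\<lambda>x. x)" and m0: "(\<integral>x. x \<partial>M) = 0" and i2: "integrable M (\<lambda>x. x\<^sup>2)" and s2: "(\<integral>x. x\<^sup>2 \<partial>M) = s2" "s2 > 0"
    and nl: "\<And>t. t \<noteq> 0 \<Longrightarrow> cmod (char M t) < 1"
  shows "\<exists>c>0. \<forall>n t. \<bar>t\<bar> \<le> A \<longrightarrow> cmod (char M t ^ n) \<le> exp (- (c * real n * t\<^sup>2))"
proof -
  define R where "R t = (\<integral>x. min (6 * x\<^sup>2) (\<bar>t\<bar> * \<bar>x\<bar> ^ 3) \<partial>M)" for t
  note q = char_quadratic[OF i1 m0 i2 s2, folded R_def]
  have "\<forall>\<^sub>F t in at 0. R t < 3 / 2 * s2" by (rule order_tendstoD(2)[OF q(2)]) (use s2 in simp)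
  then obtain d where d: "d > 0" "\<And>t. t \<noteq> 0 \<Longrightarrow> \<bar>t\<bar> < d \<Longrightarrow> R t < 3 / 2 * s2" unfolding eventually_at by (auto simp: dist_real_def)
  \<comment> \<open>With \<open>R t\<close> below 3/2 of \<open>s2\<close> the remainder t^2 R / 6
    consumes at most half of the quadratic term t^2 s2 / 2. The second entry of the minimum keeps 1
    - t^2 s2 / 2 positive.\<close>
  define d' where "d' = min (d / 2) (1 / sqrt s2)"
  have d': "d' > 0" unfolding d'_def using d s2 by simp
  have near: "cmod (char M t) \<le> exp (- (s2 / 4 * t\<^sup>2))" if "\<bar>t\<bar> \<le> d'" for t
  proof (cases "t = 0")
    case False
    have "\<bar>t\<bar> < d" using that d unfolding d'_def by auto
    hence Rt: "R t \<le> 3 / 2 * s2" using d(2)[OF False] by simp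
    have "\<bar>t\<bar> \<le> 1 / sqrt s2" using that unfolding d'_def by simp
    hence "\<bar>t\<bar>\<^sup>2 \<le> (1 / sqrt s2)\<^sup>2" by (intro power_mono) auto
    hence ts: "t\<^sup>2 * s2 \<le> 1" using s2 by (simp add: power_divide field_simps)
    have "cmod (char M t) \<le> cmod (complex_of_real (1 - t\<^sup>2 * s2 / 2)) + t\<^sup>2 / 6 * R t"
      using q(1)[of t] norm_triangle_sub[of "char M t" "complex_of_real (1 - t\<^sup>2 * s2 / 2)"] by linarith
    also have "cmod (complex_of_real (1 - t\<^sup>2 * s2 / 2)) = 1 - t\<^sup>2 * s2 / 2" unfolding norm_of_real using ts by simp
    also have "t\<^sup>2 / 6 * R t \<le> t\<^sup>2 / 6 * (3 / 2 * s2)" by (intro mult_left_mono Rt) auto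
    finally have "cmod (char M t) \<le> 1 + (- (s2 / 4 * t\<^sup>2))" by (simp add: algebra_simps)
    also have "\<dots> \<le> exp (- (s2 / 4 * t\<^sup>2))" by (rule exp_ge_add_one_self)
    finally show ?thesis .
  qed (use char_zero in simp)
  define KK where "KK = {t. d' \<le> \<bar>t\<bar> \<and> \<bar>t\<bar> \<le> A}"
  have "\<exists>r<1. \<forall>t\<in>KK. cmod (char M t) \<le> r"
  proof (cases "KK = {}")
    case False
    have "KK = cball 0 A \<inter> - ball 0 d'" by (auto simp: KK_def dist_real_def)
    hence "compact KK" using compact_Int_closed[OF compact_cball closed_Compl[OF open_ball]] by simp
    moreover have "continuous_on KK (\<lambda>t. cmod (char M t))"
      by (intro continuous_on_norm continuous_at_imp_continuous_on ballI isCont_char)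
    ultimately obtain t0 where "t0 \<in> KK" "\<forall>t\<in>KK. cmod (char M t) \<le> cmod (char M t0)"
      using continuous_attains_sup[OF _ False] by blast
    moreover have "t0 \<noteq> 0" using \<open>t0 \<in> KK\<close> d' by (auto simp: KK_def)
    ultimately show ?thesis using nl by blast
  qed (auto intro: exI[of _ 0])
  then obtain r where r: "r < 1" "\<And>t. t \<in> KK \<Longrightarrow> cmod (char M t) \<le> r" by blast
  define r' where "r' = max r (1/2)"
  have r': "0 < r'" "r' < 1" "r \<le> r'" using r by (auto simp: r'_def)
  \<comment> \<open>Away from 0 the constant bound \<open>r'\<close> has to be written as a
    Gaussian: since t^2 <= A^2, a rate of -ln \<open>r'\<close> divided by A^2 + 1 is slow
    enough.\<close>
  define c where "c = min (s2 / 4) (- ln r' / (A\<^sup>2 + 1))"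
  have A1: "A\<^sup>2 + 1 > 0" by (simp add: add_nonneg_pos)
  have "ln r' / (A\<^sup>2 + 1) < 0" using r' A1 by (intro divide_neg_pos) auto
  hence c: "c > 0" unfolding c_def using s2 by simp
  have one: "cmod (char M t) \<le> exp (- (c * t\<^sup>2))" if t: "\<bar>t\<bar> \<le> A" for t
  proof (cases "\<bar>t\<bar> \<le> d'")
    case True
    have "c * t\<^sup>2 \<le> s2 / 4 * t\<^sup>2" unfolding c_def by (intro mult_right_mono min.cobounded1) auto
    thus ?thesis using near[OF True] by (smt (verit) exp_le_cancel_iff)
  next
    case False
    hence "cmod (char M t) \<le> r'" using r(2)[of t] t r'(3) by (auto simp: KK_def)
    also have "r' = exp (ln r')" using r' by simp
    also have "\<dots> \<le> exp (- (c * t\<^sup>2))"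
    proof -
      have "\<bar>t\<bar>\<^sup>2 \<le> A\<^sup>2" using t by (intro power_mono) auto
      hence "c * t\<^sup>2 \<le> (- ln r' / (A\<^sup>2 + 1)) * (A\<^sup>2 + 1)" 
        using A1 less_imp_le[OF c] by (intro mult_mono) (auto simp: c_def intro: min.coboundedI2)
      also have "\<dots> = - ln r'" using A1 by simp
      finally show ?thesis by simp
    qed
    finally show ?thesis .
  qed
  have "cmod (char M t ^ n) \<le> exp (- (c * real n * t\<^sup>2))" if t: "\<bar>t\<bar> \<le> A" for t n
  proof -
    have "cmod (char M t ^ n) \<le> exp (- (c * t\<^sup>2)) ^ n" unfolding norm_power by (intro power_mono one t) auto
    also have "\<dots> = exp (- (c * real n * t\<^sup>2))" by (simp add: exp_of_nat_mult[symmetric] algebra_simps)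
    finally show ?thesis .
  qed
  thus ?thesis using c by blast
qed

section \<open>Spitzer's identity\<close>

text \<open>Spitzer's identity in the form available in a commutative Baxter algebra: \<open>P\<close> is a projection onto a
  subalgebra along a subspace closed under multiplication.\<close>
lemma baxter_recursion:
  fixes P :: "'a::comm_ring_1 \<Rightarrow> 'a" and \<mu> :: 'a and p :: "nat \<Rightarrow> 'a"
  assumes add: "\<And>a b. P (a + b) = P a + P b"
    and idem: "\<And>a. P (P a) = P a" and one: "P 1 = 1"
    and ran: "\<And>a b. P (P a * P b) = P a * P b"
    and ker: "\<And>a b. P a = 0 \<Longrightarrow> P b = 0 \<Longrightarrow> P (a * b) = 0"
    and p0: "p 0 = 1" and pS: "\<And>n. p (Suc n) = P (p n * \<mu>)"
  shows "of_nat n * p n = (\<Sum>k=1..n. P (\<mu> ^ k) * p (n - k))"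
proof -
  have P0: "P 0 = 0" using add[of 0 0] by simp
  have Pm: "P (- a) = - P a" for a using add[of a "- a"] P0 by (simp add: eq_neg_iff_add_eq_0 add.commute)
  have Pd: "P (a - b) = P a - P b" for a b using add[of a "-b"] Pm by simp
  have Ps: "P (sum f A) = (\<Sum>i\<in>A. P (f i))" for f and A :: "nat set"
    by (induction A rule: infinite_finite_induct) (auto simp: P0 add)
  have Pn: "P (of_nat n * a) = of_nat n * P a" for n a
    by (induction n) (auto simp: P0 add algebra_simps)
  have Pp: "P (p n) = p n" for n by (cases n) (auto simp: p0 one pS idem)
  \<comment> \<open>Wiener-Hopf factorisation in the ring of power series: \<open>Pz\<close> *
    \<open>Q\<close> = 1 - \<open>N\<close>, where \<open>Pz\<close> has coefficients in the range
    of \<open>P\<close> and \<open>N\<close> has coefficients in its kernel. The series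
    \<open>G\<close> is minus the logarithmic derivative of \<open>Q\<close> times X, and
    \<open>A\<close> and \<open>C\<close> are its two projections.\<close>
  define Pz where "Pz = Abs_fps p"
  define Q where "Q = 1 - fps_X * fps_const \<mu>"
  define N where "N = 1 - Pz * Q"
  define A where "A = Abs_fps (\<lambda>k. if k = 0 then 0 else P (\<mu> ^ k))"
  define C where "C = Abs_fps (\<lambda>k. if k = 0 then 0 else \<mu> ^ k - P (\<mu> ^ k))"
  define G where "G = Abs_fps (\<lambda>k. if k = 0 then 0 else \<mu> ^ k)"
  define E where "E = fps_X * fps_deriv Pz - A * Pz"
  define H where "H = C * (1 - N) - fps_X * fps_deriv N"
  have AC: "A + C = G" by (rule fps_ext) (auto simp: A_def C_def G_def)
  have QG: "Q * G = fps_X * fps_const \<mu>"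
  proof (rule fps_ext)
    fix n
    have "fps_nth (Q * G) n = fps_nth G n - fps_nth (fps_X * (fps_const \<mu> * G)) n" unfolding Q_def by (simp add: algebra_simps)
    also have "\<dots> = fps_nth (fps_X * fps_const \<mu>) n"
      by (cases n) (auto simp: G_def fps_X_mult_nth fps_mult_left_const_nth)
    finally show "fps_nth (Q * G) n = fps_nth (fps_X * fps_const \<mu>) n" .
  qed
  have dQ: "fps_deriv Q = - fps_const \<mu>" unfolding Q_def by simp
  have PQ: "Pz * Q = 1 - N" unfolding N_def by simp
  have "fps_deriv (Pz * Q) = - fps_deriv N" unfolding PQ by simp
  hence "fps_X * fps_deriv (Pz * Q) = - (fps_X * fps_deriv N)" by simp
  hence d: "fps_X * fps_deriv Pz * Q = - (fps_X * fps_deriv N) + Pz * (Q * G)"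
    unfolding QG by (simp add: dQ algebra_simps fps_const_neg[symmetric] del: fps_const_neg)
  \<comment> \<open>The logarithmic derivative of \<open>Pz\<close> * \<open>Q\<close> = 1 -
    \<open>N\<close>, multiplied out and sorted by projection: range terms are collected in
    \<open>E\<close>, kernel terms in \<open>H\<close>.\<close>
  have key: "E * (1 - N) = H * Pz"
  proof -
    have "E * (1 - N) = Pz * (fps_X * fps_deriv Pz * Q - A * (Pz * Q))" unfolding E_def PQ[symmetric] by (simp add: algebra_simps)
    also have "\<dots> = Pz * (- (fps_X * fps_deriv N) + (Pz * Q) * (G - A))" unfolding d by (simp add: algebra_simps)
    also have "G - A = C" using AC by (metis add_diff_cancel_left')
    finally show ?thesis unfolding H_def PQ by (simp add: algebra_simps)
  qed
  have N0: "fps_nth N 0 = 0" unfolding N_def Q_def Pz_def by (simp add: p0)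
  have NS: "fps_nth N (Suc n) = p n * \<mu> - P (p n * \<mu>)" for n
  proof -
    have "Pz * Q = Pz - fps_X * (fps_const \<mu> * Pz)" unfolding Q_def by (simp add: algebra_simps)
    thus ?thesis unfolding N_def by (simp add: Pz_def pS fps_mult_left_const_nth mult.commute)
  qed
  have kN: "P (fps_nth N n) = 0" for n by (cases n) (auto simp: N0 NS P0 Pd idem)
  have kC: "P (fps_nth C n) = 0" for n by (auto simp: C_def P0 Pd idem)
  have kH: "P (fps_nth H n) = 0" for n
  proof -
    have "H = C - C * N - fps_X * fps_deriv N" unfolding H_def by (simp add: algebra_simps)
    moreover have "P (fps_nth (C * N) n) = 0" unfolding fps_mult_nth Ps using ker[OF kC kN] by simp
    moreover have "P (fps_nth (fps_X * fps_deriv N) n) = 0"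
    proof (cases n)
      case (Suc m)
      have "P (of_nat (Suc m) * fps_nth N (Suc m)) = 0" unfolding Pn kN by simp
      thus ?thesis by (simp add: Suc fps_X_mult_nth)
    qed (simp add: P0)
    ultimately show ?thesis by (simp add: Pd kC)
  qed
  have rE: "P (fps_nth E n) = fps_nth E n" for n
  proof -
    have "P (fps_nth (A * Pz) n) = fps_nth (A * Pz) n" unfolding fps_mult_nth Ps
    proof (rule sum.cong[OF refl])
      fix i
      have "P (P (\<mu> ^ i) * P (p (n - i))) = P (\<mu> ^ i) * P (p (n - i))" by (rule ran)
      thus "P (fps_nth A i * fps_nth Pz (n - i)) = fps_nth A i * fps_nth Pz (n - i)" by (simp add: A_def Pz_def Pp P0)
    qed
    moreover have "P (fps_nth (fps_X * fps_deriv Pz) n) = fps_nth (fps_X * fps_deriv Pz) n"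
    proof (cases n)
      case (Suc m)
      have "P (of_nat (Suc m) * fps_nth Pz (Suc m)) = of_nat (Suc m) * fps_nth Pz (Suc m)" unfolding Pn by (simp add: Pz_def Pp)
      thus ?thesis by (simp add: Suc fps_X_mult_nth)
    qed (simp add: P0)
    ultimately show ?thesis unfolding E_def by (simp add: Pd)
  qed
  \<comment> \<open>Once all lower coefficients vanish, \<open>N\<close> without constant term and
    \<open>Pz\<close> with constant term 1 reduce \<open>key\<close> to equality of the n-th
    coefficients of \<open>E\<close> and \<open>H\<close>. The first is fixed by \<open>P\<close>
    and the second killed, so both are 0.\<close>
  have "fps_nth E n = 0 \<and> fps_nth H n = 0" for n
  proof (induction n rule: less_induct)
    case (less n)
    have "fps_nth (E * N) n = 0" unfolding fps_mult_nth
    proof (intro sum.neutral ballI)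
      fix i assume "i \<in> {0..n}"
      thus "fps_nth E i * fps_nth N (n - i) = 0" using less[of i] N0 by (cases "i = n") auto
    qed
    hence l: "fps_nth (E * (1 - N)) n = fps_nth E n" by (simp add: algebra_simps)
    have "fps_nth (H * Pz) n = (\<Sum>i=0..n. fps_nth H i * fps_nth Pz (n - i))" by (rule fps_mult_nth)
    also have "\<dots> = (\<Sum>i\<in>{n}. fps_nth H i * fps_nth Pz (n - i))"
      by (rule sum.mono_neutral_right) (use less in auto)
    finally have r: "fps_nth (H * Pz) n = fps_nth H n" by (simp add: Pz_def p0)
    have eq: "fps_nth E n = fps_nth H n" using l r key by simp
    hence "fps_nth E n = 0" using rE[of n] kH[of n] by simp
    thus ?case using eq by simp
  qed
  hence "fps_nth (fps_X * fps_deriv Pz) n = fps_nth (A * Pz) n" unfolding E_def by simp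
  moreover have "fps_nth (fps_X * fps_deriv Pz) n = of_nat n * p n" by (cases n) (auto simp: Pz_def fps_X_mult_nth)
  moreover have "fps_nth (A * Pz) n = (\<Sum>k=1..n. P (\<mu> ^ k) * p (n - k))"
    unfolding fps_mult_nth by (rule sum.mono_neutral_cong_right) (auto simp: A_def Pz_def)
  ultimately show ?thesis by simp
qed

section \<open>Finitely supported signed measures under convolution\<close>

definition pair :: "(real \<Rightarrow>\<^sub>0 real) \<Rightarrow> (real \<Rightarrow> real) \<Rightarrow> real" where
  "pair m f = (\<Sum>x\<in>Poly_Mapping.keys m.  Poly_Mapping.lookup m x * f x)"

lemma pair_superset: "finite A \<Longrightarrow> Poly_Mapping.keys m \<subseteq> A \<Longrightarrow> pair m f = (\<Sum>x\<in>A.  Poly_Mapping.lookup m x * f x)"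
  unfolding pair_def by (rule sum.mono_neutral_left) (auto simp: in_keys_iff)

lemma pair_add: "pair (a + b) f = pair a f + pair b f"
proof -
  let ?A = "Poly_Mapping.keys a \<union> Poly_Mapping.keys b"
  have "pair (a + b) f = (\<Sum>x\<in>?A.  Poly_Mapping.lookup (a + b) x * f x)" by (rule pair_superset) (use Poly_Mapping.keys_add[of a b] in auto)
  moreover have "pair a f = (\<Sum>x\<in>?A.  Poly_Mapping.lookup a x * f x)" "pair b f = (\<Sum>x\<in>?A.  Poly_Mapping.lookup b x * f x)" by (rule pair_superset; auto)+
  ultimately show ?thesis by (simp add: lookup_add sum.distrib algebra_simps)
qed

lemma pair_zero [simp]: "pair 0 f = 0" by (simp add: pair_def)
lemma pair_single [simp]: "pair (Poly_Mapping.single x a) f = a * f x"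
  by (subst pair_superset[of "{x}"]) auto
lemma pair_one [simp]: "pair 1 f = f 0"
  unfolding single_one[symmetric] pair_single by simp
lemma pair_of_nat: "pair (of_nat n) f = real n * f 0"
  by (induction n) (auto simp: pair_add algebra_simps)
lemma pair_sum: "pair (sum g I) f = (\<Sum>i\<in>I. pair (g i) f)"
  by (induction I rule: infinite_finite_induct) (auto simp: pair_add)

lemma sum_single_lookup: "(\<Sum>x\<in>Poly_Mapping.keys m. Poly_Mapping.single x (Poly_Mapping.lookup m x)) = m"
  by (rule poly_mapping_eqI) (auto simp: lookup_sum lookup_single when_def in_keys_iff)

lemma pair_mult: "pair (a * b) f = pair a (\<lambda>x. pair b (\<lambda>y. f (x + y)))"
proof -
  have "a * b = (\<Sum>x\<in>Poly_Mapping.keys a. Poly_Mapping.single x (Poly_Mapping.lookup a x)) * (\<Sum>y\<in>Poly_Mapping.keys b. Poly_Mapping.single y (Poly_Mapping.lookup b y))"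
    by (simp only: sum_single_lookup)
  also have "\<dots> = (\<Sum>x\<in>Poly_Mapping.keys a. \<Sum>y\<in>Poly_Mapping.keys b. Poly_Mapping.single (x + y) (Poly_Mapping.lookup a x *  Poly_Mapping.lookup b y))"
    by (simp add: sum_product mult_single)
  finally have "pair (a * b) f = (\<Sum>x\<in>Poly_Mapping.keys a. \<Sum>y\<in>Poly_Mapping.keys b.  Poly_Mapping.lookup a x *  Poly_Mapping.lookup b y * f (x + y))"
    by (simp add: pair_sum)
  thus ?thesis by (simp add: pair_def sum_distrib_left mult.assoc)
qed

lemma pair_exp_mult: "pair (a * b) (\<lambda>x. exp (c * x)) = pair a (\<lambda>x. exp (c * x)) * pair b (\<lambda>x. exp (c * x))"
proof -
  have "pair b (\<lambda>y. exp (c * (x + y))) = exp (c * x) * pair b (\<lambda>y. exp (c * y))" for x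
    by (simp add: pair_def sum_distrib_left exp_add distrib_left ac_simps)
  thus ?thesis unfolding pair_mult by (simp add: pair_def[of a] sum_distrib_right mult.assoc)
qed

lemma pair_eqI: assumes "\<And>f. pair a f = pair b f" shows "a = b"
proof (rule poly_mapping_eqI)
  fix k
  have *: "pair m (\<lambda>x. if x = k then 1 else 0) =  Poly_Mapping.lookup m k" for m
    by (subst pair_superset[of "insert k (Poly_Mapping.keys m)"]) (auto simp: if_distrib[of "(*) _"] cong: if_cong)
  show " Poly_Mapping.lookup a k =  Poly_Mapping.lookup b k" using assms * by metis
qed

text \<open>Elements of \<open>real \<Rightarrow>\<^sub>0 real\<close> are finitely supported signed measures under convolution. The operator moves
  negative mass to 0 and charges the overshoot; iterating it follows the walk reflected at its running minimum,
  weighted by \<open>exp (\<alpha> * min)\<close>.\<close>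
definition refl_op :: "real \<Rightarrow> (real \<Rightarrow>\<^sub>0 real) \<Rightarrow> (real \<Rightarrow>\<^sub>0 real)" where
  "refl_op \<alpha> m = (\<Sum>x\<in>Poly_Mapping.keys m. Poly_Mapping.single (max 0 x) (Poly_Mapping.lookup m x * exp (\<alpha> * min 0 x)))"

lemma pair_refl_op: "pair (refl_op \<alpha> m) f = pair m (\<lambda>x. exp (\<alpha> * min 0 x) * f (max 0 x))"
  unfolding refl_op_def pair_sum pair_single by (simp add: pair_def mult.assoc)

lemma pair_cong: "(\<And>x. x \<in> Poly_Mapping.keys m \<Longrightarrow> f x = g x) \<Longrightarrow> pair m f = pair m g"
  unfolding pair_def by (rule sum.cong) auto

lemma keys_refl_op: "x \<in> Poly_Mapping.keys (refl_op \<alpha> m) \<Longrightarrow> x \<ge> 0"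
  unfolding refl_op_def using keys_sum[of "\<lambda>x. Poly_Mapping.single (max 0 x) (Poly_Mapping.lookup m x * exp (\<alpha> * min 0 x))"]
  by (fastforce split: if_splits)

lemma refl_op_nonneg: assumes "\<And>x. x \<in> Poly_Mapping.keys m \<Longrightarrow> x \<ge> 0" shows "refl_op \<alpha> m = m"
  by (rule pair_eqI) (auto simp: pair_refl_op assms max_absorb2 min_absorb1 intro!: pair_cong)

text \<open>This describes the kernel so that its closure under convolution is visible: supports in
  the negative half-line add, and the exponential transform is multiplicative. That closure is the
  kernel hypothesis of \<open>baxter_recursion\<close>.\<close>

lemma refl_op_zero_iff: "refl_op \<alpha> m = 0 \<longleftrightarrow> (\<forall>x\<in>Poly_Mapping.keys m. x \<le> 0) \<and> pair m (\<lambda>x. exp (\<alpha> * x)) = 0"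
proof
  assume *: "(\<forall>x\<in>Poly_Mapping.keys m. x \<le> 0) \<and> pair m (\<lambda>x. exp (\<alpha> * x)) = 0"
  show "refl_op \<alpha> m = 0"
  proof (rule pair_eqI)
    fix f
    have "pair (refl_op \<alpha> m) f = pair m (\<lambda>x. exp (\<alpha> * x) * f 0)" unfolding pair_refl_op
      using * by (intro pair_cong) (auto simp: min_absorb2 max_absorb1)
    also have "\<dots> = pair m (\<lambda>x. exp (\<alpha> * x)) * f 0" by (simp add: pair_def sum_distrib_right mult.assoc)
    finally show "pair (refl_op \<alpha> m) f = pair 0 f" using * by simp
  qed
next
  assume *: "refl_op \<alpha> m = 0"
  have le: "x \<le> 0" if "x \<in> Poly_Mapping.keys m" for x
  proof (rule ccontr)
    assume x: "\<not> x \<le> 0"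
    have "0 = pair (refl_op \<alpha> m) (\<lambda>y. if y = x then 1 else 0)" using * by simp
    also have "\<dots> = pair m (\<lambda>y. if y = x then 1 else 0)" unfolding pair_refl_op
      using x by (intro pair_cong) (auto simp: min_def max_def)
    also have "\<dots> =  Poly_Mapping.lookup m x"
      using that by (simp add: pair_def if_distrib[of "(*) _"] cong: if_cong)
    finally show False using that by (simp add: in_keys_iff)
  qed
  have "0 = pair (refl_op \<alpha> m) (\<lambda>y. 1)" using * by simp
  also have "\<dots> = pair m (\<lambda>x. exp (\<alpha> * x))" unfolding pair_refl_op
    using le by (intro pair_cong) (auto simp: min_absorb2)
  finally show "(\<forall>x\<in>Poly_Mapping.keys m. x \<le> 0) \<and> pair m (\<lambda>x. exp (\<alpha> * x)) = 0" using le by simp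
qed

text \<open>Integration against an exponential is a ring homomorphism from measures to reals, so it
  carries the abstract identity to numbers.\<close>

lemma refl_op_recursion:
  assumes p0: "p 0 = 1" and pS: "\<And>n. p (Suc n) = refl_op \<alpha> (p n * \<mu>)"
  shows "real n * pair (p n) (\<lambda>x. exp (- (\<beta> * x))) =
    (\<Sum>k=1..n. pair (\<mu> ^ k) (\<lambda>x. exp (\<alpha> * min 0 x - \<beta> * max 0 x)) * pair (p (n - k)) (\<lambda>x. exp (- (\<beta> * x))))"
proof -
  have "of_nat n * p n = (\<Sum>k=1..n. refl_op \<alpha> (\<mu> ^ k) * p (n - k))"
  proof (rule baxter_recursion[OF _ _ _ _ _ p0 pS])
    fix a b :: "real \<Rightarrow>\<^sub>0 real"
    show "refl_op \<alpha> (a + b) = refl_op \<alpha> a + refl_op \<alpha> b"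
      by (rule pair_eqI) (simp add: pair_refl_op pair_add)
    show "refl_op \<alpha> (refl_op \<alpha> a) = refl_op \<alpha> a" by (rule refl_op_nonneg) (rule keys_refl_op)
    show "refl_op \<alpha> 1 = 1" by (rule refl_op_nonneg) (auto simp: single_one[symmetric] simp del: single_one)
    show "refl_op \<alpha> (refl_op \<alpha> a * refl_op \<alpha> b) = refl_op \<alpha> a * refl_op \<alpha> b"
    proof (rule refl_op_nonneg)
      fix x assume "x \<in> Poly_Mapping.keys (refl_op \<alpha> a * refl_op \<alpha> b)"
      then obtain y z where "x = y + z" "y \<in> Poly_Mapping.keys (refl_op \<alpha> a)" "z \<in> Poly_Mapping.keys (refl_op \<alpha> b)"
        using keys_mult by blast
      thus "0 \<le> x" using keys_refl_op by (metis add_nonneg_nonneg)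
    qed
    assume ab: "refl_op \<alpha> a = 0" "refl_op \<alpha> b = 0"
    show "refl_op \<alpha> (a * b) = 0" unfolding refl_op_zero_iff
    proof
      show "\<forall>x\<in>Poly_Mapping.keys (a * b). x \<le> 0"
      proof
        fix x assume "x \<in> Poly_Mapping.keys (a * b)"
        then obtain y z where "x = y + z" "y \<in> Poly_Mapping.keys a" "z \<in> Poly_Mapping.keys b"
          using keys_mult by blast
        thus "x \<le> 0" using ab unfolding refl_op_zero_iff by (simp add: add_nonpos_nonpos)
      qed
      show "pair (a * b) (\<lambda>x. exp (\<alpha> * x)) = 0" using ab unfolding refl_op_zero_iff pair_exp_mult by simp
    qed
  qed
  hence "pair (of_nat n * p n) (\<lambda>x. exp ((-\<beta>) * x)) = pair (\<Sum>k=1..n. refl_op \<alpha> (\<mu> ^ k) * p (n - k)) (\<lambda>x. exp ((-\<beta>) * x))" by simp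
  moreover have "pair (of_nat n * p n) (\<lambda>x. exp ((-\<beta>) * x)) = real n * pair (p n) (\<lambda>x. exp ((-\<beta>) * x))"
    unfolding pair_exp_mult by (simp add: pair_of_nat)
  ultimately show ?thesis unfolding pair_sum pair_exp_mult pair_refl_op
    by (simp add: exp_add[symmetric])
qed

section \<open>Asymptotics from an exponential recursion\<close>

lemma tannery3:
  fixes f :: "nat \<Rightarrow> nat \<Rightarrow> real"
  assumes h: "summable h" and le: "\<And>n j. norm (f n j) \<le> h j" and lim: "\<And>j. (\<lambda>n. f n j) \<longlonglongrightarrow> g j"
  shows "(\<lambda>n. suminf (\<lambda>j. f n j)) \<longlonglongrightarrow> (suminf (\<lambda>j. g j))"
proof -
  have "eventually (\<lambda>(k,n). norm (f n k) \<le> h k) (at_top \<times>\<^sub>F sequentially)"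
    using le by (intro always_eventually) auto
  from tannerys_theorem[of "\<lambda>j n. f n j" g sequentially h, OF lim this h] show ?thesis by simp
qed

text \<open>With \<open>f\<close> and \<open>g\<close> the generating functions of \<open>b\<close> and the shifted \<open>c\<close>, the recursion says \<open>f' = f * g\<close>,
  so \<open>f = exp (\<Sum> c k z^k / k)\<close> stays bounded as \<open>z\<close> tends to 1.\<close>
lemma gf_ode_bound:
  fixes b c :: "nat \<Rightarrow> real"
  assumes b0: "b 0 = 1" and bn: "\<And>n. 0 \<le> b n" and b1: "\<And>n. b n \<le> 1" and cn: "\<And>k. 0 \<le> c k" and c1: "\<And>k. c k \<le> 1"
    and rec: "\<And>n. real n * b n = (\<Sum>k=1..n. c k * b (n - k))"
    and sm: "summable (\<lambda>k. c k / real k)"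
  shows "summable b"
proof -
  define A where "A = (suminf (\<lambda>k. c k / real k))"
  define f where "f z = (suminf (\<lambda>n. b n * z ^ n))" for z :: real
  define g where "g z = (suminf (\<lambda>n. c (Suc n) * z ^ n))" for z :: real
  define a where "a z = (suminf (\<lambda>n. (c n / real n) * z ^ n))" for z :: real
  have sumb: "summable (\<lambda>n. b n * z ^ n)" if "norm z < 1" for z :: real
  proof (rule summable_comparison_test'[where g = "\<lambda>n. norm z ^ n" and N = 0])
    show "summable (\<lambda>n. norm z ^ n)" using that by (simp add: summable_geometric)
    show "norm (b n * z ^ n) \<le> norm z ^ n" for n
      using bn[of n] b1[of n] by (simp add: abs_mult power_abs mult_left_le_one_le)
  qed
  have sumc: "summable (\<lambda>n. c (Suc n) * z ^ n)" if "norm z < 1" for z :: real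
  proof (rule summable_comparison_test'[where g = "\<lambda>n. norm z ^ n" and N = 0])
    show "summable (\<lambda>n. norm z ^ n)" using that by (simp add: summable_geometric)
    show "norm (c (Suc n) * z ^ n) \<le> norm z ^ n" for n
      using cn[of "Suc n"] c1[of "Suc n"] by (simp add: abs_mult power_abs mult_left_le_one_le)
  qed
  have suma: "summable (\<lambda>n. (c n / real n) * z ^ n)" if "norm z < 1" for z :: real
  proof (rule summable_comparison_test'[where g = "\<lambda>n. norm z ^ n" and N = 0])
    show "summable (\<lambda>n. norm z ^ n)" using that by (simp add: summable_geometric)
    show "norm ((c n / real n) * z ^ n) \<le> norm z ^ n" for n
    proof -
      have "c n / real n \<le> 1" using cn[of n] c1[of n] by (cases n) (auto simp: divide_simps)
      thus ?thesis using cn[of n] mult_right_mono[of "c n / real n" 1 "\<bar>z\<bar> ^ n"] by (simp add: abs_mult power_abs)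
    qed
  qed
  have df: "(f has_real_derivative (suminf (\<lambda>n. diffs b n * z ^ n))) (at z)" if "norm z < 1" for z
    unfolding f_def using termdiffs_strong_converges_everywhere that
    by (intro termdiffs_strong[where K = "(1 + norm z)/2"]) (use sumb that in auto)
  have da: "(a has_real_derivative g z) (at z)" if "norm z < 1" for z
  proof -
    have "diffs (\<lambda>n. c n / real n) = (\<lambda>n. c (Suc n))" by (auto simp: diffs_def fun_eq_iff)
    moreover have "(a has_real_derivative (suminf (\<lambda>n. diffs (\<lambda>n. c n / real n) n * z ^ n))) (at z)"
      unfolding a_def by (intro termdiffs_strong[where K = "(1 + norm z)/2"]) (use suma that in auto)
    ultimately show ?thesis by (simp add: g_def)
  qed
  have fg: "(suminf (\<lambda>n. diffs b n * z ^ n)) = f z * g z" if "norm z < 1" for z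
  proof -
    have "f z * g z = (suminf (\<lambda>n. \<Sum>i\<le>n. (b i * z ^ i) * (c (Suc (n - i)) * z ^ (n - i))))"
      unfolding f_def g_def
    proof (rule Cauchy_product)
      show "summable (\<lambda>k. norm (b k * z ^ k))" using sumb[of "norm z"] that bn by (simp add: abs_mult power_abs)
      show "summable (\<lambda>k. norm (c (Suc k) * z ^ k))" using sumc[of "norm z"] that cn by (simp add: abs_mult power_abs)
    qed
    also have "(\<lambda>n. \<Sum>i\<le>n. (b i * z ^ i) * (c (Suc (n - i)) * z ^ (n - i))) = (\<lambda>n. diffs b n * z ^ n)"
    proof
      fix n
      have "(\<Sum>i\<le>n. (b i * z ^ i) * (c (Suc (n - i)) * z ^ (n - i))) = (\<Sum>i\<le>n. b i * c (Suc (n - i))) * z ^ n"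
        unfolding sum_distrib_right by (rule sum.cong) (auto simp: power_add[symmetric])
      also have "(\<Sum>i\<le>n. b i * c (Suc (n - i))) = (\<Sum>k=1..Suc n. c k * b (Suc n - k))"
        by (rule sum.reindex_bij_witness[where i = "\<lambda>k. Suc n - k" and j = "\<lambda>i. Suc n - i"]) (auto simp: Suc_diff_le)
      also have "\<dots> = real (Suc n) * b (Suc n)" using rec[of "Suc n"] by simp
      finally show "(\<Sum>i\<le>n. (b i * z ^ i) * (c (Suc (n - i)) * z ^ (n - i))) = diffs b n * z ^ n" by (simp add: diffs_def)
    qed
    finally show ?thesis by simp
  qed
  \<comment> \<open>Solves the differential equation: \<open>fg\<close> says f' = f g and
    \<open>da\<close> says a' = g, so f exp (-a) is constant, and its value at 0 is 1.\<close>
  have fe: "f z * exp (- a z) = 1" if z: "0 \<le> z" "z < 1" for z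
  proof -
    have "((\<lambda>z. f z * exp (- a z)) has_real_derivative 0) (at y)" if "y \<in> {-1<..<1}" for y
    proof -
      have y: "norm y < 1" using that by (auto simp: abs_less_iff)
      show ?thesis
        by (rule derivative_eq_intros df[OF y] da[OF y] refl)+ (simp add: fg[OF y])
    qed
    then have "\<exists>k. \<forall>y\<in>{-1<..<1}. f y * exp (- a y) = k"
      by (intro has_field_derivative_zero_constant) (auto intro: has_field_derivative_at_within)
    then have "f z * exp (- a z) = f 0 * exp (- a 0)" using z by auto
    also have "\<dots> = 1" 
  proof -
    have "a 0 = 0" unfolding a_def using powser_zero[of "\<lambda>n. c n / real n"] by simp
    thus ?thesis unfolding f_def using b0 by (simp add: powser_zero)
  qed
    finally show ?thesis .
  qed
  have az: "a z \<le> A" if z: "0 \<le> z" "z < 1" for z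
    unfolding a_def A_def
  proof (rule suminf_le)
    show "c n / real n * z ^ n \<le> c n / real n" for n
      using cn[of n] power_le_one[of z n] z by (intro mult_left_le) auto
  qed (use suma sm z in auto)
  have fz: "f z \<le> exp A" if z: "0 \<le> z" "z < 1" for z
  proof -
    have "f z = exp (a z)" using fe[OF z] by (simp add: exp_minus field_simps)
    thus ?thesis using az[OF z] by simp
  qed
  \<comment> \<open>For each fixed \<open>N\<close> the polynomial is continuous at 1, and
    nonnegativity bounds it by \<open>f\<close> before the limit; thus the partial sums are bounded
    although \<open>f\<close> is only controlled inside the disc.\<close>
  have ps: "(\<Sum>n<N. b n) \<le> exp A" for N
  proof (rule tendsto_le[OF trivial_limit_at_left_real tendsto_const])
    show "((\<lambda>z::real. \<Sum>n<N. b n * z ^ n) \<longlongrightarrow> (\<Sum>n<N. b n)) (at_left 1)"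
      by (auto intro!: tendsto_eq_intros)
    show "\<forall>\<^sub>F z::real in at_left 1. (\<Sum>n<N. b n * z ^ n) \<le> exp A"
    proof -
      have "\<forall>\<^sub>F z::real in at_left 1. z \<in> {0<..<1}" by (rule eventually_at_left_real) auto
      thus ?thesis
      proof eventually_elim
        case (elim z)
        have "(\<Sum>n<N. b n * z ^ n) \<le> f z" unfolding f_def
          by (rule sum_le_suminf) (use sumb[of z] elim bn in auto)
        also have "\<dots> \<le> exp A" using fz elim by auto
        finally show ?case .
      qed
    qed
  qed
  show ?thesis
    by (rule summableI_nonneg_bounded[OF bn ps])
qed

lemma sum_inverse_sqrt_le: "(\<Sum>k=1..n. 1 / sqrt (real k)) \<le> 2 * sqrt (real n)"
proof (induction n)
  case (Suc n)
  have "1 / sqrt (real (Suc n)) \<le> 2 * sqrt (real (Suc n)) - 2 * sqrt (real n)"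
  proof -
    have "2 * (sqrt (real (Suc n)) - sqrt (real n)) * sqrt (real (Suc n)) \<ge> 1"
    proof -
      have "(sqrt (real (Suc n)) - sqrt (real n))^2 \<ge> 0" by simp
      hence "real (Suc n) + real n \<ge> 2 * sqrt (real n) * sqrt (real (Suc n))"
        by (simp add: power2_diff algebra_simps)
      thus ?thesis by (simp add: algebra_simps)
    qed
    thus ?thesis by (simp add: divide_simps algebra_simps)
  qed
  thus ?case using Suc by simp
qed simp

lemma summable_inverse_n_sqrt: "summable (\<lambda>n. 1 / (real n * sqrt (real n)))"
proof -
  have "summable (\<lambda>n. real n powr (-3/2))" by (subst summable_real_powr_iff) simp
  moreover have "real n powr (-3/2) = 1 / (real n * sqrt (real n))" for n
  proof (cases "n = 0")
    case False
    have "real n powr (3/2) = real n powr (1 + 1/2)" by simp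
    also have "\<dots> = real n * sqrt (real n)" using False by (subst powr_add) (simp add: powr_half_sqrt)
    finally have "real n powr (3/2) = real n * sqrt (real n)" .
    thus ?thesis using powr_minus[of "real n" "3/2"] by (simp add: inverse_eq_divide)
  qed simp
  ultimately show ?thesis by simp
qed

text \<open>In the recursion only the terms with \<open>k\<close> close to \<open>n\<close> contribute in the limit, because \<open>b\<close> is summable.\<close>
lemma exp_recursion_asymp:
  fixes b c :: "nat \<Rightarrow> real"
  assumes b0: "b 0 = 1" and bn: "\<And>n. 0 \<le> b n" and b1: "\<And>n. b n \<le> 1" and cn: "\<And>k. 0 \<le> c k" and c1: "\<And>k. c k \<le> 1"
    and rec: "\<And>n. real n * b n = (\<Sum>k=1..n. c k * b (n - k))"
    and lim: "(\<lambda>n. sqrt (real n) * c n) \<longlonglongrightarrow> \<kappa>"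
  shows "summable b" "(\<lambda>n. real n * sqrt (real n) * b n) \<longlonglongrightarrow> \<kappa> * suminf b"
proof -
  have "Bseq (\<lambda>n. sqrt (real n) * c n)" using lim by (intro convergent_imp_Bseq) (auto simp: convergent_def)
  then obtain C where C: "C > 0" "\<And>n. norm (sqrt (real n) * c n) \<le> C" by (auto simp: Bseq_def)
  have cC: "c n \<le> C / sqrt (real n)" if "n \<ge> 1" for n
    using C(2)[of n] that by (simp add: field_simps)
  have sqC: "sqrt (real n) * c n \<le> C" for n using C(2)[of n] by simp
  have sm: "summable (\<lambda>k. c k / real k)"
  proof (rule summable_comparison_test'[where g = "\<lambda>n. C * (1 / (real n * sqrt (real n)))" and N = 1])
    show "summable (\<lambda>n. C * (1 / (real n * sqrt (real n))))" by (intro summable_mult summable_inverse_n_sqrt)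
    show "norm (c n / real n) \<le> C * (1 / (real n * sqrt (real n)))" if "n \<ge> 1" for n
      using cC[OF that] cn[of n] that by (simp add: field_simps)
  qed
  show sb: "summable b" by (rule gf_ode_bound[OF b0 bn b1 cn c1 rec sm])
  define B where "B = suminf b"
  have B0: "B \<ge> 0" unfolding B_def by (intro suminf_nonneg sb bn)
  define u where "u n = real n * sqrt (real n) * b n" for n
  have un: "u n \<ge> 0" for n unfolding u_def using bn by simp
  have split: "real n * b n = (\<Sum>j\<in>{..<n}. c (n - j) * b j)" for n
    unfolding rec by (rule sum.reindex_bij_witness[where i = "\<lambda>k. n - k" and j = "\<lambda>i. n - i"]) auto
  have sumc: "(\<Sum>j\<in>{j. n div 2 < j \<and> j < n}. c (n - j)) \<le> 2 * C * sqrt (real n)" for n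
  proof -
    have "(\<Sum>j\<in>{j. n div 2 < j \<and> j < n}. c (n - j)) \<le> (\<Sum>j\<in>{..<n}. c (n - j))"
      by (rule sum_mono2) (auto simp: cn)
    also have "\<dots> = (\<Sum>k=1..n. c k)"
      by (rule sum.reindex_bij_witness[where i = "\<lambda>k. n - k" and j = "\<lambda>i. n - i"]) auto
    also have "\<dots> \<le> (\<Sum>k=1..n. C * (1 / sqrt (real k)))" by (rule sum_mono) (use cC in auto)
    also have "\<dots> = C * (\<Sum>k=1..n. 1 / sqrt (real k))" by (simp add: sum_distrib_left)
    also have "\<dots> \<le> C * (2 * sqrt (real n))" using C sum_inverse_sqrt_le by (intro mult_left_mono) auto
    finally show ?thesis by simp
  qed
  have parts: "{..<n} = {j. j \<le> n div 2 \<and> j < n} \<union> {j. n div 2 < j \<and> j < n}" for n :: nat by auto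
  have split2: "real n * b n = (\<Sum>j\<in>{j. j \<le> n div 2 \<and> j < n}. c (n - j) * b j) + (\<Sum>j\<in>{j. n div 2 < j \<and> j < n}. c (n - j) * b j)" for n
    unfolding split by (subst parts, rule sum.union_disjoint) auto
  have half: "sqrt (real n) \<le> 2 * sqrt (real (n - j))" if "j \<le> n div 2" "j < n" for n j
  proof -
    have "real n \<le> 4 * real (n - j)" using that by linarith
    hence "sqrt (real n) \<le> sqrt (4 * real (n - j))" by (rule real_sqrt_le_mono)
    thus ?thesis by (simp add: real_sqrt_mult)
  qed
  have first: "sqrt (real n) * c (n - j) \<le> 2 * C" if "j \<le> n div 2" "j < n" for n j
  proof -
    have "sqrt (real n) * c (n - j) \<le> 2 * sqrt (real (n - j)) * c (n - j)" using half[OF that] cn by (intro mult_right_mono) auto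
    also have "\<dots> \<le> 2 * C" using sqC[of "n-j"] by simp
    finally show ?thesis .
  qed
  have firstsum: "sqrt (real n) * (\<Sum>j\<in>{j. j \<le> n div 2 \<and> j < n}. c (n - j) * b j) \<le> 2 * C * B" for n
  proof -
    have "sqrt (real n) * (\<Sum>j\<in>{j. j \<le> n div 2 \<and> j < n}. c (n - j) * b j) \<le> (\<Sum>j\<in>{j. j \<le> n div 2 \<and> j < n}. 2 * C * b j)"
      unfolding sum_distrib_left
    proof (rule sum_mono)
      fix j assume "j \<in> {j. j \<le> n div 2 \<and> j < n}"
      thus "sqrt (real n) * (c (n - j) * b j) \<le> 2 * C * b j" using first[where j=j and n=n] bn[of j]
        by (metis (no_types, lifting) mem_Collect_eq mult.assoc mult_right_mono)
    qed
    also have "\<dots> \<le> 2 * C * B" unfolding B_def sum_distrib_left[symmetric]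
      by (intro mult_left_mono sum_le_suminf sb) (use C bn in auto)
    finally show ?thesis .
  qed
  \<comment> \<open>The late indices are estimated by any bound \<open>Y\<close> on the earlier
    values of \<open>u\<close>. The gain of 1 / sqrt n turns this into a contraction for large n,
    first used to bound \<open>u\<close> and then to see that these terms vanish.\<close>
  have secsum: "sqrt (real n) * (\<Sum>j\<in>{j. n div 2 < j \<and> j < n}. c (n - j) * b j) \<le> 8 * C * Y / sqrt (real n)"
    if n: "n \<ge> 1" and Y: "Y \<ge> 0" "\<And>j. j < n \<Longrightarrow> u j \<le> Y" for n Y
  proof -
    have bj: "b j \<le> 4 * Y / (real n * sqrt (real n))" if j: "n div 2 < j" "j < n" for j
    proof -
      have r: "real n \<le> 2 * real j" using j by linarith
      have s: "sqrt (real n) \<le> sqrt 2 * sqrt (real j)" unfolding real_sqrt_mult[symmetric] using r by (intro real_sqrt_le_mono) simp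
      have "sqrt 2 \<le> (2::real)" by (rule real_le_lsqrt) auto
      hence s: "sqrt (real n) \<le> 2 * sqrt (real j)" using s mult_right_mono[of "sqrt 2" 2 "sqrt (real j)"] by simp
      have "real n * sqrt (real n) * b j \<le> (2 * real j) * (2 * sqrt (real j)) * b j"
        using r s bn[of j] by (intro mult_mono mult_nonneg_nonneg) auto
      also have "\<dots> = 4 * u j" by (simp add: u_def)
      also have "\<dots> \<le> 4 * Y" using Y(2)[of j] j by simp
      finally show ?thesis using n by (simp add: field_simps)
    qed
    have "(\<Sum>j\<in>{j. n div 2 < j \<and> j < n}. c (n - j) * b j) \<le> (\<Sum>j\<in>{j. n div 2 < j \<and> j < n}. c (n - j) * (4 * Y / (real n * sqrt (real n))))"
      by (intro sum_mono mult_left_mono) (use bj cn in auto)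
    also have "\<dots> = (\<Sum>j\<in>{j. n div 2 < j \<and> j < n}. c (n - j)) * (4 * Y / (real n * sqrt (real n)))" by (rule sum_distrib_right[symmetric])
    also have "\<dots> \<le> 2 * C * sqrt (real n) * (4 * Y / (real n * sqrt (real n)))" using sumc[of n] Y(1) by (intro mult_right_mono) auto
    also have "\<dots> = 8 * C * Y / real n" using n by (simp add: field_simps)
    finally have "sqrt (real n) * (\<Sum>j\<in>{j. n div 2 < j \<and> j < n}. c (n - j) * b j) \<le> sqrt (real n) * (8 * C * Y / real n)" by (intro mult_left_mono) auto
    also have "\<dots> = 8 * C * Y / sqrt (real n)" 
    proof -
      have "real n = sqrt (real n) * sqrt (real n)" by simp
      hence "sqrt (real n) * (8 * C * Y / real n) = sqrt (real n) * (8 * C * Y / (sqrt (real n) * sqrt (real n)))" by metis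
      also have "\<dots> = 8 * C * Y / sqrt (real n)" using n by (simp del: real_sqrt_mult_self)
      finally show ?thesis .
    qed
    finally show ?thesis .
  qed
  have "\<exists>Y\<ge>0. \<forall>n. u n \<le> Y"
  proof -
    \<comment> \<open>Beyond \<open>n0\<close> one has 16 C <= sqrt n, so the late terms contribute
      at most Y / 2; the entry 4 C B in the maximum makes the early terms at most Y / 2 as
      well.\<close>
    obtain n0 :: nat where n0: "real n0 > (16 * C)\<^sup>2" "n0 \<ge> 1" using reals_Archimedean2[of "max 1 ((16*C)\<^sup>2)"]
      by (metis less_imp_le_nat max_less_iff_conj of_nat_1 of_nat_less_iff)
    define Y where "Y = max (4 * C * B) (Max (u ` {..n0}))"
    have Y0: "Y \<ge> 0" unfolding Y_def using C B0 by (simp add: le_max_iff_disj)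
    have "u n \<le> Y" for n
    proof (induction n rule: less_induct)
      case (less n)
      show ?case
      proof (cases "n \<le> n0")
        case True
        hence "u n \<le> Max (u ` {..n0})" by (intro Max_ge) auto
        thus ?thesis unfolding Y_def by simp
      next
        case False
        hence n: "n \<ge> 1" "n > n0" by auto
        have "u n = sqrt (real n) * (real n * b n)" by (simp add: u_def)
        also have "\<dots> \<le> 2 * C * B + 8 * C * Y / sqrt (real n)"
          unfolding split2 distrib_left using firstsum[of n] secsum[OF n(1) Y0] less n by (intro add_mono) auto
        also have "8 * C * Y / sqrt (real n) \<le> Y / 2"
        proof -
          have "16 * C \<le> sqrt (real n)" using n0 n C by (intro real_le_rsqrt) auto
          hence "16 * C * Y \<le> sqrt (real n) * Y" using Y0 by (intro mult_right_mono) auto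
          thus ?thesis using n by (simp add: field_simps)
        qed
        also have "2 * C * B \<le> Y / 2" unfolding Y_def by simp
        finally show ?thesis by simp
      qed
    qed
    thus ?thesis using Y0 by blast
  qed
  then obtain Y where Y: "Y \<ge> 0" "\<And>n. u n \<le> Y" by blast
  have lim1: "(\<lambda>n. sqrt (real n) * (\<Sum>j\<in>{j. n div 2 < j \<and> j < n}. c (n - j) * b j)) \<longlonglongrightarrow> 0"
  proof (rule tendsto_sandwich[OF _ _ tendsto_const])
    show "\<forall>\<^sub>F n in sequentially. 0 \<le> sqrt (real n) * (\<Sum>j\<in>{j. n div 2 < j \<and> j < n}. c (n - j) * b j)"
      using cn bn by (intro always_eventually allI mult_nonneg_nonneg sum_nonneg) auto
    show "\<forall>\<^sub>F n in sequentially. sqrt (real n) * (\<Sum>j\<in>{j. n div 2 < j \<and> j < n}. c (n - j) * b j) \<le> 8 * C * Y / sqrt (real n)"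
      using eventually_ge_at_top[of 1] by eventually_elim (use secsum Y in auto)
    show "(\<lambda>n. 8 * C * Y / sqrt (real n)) \<longlonglongrightarrow> 0"
      by (intro real_tendsto_divide_at_top[OF tendsto_const] filterlim_compose[OF sqrt_at_top] filterlim_real_sequentially)
  qed
  \<comment> \<open>For fixed j the weight sqrt n * c (n - j) converges to \<kappa>, and for j <= n
    / 2 it is at most 2 C, so the summable majorant 2 C b allows the termwise limit.\<close>
  have lim2: "(\<lambda>n. suminf (\<lambda>j. (if j \<le> n div 2 \<and> j < n then sqrt (real n) * c (n - j) * b j else 0))) \<longlonglongrightarrow> (suminf (\<lambda>j. \<kappa> * b j))"
  proof (rule tannery3)
    show "summable (\<lambda>j. 2 * C * b j)" by (intro summable_mult sb)
    show "norm (if j \<le> n div 2 \<and> j < n then sqrt (real n) * c (n - j) * b j else 0) \<le> 2 * C * b j" for n j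
      using first[where j=j and n=n] bn[of j] cn[of "n-j"] C(1) by (auto simp: abs_mult intro!: mult_right_mono)
    show "(\<lambda>n. (if j \<le> n div 2 \<and> j < n then sqrt (real n) * c (n - j) * b j else 0)) \<longlonglongrightarrow> \<kappa> * b j" for j
    proof (rule Lim_transform_eventually)
      have "(\<lambda>n. sqrt (real (n + j)) / sqrt (real n)) \<longlonglongrightarrow> 1" by real_asymp
      from tendsto_mult[OF this lim] have "(\<lambda>n. sqrt (real (n + j)) / sqrt (real n) * (sqrt (real n) * c n)) \<longlonglongrightarrow> \<kappa>" by simp
      hence "(\<lambda>n. sqrt (real (n + j)) * c n) \<longlonglongrightarrow> \<kappa>"
        by (rule Lim_transform_eventually) (use eventually_gt_at_top[of 0] in eventually_elim, simp)
      hence "(\<lambda>n. sqrt (real (n - j + j)) * c (n - j)) \<longlonglongrightarrow> \<kappa>"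
        by (rule filterlim_compose[OF _ filterlim_minus_const_nat_at_top])
      thus "(\<lambda>n. sqrt (real (n - j + j)) * c (n - j) * b j) \<longlonglongrightarrow> \<kappa> * b j" by (intro tendsto_mult tendsto_const)
      show "\<forall>\<^sub>F n in sequentially. sqrt (real (n - j + j)) * c (n - j) * b j = (if j \<le> n div 2 \<and> j < n then sqrt (real n) * c (n - j) * b j else 0)"
        using eventually_gt_at_top[of "2 * j"] by eventually_elim auto
    qed
  qed
  have eq: "u n = (suminf (\<lambda>j. (if j \<le> n div 2 \<and> j < n then sqrt (real n) * c (n - j) * b j else 0))) + sqrt (real n) * (\<Sum>j\<in>{j. n div 2 < j \<and> j < n}. c (n - j) * b j)" for n
  proof -
    have "(suminf (\<lambda>j. (if j \<le> n div 2 \<and> j < n then sqrt (real n) * c (n - j) * b j else 0))) = (\<Sum>j\<in>{j. j \<le> n div 2 \<and> j < n}. sqrt (real n) * c (n - j) * b j)"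
      by (subst suminf_finite[of "{j. j \<le> n div 2 \<and> j < n}"]) auto
    moreover have "u n = sqrt (real n) * (real n * b n)" by (simp add: u_def)
    ultimately show ?thesis unfolding split2 distrib_left by (simp add: sum_distrib_left mult.assoc)
  qed
  have "u \<longlonglongrightarrow> (suminf (\<lambda>j. \<kappa> * b j)) + 0" unfolding eq by (intro tendsto_add lim1 lim2)
  thus "(\<lambda>n. real n * sqrt (real n) * b n) \<longlonglongrightarrow> \<kappa> * suminf b"
    unfolding u_def using suminf_mult[OF sb] by simp
qed

section \<open>Paths and their running extrema\<close>

definition pS :: "(nat \<Rightarrow> real) \<Rightarrow> nat \<Rightarrow> real" where "pS u n = (\<Sum>i<n. u i)"
definition pL :: "(nat \<Rightarrow> real) \<Rightarrow> nat \<Rightarrow> real" where "pL u n = Min (pS u ` {..n})"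
definition pM :: "(nat \<Rightarrow> real) \<Rightarrow> nat \<Rightarrow> real" where "pM u n = Max (pS u ` {..n})"

lemma pS_0 [simp]: "pS u 0 = 0" and pS_Suc: "pS u (Suc n) = pS u n + u n"
  by (simp_all add: pS_def)
lemma pL_0 [simp]: "pL u 0 = 0" by (simp add: pL_def)
lemma pM_0 [simp]: "pM u 0 = 0" by (simp add: pM_def)
lemma pL_Suc: "pL u (Suc n) = min (pL u n) (pS u (Suc n))"
  by (simp add: pL_def atMost_Suc min.commute)
lemma pM_Suc: "pM u (Suc n) = max (pM u n) (pS u (Suc n))"
  by (simp add: pM_def atMost_Suc max.commute)
lemma pL_ge_iff: "c \<le> pL u n \<longleftrightarrow> (\<forall>k\<le>n. c \<le> pS u k)"
  by (auto simp: pL_def)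
lemma pM_le_iff: "pM u n \<le> c \<longleftrightarrow> (\<forall>k\<le>n. pS u k \<le> c)"
  by (auto simp: pM_def)
lemma pL_le: "k \<le> n \<Longrightarrow> pL u n \<le> pS u k" using pL_ge_iff[of "pL u n" u n] by simp
lemma pM_ge: "k \<le> n \<Longrightarrow> pS u k \<le> pM u n" using pM_le_iff[of u n "pM u n"] by simp
lemma pL_nonpos: "pL u n \<le> 0" using pL_le[of 0 n u] by simp
lemma pM_nonneg: "0 \<le> pM u n" using pM_ge[of 0 n u] by simp
lemma pL_le_pS: "pL u n \<le> pS u n" by (rule pL_le) simp
lemma pM_mono: "m \<le> n \<Longrightarrow> pM u m \<le> pM u n" unfolding pM_le_iff using pM_ge by auto
lemma pL_attained: "\<exists>k\<le>n. pL u n = pS u k"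
proof -
  have "pL u n \<in> pS u ` {..n}" unfolding pL_def by (rule Min_in) auto
  thus ?thesis by auto
qed

lemma pS_comb_left: "n \<le> k \<Longrightarrow> pS (comb_seq k u v) n = pS u n"
  unfolding pS_def by (rule sum.cong) (auto simp: comb_seq_def)
lemma pS_comb: "pS (comb_seq k u v) (k + m) = pS u k + pS v m"
proof (induction m)
  case (Suc m)
  have "comb_seq k u v (k + m) = v m" by (simp add: comb_seq_def)
  thus ?case using Suc by (simp add: pS_Suc)
qed (simp add: pS_comb_left)
lemma pL_comb_left: "n \<le> k \<Longrightarrow> pL (comb_seq k u v) n = pL u n"
  unfolding pL_def by (rule arg_cong[where f = Min]) (auto simp: pS_comb_left intro!: image_cong)
lemma pL_comb: "pL (comb_seq k u v) (k + m) = min (pL u k) (pS u k + pL v m)"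
proof (induction m)
  case 0
  show ?case using pL_le_pS[of u k] by (simp add: pL_comb_left)
next
  case (Suc m)
  have "pS u k + min (pL v m) (pS v (Suc m)) = min (pS u k + pL v m) (pS u k + pS v (Suc m))" by (simp add: min_add_distrib_right)
  thus ?case using Suc pS_comb[of k u v "Suc m"] by (simp add: pL_Suc min.assoc)
qed

lemma comp_comb_seq: "(\<lambda>i. g (comb_seq k \<omega> \<omega>' i)) = comb_seq k (\<lambda>i. g (\<omega> i)) (\<lambda>i. g (\<omega>' i))"
  by (auto simp: comb_seq_def)

definition rev_index :: "nat \<Rightarrow> nat \<Rightarrow> nat" where "rev_index n i = (if i < n then n - 1 - i else i)"

lemma rev_index_invol: "rev_index n (rev_index n i) = i" by (auto simp: rev_index_def)
lemma inj_rev_index: "inj (rev_index n)" by (metis injI rev_index_invol)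

lemma pS_rev: "k \<le> n \<Longrightarrow> pS (\<lambda>i. u (rev_index n i)) k = pS u n - pS u (n - k)"
proof (induction k)
  case (Suc k)
  have "pS u (n - k) = pS u (n - Suc k) + u (n - Suc k)" using Suc.prems by (metis Suc_diff_Suc Suc_le_lessD pS_Suc)
  thus ?case using Suc by (simp add: pS_Suc rev_index_def)
qed simp

text \<open>Duality: reversing time turns a statement about the minimum near the end of a path into
  one about the maximum near its beginning.\<close>

lemma pL_rev: "pL (\<lambda>i. u (rev_index n i)) n = pS u n - pM u n"
proof (rule antisym)
  show "pS u n - pM u n \<le> pL (\<lambda>i. u (rev_index n i)) n"
    unfolding pL_ge_iff using pM_ge by (auto simp: pS_rev)
  have "pM u n \<in> pS u ` {..n}" unfolding pM_def by (rule Max_in) auto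
  then obtain k where k: "k \<le> n" "pM u n = pS u k" by auto
  have "pL (\<lambda>i. u (rev_index n i)) n \<le> pS (\<lambda>i. u (rev_index n i)) (n - k)" by (rule pL_le) simp
  also have "\<dots> = pS u n - pM u n" using k by (simp add: pS_rev)
  finally show "pL (\<lambda>i. u (rev_index n i)) n \<le> pS u n - pM u n" .
qed

lemma pS_tendsto: "(\<And>i. (\<lambda>N. u N i) \<longlonglongrightarrow> v i) \<Longrightarrow> (\<lambda>N. pS (u N) n) \<longlonglongrightarrow> pS v n"
  unfolding pS_def by (intro tendsto_sum)
lemma pL_tendsto: "(\<And>i. (\<lambda>N. u N i) \<longlonglongrightarrow> v i) \<Longrightarrow> (\<lambda>N. pL (u N) n) \<longlonglongrightarrow> pL v n"
  by (induction n) (auto simp: pL_Suc intro!: tendsto_min pS_tendsto)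

lemma pS_mono: "(\<And>i. u i \<le> v i) \<Longrightarrow> pS u n \<le> pS v n" unfolding pS_def by (intro sum_mono)
lemma pL_mono: "(\<And>i. u i \<le> v i) \<Longrightarrow> pL u n \<le> pL v n"
  unfolding pL_ge_iff[of "pL u n" v] using pL_le pS_mono by (meson order_trans)

lemma measurable_pS [measurable]:
  assumes "\<And>i. (\<lambda>\<omega>. f \<omega> i) \<in> borel_measurable M"
  shows "(\<lambda>\<omega>. pS (f \<omega>) n) \<in> borel_measurable M"
  unfolding pS_def using assms by measurable
lemma measurable_pL [measurable]:
  assumes "\<And>i. (\<lambda>\<omega>. f \<omega> i) \<in> borel_measurable M"
  shows "(\<lambda>\<omega>. pL (f \<omega>) n) \<in> borel_measurable M"
  by (induction n) (auto simp: pL_Suc intro!: borel_measurable_min measurable_pS assms)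
lemma measurable_pM [measurable]:
  assumes "\<And>i. (\<lambda>\<omega>. f \<omega> i) \<in> borel_measurable M"
  shows "(\<lambda>\<omega>. pM (f \<omega>) n) \<in> borel_measurable M"
  by (induction n) (auto simp: pM_Suc intro!: borel_measurable_max measurable_pS assms)

section \<open>Splitting and reversing independent coordinates\<close>

context sequence_space
begin

lemma integrable_bounded:
  fixes F :: "(nat \<Rightarrow> 'a) \<Rightarrow> 'c::{banach, second_countable_topology}"
  assumes "F \<in> borel_measurable S" "\<And>\<omega>. norm (F \<omega>) \<le> B"
  shows "integrable S F"
  using assms by (intro P.integrable_const_bound[where B = B]) auto

sublocale PP: pair_prob_space S S ..

lemma comb_measurable [measurable]: "(\<lambda>(\<omega>, \<omega>'). comb_seq k \<omega> \<omega>') \<in> S \<Otimes>\<^sub>M S \<rightarrow>\<^sub>M S"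
  by (rule measurable_comb_seq)

text \<open>Takes the role of the Markov property: the coordinates from \<open>k\<close> on are
  replaced by an independent copy, which is integrated first.\<close>

lemma E_split:
  fixes F :: "(nat \<Rightarrow> 'a) \<Rightarrow> 'c::{banach, second_countable_topology}"
  assumes F: "integrable S F"
  shows "integrable (S \<Otimes>\<^sub>M S) (\<lambda>(\<omega>, \<omega>'). F (comb_seq k \<omega> \<omega>'))"
    "integrable S (\<lambda>\<omega>. \<integral>\<omega>'. F (comb_seq k \<omega> \<omega>') \<partial>S)"
    "(\<integral>\<omega>. F \<omega> \<partial>S) = (\<integral>\<omega>. (\<integral>\<omega>'. F (comb_seq k \<omega> \<omega>') \<partial>S) \<partial>S)"
proof -
  have Fm: "F \<in> borel_measurable S" using F by simp
  have d: "distr (S \<Otimes>\<^sub>M S) S (\<lambda>(\<omega>, \<omega>'). comb_seq k \<omega> \<omega>') = S" by (rule PiM_comb_seq)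
  have "integrable (distr (S \<Otimes>\<^sub>M S) S (\<lambda>(\<omega>, \<omega>'). comb_seq k \<omega> \<omega>')) F" unfolding d by (rule F)
  hence i: "integrable (S \<Otimes>\<^sub>M S) (\<lambda>z. F (case z of (\<omega>, \<omega>') \<Rightarrow> comb_seq k \<omega> \<omega>'))"
    by (subst (asm) integrable_distr_eq) (use Fm in auto)
  thus i': "integrable (S \<Otimes>\<^sub>M S) (\<lambda>(\<omega>, \<omega>'). F (comb_seq k \<omega> \<omega>'))" by (simp add: split_beta')
  have "(\<integral>\<omega>. F \<omega> \<partial>S) = (\<integral>\<omega>. F \<omega> \<partial>distr (S \<Otimes>\<^sub>M S) S (\<lambda>(\<omega>, \<omega>'). comb_seq k \<omega> \<omega>'))" unfolding d ..
  also have "\<dots> = (\<integral>z. F (case z of (\<omega>, \<omega>') \<Rightarrow> comb_seq k \<omega> \<omega>') \<partial>(S \<Otimes>\<^sub>M S))"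
    by (rule integral_distr) (use Fm in auto)
  also have "\<dots> = (\<integral>(\<omega>, \<omega>'). F (comb_seq k \<omega> \<omega>') \<partial>(S \<Otimes>\<^sub>M S))" by (simp add: split_beta')
  also have "\<dots> = (\<integral>\<omega>. (\<integral>\<omega>'. F (comb_seq k \<omega> \<omega>') \<partial>S) \<partial>S)" using PP.integral_fst'[OF i'] by simp
  finally show "(\<integral>\<omega>. F \<omega> \<partial>S) = (\<integral>\<omega>. (\<integral>\<omega>'. F (comb_seq k \<omega> \<omega>') \<partial>S) \<partial>S)" .
  show "integrable S (\<lambda>\<omega>. \<integral>\<omega>'. F (comb_seq k \<omega> \<omega>') \<partial>S)" using PP.integrable_fst'[OF i'] by simp
qed

lemma E_split_le:
  fixes F c :: "(nat \<Rightarrow> 'a) \<Rightarrow> real"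
  assumes "integrable S F" "integrable S c" "\<And>\<omega>. (\<integral>\<omega>'. F (comb_seq k \<omega> \<omega>') \<partial>S) \<le> c \<omega>"
  shows "(\<integral>\<omega>. F \<omega> \<partial>S) \<le> (\<integral>\<omega>. c \<omega> \<partial>S)"
  unfolding E_split(3)[OF assms(1), of k] by (rule integral_mono[OF E_split(2)[OF assms(1)] assms(2) assms(3)])

lemma E_product:
  fixes F f g :: "(nat \<Rightarrow> 'a) \<Rightarrow> real"
  assumes "integrable S F" "\<And>\<omega> \<omega>'. F (comb_seq k \<omega> \<omega>') = f \<omega> * g \<omega>'"
  shows "(\<integral>\<omega>. F \<omega> \<partial>S) = (\<integral>\<omega>. f \<omega> \<partial>S) * (\<integral>\<omega>. g \<omega> \<partial>S)"
  unfolding E_split(3)[OF assms(1), of k] assms(2) by simp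

lemma E_coord:
  fixes h :: "'a \<Rightarrow> 'c::{banach, second_countable_topology}"
  assumes [measurable]: "h \<in> borel_measurable M"
  shows "(\<integral>\<omega>. h (\<omega> i) \<partial>S) = (\<integral>q. h q \<partial>M)" "integrable S (\<lambda>\<omega>. h (\<omega> i)) \<longleftrightarrow> integrable M h"
proof -
  have d: "distr S M (\<lambda>\<omega>. \<omega> i) = M" by (rule PiM_component) simp
  have m: "(\<lambda>\<omega>. \<omega> i) \<in> S \<rightarrow>\<^sub>M M" by measurable
  show "(\<integral>\<omega>. h (\<omega> i) \<partial>S) = (\<integral>q. h q \<partial>M)" using integral_distr[OF m assms] unfolding d by simp
  show "integrable S (\<lambda>\<omega>. h (\<omega> i)) \<longleftrightarrow> integrable M h" using integrable_distr_eq[OF m assms] unfolding d by simp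
qed

text \<open>The Fubini argument also covers unbounded \<open>G\<close>, as required when
  \<open>G\<close> is the walk itself and \<open>h\<close> its next increment.\<close>

lemma E_indep_mult:
  fixes G :: "(nat \<Rightarrow> 'a) \<Rightarrow> real" and h :: "'a \<Rightarrow> real"
  assumes G: "integrable S G" and h: "integrable M h" and dep: "\<And>\<omega> \<omega>'. G (comb_seq k \<omega> \<omega>') = G \<omega>"
  shows "integrable S (\<lambda>\<omega>. G \<omega> * h (\<omega> k))" "(\<integral>\<omega>. G \<omega> * h (\<omega> k) \<partial>S) = (\<integral>\<omega>. G \<omega> \<partial>S) * (\<integral>q. h q \<partial>M)"
proof -
  have [measurable]: "G \<in> borel_measurable S" "h \<in> borel_measurable M" using G h by auto
  have h0: "integrable S (\<lambda>\<omega>. h (\<omega> 0))" using h by (simp add: E_coord)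
  have eq: "G (comb_seq k \<omega> \<omega>') * h (comb_seq k \<omega> \<omega>' k) = G \<omega> * h (\<omega>' 0)" for \<omega> \<omega>' by (simp add: dep comb_seq_def)
  have "integrable (S \<Otimes>\<^sub>M S) (\<lambda>(\<omega>, \<omega>'). G \<omega> * h (\<omega>' 0))"
  proof (rule PP.Fubini_integrable)
    show "integrable S (\<lambda>x. \<integral>y. norm (case (x, y) of (\<omega>, \<omega>') \<Rightarrow> G \<omega> * h (\<omega>' 0)) \<partial>S)"
      using G by (simp add: abs_mult)
  qed (use h0 in auto)
  hence "integrable (S \<Otimes>\<^sub>M S) (\<lambda>z. (\<lambda>\<omega>. G \<omega> * h (\<omega> k)) (case z of (\<omega>, \<omega>') \<Rightarrow> comb_seq k \<omega> \<omega>'))"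
    by (simp add: split_beta' eq)
  hence "integrable (distr (S \<Otimes>\<^sub>M S) S (\<lambda>(\<omega>, \<omega>'). comb_seq k \<omega> \<omega>')) (\<lambda>\<omega>. G \<omega> * h (\<omega> k))"
    by (subst integrable_distr_eq) auto
  thus i: "integrable S (\<lambda>\<omega>. G \<omega> * h (\<omega> k))" unfolding PiM_comb_seq .
  show "(\<integral>\<omega>. G \<omega> * h (\<omega> k) \<partial>S) = (\<integral>\<omega>. G \<omega> \<partial>S) * (\<integral>q. h q \<partial>M)"
    using E_product[OF i, of k G "\<lambda>\<omega>. h (\<omega> 0)"] eq by (simp add: E_coord)
qed

lemma E_rev:
  fixes F :: "(nat \<Rightarrow> 'a) \<Rightarrow> 'c::{banach, second_countable_topology}"
  assumes [measurable]: "F \<in> borel_measurable S"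
  shows "(\<integral>\<omega>. F (\<lambda>i. \<omega> (rev_index n i)) \<partial>S) = (\<integral>\<omega>. F \<omega> \<partial>S)"
proof -
  have d: "distr S S (\<lambda>\<omega>. \<lambda>i\<in>UNIV. \<omega> (rev_index n i)) = S"
    by (rule distr_PiM_reindex) (use M.prob_space_axioms inj_rev_index in auto)
  have m: "(\<lambda>\<omega>. \<lambda>i\<in>UNIV. \<omega> (rev_index n i)) \<in> S \<rightarrow>\<^sub>M S" by measurable
  have "(\<integral>\<omega>. F \<omega> \<partial>distr S S (\<lambda>\<omega>. \<lambda>i\<in>UNIV. \<omega> (rev_index n i))) = (\<integral>\<omega>. F (\<lambda>i\<in>UNIV. \<omega> (rev_index n i)) \<partial>S)"
    by (rule integral_distr[OF m assms])
  thus ?thesis unfolding d by (simp add: restrict_UNIV)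
qed

end

lemma exp_diff_le_1: "a \<le> 0 \<Longrightarrow> 0 \<le> b \<Longrightarrow> exp (a - b) \<le> (1 :: real)" by simp
lemma norm_exp_real: "norm (exp a :: real) = exp a" by simp

section \<open>A centred non-lattice random walk with steps bounded below\<close>

locale env_walk = sequence_space D for D :: "'b measure" +
  fixes x :: "'b \<Rightarrow> real" and s2 x0 :: real
  assumes x_meas [measurable]: "x \<in> borel_measurable D"
    and x_lower: "\<And>q. - x0 \<le> x q"
    and x_square_int: "integrable D (\<lambda>q. (x q)\<^sup>2)"
    and x_mean: "(\<integral>q. x q \<partial>D) = 0"
    and x_var: "(\<integral>q. (x q)\<^sup>2 \<partial>D) = s2" and s2_pos: "s2 > 0"
    and nonlattice: "\<And>t. t \<noteq> 0 \<Longrightarrow> cmod (\<integral>q. iexp (t * x q) \<partial>D) < 1"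
begin

lemma x0_nonneg: "x0 \<ge> 0"
proof (rule ccontr)
  assume "\<not> 0 \<le> x0"
  hence "0 < - x0" by simp
  also have "- x0 = (\<integral>q. - x0 \<partial>D)" by (simp add: M.prob_space)
  also have "\<dots> \<le> (\<integral>q. x q \<partial>D)"
    using M.square_integrable_imp_integrable[OF x_meas x_square_int] x_lower by (intro integral_mono) auto
  finally show False using x_mean by simp
qed

lemma x_int: "integrable D x"
  by (rule M.square_integrable_imp_integrable[OF x_meas x_square_int])

definition walk :: "(nat \<Rightarrow> 'b) \<Rightarrow> nat \<Rightarrow> real" where "walk \<omega> n = pS (\<lambda>i. x (\<omega> i)) n"
definition wmin :: "(nat \<Rightarrow> 'b) \<Rightarrow> nat \<Rightarrow> real" where "wmin \<omega> n = pL (\<lambda>i. x (\<omega> i)) n"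
definition wmax :: "(nat \<Rightarrow> 'b) \<Rightarrow> nat \<Rightarrow> real" where "wmax \<omega> n = pM (\<lambda>i. x (\<omega> i)) n"

lemma walk_meas [measurable]: "(\<lambda>\<omega>. walk \<omega> n) \<in> borel_measurable S" unfolding walk_def by measurable
lemma wmin_meas [measurable]: "(\<lambda>\<omega>. wmin \<omega> n) \<in> borel_measurable S" unfolding wmin_def by measurable
lemma wmax_meas [measurable]: "(\<lambda>\<omega>. wmax \<omega> n) \<in> borel_measurable S" unfolding wmax_def by measurable

lemma walk_0 [simp]: "walk \<omega> 0 = 0" and wmin_0 [simp]: "wmin \<omega> 0 = 0" and wmax_0 [simp]: "wmax \<omega> 0 = 0"
  by (simp_all add: walk_def wmin_def wmax_def)
lemma walk_Suc: "walk \<omega> (Suc n) = walk \<omega> n + x (\<omega> n)" by (simp add: walk_def pS_Suc)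
lemma wmin_Suc: "wmin \<omega> (Suc n) = min (wmin \<omega> n) (walk \<omega> (Suc n))" by (simp add: walk_def wmin_def pL_Suc)
lemma wmin_ge_iff: "c \<le> wmin \<omega> n \<longleftrightarrow> (\<forall>k\<le>n. c \<le> walk \<omega> k)" by (simp add: walk_def wmin_def pL_ge_iff)
lemma wmax_le_iff: "wmax \<omega> n \<le> c \<longleftrightarrow> (\<forall>k\<le>n. walk \<omega> k \<le> c)" by (simp add: walk_def wmax_def pM_le_iff)
lemma wmin_le: "k \<le> n \<Longrightarrow> wmin \<omega> n \<le> walk \<omega> k" by (simp add: walk_def wmin_def pL_le)
lemma wmin_nonpos: "wmin \<omega> n \<le> 0" by (simp add: wmin_def pL_nonpos)
lemma wmax_nonneg: "0 \<le> wmax \<omega> n" by (simp add: wmax_def pM_nonneg)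
lemma wmin_le_walk: "wmin \<omega> n \<le> walk \<omega> n" by (simp add: wmin_le)
lemma wmax_mono: "m \<le> n \<Longrightarrow> wmax \<omega> m \<le> wmax \<omega> n" by (simp add: wmax_def pM_mono)
lemma walk_comb_left: "n \<le> k \<Longrightarrow> walk (comb_seq k \<omega> \<omega>') n = walk \<omega> n" by (simp add: walk_def comp_comb_seq pS_comb_left)
lemma wmin_comb_left: "n \<le> k \<Longrightarrow> wmin (comb_seq k \<omega> \<omega>') n = wmin \<omega> n" by (simp add: wmin_def comp_comb_seq pL_comb_left)
lemma walk_comb: "walk (comb_seq k \<omega> \<omega>') (k + m) = walk \<omega> k + walk \<omega>' m" by (simp add: walk_def comp_comb_seq pS_comb)
lemma wmin_comb: "wmin (comb_seq k \<omega> \<omega>') (k + m) = min (wmin \<omega> k) (walk \<omega> k + wmin \<omega>' m)" by (simp add: walk_def wmin_def comp_comb_seq pL_comb)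
lemma wmax_comb_left: "n \<le> k \<Longrightarrow> wmax (comb_seq k \<omega> \<omega>') n = wmax \<omega> n"
proof (rule antisym)
  assume "n \<le> k"
  thus "wmax (comb_seq k \<omega> \<omega>') n \<le> wmax \<omega> n" "wmax \<omega> n \<le> wmax (comb_seq k \<omega> \<omega>') n"
    using wmax_le_iff[of "comb_seq k \<omega> \<omega>'" n "wmax \<omega> n"] wmax_le_iff[of \<omega> n "wmax \<omega> n"]
      wmax_le_iff[of \<omega> n "wmax (comb_seq k \<omega> \<omega>') n"] wmax_le_iff[of "comb_seq k \<omega> \<omega>'" n "wmax (comb_seq k \<omega> \<omega>') n"]
    by (auto simp: walk_comb_left)
qed
lemma walk_rev: "k \<le> n \<Longrightarrow> walk (\<lambda>i. \<omega> (rev_index n i)) k = walk \<omega> n - walk \<omega> (n - k)"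
  unfolding walk_def by (rule pS_rev)
lemma wmin_rev: "wmin (\<lambda>i. \<omega> (rev_index n i)) n = walk \<omega> n - wmax \<omega> n"
  unfolding walk_def wmin_def wmax_def by (rule pL_rev)

lemma walk_integrable: "integrable S (\<lambda>\<omega>. walk \<omega> n)"
  unfolding walk_def pS_def by (intro Bochner_Integration.integrable_sum) (simp add: E_coord x_int)
lemma walk_square_integrable: "integrable S (\<lambda>\<omega>. (walk \<omega> n)\<^sup>2)"
proof (induction n)
  case (Suc n)
  have "integrable S (\<lambda>\<omega>. walk \<omega> n * x (\<omega> n))"
    by (rule E_indep_mult[OF walk_integrable x_int]) (simp add: walk_comb_left)
  moreover have "integrable S (\<lambda>\<omega>. (x (\<omega> n))\<^sup>2)" using E_coord(2)[of "\<lambda>q. (x q)\<^sup>2" n] x_square_int by simp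
  ultimately have "integrable S (\<lambda>\<omega>. (walk \<omega> n)\<^sup>2 + 2 * (walk \<omega> n * x (\<omega> n)) + (x (\<omega> n))\<^sup>2)" using Suc by auto
  thus ?case by (simp add: walk_Suc power2_sum algebra_simps)
qed simp

definition \<nu> :: "nat \<Rightarrow> real measure" where "\<nu> n = distr S borel (\<lambda>\<omega>. walk \<omega> n)"
definition \<mu> :: "real measure" where "\<mu> = distr D borel x"

lemma rd_nu: "real_distribution (\<nu> n)"
  unfolding \<nu>_def by (rule P.real_distribution_distr) simp
lemma rd_mu: "real_distribution \<mu>"
  unfolding \<mu>_def by (rule M.real_distribution_distr) simp

lemma int_nu: "f \<in> borel_measurable borel \<Longrightarrow> (\<integral>z. f z \<partial>\<nu> n) = (\<integral>\<omega>. f (walk \<omega> n) \<partial>S)"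
  for f :: "real \<Rightarrow> 'c::{banach, second_countable_topology}"
  unfolding \<nu>_def by (rule integral_distr) auto

lemma char_mu: "char \<mu> t = (\<integral>q. iexp (t * x q) \<partial>D)"
  unfolding \<mu>_def char_def by (rule integral_distr) auto

lemma char_nu: "char (\<nu> n) t = char \<mu> t ^ n"
proof (induction n)
  case 0
  have "char (\<nu> 0) t = (\<integral>\<omega>. iexp (t * walk \<omega> 0) \<partial>S)" unfolding char_def by (rule int_nu) simp
  thus ?case by (simp add: P.prob_space)
next
  case (Suc n)
  have bm [measurable]: "(\<lambda>\<omega>. iexp (t * walk \<omega> m)) \<in> borel_measurable S" for m by measurable
  have "char (\<nu> (Suc n)) t = (\<integral>\<omega>. iexp (t * walk \<omega> (Suc n)) \<partial>S)" unfolding char_def by (rule int_nu) simp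
  also have "\<dots> = (\<integral>\<omega>. (\<integral>\<omega>'. iexp (t * walk (comb_seq n \<omega> \<omega>') (Suc n)) \<partial>S) \<partial>S)"
    by (rule E_split, rule integrable_bounded[where B = 1]) auto
  also have "\<dots> = (\<integral>\<omega>. (\<integral>\<omega>'. iexp (t * walk \<omega> n) * iexp (t * x (\<omega>' 0)) \<partial>S) \<partial>S)"
    by (intro Bochner_Integration.integral_cong refl) (simp add: walk_Suc walk_comb_left comb_seq_def exp_add[symmetric] algebra_simps)
  also have "\<dots> = (\<integral>\<omega>. iexp (t * walk \<omega> n) \<partial>S) * (\<integral>\<omega>'. iexp (t * x (\<omega>' 0)) \<partial>S)" by (simp only: integral_mult_right_zero integral_mult_left_zero)
  also have "(\<integral>\<omega>'. iexp (t * x (\<omega>' 0)) \<partial>S) = char \<mu> t" unfolding char_mu using E_coord(1)[of "\<lambda>q. iexp (t * x q)" 0] by simp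
  also have "(\<integral>\<omega>. iexp (t * walk \<omega> n) \<partial>S) = char (\<nu> n) t" unfolding char_def by (rule int_nu[symmetric]) simp
  finally show ?case using Suc by (simp add: mult.commute)
qed

lemma mu_moments: "integrable \<mu> (\<lambda>z. z)" "(\<integral>z. z \<partial>\<mu>) = 0" "integrable \<mu> (\<lambda>z. z\<^sup>2)" "(\<integral>z. z\<^sup>2 \<partial>\<mu>) = s2"
  unfolding \<mu>_def using x_int x_mean x_square_int x_var by (auto simp: integrable_distr_eq integral_distr)

lemma char_nu_limit: "(\<lambda>n. char (\<nu> n) (u / sqrt (real n))) \<longlonglongrightarrow> complex_of_real (exp (- (s2 * u\<^sup>2 / 2)))"
  unfolding char_nu by (rule real_distribution.char_power_limit[OF rd_mu mu_moments s2_pos])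

lemma char_nu_bound: "\<exists>c>0. \<forall>n t. \<bar>t\<bar> \<le> A \<longrightarrow> cmod (char (\<nu> n) t) \<le> exp (- (c * real n * t\<^sup>2))"
  unfolding char_nu by (rule real_distribution.char_power_bound[OF rd_mu mu_moments s2_pos]) (unfold char_mu, rule nonlattice)

lemma local_limit:
  assumes "\<And>z. isCont \<phi> z" "\<And>z. \<bar>\<phi> z\<bar> \<le> C / (1 + z\<^sup>2)"
  shows "(\<lambda>n. sqrt (real n) * (\<integral>\<omega>. \<phi> (walk \<omega> n) \<partial>S)) \<longlonglongrightarrow> (\<integral>z. \<phi> z \<partial>lborel) / sqrt (2 * pi * s2)"
proof -
  have "\<phi> \<in> borel_measurable borel"
    by (rule borel_measurable_continuous_onI) (use assms(1) in \<open>simp add: continuous_on_eq_continuous_at\<close>)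
  thus ?thesis using local_limit_theorem[OF rd_nu s2_pos char_nu_limit char_nu_bound assms] by (simp add: int_nu)
qed

lemma local_bound:
  assumes "b > 0"
  shows "\<exists>C>0. \<forall>n\<ge>1. \<forall>s. (\<integral>\<omega>. exp (- (b * \<bar>s + walk \<omega> n\<bar>)) \<partial>S) \<le> C / sqrt (real n)"
proof -
  obtain C where C: "\<And>n s. n \<ge> 1 \<Longrightarrow> (\<integral>z. exp (- (b * \<bar>z + s\<bar>)) \<partial>\<nu> n) \<le> C / sqrt (real n)"
    using exp_sup_bound[OF rd_nu assms char_nu_bound] by blast
  have "(\<integral>\<omega>. exp (- (b * \<bar>s + walk \<omega> n\<bar>)) \<partial>S) \<le> max C 1 / sqrt (real n)" if "n \<ge> 1" for n s
  proof -
    have "(\<integral>\<omega>. exp (- (b * \<bar>s + walk \<omega> n\<bar>)) \<partial>S) \<le> C / sqrt (real n)" using C[OF that, of s] by (simp add: int_nu add.commute)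
    also have "\<dots> \<le> max C 1 / sqrt (real n)" by (intro divide_right_mono) auto
    finally show ?thesis .
  qed
  thus ?thesis by (intro exI[of _ "max C 1"]) auto
qed


lemma pair_integral:
  assumes [measurable]: "y \<in> borel_measurable D" and fin: "finite (range y)"
  shows "pair (\<Sum>v\<in>range y. Poly_Mapping.single v (measure D {q \<in> space D. y q = v})) f = (\<integral>q. f (y q) \<partial>D)"
    "integrable D (\<lambda>q. f (y q))"
proof -
  have e: "f (y q) = (\<Sum>v\<in>range y. f v * indicator {q \<in> space D. y q = v} q)" if "q \<in> space D" for q
  proof -
    have "(\<Sum>v\<in>range y. f v * indicator {q \<in> space D. y q = v} q) = (\<Sum>v\<in>range y. if v = y q then f v else 0)"
      using that by (intro sum.cong) (auto simp: indicator_def)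
    thus ?thesis using fin by simp
  qed
  have i: "integrable D (\<lambda>q. f v * indicator {q \<in> space D. y q = v} q)" for v
    by (intro integrable_mult_right integrable_real_indicator) (auto simp: M.emeasure_eq_measure)
  show "integrable D (\<lambda>q. f (y q))"
    by (subst Bochner_Integration.integrable_cong[OF refl e]) (auto intro!: Bochner_Integration.integrable_sum i)
  have "(\<integral>q. f (y q) \<partial>D) = (\<integral>q. (\<Sum>v\<in>range y. f v * indicator {q \<in> space D. y q = v} q) \<partial>D)"
    by (rule Bochner_Integration.integral_cong[OF refl e])
  also have "\<dots> = (\<Sum>v\<in>range y. f v * measure D {q \<in> space D. y q = v})"
    by (subst Bochner_Integration.integral_sum[OF i]) (auto intro!: sum.cong)
  finally show "pair (\<Sum>v\<in>range y. Poly_Mapping.single v (measure D {q \<in> space D. y q = v})) f = (\<integral>q. f (y q) \<partial>D)"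
    by (simp add: pair_sum mult.commute)
qed

text \<open>The measure \<open>p n\<close> is the law of S - L weighted by exp (\<alpha> L): one
  more step either leaves the minimum in place or lowers it by the overshoot, and
  \<open>refl_op\<close> charges exactly that overshoot. This is the induction
  \<open>pp\<close>.\<close>

lemma spitzer_finite:
  assumes y [measurable]: "y \<in> borel_measurable D" and fin: "finite (range y)" and ab: "\<alpha> > 0" "\<beta> > 0"
  defines "b \<equiv> \<lambda>n. \<integral>\<omega>. exp (\<alpha> * pL (\<lambda>i. y (\<omega> i)) n - \<beta> * (pS (\<lambda>i. y (\<omega> i)) n - pL (\<lambda>i. y (\<omega> i)) n)) \<partial>S"
    and "c \<equiv> \<lambda>k. \<integral>\<omega>. exp (\<alpha> * min 0 (pS (\<lambda>i. y (\<omega> i)) k) - \<beta> * max 0 (pS (\<lambda>i. y (\<omega> i)) k)) \<partial>S"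
  shows "real n * b n = (\<Sum>k=1..n. c k * b (n - k))"
proof -
  define m where "m = (\<Sum>v\<in>range y. Poly_Mapping.single v (measure D {q \<in> space D. y q = v}))"
  define Y where "Y \<omega> = (\<lambda>i. y (\<omega> i))" for \<omega> :: "nat \<Rightarrow> 'b"
  define p where "p = rec_nat 1 (\<lambda>_ a. refl_op \<alpha> (a * m))"
  have p0: "p 0 = 1" and pSuc: "p (Suc n) = refl_op \<alpha> (p n * m)" for n by (simp_all add: p_def)
  have Ym [measurable]: "(\<lambda>\<omega>. Y \<omega> i) \<in> borel_measurable S" for i unfolding Y_def by measurable
  have pm: "pair m f = (\<integral>q. f (y q) \<partial>D)" for f unfolding m_def by (rule pair_integral[OF y fin])
  have Ycomb: "Y (comb_seq k \<omega> \<omega>') = comb_seq k (Y \<omega>) (Y \<omega>')" for k \<omega> \<omega>' by (simp add: Y_def comp_comb_seq)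
  have iD: "(\<integral>\<omega>. g (y (\<omega> 0)) \<partial>S) = (\<integral>q. g (y q) \<partial>D)" if [measurable]: "g \<in> borel_measurable borel" for g :: "real \<Rightarrow> real"
    using E_coord(1)[of "\<lambda>q. g (y q)" 0] by simp
  have pow: "pair (m ^ k) f = (\<integral>\<omega>. f (pS (Y \<omega>) k) \<partial>S)" if "f \<in> borel_measurable borel" "\<And>z. \<bar>f z\<bar> \<le> B" for f B k
    using that
  proof (induction k arbitrary: f)
    case 0
    show ?case by (simp add: P.prob_space)
  next
    case (Suc k)
    note [measurable] = Suc.prems(1)
    have "pair (m ^ Suc k) f = pair (m ^ k) (\<lambda>a. pair m (\<lambda>z. f (a + z)))" by (simp only: power_Suc2 pair_mult)
    also have "\<dots> = (\<integral>\<omega>. (\<integral>q. f (pS (Y \<omega>) k + y q) \<partial>D) \<partial>S)" unfolding pm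
    proof (rule Suc.IH)
      show "\<bar>\<integral>q. f (z + y q) \<partial>D\<bar> \<le> B" for z
      proof -
        have "\<bar>\<integral>q. f (z + y q) \<partial>D\<bar> \<le> (\<integral>q. \<bar>f (z + y q)\<bar> \<partial>D)" by (rule integral_abs_bound)
        also have "\<dots> \<le> (\<integral>q. B \<partial>D)" by (rule integral_mono') (use Suc.prems(2) order_trans[OF abs_ge_zero Suc.prems(2)] in auto)
        finally show ?thesis by (simp add: M.prob_space)
      qed
    qed measurable
    also have "\<dots> = (\<integral>\<omega>. (\<integral>\<omega>'. f (pS (Y (comb_seq k \<omega> \<omega>')) (Suc k)) \<partial>S) \<partial>S)"
      using iD[of "\<lambda>z. f (a + z)" for a]
      by (intro Bochner_Integration.integral_cong refl) (simp add: Ycomb pS_Suc pS_comb_left comb_seq_def, simp add: Y_def)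
    also have "\<dots> = (\<integral>\<omega>. f (pS (Y \<omega>) (Suc k)) \<partial>S)"
      by (rule E_split(3)[symmetric], rule integrable_bounded[where B = B]) (use Suc.prems in auto)
    finally show ?case .
  qed
  have pp: "pair (p n) f = (\<integral>\<omega>. exp (\<alpha> * pL (Y \<omega>) n) * f (pS (Y \<omega>) n - pL (Y \<omega>) n) \<partial>S)"
    if "f \<in> borel_measurable borel" "\<And>z. \<bar>f z\<bar> \<le> B" for f B n
    using that
  proof (induction n arbitrary: f)
    case 0
    show ?case by (simp add: P.prob_space p0)
  next
    case (Suc n)
    note [measurable] = Suc.prems(1)
    have bd: "\<bar>exp (\<alpha> * min 0 w) * f w'\<bar> \<le> B" for w w'
    proof -
      have "exp (\<alpha> * min 0 w) \<le> 1" using ab by (simp add: mult_nonneg_nonpos)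
      hence "exp (\<alpha> * min 0 w) * \<bar>f w'\<bar> \<le> 1 * B" by (intro mult_mono Suc.prems(2)) auto
      thus ?thesis by (simp add: abs_mult)
    qed
    have "pair (p (Suc n)) f = pair (p n) (\<lambda>w. \<integral>q. exp (\<alpha> * min 0 (w + y q)) * f (max 0 (w + y q)) \<partial>D)"
      by (simp only: pSuc pair_refl_op pair_mult pm)
    also have "\<dots> = (\<integral>\<omega>. exp (\<alpha> * pL (Y \<omega>) n) * (\<integral>q. exp (\<alpha> * min 0 ((pS (Y \<omega>) n - pL (Y \<omega>) n) + y q)) * f (max 0 ((pS (Y \<omega>) n - pL (Y \<omega>) n) + y q)) \<partial>D) \<partial>S)"
    proof (rule Suc.IH)
      show "\<bar>\<integral>q. exp (\<alpha> * min 0 (w + y q)) * f (max 0 (w + y q)) \<partial>D\<bar> \<le> B" for w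
      proof -
        have "\<bar>\<integral>q. exp (\<alpha> * min 0 (w + y q)) * f (max 0 (w + y q)) \<partial>D\<bar> \<le> (\<integral>q. \<bar>exp (\<alpha> * min 0 (w + y q)) * f (max 0 (w + y q))\<bar> \<partial>D)" by (rule integral_abs_bound)
        also have "\<dots> \<le> (\<integral>q. B \<partial>D)" by (rule integral_mono') (use bd order_trans[OF abs_ge_zero bd] in auto)
        finally show ?thesis by (simp add: M.prob_space)
      qed
    qed measurable
    also have "\<dots> = (\<integral>\<omega>. (\<integral>\<omega>'. exp (\<alpha> * pL (Y (comb_seq n \<omega> \<omega>')) (Suc n)) * f (pS (Y (comb_seq n \<omega> \<omega>')) (Suc n) - pL (Y (comb_seq n \<omega> \<omega>')) (Suc n)) \<partial>S) \<partial>S)"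
    proof (rule Bochner_Integration.integral_cong[OF refl])
      fix \<omega>
      have eq: "exp (\<alpha> * pL (Y (comb_seq n \<omega> \<omega>')) (Suc n)) * f (pS (Y (comb_seq n \<omega> \<omega>')) (Suc n) - pL (Y (comb_seq n \<omega> \<omega>')) (Suc n))
         = exp (\<alpha> * pL (Y \<omega>) n) * (exp (\<alpha> * min 0 ((pS (Y \<omega>) n - pL (Y \<omega>) n) + y (\<omega>' 0))) * f (max 0 ((pS (Y \<omega>) n - pL (Y \<omega>) n) + y (\<omega>' 0))))" for \<omega>'
      proof -
        have "pL (Y (comb_seq n \<omega> \<omega>')) (Suc n) = pL (Y \<omega>) n + min 0 ((pS (Y \<omega>) n - pL (Y \<omega>) n) + y (\<omega>' 0))"
          "pS (Y (comb_seq n \<omega> \<omega>')) (Suc n) - pL (Y (comb_seq n \<omega> \<omega>')) (Suc n) = max 0 ((pS (Y \<omega>) n - pL (Y \<omega>) n) + y (\<omega>' 0))"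
          unfolding Ycomb by (auto simp: pL_Suc pS_Suc pS_comb_left pL_comb_left comb_seq_def Y_def min_def max_def)
        thus ?thesis by (simp add: exp_add[symmetric] algebra_simps)
      qed
      show "exp (\<alpha> * pL (Y \<omega>) n) * (\<integral>q. exp (\<alpha> * min 0 ((pS (Y \<omega>) n - pL (Y \<omega>) n) + y q)) * f (max 0 ((pS (Y \<omega>) n - pL (Y \<omega>) n) + y q)) \<partial>D)
        = (\<integral>\<omega>'. exp (\<alpha> * pL (Y (comb_seq n \<omega> \<omega>')) (Suc n)) * f (pS (Y (comb_seq n \<omega> \<omega>')) (Suc n) - pL (Y (comb_seq n \<omega> \<omega>')) (Suc n)) \<partial>S)"
        unfolding eq integral_mult_right_zero
        by (subst iD[of "\<lambda>z. exp (\<alpha> * min 0 ((pS (Y \<omega>) n - pL (Y \<omega>) n) + z)) * f (max 0 ((pS (Y \<omega>) n - pL (Y \<omega>) n) + z))"]) auto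
    qed
    also have "\<dots> = (\<integral>\<omega>. exp (\<alpha> * pL (Y \<omega>) (Suc n)) * f (pS (Y \<omega>) (Suc n) - pL (Y \<omega>) (Suc n)) \<partial>S)"
    proof (rule E_split(3)[symmetric], rule integrable_bounded[where B = B])
      fix \<omega>
      show "norm (exp (\<alpha> * pL (Y \<omega>) (Suc n)) * f (pS (Y \<omega>) (Suc n) - pL (Y \<omega>) (Suc n))) \<le> B"
        using bd[of "pL (Y \<omega>) (Suc n)"] pL_nonpos[of "Y \<omega>" "Suc n"] by (simp add: min_absorb2)
    qed measurable
    finally show ?case .
  qed
  have b_eq: "pair (p n) (\<lambda>z. exp (- (\<beta> * z))) = b n" for n
  proof -
    have nn: "z \<ge> 0" if "z \<in> Poly_Mapping.keys (p n)" for z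
      using that keys_refl_op by (cases n) (auto simp: p0 pSuc single_one[symmetric] simp del: single_one)
    \<comment> \<open>All mass of \<open>p n\<close> lies on the nonnegative half-line, so the
      exponential may be replaced by a bounded function, as \<open>pp\<close> demands.\<close>
    have "pair (p n) (\<lambda>z. exp (- (\<beta> * z))) = pair (p n) (\<lambda>z. exp (- (\<beta> * max 0 z)))"
      using nn by (intro pair_cong) (simp add: max_absorb2)
    also have "\<dots> = (\<integral>\<omega>. exp (\<alpha> * pL (Y \<omega>) n) * exp (- (\<beta> * max 0 (pS (Y \<omega>) n - pL (Y \<omega>) n))) \<partial>S)"
    proof (rule pp)
      show "\<bar>exp (- (\<beta> * max 0 z))\<bar> \<le> 1" for z using ab by simp
    qed measurable
    also have "\<dots> = b n" unfolding b_def Y_def[symmetric]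
      using pL_le_pS by (intro Bochner_Integration.integral_cong refl) (simp add: exp_add[symmetric] max_absorb2)
    finally show ?thesis .
  qed
  have c_eq: "pair (m ^ k) (\<lambda>z. exp (\<alpha> * min 0 z - \<beta> * max 0 z)) = c k" for k
    unfolding c_def Y_def[symmetric]
  proof (rule pow)
    fix z show "\<bar>exp (\<alpha> * min 0 z - \<beta> * max 0 z)\<bar> \<le> 1"
      unfolding abs_exp_cancel using ab by (intro exp_diff_le_1 mult_nonneg_nonpos mult_nonneg_nonneg) auto
  qed measurable
  show ?thesis using refl_op_recursion[OF p0 pSuc, of n \<beta>] unfolding b_eq c_eq .
qed

definition wmin_mgf :: "real \<Rightarrow> real \<Rightarrow> nat \<Rightarrow> real" where
  "wmin_mgf \<alpha> \<beta> n = (\<integral>\<omega>. exp (\<alpha> * wmin \<omega> n - \<beta> * (walk \<omega> n - wmin \<omega> n)) \<partial>S)"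

definition step_mgf :: "real \<Rightarrow> real \<Rightarrow> nat \<Rightarrow> real" where
  "step_mgf \<alpha> \<beta> k = (\<integral>\<omega>. exp (\<alpha> * min 0 (walk \<omega> k) - \<beta> * max 0 (walk \<omega> k)) \<partial>S)"

text \<open>Reduction to increments with finite range, where the algebra of finitely supported measures applies.\<close>
lemma spitzer:
  assumes ab: "\<alpha> > 0" "\<beta> > 0"
  shows "real n * wmin_mgf \<alpha> \<beta> n = (\<Sum>k=1..n. step_mgf \<alpha> \<beta> k * wmin_mgf \<alpha> \<beta> (n - k))"
proof -
  \<comment> \<open>Truncation to [-N, N] and rounding down to the grid of mesh 1 / (N + 1): finite
    range, and pointwise convergence as N grows.\<close>
  define d where "d N z = real_of_int \<lfloor>real (Suc N) * max (- real N) (min (real N) z)\<rfloor> / real (Suc N)" for N :: nat and z :: real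
  have dm [measurable]: "d N \<in> borel_measurable borel" for N unfolding d_def by measurable
  have dfin: "finite (range (\<lambda>q. d N (x q)))" for N
  proof (rule finite_subset)
    show "range (\<lambda>q. d N (x q)) \<subseteq> (\<lambda>k. real_of_int k / real (Suc N)) ` {- int (Suc N * N) .. int (Suc N * N)}"
    proof
      fix r assume "r \<in> range (\<lambda>q. d N (x q))"
      then obtain q where r: "r = d N (x q)" by auto
      define w where "w = max (- real N) (min (real N) (x q))"
      have w: "- real N \<le> w" "w \<le> real N" unfolding w_def by auto
      have "real (Suc N) * (- real N) \<le> real (Suc N) * w" "real (Suc N) * w \<le> real (Suc N) * real N" using w by (intro mult_left_mono; simp)+
      hence "- int (Suc N * N) \<le> \<lfloor>real (Suc N) * w\<rfloor>" "\<lfloor>real (Suc N) * w\<rfloor> \<le> int (Suc N * N)"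
        by (auto simp: le_floor_iff floor_le_iff algebra_simps)
      thus "r \<in> (\<lambda>k. real_of_int k / real (Suc N)) ` {- int (Suc N * N) .. int (Suc N * N)}"
        unfolding r d_def w_def[symmetric] by auto
    qed
  qed simp
  have dlim: "(\<lambda>N. d N z) \<longlonglongrightarrow> z" for z
  proof (rule tendsto_sandwich)
    obtain N0 :: nat where N0: "\<bar>z\<bar> \<le> real N0" using real_arch_simple by blast
    have e: "max (- real N) (min (real N) z) = z" if "N \<ge> N0" for N using N0 that by (auto simp: max_def min_def)
    show "\<forall>\<^sub>F N in sequentially. z - 1 / real (Suc N) \<le> d N z" using eventually_ge_at_top[of N0]
    proof eventually_elim
      case (elim N)
      have "real (Suc N) * z - 1 \<le> real_of_int \<lfloor>real (Suc N) * z\<rfloor>" by linarith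
      hence "(real (Suc N) * z - 1) / real (Suc N) \<le> real_of_int \<lfloor>real (Suc N) * z\<rfloor> / real (Suc N)" by (intro divide_right_mono) auto
      thus ?case unfolding d_def e[OF elim] by (simp add: diff_divide_distrib del: of_nat_Suc)
    qed
    show "\<forall>\<^sub>F N in sequentially. d N z \<le> z" using eventually_ge_at_top[of N0]
    proof eventually_elim
      case (elim N)
      have "real_of_int \<lfloor>real (Suc N) * z\<rfloor> \<le> real (Suc N) * z" by linarith
      hence "real_of_int \<lfloor>real (Suc N) * z\<rfloor> / real (Suc N) \<le> real (Suc N) * z / real (Suc N)" by (intro divide_right_mono) auto
      thus ?case unfolding d_def e[OF elim] by simp
    qed
    show "(\<lambda>N. z - 1 / real (Suc N)) \<longlonglongrightarrow> z" by real_asymp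
  qed simp
  define bN where "bN N n = (\<integral>\<omega>. exp (\<alpha> * pL (\<lambda>i. d N (x (\<omega> i))) n - \<beta> * (pS (\<lambda>i. d N (x (\<omega> i))) n - pL (\<lambda>i. d N (x (\<omega> i))) n)) \<partial>S)" for N n
  define cN where "cN N k = (\<integral>\<omega>. exp (\<alpha> * min 0 (pS (\<lambda>i. d N (x (\<omega> i))) k) - \<beta> * max 0 (pS (\<lambda>i. d N (x (\<omega> i))) k)) \<partial>S)" for N k
  have rec: "real n * bN N n = (\<Sum>k=1..n. cN N k * bN N (n - k))" for N n
    unfolding bN_def cN_def by (rule spitzer_finite[OF _ dfin ab]) measurable
  have bl: "(\<lambda>N. bN N n) \<longlonglongrightarrow> wmin_mgf \<alpha> \<beta> n" for n
    unfolding bN_def wmin_mgf_def walk_def wmin_def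
  proof (rule integral_dominated_convergence[where w = "\<lambda>_. 1"])
    show "AE \<omega> in S. norm (exp (\<alpha> * pL (\<lambda>i. d N (x (\<omega> i))) n - \<beta> * (pS (\<lambda>i. d N (x (\<omega> i))) n - pL (\<lambda>i. d N (x (\<omega> i))) n))) \<le> 1" for N
    proof (intro always_eventually allI)
      fix \<omega>
      show "norm (exp (\<alpha> * pL (\<lambda>i. d N (x (\<omega> i))) n - \<beta> * (pS (\<lambda>i. d N (x (\<omega> i))) n - pL (\<lambda>i. d N (x (\<omega> i))) n))) \<le> 1"
        unfolding norm_exp_real using ab pL_nonpos pL_le_pS by (intro exp_diff_le_1 mult_nonneg_nonpos mult_nonneg_nonneg) auto
    qed
  qed (auto intro!: always_eventually tendsto_intros pL_tendsto pS_tendsto dlim P.integrable_const)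
  have cl: "(\<lambda>N. cN N k) \<longlonglongrightarrow> step_mgf \<alpha> \<beta> k" for k
    unfolding cN_def step_mgf_def walk_def
  proof (rule integral_dominated_convergence[where w = "\<lambda>_. 1"])
    show "AE \<omega> in S. norm (exp (\<alpha> * min 0 (pS (\<lambda>i. d N (x (\<omega> i))) k) - \<beta> * max 0 (pS (\<lambda>i. d N (x (\<omega> i))) k))) \<le> 1" for N
    proof (intro always_eventually allI)
      fix \<omega>
      show "norm (exp (\<alpha> * min 0 (pS (\<lambda>i. d N (x (\<omega> i))) k) - \<beta> * max 0 (pS (\<lambda>i. d N (x (\<omega> i))) k))) \<le> 1"
        unfolding norm_exp_real using ab by (intro exp_diff_le_1 mult_nonneg_nonpos mult_nonneg_nonneg) auto
    qed
  qed (auto intro!: always_eventually tendsto_intros pS_tendsto dlim P.integrable_const)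
  have "(\<lambda>N. real n * bN N n) \<longlonglongrightarrow> real n * wmin_mgf \<alpha> \<beta> n" by (intro tendsto_intros bl)
  moreover have "(\<lambda>N. real n * bN N n) \<longlonglongrightarrow> (\<Sum>k=1..n. step_mgf \<alpha> \<beta> k * wmin_mgf \<alpha> \<beta> (n - k))"
    unfolding rec by (intro tendsto_intros bl cl)
  ultimately show ?thesis by (rule LIMSEQ_unique)
qed

lemma exp_wmin_mgf_le_1:
  assumes "\<alpha> \<ge> 0" "\<beta> \<ge> 0"
  shows "exp (\<alpha> * wmin \<omega> n - \<beta> * (walk \<omega> n - wmin \<omega> n)) \<le> 1"
  using assms wmin_nonpos wmin_le_walk by (intro exp_diff_le_1 mult_nonneg_nonpos mult_nonneg_nonneg) auto

lemma integrable_wmin_mgf: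
  assumes "\<alpha> \<ge> 0" "\<beta> \<ge> 0"
  shows "integrable S (\<lambda>\<omega>. exp (\<alpha> * wmin \<omega> n - \<beta> * (walk \<omega> n - wmin \<omega> n)))"
  by (rule integrable_bounded[where B = 1]) (use exp_wmin_mgf_le_1[OF assms] in auto)

text \<open>The coefficient \<open>step_mgf\<close> is the mean of a function of S_k that is
  continuous, positive and exponentially small on both sides. The local limit theorem makes it
  asymptotic to a positive multiple of k^(-1/2), and the exponential recursion does the
  rest.\<close>

theorem wmin_mgf_asymp:
  assumes ab: "\<alpha> > 0" "\<beta> > 0"
  shows "summable (wmin_mgf \<alpha> \<beta>)" "\<exists>l>0. (\<lambda>n. real n * sqrt (real n) * wmin_mgf \<alpha> \<beta> n) \<longlonglongrightarrow> l"
    "\<exists>C>0. \<forall>n\<ge>1. wmin_mgf \<alpha> \<beta> n \<le> C / (real n * sqrt (real n))"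
proof -
  define \<phi> where "\<phi> z = exp (\<alpha> * min 0 z - \<beta> * max 0 z)" for z :: real
  define g where "g = min \<alpha> \<beta>"
  have g: "g > 0" using ab by (simp add: g_def)
  have \<phi>le: "\<phi> z \<le> exp (- (g * \<bar>z\<bar>))" for z
  proof -
    have "\<alpha> * min 0 z - \<beta> * max 0 z \<le> - (g * \<bar>z\<bar>)"
    proof (cases "z \<ge> 0")
      case True
      thus ?thesis using mult_right_mono[of g \<beta> z] by (simp add: g_def max_absorb2 min_absorb1)
    next
      case False
      thus ?thesis using mult_right_mono[of g \<alpha> "-z"] by (simp add: g_def max_absorb1 min_absorb2)
    qed
    thus ?thesis by (simp add: \<phi>_def)
  qed
  have \<phi>b: "\<bar>\<phi> z\<bar> \<le> (1 + 2 / g\<^sup>2) / (1 + z\<^sup>2)" for z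
  proof -
    have "\<phi> z \<ge> 0" by (simp add: \<phi>_def)
    thus ?thesis using \<phi>le[of z] exp_abs_le_inverse_square[OF g, of z] by linarith
  qed
  have \<phi>c: "isCont \<phi> z" for z unfolding \<phi>_def by (intro continuous_intros)
  have \<phi>m [measurable]: "\<phi> \<in> borel_measurable borel" unfolding \<phi>_def by measurable
  define \<kappa> where "\<kappa> = (\<integral>z. \<phi> z \<partial>lborel) / sqrt (2 * pi * s2)"
  have \<phi>i: "integrable lborel \<phi>"
    by (rule Bochner_Integration.integrable_bound[OF integrable_mult_right[OF integrable_one_over_1_plus_square, of "1 + 2 / g\<^sup>2"]])
       (use \<phi>b in \<open>auto intro!: always_eventually order_trans[OF _ abs_ge_self]\<close>)
  have "(\<integral>z. \<phi> z \<partial>lborel) > 0"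
  proof -
    have "(\<integral>z. \<phi> z \<partial>lborel) \<noteq> 0"
    proof
      assume "(\<integral>z. \<phi> z \<partial>lborel) = 0"
      moreover have "AE z in lborel. 0 \<le> \<phi> z" by (simp add: \<phi>_def)
      ultimately have "AE z in lborel. \<phi> z = 0" using integral_nonneg_eq_0_iff_AE[OF \<phi>i] by blast
      hence "AE z in (lborel :: real measure). False" by (simp add: \<phi>_def)
      thus False by (simp add: ae_filter_eq_bot_iff)
    qed
    moreover have "(\<integral>z. \<phi> z \<partial>lborel) \<ge> 0" by (rule integral_nonneg_AE) (simp add: \<phi>_def)
    ultimately show ?thesis by simp
  qed
  hence \<kappa>: "\<kappa> > 0" unfolding \<kappa>_def using s2_pos by simp
  have lim: "(\<lambda>n. sqrt (real n) * step_mgf \<alpha> \<beta> n) \<longlonglongrightarrow> \<kappa>"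
    unfolding \<kappa>_def step_mgf_def \<phi>_def[symmetric] by (rule local_limit[OF \<phi>c \<phi>b])
  have b0: "wmin_mgf \<alpha> \<beta> 0 = 1" by (simp add: wmin_mgf_def P.prob_space)
  have bn: "wmin_mgf \<alpha> \<beta> n \<ge> 0" for n unfolding wmin_mgf_def by (rule integral_nonneg_AE) simp
  have b1: "wmin_mgf \<alpha> \<beta> n \<le> 1" for n
  proof -
    have "wmin_mgf \<alpha> \<beta> n \<le> (\<integral>\<omega>. 1 \<partial>S)" unfolding wmin_mgf_def
      by (rule integral_mono') (use exp_wmin_mgf_le_1 ab in auto)
    thus ?thesis by (simp add: P.prob_space)
  qed
  have cn: "step_mgf \<alpha> \<beta> n \<ge> 0" for n unfolding step_mgf_def by (rule integral_nonneg_AE) simp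
  have c1: "step_mgf \<alpha> \<beta> n \<le> 1" for n
  proof -
    have "step_mgf \<alpha> \<beta> n \<le> (\<integral>\<omega>. 1 \<partial>S)" unfolding step_mgf_def \<phi>_def[symmetric]
    proof (rule integral_mono')
      fix \<omega>
      have "exp (- (g * \<bar>walk \<omega> n\<bar>)) \<le> 1" using g by simp
      thus "\<phi> (walk \<omega> n) \<le> 1" using \<phi>le[of "walk \<omega> n"] by linarith
    qed auto
    thus ?thesis by (simp add: P.prob_space)
  qed
  note r = exp_recursion_asymp[OF b0 bn b1 cn c1 spitzer[OF ab] lim]
  show "summable (wmin_mgf \<alpha> \<beta>)" by (rule r(1))
  have "suminf (wmin_mgf \<alpha> \<beta>) > 0" by (rule suminf_pos2[OF r(1), of 0]) (use bn b0 in auto)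
  thus ex: "\<exists>l>0. (\<lambda>n. real n * sqrt (real n) * wmin_mgf \<alpha> \<beta> n) \<longlonglongrightarrow> l" using r(2) \<kappa> by (intro exI[of _ "\<kappa> * suminf (wmin_mgf \<alpha> \<beta>)"]) auto
  have "Bseq (\<lambda>n. real n * sqrt (real n) * wmin_mgf \<alpha> \<beta> n)" using ex by (intro convergent_imp_Bseq) (auto simp: convergent_def)
  then obtain C where C: "C > 0" "\<And>n. norm (real n * sqrt (real n) * wmin_mgf \<alpha> \<beta> n) \<le> C" by (auto simp: Bseq_def)
  have "wmin_mgf \<alpha> \<beta> n \<le> C / (real n * sqrt (real n))" if "n \<ge> 1" for n
    using C(2)[of n] that bn[of n] by (simp add: field_simps)
  thus "\<exists>C>0. \<forall>n\<ge>1. wmin_mgf \<alpha> \<beta> n \<le> C / (real n * sqrt (real n))" using C(1) by blast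
qed

end

section \<open>Survival of the walk above a level\<close>

text \<open>One of the indices k and n - k is at least about n / 2 and supplies the decay: for small
  k it is \<open>g\<close> that is of order n^(-1/2) while \<open>b\<close> is summable; for large k
  it is \<open>b\<close> that is of order n^(-3/2), while the sum of \<open>g\<close> is only of
  order sqrt n.\<close>

lemma sum_conv_bound:
  fixes b g :: "nat \<Rightarrow> real"
  assumes bn: "\<And>k. 0 \<le> b k" and bs: "summable b" and bB: "\<And>k. k \<ge> 1 \<Longrightarrow> b k \<le> B / (real k * sqrt (real k))" and B: "B \<ge> 0"
    and gn: "\<And>m. 0 \<le> g m" and gG: "\<And>m. g m \<le> G / sqrt (real (Suc m))" and G: "G \<ge> 0"
  shows "\<exists>C>0. \<forall>n\<ge>1. (\<Sum>k\<le>n. b k * g (n - k)) \<le> C / sqrt (real n)"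
proof -
  define C where "C = 2 * G * suminf b + 16 * B * G + 1"
  have C: "C > 0" unfolding C_def using suminf_nonneg[OF bs bn] G B by (intro add_nonneg_pos add_nonneg_nonneg mult_nonneg_nonneg) auto
  have "(\<Sum>k\<le>n. b k * g (n - k)) \<le> C / sqrt (real n)" if n: "n \<ge> 1" for n
  proof -
    have sn: "sqrt (real n) > 0" using n by simp
    have parts: "{..n} = {..n div 2} \<union> {n div 2<..n}" by auto
    have 1: "(\<Sum>k\<in>{..n div 2}. b k * g (n - k)) \<le> 2 * G * suminf b / sqrt (real n)"
    proof -
      have gk: "g (n - k) \<le> 2 * G / sqrt (real n)" if "k \<le> n div 2" for k
      proof -
        have kn: "2 * k \<le> n" using that by simp
        then obtain m where "n = k + m" using le_Suc_ex[of k n] by auto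
        hence "n \<le> 4 * Suc (n - k)" using kn by simp
        hence "real n \<le> 4 * real (Suc (n - k))" by (metis of_nat_mono of_nat_mult of_nat_numeral)
        hence "sqrt (real n) \<le> sqrt (4 * real (Suc (n - k)))" by (rule real_sqrt_le_mono)
        hence s: "sqrt (real n) \<le> 2 * sqrt (real (Suc (n - k)))" by (simp add: real_sqrt_mult del: of_nat_Suc)
        have "g (n - k) \<le> G / sqrt (real (Suc (n - k)))" by (rule gG)
        also have "\<dots> = 2 * G / (2 * sqrt (real (Suc (n - k))))" by simp
        also have "\<dots> \<le> 2 * G / sqrt (real n)" using s sn G by (intro divide_left_mono mult_pos_pos) auto
        finally show ?thesis .
      qed
      have "(\<Sum>k\<in>{..n div 2}. b k * g (n - k)) \<le> (\<Sum>k\<in>{..n div 2}. b k * (2 * G / sqrt (real n)))"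
        by (intro sum_mono mult_left_mono gk bn) auto
      also have "\<dots> = (\<Sum>k\<in>{..n div 2}. b k) * (2 * G / sqrt (real n))" by (rule sum_distrib_right[symmetric])
      also have "\<dots> \<le> suminf b * (2 * G / sqrt (real n))"
        by (intro mult_right_mono sum_le_suminf bs) (use bn G in auto)
      finally show ?thesis by (simp add: mult.commute mult.left_commute)
    qed
    have 2: "(\<Sum>k\<in>{n div 2<..n}. b k * g (n - k)) \<le> 16 * B * G / sqrt (real n)"
    proof -
      have bk: "b k \<le> 4 * B / (real n * sqrt (real n))" if k: "k \<in> {n div 2<..n}" for k
      proof -
        have k1: "k \<ge> 1" using k by auto
        have r: "real n \<le> 2 * real k" using k by auto
        have "sqrt (real n) \<le> sqrt (4 * real k)" using r by (intro real_sqrt_le_mono) simp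
        hence s: "sqrt (real n) \<le> 2 * sqrt (real k)" by (simp add: real_sqrt_mult)
        have m: "real n * sqrt (real n) \<le> (2 * real k) * (2 * sqrt (real k))" using r s by (intro mult_mono) auto
        have "b k \<le> B / (real k * sqrt (real k))" by (rule bB[OF k1])
        also have "\<dots> = 4 * B / ((2 * real k) * (2 * sqrt (real k)))" using k1 by simp
        also have "\<dots> \<le> 4 * B / (real n * sqrt (real n))" using m n k1 B by (intro divide_left_mono mult_pos_pos) auto
        finally show ?thesis .
      qed
      have "(\<Sum>k\<in>{n div 2<..n}. b k * g (n - k)) \<le> (\<Sum>k\<in>{n div 2<..n}. 4 * B / (real n * sqrt (real n)) * g (n - k))"
        by (intro sum_mono mult_right_mono bk gn)
      also have "\<dots> = 4 * B / (real n * sqrt (real n)) * (\<Sum>k\<in>{n div 2<..n}. g (n - k))" by (rule sum_distrib_left[symmetric])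
      also have "\<dots> \<le> 4 * B / (real n * sqrt (real n)) * (G * (4 * sqrt (real n)))"
      proof (rule mult_left_mono)
        have "(\<Sum>k\<in>{n div 2<..n}. g (n - k)) \<le> (\<Sum>k\<in>{1..n}. g (n - k))" by (rule sum_mono2) (auto simp: gn)
        also have "\<dots> = (\<Sum>m<n. g m)" by (rule sum.reindex_bij_witness[where i = "\<lambda>m. n - m" and j = "\<lambda>k. n - k"]) auto
        also have "\<dots> \<le> (\<Sum>m<n. G * (1 / sqrt (real (Suc m))))" by (rule sum_mono) (use gG in auto)
        also have "\<dots> = G * (\<Sum>m<n. 1 / sqrt (real (Suc m)))" by (rule sum_distrib_left[symmetric])
        also have "(\<Sum>m<n. 1 / sqrt (real (Suc m))) = (\<Sum>k=1..n. 1 / sqrt (real k))"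
          by (rule sum.reindex_bij_witness[where i = "\<lambda>m. m - 1" and j = Suc]) auto
        also have "G * \<dots> \<le> G * (2 * sqrt (real n))" by (intro mult_left_mono sum_inverse_sqrt_le G)
        also have "\<dots> \<le> G * (4 * sqrt (real n))" using G by (intro mult_left_mono) auto
        finally show "(\<Sum>k\<in>{n div 2<..n}. g (n - k)) \<le> G * (4 * sqrt (real n))" .
      qed (use B in auto)
      also have "\<dots> = 16 * B * G / real n" using n by (simp add: field_simps)
      also have "\<dots> \<le> 16 * B * G / sqrt (real n)"
      proof -
        have "sqrt (real n) \<le> real n" using n by (intro real_le_lsqrt) (auto simp: power2_eq_square)
        thus ?thesis using B G n by (intro divide_left_mono mult_pos_pos) auto
      qed
      finally show ?thesis .
    qed
    have "(\<Sum>k\<le>n. b k * g (n - k)) = (\<Sum>k\<in>{..n div 2}. b k * g (n - k)) + (\<Sum>k\<in>{n div 2<..n}. b k * g (n - k))"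
      by (subst parts, rule sum.union_disjoint) auto
    also have "\<dots> \<le> 2 * G * suminf b / sqrt (real n) + 16 * B * G / sqrt (real n)" by (intro add_mono 1 2)
    also have "\<dots> \<le> C / sqrt (real n)" unfolding C_def add_divide_distrib using sn by simp
    finally show ?thesis .
  qed
  thus ?thesis using C by blast
qed

section \<open>Association of increasing functionals\<close>

definition incr :: "((nat \<Rightarrow> real) \<Rightarrow> real) \<Rightarrow> bool" where
  "incr F \<longleftrightarrow> (\<forall>u v. (\<forall>i. u i \<le> v i) \<longrightarrow> F u \<le> F v)"

text \<open>For an independent copy r of q the product of f (X q) - f (X r) and g (X q) - g (X r) is
  nonnegative; integrating it gives twice the covariance.\<close>

lemma (in prob_space) chebyshev_association:
  fixes f g :: "real \<Rightarrow> real"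
  assumes [measurable]: "X \<in> borel_measurable M" "f \<in> borel_measurable borel" "g \<in> borel_measurable borel"
    and f: "mono f" "\<And>z. \<bar>f z\<bar> \<le> 1" and g: "mono g" "\<And>z. \<bar>g z\<bar> \<le> 1"
  shows "(\<integral>q. f (X q) \<partial>M) * (\<integral>q. g (X q) \<partial>M) \<le> (\<integral>q. f (X q) * g (X q) \<partial>M)"
proof -
  have i: "integrable M (\<lambda>q. f (X q))" "integrable M (\<lambda>q. g (X q))" "integrable M (\<lambda>q. f (X q) * g (X q))"
    using f g by (auto intro!: integrable_const_bound[where B = 1] simp: abs_mult mult_le_one)
  define A where "A = (\<integral>q. f (X q) \<partial>M)"
  define B where "B = (\<integral>q. g (X q) \<partial>M)"
  define C where "C = (\<integral>q. f (X q) * g (X q) \<partial>M)"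
  have inner: "(\<integral>r. (f (X q) - f (X r)) * (g (X q) - g (X r)) \<partial>M) = f (X q) * g (X q) - f (X q) * B - A * g (X q) + C" for q
  proof -
    have "(\<integral>r. (f (X q) - f (X r)) * (g (X q) - g (X r)) \<partial>M) = (\<integral>r. f (X q) * g (X q) - f (X q) * g (X r) - f (X r) * g (X q) + f (X r) * g (X r) \<partial>M)"
      by (intro Bochner_Integration.integral_cong refl) (simp add: algebra_simps)
    thus ?thesis using i by (simp add: A_def B_def C_def prob_space)
  qed
  have "0 \<le> (\<integral>q. (\<integral>r. (f (X q) - f (X r)) * (g (X q) - g (X r)) \<partial>M) \<partial>M)"
  proof (intro integral_nonneg_AE always_eventually allI)
    fix q r
    show "0 \<le> (f (X q) - f (X r)) * (g (X q) - g (X r))"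
    proof (cases "X q \<le> X r")
      case True
      thus ?thesis using monoD[OF f(1) True] monoD[OF g(1) True] by (simp add: mult_nonpos_nonpos)
    next
      case False
      thus ?thesis using monoD[OF f(1), of "X r" "X q"] monoD[OF g(1), of "X r" "X q"] by simp
    qed
  qed
  also have "\<dots> = C - A * B - A * B + C" unfolding inner using i by (simp add: A_def B_def C_def prob_space)
  finally show ?thesis by (simp add: A_def B_def C_def)
qed

context env_walk
begin

definition increments :: "(nat \<Rightarrow> 'b) \<Rightarrow> nat \<Rightarrow> real" where "increments \<omega> = (\<lambda>i. x (\<omega> i))"

lemma increments_meas [measurable]: "increments \<in> S \<rightarrow>\<^sub>M PiM UNIV (\<lambda>_. borel)"
  unfolding increments_def by (rule measurable_PiM_single') auto

text \<open>Induction on the number of coordinates: with the first one frozen the claim holds by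
  induction, and the conditional means are increasing functions of that coordinate, where
  Chebyshev's inequality applies. It will compare survival above a level with a high final
  position.\<close>

lemma harris:
  assumes F: "F \<in> borel_measurable (PiM UNIV (\<lambda>_. borel))" "incr F" "\<And>u. \<bar>F u\<bar> \<le> 1" "\<And>u v. (\<forall>i<n. u i = v i) \<Longrightarrow> F u = F v"
    and G: "G \<in> borel_measurable (PiM UNIV (\<lambda>_. borel))" "incr G" "\<And>u. \<bar>G u\<bar> \<le> 1" "\<And>u v. (\<forall>i<n. u i = v i) \<Longrightarrow> G u = G v"
  shows "(\<integral>\<omega>. F (increments \<omega>) \<partial>S) * (\<integral>\<omega>. G (increments \<omega>) \<partial>S) \<le> (\<integral>\<omega>. F (increments \<omega>) * G (increments \<omega>) \<partial>S)"
  using assms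
proof (induction n arbitrary: F G)
  case 0
  have "F (increments \<omega>) = F (\<lambda>_. 0)" "G (increments \<omega>) = G (\<lambda>_. 0)" for \<omega> using 0(4)[of "increments \<omega>" "\<lambda>_. 0"] 0(8)[of "increments \<omega>" "\<lambda>_. 0"] by auto
  hence "(\<lambda>\<omega>. F (increments \<omega>)) = (\<lambda>_. F (\<lambda>_. 0))" "(\<lambda>\<omega>. G (increments \<omega>)) = (\<lambda>_. G (\<lambda>_. 0))" by auto
  moreover from this have "(\<lambda>\<omega>. F (increments \<omega>) * G (increments \<omega>)) = (\<lambda>_. F (\<lambda>_. 0) * G (\<lambda>_. 0))" by (simp add: fun_eq_iff)
  ultimately show ?case by (simp add: P.prob_space)
next
  case (Suc n)
  note [measurable] = Suc.prems(1,5)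
  have cn: "increments (comb_seq (Suc 0) \<omega> \<omega>') = case_nat (x (\<omega> 0)) (increments \<omega>')" for \<omega> \<omega>'
    by (auto simp: increments_def fun_eq_iff split: nat.split)
  define f where "f a = (\<integral>\<omega>. F (case_nat a (increments \<omega>)) \<partial>S)" for a
  define g where "g a = (\<integral>\<omega>. G (case_nat a (increments \<omega>)) \<partial>S)" for a
  have im: "integrable S (\<lambda>\<omega>. F (case_nat a (increments \<omega>)))" "integrable S (\<lambda>\<omega>. G (case_nat a (increments \<omega>)))" for a
    using Suc.prems by (auto intro!: integrable_bounded[where B = 1])
  have iF: "integrable S (\<lambda>\<omega>. F (increments \<omega>))" "integrable S (\<lambda>\<omega>. G (increments \<omega>))" "integrable S (\<lambda>\<omega>. F (increments \<omega>) * G (increments \<omega>))"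
    using Suc.prems by (auto intro!: integrable_bounded[where B = 1] simp: abs_mult mult_le_one)
  have fm [measurable]: "f \<in> borel_measurable borel" "g \<in> borel_measurable borel" unfolding f_def g_def by measurable
  have fb: "\<bar>f a\<bar> \<le> 1" "\<bar>g a\<bar> \<le> 1" for a
  proof -
    have "\<bar>f a\<bar> \<le> (\<integral>\<omega>. \<bar>F (case_nat a (increments \<omega>))\<bar> \<partial>S)" unfolding f_def by (rule integral_abs_bound)
    also have "\<dots> \<le> (\<integral>\<omega>. 1 \<partial>S)" by (rule integral_mono') (use Suc.prems in auto)
    finally show "\<bar>f a\<bar> \<le> 1" by (simp add: P.prob_space)
    have "\<bar>g a\<bar> \<le> (\<integral>\<omega>. \<bar>G (case_nat a (increments \<omega>))\<bar> \<partial>S)" unfolding g_def by (rule integral_abs_bound)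
    also have "\<dots> \<le> (\<integral>\<omega>. 1 \<partial>S)" by (rule integral_mono') (use Suc.prems in auto)
    finally show "\<bar>g a\<bar> \<le> 1" by (simp add: P.prob_space)
  qed
  have incF: "F (case_nat a u) \<le> F (case_nat b u)" "G (case_nat a u) \<le> G (case_nat b u)" if "a \<le> b" for a b u
    using Suc.prems(2,6) that unfolding incr_def by (auto split: nat.split)
  have fmono: "mono f" "mono g"
    unfolding mono_def f_def g_def using im incF by (auto intro!: integral_mono)
  have eF: "(\<integral>\<omega>. F (increments \<omega>) \<partial>S) = (\<integral>q. f (x q) \<partial>D)"
    unfolding E_split(3)[OF iF(1), of "Suc 0"] cn using E_coord(1)[of "\<lambda>q. f (x q)" 0] by (simp add: f_def)
  have eG: "(\<integral>\<omega>. G (increments \<omega>) \<partial>S) = (\<integral>q. g (x q) \<partial>D)"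
    unfolding E_split(3)[OF iF(2), of "Suc 0"] cn using E_coord(1)[of "\<lambda>q. g (x q)" 0] by (simp add: g_def)
  have "(\<integral>q. f (x q) \<partial>D) * (\<integral>q. g (x q) \<partial>D) \<le> (\<integral>q. f (x q) * g (x q) \<partial>D)"
    by (rule M.chebyshev_association) (use fmono fb in auto)
  also have "\<dots> = (\<integral>\<omega>. f (x (\<omega> 0)) * g (x (\<omega> 0)) \<partial>S)" using E_coord(1)[of "\<lambda>q. f (x q) * g (x q)" 0] by simp
  also have "\<dots> \<le> (\<integral>\<omega>. (\<integral>\<omega>'. F (increments (comb_seq (Suc 0) \<omega> \<omega>')) * G (increments (comb_seq (Suc 0) \<omega> \<omega>')) \<partial>S) \<partial>S)"
  proof (rule integral_mono)
    show "integrable S (\<lambda>\<omega>. f (x (\<omega> 0)) * g (x (\<omega> 0)))"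
      using fb by (auto intro!: integrable_bounded[where B = 1] simp: abs_mult mult_le_one)
    show "integrable S (\<lambda>\<omega>. \<integral>\<omega>'. F (increments (comb_seq (Suc 0) \<omega> \<omega>')) * G (increments (comb_seq (Suc 0) \<omega> \<omega>')) \<partial>S)"
      by (rule E_split(2)[OF iF(3)])
    fix \<omega>
    show "f (x (\<omega> 0)) * g (x (\<omega> 0)) \<le> (\<integral>\<omega>'. F (increments (comb_seq (Suc 0) \<omega> \<omega>')) * G (increments (comb_seq (Suc 0) \<omega> \<omega>')) \<partial>S)"
      unfolding cn f_def g_def
    proof (rule Suc.IH)
      show "incr (\<lambda>u. F (case_nat (x (\<omega> 0)) u))" "incr (\<lambda>u. G (case_nat (x (\<omega> 0)) u))"
        using Suc.prems(2,6) unfolding incr_def by (auto split: nat.split)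
      show "F (case_nat (x (\<omega> 0)) u) = F (case_nat (x (\<omega> 0)) v)" if "\<forall>i<n. u i = v i" for u v
        using that by (intro Suc.prems(4)) (auto split: nat.split)
      show "G (case_nat (x (\<omega> 0)) u) = G (case_nat (x (\<omega> 0)) v)" if "\<forall>i<n. u i = v i" for u v
        using that by (intro Suc.prems(8)) (auto split: nat.split)
    qed (use Suc.prems in auto)
  qed
  also have "\<dots> = (\<integral>\<omega>. F (increments \<omega>) * G (increments \<omega>) \<partial>S)" by (rule E_split(3)[OF iF(3), symmetric])
  finally show ?case unfolding eF eG .
qed

text \<open>The central limit theorem. Capping at 1 makes the functional bounded, as weak
  convergence and association both require.\<close>

lemma positive_part_lower:
  "\<exists>c>0. \<exists>n0\<ge>1. \<forall>n\<ge>n0. c \<le> (\<integral>\<omega>. min 1 (max 0 (walk \<omega> n) / sqrt (real n)) \<partial>S)"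
proof -
  define m where "m n = distr S borel (\<lambda>\<omega>. walk \<omega> n / sqrt (real n))" for n
  define m' where "m' = distr std_normal_distribution borel (\<lambda>z. sqrt s2 * z)"
  define f where "f z = min 1 (max 0 z)" for z :: real
  interpret N: real_distribution std_normal_distribution by (rule real_dist_normal_dist)
  have rdm: "real_distribution (m n)" for n unfolding m_def by (rule P.real_distribution_distr) simp
  have rdm': "real_distribution m'" unfolding m'_def by (rule N.real_distribution_distr) simp
  have wc: "weak_conv_m m m'"
  proof (rule levy_continuity[OF rdm rdm'])
    fix t
    have "char (m n) t = char (\<nu> n) (t / sqrt (real n))" for n
    proof -
      have "char (m n) t = (\<integral>\<omega>. iexp (t * (walk \<omega> n / sqrt (real n))) \<partial>S)"
        unfolding char_def m_def by (rule integral_distr) auto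
      also have "\<dots> = (\<integral>\<omega>. iexp ((t / sqrt (real n)) * walk \<omega> n) \<partial>S)" by (simp add: mult.commute)
      also have "\<dots> = char (\<nu> n) (t / sqrt (real n))" unfolding char_def by (rule int_nu[symmetric]) simp
      finally show ?thesis .
    qed
    moreover have "char m' t = complex_of_real (exp (- (s2 * t\<^sup>2 / 2)))"
    proof -
      have "char m' t = char std_normal_distribution (t * sqrt s2)"
        unfolding char_def m'_def by (subst integral_distr) (auto simp: algebra_simps)
      thus ?thesis using s2_pos by (simp add: char_std_normal_distribution power_mult_distrib algebra_simps)
    qed
    ultimately show "(\<lambda>n. char (m n) t) \<longlonglongrightarrow> char m' t" using char_nu_limit[of t] by simp
  qed
  have fm [measurable]: "f \<in> borel_measurable borel" unfolding f_def by measurable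
  have "(\<lambda>n. \<integral>z. f z \<partial>m n) \<longlonglongrightarrow> (\<integral>z. f z \<partial>m')"
    by (rule weak_conv_imp_integral_bdd_continuous_conv[OF rdm rdm' wc, of _ 1]) (auto simp: f_def intro!: continuous_intros)
  moreover have "(\<integral>z. f z \<partial>m n) = (\<integral>\<omega>. min 1 (max 0 (walk \<omega> n) / sqrt (real n)) \<partial>S)" for n
  proof -
    have "(\<integral>z. f z \<partial>m n) = (\<integral>\<omega>. f (walk \<omega> n / sqrt (real n)) \<partial>S)" unfolding m_def by (rule integral_distr) auto
    also have "\<dots> = (\<integral>\<omega>. min 1 (max 0 (walk \<omega> n) / sqrt (real n)) \<partial>S)"
      by (intro Bochner_Integration.integral_cong refl) (simp add: f_def max_divide_distrib_right)
    finally show ?thesis .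
  qed
  moreover have "(\<integral>z. f z \<partial>m') > 0"
  proof -
    interpret m': real_distribution m' by (rule rdm')
    have i: "integrable m' f" by (rule m'.integrable_const_bound[where B = 1]) (auto simp: f_def m'_def)
    have "(\<integral>z. f z \<partial>m') \<noteq> 0"
    proof
      assume 0: "(\<integral>z. f z \<partial>m') = 0"
      have "AE z in m'. 0 \<le> f z" by (simp add: f_def)
      hence "AE z in m'. f z = 0" using integral_nonneg_eq_0_iff_AE[OF i] 0 by blast
      hence "AE z in m'. z \<le> 0" by eventually_elim (auto simp: f_def min_def max_def split: if_splits)
      hence "AE z in std_normal_distribution. sqrt s2 * z \<le> 0" unfolding m'_def by (subst (asm) AE_distr_iff) auto
      hence "AE z in std_normal_distribution. z \<le> 0" by eventually_elim (use s2_pos in \<open>auto simp: mult_le_0_iff\<close>)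
      hence "AE z in lborel. std_normal_density z > 0 \<longrightarrow> z \<le> 0" by (subst (asm) AE_density) auto
      hence "AE z in lborel. z \<le> (0::real)" by eventually_elim (auto simp: normal_density_pos)
      hence "AE z in lborel. z \<in> {0<..<(1::real)} \<longrightarrow> z \<in> {}" by eventually_elim auto
      from emeasure_mono_AE[OF this] show False by simp
    qed
    moreover have "(\<integral>z. f z \<partial>m') \<ge> 0" by (rule integral_nonneg_AE) (simp add: f_def)
    ultimately show ?thesis by simp
  qed
  ultimately have "\<forall>\<^sub>F n in sequentially. (\<integral>z. f z \<partial>m') / 2 < (\<integral>\<omega>. min 1 (max 0 (walk \<omega> n) / sqrt (real n)) \<partial>S)"
    by (intro order_tendstoD(1)) auto
  then obtain n0 where "\<And>n. n \<ge> n0 \<Longrightarrow> (\<integral>z. f z \<partial>m') / 2 < (\<integral>\<omega>. min 1 (max 0 (walk \<omega> n) / sqrt (real n)) \<partial>S)"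
    unfolding eventually_at_top_linorder by blast
  thus ?thesis using \<open>(\<integral>z. f z \<partial>m') > 0\<close>
    by (intro exI[of _ "(\<integral>z. f z \<partial>m') / 2"] conjI exI[of _ "max 1 n0"]) (auto intro: less_imp_le)
qed

lemma E_if_mult:
  assumes [measurable]: "Measurable.pred S A" and G: "integrable S G" and h: "integrable D h"
    and dep: "\<And>\<omega> \<omega>'. A (comb_seq k \<omega> \<omega>') = A \<omega>" "\<And>\<omega> \<omega>'. G (comb_seq k \<omega> \<omega>') = G \<omega>"
  shows "integrable S (\<lambda>\<omega>. if A \<omega> then G \<omega> * h (\<omega> k) else 0)"
    "(\<integral>\<omega>. (if A \<omega> then G \<omega> * h (\<omega> k) else 0) \<partial>S) = (\<integral>\<omega>. (if A \<omega> then G \<omega> else (0::real)) \<partial>S) * (\<integral>q. h q \<partial>D)"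
proof -
  have G': "integrable S (\<lambda>\<omega>. if A \<omega> then G \<omega> else 0)"
    by (rule Bochner_Integration.integrable_bound[OF G]) (use G in auto)
  have eq: "(if A \<omega> then G \<omega> * h (\<omega> k) else 0) = (if A \<omega> then G \<omega> else 0) * h (\<omega> k)" for \<omega> by simp
  show "integrable S (\<lambda>\<omega>. if A \<omega> then G \<omega> * h (\<omega> k) else 0)"
    "(\<integral>\<omega>. (if A \<omega> then G \<omega> * h (\<omega> k) else 0) \<partial>S) = (\<integral>\<omega>. (if A \<omega> then G \<omega> else (0::real)) \<partial>S) * (\<integral>q. h q \<partial>D)"
    unfolding eq by (rule E_indep_mult[OF G' h]; simp add: dep)+
qed

definition survive :: "real \<Rightarrow> nat \<Rightarrow> real" where
  "survive z n = (\<integral>\<omega>. (if - z \<le> wmin \<omega> n then 1 else 0) \<partial>S)"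

lemma survive_nonneg: "0 \<le> survive z n" unfolding survive_def by (rule integral_nonneg_AE) simp
lemma survive_le_1: "survive z n \<le> 1"
proof -
  have "survive z n \<le> (\<integral>\<omega>. 1 \<partial>S)" unfolding survive_def by (rule integral_mono') auto
  thus ?thesis by (simp add: P.prob_space)
qed

lemma integrable_if: "Measurable.pred S A \<Longrightarrow> integrable S G \<Longrightarrow> integrable S (\<lambda>\<omega>. if A \<omega> then G \<omega> else (0::real))"
  by (rule Bochner_Integration.integrable_bound[of _ G]) auto

text \<open>A step undershoots the level -z by at most \<open>x0\<close>, so the shifted walk is
  still nonnegative when it is killed. Dropping the killed paths can therefore only lower the mean,
  and the walk is a martingale.\<close>

lemma killed_mean_upper:
  assumes z: "z \<ge> 0"
  shows "(\<integral>\<omega>. (if - z \<le> wmin \<omega> n then walk \<omega> n + z + x0 else 0) \<partial>S) \<le> z + x0"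
proof (induction n)
  case 0
  show ?case using z by (simp add: P.prob_space)
next
  case (Suc n)
  have i: "integrable S (\<lambda>\<omega>. walk \<omega> m + z + x0)" for m using walk_integrable by auto
  have i1: "integrable S (\<lambda>\<omega>. if - z \<le> wmin \<omega> n then walk \<omega> n + z + x0 else 0)" by (rule integrable_if[OF _ i]) measurable
  note 2 = E_if_mult[of "\<lambda>\<omega>. - z \<le> wmin \<omega> n" "\<lambda>_. 1" x n, simplified wmin_comb_left[OF order_refl] mult_1]
  have "(\<integral>\<omega>. (if - z \<le> wmin \<omega> (Suc n) then walk \<omega> (Suc n) + z + x0 else 0) \<partial>S)
      \<le> (\<integral>\<omega>. (if - z \<le> wmin \<omega> n then walk \<omega> n + z + x0 else 0) + (if - z \<le> wmin \<omega> n then x (\<omega> n) else 0) \<partial>S)"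
  proof (rule integral_mono)
    show "integrable S (\<lambda>\<omega>. if - z \<le> wmin \<omega> (Suc n) then walk \<omega> (Suc n) + z + x0 else 0)" by (rule integrable_if[OF _ i]) measurable
    show "integrable S (\<lambda>\<omega>. (if - z \<le> wmin \<omega> n then walk \<omega> n + z + x0 else 0) + (if - z \<le> wmin \<omega> n then x (\<omega> n) else 0))"
      by (rule Bochner_Integration.integrable_add[OF i1 2(1)]) (use x_int in auto)
    fix \<omega>
    show "(if - z \<le> wmin \<omega> (Suc n) then walk \<omega> (Suc n) + z + x0 else 0) \<le> (if - z \<le> wmin \<omega> n then walk \<omega> n + z + x0 else 0) + (if - z \<le> wmin \<omega> n then x (\<omega> n) else 0)"
      using x_lower[of "\<omega> n"] wmin_le_walk[of \<omega> n] by (auto simp: wmin_Suc walk_Suc)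
  qed
  also have "\<dots> = (\<integral>\<omega>. (if - z \<le> wmin \<omega> n then walk \<omega> n + z + x0 else 0) \<partial>S) + (\<integral>\<omega>. (if - z \<le> wmin \<omega> n then x (\<omega> n) else 0) \<partial>S)"
    by (rule Bochner_Integration.integral_add[OF i1 2(1)]) (use x_int in auto)
  also have "(\<integral>\<omega>. (if - z \<le> wmin \<omega> n then x (\<omega> n) else 0) \<partial>S) = 0" by (subst 2(2)) (use x_int x_mean in auto)
  finally show ?case using Suc by simp
qed

text \<open>Survival and the capped positive part of S_n / sqrt n are both increasing in the steps.
  Hence the product of their means is at most the mean of the product, which
  \<open>killed_mean_upper\<close> bounds by (z + x0) / sqrt n. The second mean is bounded below by
  the central limit theorem, and division gives a bound linear in z.\<close>

lemma survive_upper: "\<exists>C>0. \<forall>n\<ge>1. \<forall>z\<ge>0. survive z n \<le> C * (1 + z) / sqrt (real n)"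
proof -
  obtain c n0 where c: "c > 0" "n0 \<ge> 1" "\<And>n. n \<ge> n0 \<Longrightarrow> c \<le> (\<integral>\<omega>. min 1 (max 0 (walk \<omega> n) / sqrt (real n)) \<partial>S)"
    using positive_part_lower by blast
  define C where "C = max (sqrt (real n0)) ((1 + x0) / c)"
  have C: "C > 0" unfolding C_def using c by (simp add: less_max_iff_disj)
  have "survive z n \<le> C * (1 + z) / sqrt (real n)" if n: "n \<ge> 1" and z: "z \<ge> 0" for n z
  proof (cases "n \<ge> n0")
    case False
    have "survive z n * sqrt (real n) \<le> 1 * sqrt (real n0)" using False by (intro mult_mono survive_le_1) auto
    also have "\<dots> \<le> C * 1" by (simp add: C_def)
    also have "\<dots> \<le> C * (1 + z)" using z C by (intro mult_left_mono) auto
    finally show ?thesis using n by (simp add: field_simps)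
  next
    case True
    define F where "F u = (if - z \<le> pL u n then 1 else (0::real))" for u
    define G where "G u = min 1 (max 0 (pS u n) / sqrt (real n))" for u
    have pm [measurable]: "(\<lambda>u. pS u n) \<in> borel_measurable (PiM UNIV (\<lambda>_. borel))" "(\<lambda>u. pL u n) \<in> borel_measurable (PiM UNIV (\<lambda>_. borel))"
      by (auto intro!: measurable_pS measurable_pL)
    have dep: "pS u n = pS v n" "pL u n = pL v n" if "\<forall>i<n. u i = v i" for u v :: "nat \<Rightarrow> real"
    proof -
      have e: "pS u k = pS v k" if "k \<le> n" for k using \<open>\<forall>i<n. u i = v i\<close> that unfolding pS_def by (intro sum.cong) auto
      thus "pS u n = pS v n" by simp
      show "pL u n = pL v n" unfolding pL_def by (intro arg_cong[where f = Min] image_cong) (auto simp: e)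
    qed
    have "(\<integral>\<omega>. F (increments \<omega>) \<partial>S) * (\<integral>\<omega>. G (increments \<omega>) \<partial>S) \<le> (\<integral>\<omega>. F (increments \<omega>) * G (increments \<omega>) \<partial>S)"
    proof (rule harris)
      show "incr F" unfolding incr_def F_def using pL_mono by (auto intro: order_trans)
      show "incr G" unfolding incr_def G_def
        by (intro allI impI min.mono divide_right_mono max.mono order_refl pS_mono) auto
      show "F u = F v" "G u = G v" if "\<forall>i<n. u i = v i" for u v using dep[OF that] by (simp_all add: F_def G_def)
      show "F \<in> borel_measurable (PiM UNIV (\<lambda>_. borel))" "G \<in> borel_measurable (PiM UNIV (\<lambda>_. borel))" unfolding F_def G_def by measurable
      show "\<bar>F u\<bar> \<le> 1" "\<bar>G u\<bar> \<le> 1" for u unfolding F_def G_def by (auto simp: abs_le_iff min_def)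
    qed
    also have "(\<integral>\<omega>. F (increments \<omega>) * G (increments \<omega>) \<partial>S) \<le> (\<integral>\<omega>. (if - z \<le> wmin \<omega> n then walk \<omega> n + z + x0 else 0) / sqrt (real n) \<partial>S)"
    proof (rule integral_mono)
      show "integrable S (\<lambda>\<omega>. F (increments \<omega>) * G (increments \<omega>))"
        unfolding F_def G_def by (rule integrable_bounded[where B = 1]) (auto simp: abs_le_iff min_def)
      show "integrable S (\<lambda>\<omega>. (if - z \<le> wmin \<omega> n then walk \<omega> n + z + x0 else 0) / sqrt (real n))"
        by (intro integrable_divide integrable_if) (use walk_integrable in auto)
      fix \<omega>
      have "max 0 (walk \<omega> n) \<le> walk \<omega> n + z + x0" if "- z \<le> wmin \<omega> n" using that z x0_nonneg wmin_le_walk[of \<omega> n] by auto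
      hence "max 0 (walk \<omega> n) / sqrt (real n) \<le> (walk \<omega> n + z + x0) / sqrt (real n)" if "- z \<le> wmin \<omega> n" using that by (intro divide_right_mono) auto
      thus "F (increments \<omega>) * G (increments \<omega>) \<le> (if - z \<le> wmin \<omega> n then walk \<omega> n + z + x0 else 0) / sqrt (real n)"
        unfolding F_def G_def increments_def walk_def wmin_def by (auto simp: min_le_iff_disj)
    qed
    also have "\<dots> = (\<integral>\<omega>. (if - z \<le> wmin \<omega> n then walk \<omega> n + z + x0 else 0) \<partial>S) / sqrt (real n)" by simp
    also have "\<dots> \<le> (z + x0) / sqrt (real n)" by (intro divide_right_mono killed_mean_upper z) auto
    finally have "(\<integral>\<omega>. F (increments \<omega>) \<partial>S) * (\<integral>\<omega>. G (increments \<omega>) \<partial>S) \<le> (z + x0) / sqrt (real n)" .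
    moreover have "(\<integral>\<omega>. F (increments \<omega>) \<partial>S) = survive z n" by (simp add: F_def increments_def survive_def wmin_def)
    ultimately have lG: "survive z n * (\<integral>\<omega>. G (increments \<omega>) \<partial>S) \<le> (z + x0) / sqrt (real n)" by simp
    have "c \<le> (\<integral>\<omega>. G (increments \<omega>) \<partial>S)" using c(3)[OF True] by (simp add: G_def increments_def walk_def)
    hence "survive z n * c \<le> survive z n * (\<integral>\<omega>. G (increments \<omega>) \<partial>S)" by (rule mult_left_mono[OF _ survive_nonneg])
    also note lG
    finally have "survive z n * c \<le> (z + x0) / sqrt (real n)" .
    hence "survive z n \<le> (z + x0) / sqrt (real n) / c" by (simp only: pos_le_divide_eq[OF c(1)])
    also have "\<dots> = (z + x0) / c / sqrt (real n)" by simp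
    also have "\<dots> \<le> C * (1 + z) / sqrt (real n)"
    proof (rule divide_right_mono)
      have "(z + x0) \<le> (1 + x0) * (1 + z)" using z x0_nonneg by (simp add: algebra_simps)
      hence "(z + x0) / c \<le> (1 + x0) * (1 + z) / c" using c(1) by (intro divide_right_mono) auto
      also have "\<dots> = (1 + x0) / c * (1 + z)" by simp
      also have "\<dots> \<le> C * (1 + z)" using z by (intro mult_right_mono) (auto simp: C_def)
      finally show "(z + x0) / c \<le> C * (1 + z)" .
    qed simp
    finally show ?thesis .
  qed
  thus ?thesis using C by blast
qed

lemma x_pos_part: "(\<integral>q. max 0 (x q) \<partial>D) > 0"
proof -
  have i: "integrable D (\<lambda>q. max 0 (x q))" using x_int by auto
  have "(\<integral>q. max 0 (x q) \<partial>D) \<noteq> 0"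
  proof
    assume 0: "(\<integral>q. max 0 (x q) \<partial>D) = 0"
    hence ae: "AE q in D. max 0 (x q) = 0" using integral_nonneg_eq_0_iff_AE[OF i] by simp
    have "(\<integral>q. max 0 (x q) - x q \<partial>D) = 0" using 0 x_mean i x_int by simp
    moreover have "integrable D (\<lambda>q. max 0 (x q) - x q)" using i x_int by auto
    ultimately have "AE q in D. max 0 (x q) - x q = 0" using integral_nonneg_eq_0_iff_AE[of D "\<lambda>q. max 0 (x q) - x q"] by simp
    with ae have "AE q in D. (x q)\<^sup>2 = 0" by eventually_elim simp
    hence "(\<integral>q. (x q)\<^sup>2 \<partial>D) = (\<integral>q. 0 \<partial>D)" by (intro integral_cong_AE) auto
    thus False using x_var s2_pos by simp
  qed
  moreover have "(\<integral>q. max 0 (x q) \<partial>D) \<ge> 0" by (rule integral_nonneg_AE) simp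
  ultimately show ?thesis by linarith
qed

text \<open>The step that kills the walk leaves it below 0, so discarding the path can only raise
  the mean; the case of one step is the mean of the positive part of the increment.\<close>

lemma killed_mean_lower:
  "n \<ge> 1 \<Longrightarrow> (\<integral>q. max 0 (x q) \<partial>D) \<le> (\<integral>\<omega>. (if 0 \<le> wmin \<omega> n then walk \<omega> n else 0) \<partial>S)"
proof (induction n rule: dec_induct)
  case base
  have "(\<integral>\<omega>. (if 0 \<le> wmin \<omega> 1 then walk \<omega> 1 else 0) \<partial>S) = (\<integral>\<omega>. max 0 (x (\<omega> 0)) \<partial>S)"
    by (intro Bochner_Integration.integral_cong refl) (auto simp: wmin_Suc walk_Suc)
  thus ?case using E_coord(1)[of "\<lambda>q. max 0 (x q)" 0] by simp
next
  case (step n)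
  have i1: "integrable S (\<lambda>\<omega>. if 0 \<le> wmin \<omega> m then walk \<omega> m else 0)" for m by (rule integrable_if[OF _ walk_integrable]) measurable
  note 2 = E_if_mult[of "\<lambda>\<omega>. 0 \<le> wmin \<omega> n" "\<lambda>_. 1" x n, simplified wmin_comb_left[OF order_refl] mult_1]
  have "(\<integral>\<omega>. (if 0 \<le> wmin \<omega> n then walk \<omega> n else 0) \<partial>S) = (\<integral>\<omega>. (if 0 \<le> wmin \<omega> n then walk \<omega> n else 0) \<partial>S) + (\<integral>\<omega>. (if 0 \<le> wmin \<omega> n then x (\<omega> n) else 0) \<partial>S)"
    by (subst 2(2)) (use x_int x_mean in auto)
  also have "\<dots> = (\<integral>\<omega>. (if 0 \<le> wmin \<omega> n then walk \<omega> n else 0) + (if 0 \<le> wmin \<omega> n then x (\<omega> n) else 0) \<partial>S)"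
    by (rule Bochner_Integration.integral_add[OF i1 2(1), symmetric]) (use x_int in auto)
  also have "\<dots> \<le> (\<integral>\<omega>. (if 0 \<le> wmin \<omega> (Suc n) then walk \<omega> (Suc n) else 0) \<partial>S)"
  proof (rule integral_mono[OF _ i1])
    show "integrable S (\<lambda>\<omega>. (if 0 \<le> wmin \<omega> n then walk \<omega> n else 0) + (if 0 \<le> wmin \<omega> n then x (\<omega> n) else 0))"
      by (rule Bochner_Integration.integrable_add[OF i1 2(1)]) (use x_int in auto)
    fix \<omega>
    show "(if 0 \<le> wmin \<omega> n then walk \<omega> n else 0) + (if 0 \<le> wmin \<omega> n then x (\<omega> n) else 0) \<le> (if 0 \<le> wmin \<omega> (Suc n) then walk \<omega> (Suc n) else 0)"
      by (auto simp: wmin_Suc walk_Suc)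
  qed
  finally show ?case using step by simp
qed

text \<open>Each step adds \<open>s2\<close> on the surviving paths, the mixed term having mean 0;
  discarding killed paths drops only squares.\<close>

lemma killed_square:
  "(\<integral>\<omega>. (if 0 \<le> wmin \<omega> n then (walk \<omega> n)\<^sup>2 else 0) \<partial>S) \<le> s2 * (\<Sum>k<n. survive 0 k)"
proof (induction n)
  case (Suc n)
  have i1: "integrable S (\<lambda>\<omega>. if 0 \<le> wmin \<omega> m then (walk \<omega> m)\<^sup>2 else 0)" for m by (rule integrable_if[OF _ walk_square_integrable]) measurable
  have 2: "integrable S (\<lambda>\<omega>. if 0 \<le> wmin \<omega> n then walk \<omega> n * x (\<omega> n) else 0)"
    "(\<integral>\<omega>. (if 0 \<le> wmin \<omega> n then walk \<omega> n * x (\<omega> n) else 0) \<partial>S) = 0"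
    using E_if_mult[of "\<lambda>\<omega>. 0 \<le> wmin \<omega> n" "\<lambda>\<omega>. walk \<omega> n" x n] walk_integrable x_int x_mean by (auto simp: wmin_comb_left walk_comb_left)
  have 3: "integrable S (\<lambda>\<omega>. if 0 \<le> wmin \<omega> n then (x (\<omega> n))\<^sup>2 else 0)"
    "(\<integral>\<omega>. (if 0 \<le> wmin \<omega> n then (x (\<omega> n))\<^sup>2 else 0) \<partial>S) = survive 0 n * s2"
    using E_if_mult[of "\<lambda>\<omega>. 0 \<le> wmin \<omega> n" "\<lambda>\<omega>. 1" "\<lambda>q. (x q)\<^sup>2" n, simplified wmin_comb_left[OF order_refl] mult_1] x_square_int x_var by (auto simp: survive_def)
  have i4: "integrable S (\<lambda>\<omega>. (if 0 \<le> wmin \<omega> n then (walk \<omega> n)\<^sup>2 else 0) + 2 * (if 0 \<le> wmin \<omega> n then walk \<omega> n * x (\<omega> n) else 0) + (if 0 \<le> wmin \<omega> n then (x (\<omega> n))\<^sup>2 else 0))"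
    by (intro Bochner_Integration.integrable_add integrable_mult_right i1 2(1) 3(1))
  have "(\<integral>\<omega>. (if 0 \<le> wmin \<omega> (Suc n) then (walk \<omega> (Suc n))\<^sup>2 else 0) \<partial>S) \<le>
     (\<integral>\<omega>. (if 0 \<le> wmin \<omega> n then (walk \<omega> n)\<^sup>2 else 0) + 2 * (if 0 \<le> wmin \<omega> n then walk \<omega> n * x (\<omega> n) else 0) + (if 0 \<le> wmin \<omega> n then (x (\<omega> n))\<^sup>2 else 0) \<partial>S)"
  proof (rule integral_mono[OF i1 i4])
    fix \<omega>
    have "(walk \<omega> (Suc n))\<^sup>2 = (walk \<omega> n)\<^sup>2 + 2 * (walk \<omega> n * x (\<omega> n)) + (x (\<omega> n))\<^sup>2" by (simp add: walk_Suc power2_sum)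
    moreover have "0 \<le> (walk \<omega> n)\<^sup>2 + 2 * (walk \<omega> n * x (\<omega> n)) + (x (\<omega> n))\<^sup>2" unfolding calculation[symmetric] by simp
    ultimately show "(if 0 \<le> wmin \<omega> (Suc n) then (walk \<omega> (Suc n))\<^sup>2 else 0) \<le> (if 0 \<le> wmin \<omega> n then (walk \<omega> n)\<^sup>2 else 0) + 2 * (if 0 \<le> wmin \<omega> n then walk \<omega> n * x (\<omega> n) else 0) + (if 0 \<le> wmin \<omega> n then (x (\<omega> n))\<^sup>2 else 0)"
      by (auto simp: wmin_Suc)
  qed
  also have "\<dots> = (\<integral>\<omega>. (if 0 \<le> wmin \<omega> n then (walk \<omega> n)\<^sup>2 else 0) \<partial>S) + 2 * 0 + survive 0 n * s2"
    using i1[of n] 2 3 by simp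
  finally show ?case using Suc by (simp add: algebra_simps)
qed simp

text \<open>Second moment method for the walk killed below 0, whose mean is bounded below by optional stopping.\<close>
lemma survive_lower: "\<exists>c>0. \<forall>n\<ge>1. c / sqrt (real n) \<le> survive 0 n"
proof -
  obtain C where C: "C > 0" "\<And>n z. n \<ge> 1 \<Longrightarrow> z \<ge> 0 \<Longrightarrow> survive z n \<le> C * (1 + z) / sqrt (real n)" using survive_upper by blast
  define c0 where "c0 = (\<integral>q. max 0 (x q) \<partial>D)"
  have c0: "c0 > 0" unfolding c0_def by (rule x_pos_part)
  define K where "K = s2 * (1 + 2 * C)"
  have K: "K > 0" unfolding K_def using s2_pos C by (intro mult_pos_pos) auto
  have "c0\<^sup>2 / K / sqrt (real n) \<le> survive 0 n" if n: "n \<ge> 1" for n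
  proof -
    define Q where "Q = (\<integral>\<omega>. (if 0 \<le> wmin \<omega> n then (walk \<omega> n)\<^sup>2 else 0) \<partial>S)"
    have sn: "sqrt (real n) \<ge> 1" using n by simp
    have Q: "Q \<le> K * sqrt (real n)"
    proof -
      have "(\<Sum>k<n. survive 0 k) \<le> 1 + (\<Sum>k=1..n. C * (1 / sqrt (real k)))"
      proof -
        have "(\<Sum>k<n. survive 0 k) \<le> (\<Sum>k\<in>insert 0 {1..n}. survive 0 k)" by (rule sum_mono2) (auto simp: survive_nonneg)
        also have "\<dots> = survive 0 0 + (\<Sum>k=1..n. survive 0 k)" by simp
        also have "\<dots> \<le> 1 + (\<Sum>k=1..n. C * (1 / sqrt (real k)))" using C(2)[of _ 0] by (intro add_mono survive_le_1 sum_mono) auto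
        finally show ?thesis .
      qed
      also have "\<dots> = 1 + C * (\<Sum>k=1..n. 1 / sqrt (real k))" by (simp add: sum_distrib_left)
      also have "\<dots> \<le> sqrt (real n) + C * (2 * sqrt (real n))" using C sn by (intro add_mono mult_left_mono sum_inverse_sqrt_le) auto
      finally have "(\<Sum>k<n. survive 0 k) \<le> (1 + 2 * C) * sqrt (real n)" by (simp add: algebra_simps)
      hence "s2 * (\<Sum>k<n. survive 0 k) \<le> s2 * ((1 + 2 * C) * sqrt (real n))" using s2_pos by (intro mult_left_mono) auto
      thus ?thesis using killed_square[of n] unfolding Q_def K_def by simp
    qed
    \<comment> \<open>Cauchy-Schwarz in the form 2 w <= lam w^2 + 1 / lam, on the surviving paths.
      This \<open>lam\<close> makes the quadratic term at most c0, half of the lower bound 2 c0 for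
      the left side.\<close>
    define lam where "lam = c0 / (K * sqrt (real n))"
    have l: "lam > 0" unfolding lam_def using c0 K n by simp
    have i1: "integrable S (\<lambda>\<omega>. if 0 \<le> wmin \<omega> n then walk \<omega> n else 0)" by (rule integrable_if[OF _ walk_integrable]) measurable
    have i2: "integrable S (\<lambda>\<omega>. if 0 \<le> wmin \<omega> n then (walk \<omega> n)\<^sup>2 else 0)" by (rule integrable_if[OF _ walk_square_integrable]) measurable
    have i3: "integrable S (\<lambda>\<omega>. if 0 \<le> wmin \<omega> n then 1 else (0::real))" by (rule integrable_if) auto
    have "2 * c0 \<le> 2 * (\<integral>\<omega>. (if 0 \<le> wmin \<omega> n then walk \<omega> n else 0) \<partial>S)" using killed_mean_lower[OF n] by (simp add: c0_def)
    also have "\<dots> = (\<integral>\<omega>. 2 * (if 0 \<le> wmin \<omega> n then walk \<omega> n else 0) \<partial>S)" by simp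
    also have "\<dots> \<le> (\<integral>\<omega>. lam * (if 0 \<le> wmin \<omega> n then (walk \<omega> n)\<^sup>2 else 0) + 1 / lam * (if 0 \<le> wmin \<omega> n then 1 else 0) \<partial>S)"
    proof (rule integral_mono)
      fix \<omega>
      have "2 * walk \<omega> n \<le> lam * (walk \<omega> n)\<^sup>2 + 1 / lam"
      proof -
        have "0 \<le> (lam * walk \<omega> n - 1)\<^sup>2 / lam" using l by simp
        also have "(lam * walk \<omega> n - 1)\<^sup>2 = lam * (lam * (walk \<omega> n)\<^sup>2) + 1 - lam * (2 * walk \<omega> n)" by (simp add: power2_eq_square algebra_simps)
        also have "\<dots> / lam = lam * (walk \<omega> n)\<^sup>2 + 1 / lam - 2 * walk \<omega> n" using l by (simp only: add_divide_distrib diff_divide_distrib nonzero_mult_div_cancel_left less_imp_neq[OF l, symmetric] not_False_eq_True)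
        finally show ?thesis by simp
      qed
      thus "2 * (if 0 \<le> wmin \<omega> n then walk \<omega> n else 0) \<le> lam * (if 0 \<le> wmin \<omega> n then (walk \<omega> n)\<^sup>2 else 0) + 1 / lam * (if 0 \<le> wmin \<omega> n then 1 else 0)" by auto
    qed (intro integrable_mult_right Bochner_Integration.integrable_add i1 i2 i3)+
    also have "\<dots> = lam * Q + survive 0 n / lam" unfolding Q_def survive_def using i2 i3 by simp
    also have "\<dots> \<le> lam * (K * sqrt (real n)) + survive 0 n / lam" using Q l by (intro add_right_mono mult_left_mono) auto
    also have "lam * (K * sqrt (real n)) = c0" unfolding lam_def using K n by simp
    finally have "c0 \<le> survive 0 n / lam" by simp
    hence "c0 * lam \<le> survive 0 n" by (simp only: pos_le_divide_eq[OF l])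
    thus ?thesis unfolding lam_def by (simp add: power2_eq_square)
  qed
  thus ?thesis using c0 K by (intro exI[of _ "c0\<^sup>2 / K"]) auto
qed

end

section \<open>Records, reversal, and the walk started at an arbitrary level\<close>

context env_walk
begin

lemma measurable_pred_le:
  fixes f g :: "'c \<Rightarrow> real"
  assumes [measurable]: "f \<in> borel_measurable N" "g \<in> borel_measurable N"
  shows "Measurable.pred N (\<lambda>w. f w \<le> g w)"
  by measurable

text \<open>After time reversal this is the probability of a strict descending record at time \<open>n\<close>.\<close>
definition stay_neg :: "nat \<Rightarrow> real" where
  "stay_neg n = (\<integral>\<omega>. (if \<forall>k\<in>{1..n}. walk \<omega> k < 0 then 1 else 0) \<partial>S)"

lemma pred_ball_walk [measurable]:
  "Measurable.pred S (\<lambda>\<omega>. \<forall>k\<in>{1..n::nat}. walk \<omega> k < 0)" "Measurable.pred S (\<lambda>\<omega>. \<forall>k\<in>{1..n::nat}. walk \<omega> k > 0)"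
  "Measurable.pred S (\<lambda>\<omega>. \<forall>i<n. walk \<omega> n < walk \<omega> i)" "Measurable.pred S (\<lambda>\<omega>. \<forall>i<n. walk \<omega> i < walk \<omega> n)"
  "Measurable.pred S (\<lambda>\<omega>. \<forall>j. k \<le> j \<and> j \<le> n \<longrightarrow> walk \<omega> k \<le> walk \<omega> j)" "Measurable.pred S (\<lambda>\<omega>. \<forall>j. k \<le> j \<and> j \<le> n \<longrightarrow> walk \<omega> j \<le> walk \<omega> k)"
  unfolding Ball_def
  by (intro pred_intros_countable(1) pred_intros_imp' borel_measurable_pred_less measurable_pred_le walk_meas borel_measurable_const)+

lemma all_rev_iff: "(\<forall>k\<in>{1..n::nat}. P (n - k)) \<longleftrightarrow> (\<forall>i<n. P i)"
proof (intro iffI allI impI ballI)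
  fix i assume "\<forall>k\<in>{1..n}. P (n - k)" "i < n"
  thus "P i" using bspec[of "{1..n}" "\<lambda>k. P (n - k)" "n - i"] by auto
qed auto

lemma all_shift_iff: "k \<le> n \<Longrightarrow> (\<forall>j. k \<le> j \<and> j \<le> n \<longrightarrow> P j) \<longleftrightarrow> (\<forall>m\<le>n - k. P (k + m :: nat))"
proof (intro iffI allI impI)
  fix j assume a: "\<forall>m\<le>n - k. P (k + m)" "k \<le> j \<and> j \<le> n"
  have "P (k + (j - k))" using a by (intro a(1)[rule_format]) auto
  thus "P j" using a by simp
qed auto

lemma stay_neg_rev: "(\<integral>\<omega>. (if \<forall>i<n. walk \<omega> n < walk \<omega> i then 1 else (0::real)) \<partial>S) = stay_neg n"
proof -
  have e: "(\<forall>k\<in>{1..n}. walk (\<lambda>i. \<omega> (rev_index n i)) k < 0) \<longleftrightarrow> (\<forall>i<n. walk \<omega> n < walk \<omega> i)" for \<omega>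
    using all_rev_iff[of n "\<lambda>i. walk \<omega> n < walk \<omega> i"] by (auto simp: walk_rev)
  have "(\<integral>\<omega>. (if \<forall>k\<in>{1..n}. walk (\<lambda>i. \<omega> (rev_index n i)) k < 0 then 1 else (0::real)) \<partial>S) = stay_neg n"
    unfolding stay_neg_def by (rule E_rev) measurable
  thus ?thesis unfolding e .
qed

lemma stay_neg_nonneg: "0 \<le> stay_neg n" unfolding stay_neg_def by (rule integral_nonneg_AE) simp
lemma stay_neg_mono: "k \<le> n \<Longrightarrow> stay_neg n \<le> stay_neg k"
  unfolding stay_neg_def
proof (rule integral_mono)
  fix \<omega> assume "k \<le> n"
  hence "(\<forall>k\<in>{1..n}. walk \<omega> k < 0) \<Longrightarrow> (\<forall>j\<in>{1..k}. walk \<omega> j < 0)" by force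
  thus "(if \<forall>k\<in>{1..n}. walk \<omega> k < 0 then 1 else 0) \<le> (if \<forall>k\<in>{1..k}. walk \<omega> k < 0 then 1 else (0::real))" by (simp only: if_True if_False split: if_split) simp
qed (rule integrable_if; simp)+

text \<open>Decomposition at the first time the minimum over the whole interval is attained: before
  it, reversal gives a walk staying negative; after it, a walk staying nonnegative. The inequality
  rests only on disjointness of these events.\<close>

lemma sum_stay_neg_survive: "(\<Sum>k\<le>n. stay_neg k * survive 0 (n - k)) \<le> 1"
proof -
  define E where "E k \<omega> \<longleftrightarrow> (\<forall>i<k. walk \<omega> k < walk \<omega> i) \<and> (\<forall>j. k \<le> j \<and> j \<le> n \<longrightarrow> walk \<omega> k \<le> walk \<omega> j)" for k \<omega>
  have [measurable]: "Measurable.pred S (E k)" for k unfolding E_def by (intro pred_intros_logic pred_ball_walk)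
  have iE: "integrable S (\<lambda>\<omega>. if E k \<omega> then 1 else (0::real))" for k by (rule integrable_if) auto
  have e: "(\<integral>\<omega>. (if E k \<omega> then 1 else 0) \<partial>S) = stay_neg k * survive 0 (n - k)" if k: "k \<le> n" for k
    unfolding stay_neg_rev[symmetric] survive_def
  proof (rule E_product[OF iE, of k k])
    fix \<omega> \<omega>'
    have 1: "(\<forall>i<k. walk (comb_seq k \<omega> \<omega>') k < walk (comb_seq k \<omega> \<omega>') i) \<longleftrightarrow> (\<forall>i<k. walk \<omega> k < walk \<omega> i)"
      by (auto simp: walk_comb_left)
    have 2: "(\<forall>j. k \<le> j \<and> j \<le> n \<longrightarrow> walk (comb_seq k \<omega> \<omega>') k \<le> walk (comb_seq k \<omega> \<omega>') j) \<longleftrightarrow> - 0 \<le> wmin \<omega>' (n - k)"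
    proof -
      have "(\<forall>j. k \<le> j \<and> j \<le> n \<longrightarrow> walk (comb_seq k \<omega> \<omega>') k \<le> walk (comb_seq k \<omega> \<omega>') j) \<longleftrightarrow> (\<forall>m\<le>n - k. walk (comb_seq k \<omega> \<omega>') k \<le> walk (comb_seq k \<omega> \<omega>') (k + m))"
        by (rule all_shift_iff[OF k])
      thus ?thesis by (simp add: walk_comb walk_comb_left wmin_ge_iff)
    qed
    show "(if E k (comb_seq k \<omega> \<omega>') then 1 else 0) = (if \<forall>i<k. walk \<omega> k < walk \<omega> i then 1 else 0) * (if - 0 \<le> wmin \<omega>' (n - k) then 1 else (0::real))"
      unfolding E_def 1 2 by simp
  qed
  have "(\<Sum>k\<le>n. stay_neg k * survive 0 (n - k)) = (\<Sum>k\<le>n. \<integral>\<omega>. (if E k \<omega> then 1 else 0) \<partial>S)" using e by simp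
  also have "\<dots> = (\<integral>\<omega>. (\<Sum>k\<le>n. if E k \<omega> then 1 else 0) \<partial>S)" by (rule Bochner_Integration.integral_sum[symmetric]) (rule iE)
  also have "\<dots> \<le> (\<integral>\<omega>. 1 \<partial>S)"
  proof (rule integral_mono)
    fix \<omega>
    have uniq: "k = k'" if "E k \<omega>" "E k' \<omega>" "k \<le> n" "k' \<le> n" for k k'
    proof (rule ccontr)
      assume "k \<noteq> k'"
      then consider "k < k'" | "k' < k" by linarith
      thus False using that unfolding E_def by cases (meson leD less_imp_le order_refl)+
    qed
    show "(\<Sum>k\<le>n. if E k \<omega> then 1 else 0) \<le> (1::real)"
    proof (cases "\<exists>k\<le>n. E k \<omega>")
      case True
      then obtain k0 where k0: "k0 \<le> n" "E k0 \<omega>" by blast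
      have "(\<Sum>k\<le>n. if E k \<omega> then 1 else 0) = (\<Sum>k\<le>n. if k = k0 then 1 else (0::real))"
        using uniq k0 by (intro sum.cong) auto
      thus ?thesis using k0 by simp
    next
      case False
      hence "(\<Sum>k\<le>n. if E k \<omega> then 1 else (0::real)) = 0" by (intro sum.neutral) auto
      thus ?thesis by simp
    qed
  qed (auto intro!: Bochner_Integration.integrable_sum iE)
  finally show ?thesis by (simp add: P.prob_space)
qed

text \<open>By monotonicity \<open>stay_neg n\<close> may be pulled out of the record decomposition,
  and what remains is a sum of survival probabilities, which is at least of order sqrt n.\<close>

lemma stay_neg_upper: "\<exists>C>0. \<forall>n\<ge>1. stay_neg n \<le> C / sqrt (real n)"
proof -
  obtain c where c: "c > 0" "\<And>n. n \<ge> 1 \<Longrightarrow> c / sqrt (real n) \<le> survive 0 n" using survive_lower by blast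
  have "stay_neg n \<le> (1 / c) / sqrt (real n)" if n: "n \<ge> 1" for n
  proof -
    have "(\<Sum>k=1..n. c / sqrt (real n)) = c * (real n / sqrt (real n))" by simp
    also have "real n / sqrt (real n) = sqrt (real n)" by (simp add: real_div_sqrt)
    finally have "stay_neg n * (c * sqrt (real n)) = stay_neg n * (\<Sum>k=1..n. c / sqrt (real n))" by simp
    also have "\<dots> \<le> stay_neg n * (\<Sum>k=1..n. survive 0 k)"
    proof (intro mult_left_mono sum_mono stay_neg_nonneg)
      fix k assume k: "k \<in> {1..n}"
      have "c / sqrt (real n) \<le> c / sqrt (real k)" using k c by (intro divide_left_mono) auto
      also have "\<dots> \<le> survive 0 k" using c(2)[of k] k by simp
      finally show "c / sqrt (real n) \<le> survive 0 k" .
    qed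
    also have "(\<Sum>k=1..n. survive 0 k) \<le> (\<Sum>k\<le>n. survive 0 k)" by (rule sum_mono2) (auto simp: survive_nonneg)
    also have "(\<Sum>k\<le>n. survive 0 k) = (\<Sum>k\<le>n. survive 0 (n - k))"
      by (rule sum.reindex_bij_witness[where i = "\<lambda>k. n - k" and j = "\<lambda>k. n - k"]) auto
    also have "stay_neg n * (\<Sum>k\<le>n. survive 0 (n - k)) \<le> (\<Sum>k\<le>n. stay_neg k * survive 0 (n - k))" unfolding sum_distrib_left
      by (intro sum_mono mult_right_mono stay_neg_mono survive_nonneg) auto
    also have "\<dots> \<le> 1" by (rule sum_stay_neg_survive)
    finally have "stay_neg n * (c * sqrt (real n)) \<le> 1" using stay_neg_nonneg[of n] by (simp add: mult_left_mono)
    hence "stay_neg n \<le> 1 / (c * sqrt (real n))" using c(1) n by (subst pos_le_divide_eq) auto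
    thus ?thesis by simp
  qed
  thus ?thesis using c(1) by (intro exI[of _ "1 / c"]) auto
qed

definition stay_nonpos :: "nat \<Rightarrow> real" where "stay_nonpos n = (\<integral>\<omega>. (if wmax \<omega> n \<le> 0 then 1 else 0) \<partial>S)"

lemma stay_nonpos_nonneg: "0 \<le> stay_nonpos n" unfolding stay_nonpos_def by (rule integral_nonneg_AE) simp

lemma x_neg_prob: "(\<integral>q. (if x q < 0 then 1 else 0) \<partial>D) > (0::real)"
proof -
  have i: "integrable D (\<lambda>q. (if x q < 0 then 1 else 0::real))" by (rule M.integrable_const_bound[where B = 1]) auto
  have "(\<integral>q. (if x q < 0 then 1 else 0) \<partial>D) \<noteq> (0::real)"
  proof
    assume 0: "(\<integral>q. (if x q < 0 then 1 else 0) \<partial>D) = (0::real)"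
    hence "AE q in D. (if x q < 0 then 1 else 0) = (0::real)" using integral_nonneg_eq_0_iff_AE[OF i] by simp
    hence ae: "AE q in D. 0 \<le> x q" by eventually_elim (auto split: if_splits)
    hence "AE q in D. x q = 0" using integral_nonneg_eq_0_iff_AE[OF x_int ae] x_mean by simp
    hence "AE q in D. max 0 (x q) = 0" by eventually_elim simp
    hence "(\<integral>q. max 0 (x q) \<partial>D) = (\<integral>q. 0 \<partial>D)" by (intro integral_cong_AE) auto
    thus False using x_pos_part by simp
  qed
  moreover have "(\<integral>q. (if x q < 0 then 1 else 0) \<partial>D) \<ge> (0::real)" by (rule integral_nonneg_AE) simp
  ultimately show ?thesis by linarith
qed

text \<open>A strictly negative first step, followed by a path that never exceeds its position at
  time 1, stays strictly negative. This passes from the strict to the weak condition at the cost of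
  the constant \<open>p\<close> and one time step.\<close>

lemma stay_nonpos_upper: "\<exists>C>0. \<forall>n. stay_nonpos n \<le> C / sqrt (real (Suc n))"
proof -
  obtain C where C: "C > 0" "\<And>n. n \<ge> 1 \<Longrightarrow> stay_neg n \<le> C / sqrt (real n)" using stay_neg_upper by blast
  define p where "p = (\<integral>q. (if x q < 0 then 1 else 0) \<partial>D :: real)"
  have p: "p > 0" unfolding p_def by (rule x_neg_prob)
  have "stay_nonpos n \<le> (C / p) / sqrt (real (Suc n))" for n
  proof -
    define A where "A \<omega> \<longleftrightarrow> x (\<omega> 0) < 0 \<and> (\<forall>k. 1 \<le> k \<and> k \<le> Suc n \<longrightarrow> walk \<omega> k - walk \<omega> 1 \<le> 0)" for \<omega>
    have [measurable]: "Measurable.pred S A" unfolding A_def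
    proof (rule pred_intros_logic)
      show "Measurable.pred S (\<lambda>\<omega>. x (\<omega> 0) < 0)" by measurable
      show "Measurable.pred S (\<lambda>\<omega>. \<forall>k. 1 \<le> k \<and> k \<le> Suc n \<longrightarrow> walk \<omega> k - walk \<omega> 1 \<le> 0)"
        by (intro pred_intros_countable(1) pred_intros_imp' measurable_pred_le borel_measurable_diff walk_meas borel_measurable_const)
    qed
    have "(\<integral>\<omega>. (if A \<omega> then 1 else 0) \<partial>S) = (\<integral>\<omega>. (if x (\<omega> 0) < 0 then 1 else 0) \<partial>S) * stay_nonpos n"
      unfolding stay_nonpos_def
    proof (rule E_product[of _ 1])
      fix \<omega> \<omega>'
      have 1: "(\<forall>k. 1 \<le> k \<and> k \<le> Suc n \<longrightarrow> walk (comb_seq 1 \<omega> \<omega>') k - walk (comb_seq 1 \<omega> \<omega>') 1 \<le> 0) \<longleftrightarrow> wmax \<omega>' n \<le> 0"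
      proof -
        have "(\<forall>k. 1 \<le> k \<and> k \<le> Suc n \<longrightarrow> walk (comb_seq 1 \<omega> \<omega>') k - walk (comb_seq 1 \<omega> \<omega>') 1 \<le> 0) \<longleftrightarrow> (\<forall>m\<le>n. walk (comb_seq 1 \<omega> \<omega>') (1 + m) - walk (comb_seq 1 \<omega> \<omega>') 1 \<le> 0)"
          using all_shift_iff[of 1 "Suc n" "\<lambda>k. walk (comb_seq 1 \<omega> \<omega>') k - walk (comb_seq 1 \<omega> \<omega>') 1 \<le> 0"] by simp
        thus ?thesis unfolding walk_comb walk_comb_left[OF order_refl] wmax_le_iff by simp
      qed
      show "(if A (comb_seq 1 \<omega> \<omega>') then 1 else 0) = (if x (\<omega> 0) < 0 then 1 else 0) * (if wmax \<omega>' n \<le> 0 then 1 else (0::real))"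
        unfolding A_def 1 by (simp add: comb_seq_def)
    qed (rule integrable_if; simp)
    also have "(\<integral>\<omega>. (if x (\<omega> 0) < 0 then 1 else 0) \<partial>S) = p" unfolding p_def using E_coord(1)[of "\<lambda>q. (if x q < 0 then 1 else (0::real))" 0] by simp
    finally have "p * stay_nonpos n = (\<integral>\<omega>. (if A \<omega> then 1 else 0) \<partial>S)" by simp
    also have "\<dots> \<le> stay_neg (Suc n)" unfolding stay_neg_def
    proof (rule integral_mono)
      fix \<omega>
      have "\<forall>k\<in>{1..Suc n}. walk \<omega> k < 0" if "A \<omega>"
      proof
        fix k assume "k \<in> {1..Suc n}"
        hence "walk \<omega> k - walk \<omega> 1 \<le> 0" using that by (auto simp: A_def)
        moreover have "walk \<omega> 1 < 0" using that by (simp add: A_def walk_Suc)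
        ultimately show "walk \<omega> k < 0" by simp
      qed
      thus "(if A \<omega> then 1 else 0) \<le> (if \<forall>k\<in>{1..Suc n}. walk \<omega> k < 0 then 1 else (0::real))" by auto
    qed (rule integrable_if; simp)+
    also have "\<dots> \<le> C / sqrt (real (Suc n))" by (rule C(2)) simp
    finally have "stay_nonpos n \<le> C / sqrt (real (Suc n)) / p" by (simp only: pos_le_divide_eq[OF p] mult.commute)
    thus ?thesis by (simp add: mult.commute)
  qed
  thus ?thesis using C p by (intro exI[of _ "C / p"]) auto
qed

definition wmax_mgf :: "real \<Rightarrow> nat \<Rightarrow> real" where "wmax_mgf \<beta> n = (\<integral>\<omega>. exp (- (\<beta> * wmax \<omega> n)) \<partial>S)"

text \<open>Decomposition at the first time k of the maximum. The part before k, reversed, is a walk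
  staying positive, for which L = 0, so its weight is dominated by
  \<open>wmin_mgf 1 \<beta> k\<close>, of order k^(-3/2). The part after k never rises above its
  start and contributes (n - k + 1)^(-1/2).\<close>

lemma wmax_mgf_upper:
  assumes b: "\<beta> > 0"
  shows "\<exists>C>0. \<forall>n\<ge>1. wmax_mgf \<beta> n \<le> C / sqrt (real n)"
proof -
  obtain G where G: "G > 0" "\<And>m. stay_nonpos m \<le> G / sqrt (real (Suc m))" using stay_nonpos_upper by blast
  note wmin_mgf = wmin_mgf_asymp[OF zero_less_one b]
  obtain B where B: "B > 0" "\<And>n. n \<ge> 1 \<Longrightarrow> wmin_mgf 1 \<beta> n \<le> B / (real n * sqrt (real n))" using wmin_mgf(3) by blast
  have bn: "0 \<le> wmin_mgf 1 \<beta> k" for k unfolding wmin_mgf_def by (rule integral_nonneg_AE) simp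
  obtain C where C: "C > 0" "\<And>n. n \<ge> 1 \<Longrightarrow> (\<Sum>k\<le>n. wmin_mgf 1 \<beta> k * stay_nonpos (n - k)) \<le> C / sqrt (real n)"
    using sum_conv_bound[of "wmin_mgf 1 \<beta>" B stay_nonpos G, OF bn wmin_mgf(1) B(2) less_imp_le[OF B(1)] stay_nonpos_nonneg G(2) less_imp_le[OF G(1)]] by blast
  have "wmax_mgf \<beta> n \<le> (\<Sum>k\<le>n. wmin_mgf 1 \<beta> k * stay_nonpos (n - k))" for n
  proof -
    define E where "E k \<omega> \<longleftrightarrow> (\<forall>i<k. walk \<omega> i < walk \<omega> k) \<and> (\<forall>j. k \<le> j \<and> j \<le> n \<longrightarrow> walk \<omega> j \<le> walk \<omega> k)" for k \<omega>
    have [measurable]: "Measurable.pred S (E k)" for k unfolding E_def by (intro pred_intros_logic pred_ball_walk)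
    have iE: "integrable S (\<lambda>\<omega>. if E k \<omega> then exp (- (\<beta> * walk \<omega> k)) else 0)" for k
    proof (rule integrable_bounded[where B = 1])
      fix \<omega>
      have "walk \<omega> k \<ge> 0" if "E k \<omega>"
        using that unfolding E_def by (cases k) (auto dest: spec[of _ 0] intro: less_imp_le)
      thus "norm (if E k \<omega> then exp (- (\<beta> * walk \<omega> k)) else 0) \<le> 1" using b by auto
    qed measurable
    define rr where "rr k = (\<integral>\<omega>. (if \<forall>i<k. walk \<omega> i < walk \<omega> k then exp (- (\<beta> * walk \<omega> k)) else 0) \<partial>S)" for k
    have e: "(\<integral>\<omega>. (if E k \<omega> then exp (- (\<beta> * walk \<omega> k)) else 0) \<partial>S) = rr k * stay_nonpos (n - k)" if k: "k \<le> n" for k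
      unfolding rr_def stay_nonpos_def
    proof (rule E_product[OF iE, of k k])
      fix \<omega> \<omega>'
      have 1: "(\<forall>i<k. walk (comb_seq k \<omega> \<omega>') i < walk (comb_seq k \<omega> \<omega>') k) \<longleftrightarrow> (\<forall>i<k. walk \<omega> i < walk \<omega> k)"
        by (auto simp: walk_comb_left)
      have 2: "(\<forall>j. k \<le> j \<and> j \<le> n \<longrightarrow> walk (comb_seq k \<omega> \<omega>') j \<le> walk (comb_seq k \<omega> \<omega>') k) \<longleftrightarrow> wmax \<omega>' (n - k) \<le> 0"
      proof -
        have "(\<forall>j. k \<le> j \<and> j \<le> n \<longrightarrow> walk (comb_seq k \<omega> \<omega>') j \<le> walk (comb_seq k \<omega> \<omega>') k) \<longleftrightarrow> (\<forall>m\<le>n - k. walk (comb_seq k \<omega> \<omega>') (k + m) \<le> walk (comb_seq k \<omega> \<omega>') k)"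
          by (rule all_shift_iff[OF k])
        thus ?thesis by (simp add: walk_comb walk_comb_left wmax_le_iff)
      qed
      show "(if E k (comb_seq k \<omega> \<omega>') then exp (- (\<beta> * walk (comb_seq k \<omega> \<omega>') k)) else 0) = (if \<forall>i<k. walk \<omega> i < walk \<omega> k then exp (- (\<beta> * walk \<omega> k)) else 0) * (if wmax \<omega>' (n - k) \<le> 0 then 1 else (0::real))"
        unfolding E_def 1 2 by (simp add: walk_comb_left)
    qed
    have rr_le: "rr k \<le> wmin_mgf 1 \<beta> k" for k
    proof -
      define F where "F \<omega> = (if \<forall>j\<in>{1..k}. walk \<omega> j > 0 then exp (- (\<beta> * walk \<omega> k)) else 0)" for \<omega>
      have [measurable]: "F \<in> borel_measurable S" unfolding F_def by measurable
      have e2: "walk (\<lambda>i. \<omega> (rev_index k i)) k = walk \<omega> k" for \<omega> using walk_rev[of k k \<omega>] by simp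
      have e1: "(\<forall>j\<in>{1..k}. walk (\<lambda>i. \<omega> (rev_index k i)) j > 0) \<longleftrightarrow> (\<forall>i<k. walk \<omega> i < walk \<omega> k)" for \<omega>
        using all_rev_iff[of k "\<lambda>i. walk \<omega> i < walk \<omega> k"] by (auto simp: walk_rev)
      have "rr k = (\<integral>\<omega>. F (\<lambda>i. \<omega> (rev_index k i)) \<partial>S)" unfolding rr_def F_def e1 e2 ..
      also have "\<dots> = (\<integral>\<omega>. F \<omega> \<partial>S)" by (rule E_rev) measurable
      also have "\<dots> \<le> wmin_mgf 1 \<beta> k" unfolding wmin_mgf_def
      proof (rule integral_mono')
        show "integrable S (\<lambda>\<omega>. exp (1 * wmin \<omega> k - \<beta> * (walk \<omega> k - wmin \<omega> k)))" by (rule integrable_wmin_mgf) (use b in auto)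
        fix \<omega>
        have "wmin \<omega> k = 0" if "\<forall>j\<in>{1..k}. walk \<omega> j > 0"
        proof (rule antisym[OF wmin_nonpos])
          show "0 \<le> wmin \<omega> k" unfolding wmin_ge_iff
          proof (intro allI impI)
            fix j assume "j \<le> k" thus "0 \<le> walk \<omega> j" using that by (cases "j = 0") (auto intro: less_imp_le)
          qed
        qed
        thus "F \<omega> \<le> exp (1 * wmin \<omega> k - \<beta> * (walk \<omega> k - wmin \<omega> k))" unfolding F_def by auto
      qed simp
      finally show ?thesis .
    qed
    have "wmax_mgf \<beta> n \<le> (\<integral>\<omega>. (\<Sum>k\<le>n. if E k \<omega> then exp (- (\<beta> * walk \<omega> k)) else 0) \<partial>S)"
      unfolding wmax_mgf_def
    proof (rule integral_mono')
      show "integrable S (\<lambda>\<omega>. \<Sum>k\<le>n. if E k \<omega> then exp (- (\<beta> * walk \<omega> k)) else 0)" by (intro Bochner_Integration.integrable_sum iE)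
      fix \<omega>
      have ex: "\<exists>k. k \<le> n \<and> walk \<omega> k = wmax \<omega> n"
      proof -
        have "wmax \<omega> n \<in> pS (\<lambda>i. x (\<omega> i)) ` {..n}" unfolding wmax_def pM_def by (rule Max_in) auto
        thus ?thesis by (auto simp: walk_def)
      qed
      define k where "k = (LEAST k. k \<le> n \<and> walk \<omega> k = wmax \<omega> n)"
      have k: "k \<le> n" "walk \<omega> k = wmax \<omega> n" using LeastI_ex[OF ex] unfolding k_def by auto
      have le: "walk \<omega> j \<le> wmax \<omega> n" if "j \<le> n" for j using wmax_le_iff[of \<omega> n "wmax \<omega> n"] that by simp
      have "E k \<omega>" unfolding E_def
      proof (intro conjI allI impI)
        fix i assume i: "i < k"
        have "walk \<omega> i \<noteq> wmax \<omega> n" using not_less_Least[of i "\<lambda>k. k \<le> n \<and> walk \<omega> k = wmax \<omega> n"] i k unfolding k_def[symmetric] by auto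
        thus "walk \<omega> i < walk \<omega> k" using le[of i] i k by auto
      qed (use le k in auto)
      hence "exp (- (\<beta> * wmax \<omega> n)) = (if E k \<omega> then exp (- (\<beta> * walk \<omega> k)) else 0)" using k by simp
      also have "\<dots> \<le> (\<Sum>k\<le>n. if E k \<omega> then exp (- (\<beta> * walk \<omega> k)) else 0)"
        by (rule member_le_sum) (use k in auto)
      finally show "exp (- (\<beta> * wmax \<omega> n)) \<le> (\<Sum>k\<le>n. if E k \<omega> then exp (- (\<beta> * walk \<omega> k)) else 0)" .
    qed (auto intro: sum_nonneg)
    also have "\<dots> = (\<Sum>k\<le>n. \<integral>\<omega>. (if E k \<omega> then exp (- (\<beta> * walk \<omega> k)) else 0) \<partial>S)" by (rule Bochner_Integration.integral_sum) (rule iE)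
    also have "\<dots> = (\<Sum>k\<le>n. rr k * stay_nonpos (n - k))" using e by simp
    also have "\<dots> \<le> (\<Sum>k\<le>n. wmin_mgf 1 \<beta> k * stay_nonpos (n - k))" by (intro sum_mono mult_right_mono rr_le stay_nonpos_nonneg)
    finally show ?thesis .
  qed
  thus ?thesis using C by (meson order_trans)
qed

text \<open>Slice according to the depth of the minimum below -z in unit layers. Survival above the
  lower edge of layer i has probability at most of order (1 + z)(2 + i) / sqrt p, and the
  exponential weight makes the sum over i converge. Depths beyond p are collected in one
  term.\<close>

lemma first_factor:
  "\<exists>C>0. \<forall>p\<ge>1. \<forall>z\<ge>0. (\<integral>\<omega>. exp (min 0 (z + wmin \<omega> p) / 2) \<partial>S) \<le> C * (1 + z) / sqrt (real p)"
proof -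
  obtain C where C: "C > 0" "\<And>n z. n \<ge> 1 \<Longrightarrow> z \<ge> 0 \<Longrightarrow> survive z n \<le> C * (1 + z) / sqrt (real n)" using survive_upper by blast
  \<comment> \<open>Half of the weight exp (-i/2) is spent on absorbing the linear growth, through 2
    + i <= 8 exp (i/4); the other half is \<open>r\<close> to the power i.\<close>
  define r where "r = exp (- (1/4 :: real))"
  have r: "0 < r" "r < 1" by (auto simp: r_def)
  define K where "K = C * (8 / (1 - r)) + 1"
  have K: "K > 0" unfolding K_def using C r by (intro add_nonneg_pos) auto
  have "(\<integral>\<omega>. exp (min 0 (z + wmin \<omega> p) / 2) \<partial>S) \<le> K * (1 + z) / sqrt (real p)" if p: "p \<ge> 1" and z: "z \<ge> 0" for p z
  proof -
    have i1: "integrable S (\<lambda>\<omega>. (if - (z + real i + 1) \<le> wmin \<omega> p then 1 else (0::real)))" for i by (rule integrable_if) auto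
    have "(\<integral>\<omega>. exp (min 0 (z + wmin \<omega> p) / 2) \<partial>S) \<le> (\<integral>\<omega>. (\<Sum>i<p. exp (- (real i / 2)) * (if - (z + real i + 1) \<le> wmin \<omega> p then 1 else 0)) + exp (- (real p / 2)) \<partial>S)"
    proof (rule integral_mono')
      show "integrable S (\<lambda>\<omega>. (\<Sum>i<p. exp (- (real i / 2)) * (if - (z + real i + 1) \<le> wmin \<omega> p then 1 else 0)) + exp (- (real p / 2)))"
        by (intro Bochner_Integration.integrable_add Bochner_Integration.integrable_sum integrable_mult_right i1) auto
      fix \<omega>
      define w where "w = z + wmin \<omega> p"
      define i where "i = nat \<lfloor>max 0 (- w)\<rfloor>"
      have i: "real i \<le> max 0 (- w)" "max 0 (- w) < real i + 1" unfolding i_def by linarith+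
      have nn: "0 \<le> (\<Sum>i<p. exp (- (real i / 2)) * (if - (z + real i + 1) \<le> wmin \<omega> p then 1 else 0))" by (intro sum_nonneg) auto
      have me: "min 0 w / 2 \<le> - (real i / 2)" using i(1) by (auto simp: min_def max_def split: if_splits)
      show "exp (min 0 (z + wmin \<omega> p) / 2) \<le> (\<Sum>i<p. exp (- (real i / 2)) * (if - (z + real i + 1) \<le> wmin \<omega> p then 1 else 0)) + exp (- (real p / 2))"
      proof (cases "i < p")
        case True
        have "- (z + real i + 1) \<le> wmin \<omega> p" using i(2) unfolding w_def by linarith
        hence "exp (min 0 w / 2) \<le> exp (- (real i / 2)) * (if - (z + real i + 1) \<le> wmin \<omega> p then 1 else 0)" using me by simp
        also have "\<dots> \<le> (\<Sum>i<p. exp (- (real i / 2)) * (if - (z + real i + 1) \<le> wmin \<omega> p then 1 else 0))"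
          by (rule member_le_sum) (use True in auto)
        also have "\<dots> \<le> \<dots> + exp (- (real p / 2))" by simp
        finally show ?thesis by (simp add: w_def)
      next
        case False
        hence "exp (min 0 w / 2) \<le> exp (- (real p / 2))" using me by simp
        thus ?thesis using nn unfolding w_def by linarith
      qed
    qed (auto intro!: add_nonneg_nonneg sum_nonneg)
    also have "\<dots> = (\<Sum>i<p. exp (- (real i / 2)) * survive (z + real i + 1) p) + exp (- (real p / 2))"
      using i1 by (simp add: survive_def P.prob_space)
    also have "(\<Sum>i<p. exp (- (real i / 2)) * survive (z + real i + 1) p) \<le> (\<Sum>i<p. C * (1 + z) / sqrt (real p) * (8 * r ^ i))"
    proof (rule sum_mono)
      fix i
      have e: "exp (- (real i / 2)) * (2 + real i) \<le> 8 * r ^ i"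
      proof -
        have "2 + real i \<le> 8 * (1 + real i / 4)" by simp
        also have "\<dots> \<le> 8 * exp (real i / 4)" by (intro mult_left_mono exp_ge_add_one_self) auto
        finally have "exp (- (real i / 2)) * (2 + real i) \<le> exp (- (real i / 2)) * (8 * exp (real i / 4))" by (intro mult_left_mono) auto
        also have "\<dots> = 8 * exp (- (real i / 2) + real i / 4)" unfolding exp_add by simp
        also have "- (real i / 2) + real i / 4 = real i * (- (1/4))" by simp
        also have "exp (real i * (- (1/4))) = r ^ i" unfolding r_def by (rule exp_of_nat_mult)
        finally show ?thesis .
      qed
      have "survive (z + real i + 1) p \<le> C * (1 + (z + real i + 1)) / sqrt (real p)" using C(2)[of p "z + real i + 1"] p z by simp
      also have "\<dots> \<le> C * ((1 + z) * (2 + real i)) / sqrt (real p)"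
        using C z by (intro divide_right_mono mult_left_mono) (auto simp: algebra_simps)
      finally have "exp (- (real i / 2)) * survive (z + real i + 1) p \<le> exp (- (real i / 2)) * (C * ((1 + z) * (2 + real i)) / sqrt (real p))" by (intro mult_left_mono) auto
      also have "\<dots> = C * (1 + z) / sqrt (real p) * (exp (- (real i / 2)) * (2 + real i))" by simp
      also have "\<dots> \<le> C * (1 + z) / sqrt (real p) * (8 * r ^ i)" using C z by (intro mult_left_mono e) auto
      finally show "exp (- (real i / 2)) * survive (z + real i + 1) p \<le> C * (1 + z) / sqrt (real p) * (8 * r ^ i)" .
    qed
    also have "(\<Sum>i<p. C * (1 + z) / sqrt (real p) * (8 * r ^ i)) = C * (1 + z) / sqrt (real p) * (8 * (\<Sum>i<p. r ^ i))" by (simp only: sum_distrib_left)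
    also have "\<dots> \<le> C * (1 + z) / sqrt (real p) * (8 * (1 / (1 - r)))"
    proof (intro mult_left_mono)
      show "(\<Sum>i<p. r ^ i) \<le> 1 / (1 - r)" using r by (simp add: sum_gp_strict divide_right_mono)
    qed (use C z in auto)
    also have "exp (- (real p / 2)) \<le> (1 + z) / sqrt (real p)"
    proof -
      have "1 + real p \<le> exp (real p)" by (rule exp_ge_add_one_self)
      hence "real p \<le> exp (real p)" by linarith
      hence "real p \<le> exp (real p / 2) ^ 2" by (simp add: power2_eq_square exp_add[symmetric])
      hence "sqrt (real p) \<le> exp (real p / 2)" by (intro real_le_lsqrt) auto
      hence "exp (- (real p / 2)) \<le> 1 / sqrt (real p)" using p by (simp add: exp_minus field_simps)
      also have "\<dots> \<le> (1 + z) / sqrt (real p)" using z by (intro divide_right_mono) auto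
      finally show ?thesis .
    qed
    finally show ?thesis unfolding K_def by (simp add: algebra_simps add_divide_distrib)
  qed
  thus ?thesis using K by blast
qed

lemma min_bound_le_1: "exp (3/2 * min 0 (s + wmin \<omega> q) - (s + walk \<omega> q)) \<le> 1"
proof -
  have "3/2 * min 0 (s + wmin \<omega> q) \<le> s + walk \<omega> q" using wmin_le_walk[of \<omega> q] by (auto simp: min_def)
  thus ?thesis by simp
qed

text \<open>After reversal the minimum becomes y minus the maximum, where y = s + S_q is the end
  level, and the integrand is at most exp (-(max + |y|) / 2). Restricting the maximum to the first
  \<open>q1\<close> steps gives one factor by \<open>wmax_mgf_upper\<close>; the remaining
  \<open>q2\<close> steps give the other by the local bound, uniformly in the level reached.\<close>

lemma second_factor:
  "\<exists>C>0. \<forall>q1\<ge>1. \<forall>q2\<ge>1. \<forall>s. (\<integral>\<omega>. exp (3/2 * min 0 (s + wmin \<omega> (q1 + q2)) - (s + walk \<omega> (q1 + q2))) \<partial>S) \<le> C / (sqrt (real q1) * sqrt (real q2))"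
proof -
  obtain C where C: "C > 0" "\<And>n. n \<ge> 1 \<Longrightarrow> wmax_mgf (1/2) n \<le> C / sqrt (real n)" using wmax_mgf_upper[of "1/2"] by auto
  obtain C' where C': "C' > 0" "\<And>n s. n \<ge> 1 \<Longrightarrow> (\<integral>\<omega>. exp (- (1/2 * \<bar>s + walk \<omega> n\<bar>)) \<partial>S) \<le> C' / sqrt (real n)" using local_bound[of "1/2"] by auto
  have "(\<integral>\<omega>. exp (3/2 * min 0 (s + wmin \<omega> (q1 + q2)) - (s + walk \<omega> (q1 + q2))) \<partial>S) \<le> C * C' / (sqrt (real q1) * sqrt (real q2))"
    if q: "q1 \<ge> 1" "q2 \<ge> 1" for q1 q2 s
  proof -
    define q where "q = q1 + q2"
    define F where "F \<omega> = exp (3/2 * min 0 (s + wmin \<omega> q) - (s + walk \<omega> q))" for \<omega>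
    have [measurable]: "F \<in> borel_measurable S" unfolding F_def by measurable
    have im: "integrable S (\<lambda>\<omega>. exp (- (1/2 * wmax \<omega> q1)))" by (rule integrable_bounded[where B = 1]) (use wmax_nonneg in auto)
    have i2: "integrable S (\<lambda>\<omega>. exp (- (1/2 * (wmax \<omega> q1 + \<bar>s + walk \<omega> q\<bar>))))"
      by (rule integrable_bounded[where B = 1]) (use wmax_nonneg in \<open>auto intro: add_nonneg_nonneg\<close>)
    have "(\<integral>\<omega>. F \<omega> \<partial>S) = (\<integral>\<omega>. F (\<lambda>i. \<omega> (rev_index q i)) \<partial>S)" by (rule E_rev[symmetric]) measurable
    also have "\<dots> \<le> (\<integral>\<omega>. exp (- (1/2 * (wmax \<omega> q1 + \<bar>s + walk \<omega> q\<bar>))) \<partial>S)"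
    proof (rule integral_mono'[OF i2])
      fix \<omega>
      define y where "y = s + walk \<omega> q"
      have m: "wmax \<omega> q1 \<le> wmax \<omega> q" unfolding q_def by (rule wmax_mono) simp
      have "F (\<lambda>i. \<omega> (rev_index q i)) = exp (3/2 * min 0 (y - wmax \<omega> q) - y)"
        unfolding F_def wmin_rev walk_rev[OF order_refl] y_def by (simp add: algebra_simps)
      also have "3/2 * min 0 (y - wmax \<omega> q) - y \<le> - (1/2 * (wmax \<omega> q + \<bar>y\<bar>))"
        using wmax_nonneg[of \<omega> q] by (auto simp: min_def abs_if field_simps)
      also have "\<dots> \<le> - (1/2 * (wmax \<omega> q1 + \<bar>y\<bar>))" using m by simp
      finally show "F (\<lambda>i. \<omega> (rev_index q i)) \<le> exp (- (1/2 * (wmax \<omega> q1 + \<bar>s + walk \<omega> q\<bar>)))" by (simp add: y_def)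
    qed simp
    also have "\<dots> \<le> (\<integral>\<omega>. exp (- (1/2 * wmax \<omega> q1)) * (C' / sqrt (real q2)) \<partial>S)"
    proof (rule E_split_le[OF i2, where k = q1])
      show "integrable S (\<lambda>\<omega>. exp (- (1/2 * wmax \<omega> q1)) * (C' / sqrt (real q2)))" using im by (intro integrable_mult_left)
      fix \<omega>
      have "exp (- (1/2 * (wmax (comb_seq q1 \<omega> \<omega>') q1 + \<bar>s + walk (comb_seq q1 \<omega> \<omega>') q\<bar>))) = exp (- (1/2 * wmax \<omega> q1)) * exp (- (1/2 * \<bar>(s + walk \<omega> q1) + walk \<omega>' q2\<bar>))" for \<omega>'
        unfolding q_def walk_comb wmax_comb_left[OF order_refl] exp_add[symmetric] by (simp add: algebra_simps)
      hence "(\<integral>\<omega>'. exp (- (1/2 * (wmax (comb_seq q1 \<omega> \<omega>') q1 + \<bar>s + walk (comb_seq q1 \<omega> \<omega>') q\<bar>))) \<partial>S) = exp (- (1/2 * wmax \<omega> q1)) * (\<integral>\<omega>'. exp (- (1/2 * \<bar>(s + walk \<omega> q1) + walk \<omega>' q2\<bar>)) \<partial>S)" by simp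
      also have "\<dots> \<le> exp (- (1/2 * wmax \<omega> q1)) * (C' / sqrt (real q2))" by (intro mult_left_mono C'(2) q) auto
      finally show "(\<integral>\<omega>'. exp (- (1/2 * (wmax (comb_seq q1 \<omega> \<omega>') q1 + \<bar>s + walk (comb_seq q1 \<omega> \<omega>') q\<bar>))) \<partial>S) \<le> exp (- (1/2 * wmax \<omega> q1)) * (C' / sqrt (real q2))" .
    qed
    also have "\<dots> = wmax_mgf (1/2) q1 * (C' / sqrt (real q2))" by (simp add: wmax_mgf_def)
    also have "\<dots> \<le> C / sqrt (real q1) * (C' / sqrt (real q2))" using C(2)[OF q(1)] C' by (intro mult_right_mono) auto
    finally show ?thesis by (simp add: F_def q_def)
  qed
  thus ?thesis using C C' by (intro exI[of _ "C * C'"]) auto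
qed

text \<open>Soft killing for the walk started at z: a path may go below 0, but pays exp (-2 *
  depth), while the other factor keeps the end point low. The softness lets the weight be shared
  between consecutive pieces of a path.\<close>

definition killed_exp :: "nat \<Rightarrow> real \<Rightarrow> real" where
  "killed_exp n z = (\<integral>\<omega>. exp (2 * min 0 (z + wmin \<omega> n) - (z + walk \<omega> n)) \<partial>S)"

lemma killed_exp_integrand_le_1: "exp (2 * min 0 (z + wmin \<omega> n) - (z + walk \<omega> n)) \<le> 1"
proof -
  have "2 * min 0 (z + wmin \<omega> n) \<le> z + walk \<omega> n" using wmin_le_walk[of \<omega> n] by (auto simp: min_def)
  thus ?thesis by simp
qed

lemma integrable_killed_exp: "integrable S (\<lambda>\<omega>. exp (2 * min 0 (z + wmin \<omega> n) - (z + walk \<omega> n)))"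
  by (rule integrable_bounded[where B = 1]) (use killed_exp_integrand_le_1 in auto)

lemma killed_exp_le_1: "killed_exp n z \<le> 1"
proof -
  have "killed_exp n z \<le> (\<integral>\<omega>. 1 \<partial>S)" unfolding killed_exp_def by (rule integral_mono') (use killed_exp_integrand_le_1 in auto)
  thus ?thesis by (simp add: P.prob_space)
qed

text \<open>The path is cut into an initial, a middle and a reversed final piece; staying above the level costs a factor
  \<open>n powr (-1/2)\<close> at either end, and the local limit theorem gives a third one in the middle.\<close>
theorem killed_exp_upper: "\<exists>C>0. \<forall>n\<ge>1. \<forall>z\<ge>0. killed_exp n z \<le> C * (1 + z) / (real n * sqrt (real n))"
proof -
  obtain C where C: "C > 0" "\<And>p z. p \<ge> 1 \<Longrightarrow> z \<ge> 0 \<Longrightarrow> (\<integral>\<omega>. exp (min 0 (z + wmin \<omega> p) / 2) \<partial>S) \<le> C * (1 + z) / sqrt (real p)"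
    using first_factor by blast
  obtain C' where C': "C' > 0" "\<And>q1 q2 s. q1 \<ge> 1 \<Longrightarrow> q2 \<ge> 1 \<Longrightarrow> (\<integral>\<omega>. exp (3/2 * min 0 (s + wmin \<omega> (q1 + q2)) - (s + walk \<omega> (q1 + q2))) \<partial>S) \<le> C' / (sqrt (real q1) * sqrt (real q2))"
    using second_factor by blast
  define K where "K = max 8 (C * C' * (5 * sqrt 5))"
  have K: "K > 0" by (simp add: K_def less_max_iff_disj)
  have "killed_exp n z \<le> K * (1 + z) / (real n * sqrt (real n))" if n: "n \<ge> 1" and z: "z \<ge> 0" for n z
  proof (cases "n \<ge> 3")
    case False
    have "sqrt (real n) \<le> 2" using False by (intro real_le_lsqrt) auto
    hence "real n * sqrt (real n) \<le> 3 * 2" using False by (intro mult_mono) auto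
    also have "\<dots> \<le> K * 1" by (simp add: K_def)
    also have "\<dots> \<le> K * (1 + z)" using z K by (intro mult_left_mono) auto
    finally have "1 \<le> K * (1 + z) / (real n * sqrt (real n))" using n by (subst le_divide_eq) auto
    thus ?thesis using killed_exp_le_1[of n z] by linarith
  next
    case True
    \<comment> \<open>Both \<open>p\<close> and \<open>r\<close> are comparable to n once n >= 3;
      the extreme case n = 5, \<open>p\<close> = 1 explains the factor 5.\<close>
    define p where "p = n div 3"
    define r where "r = n - 2 * p"
    have p3: "3 * p \<le> n" "n < 3 * p + 3" using div_mult_mod_eq[of n 3] mod_less_divisor[of 3 n] unfolding p_def by linarith+
    have p1: "p \<ge> 1" using p3 True by linarith
    have r: "n = 2 * p + r" unfolding r_def using p3 by simp
    have p: "p \<ge> 1" "r \<ge> 1" "n = p + (p + r)" "n \<le> 5 * p" "n \<le> 5 * r" using p1 p3 r by linarith+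
    have i1: "integrable S (\<lambda>\<omega>. exp (min 0 (z + wmin \<omega> p) / 2))" by (rule integrable_bounded[where B = 1]) auto
    have "killed_exp n z \<le> (\<integral>\<omega>. exp (min 0 (z + wmin \<omega> p) / 2) * (C' / (sqrt (real p) * sqrt (real r))) \<partial>S)"
      unfolding killed_exp_def
    proof (rule E_split_le[OF integrable_killed_exp, where k = p])
      show "integrable S (\<lambda>\<omega>. exp (min 0 (z + wmin \<omega> p) / 2) * (C' / (sqrt (real p) * sqrt (real r))))" using i1 by (intro integrable_mult_left)
      fix \<omega>
      define s where "s = z + walk \<omega> p"
      have i2: "integrable S (\<lambda>\<omega>'. exp (min 0 (z + wmin \<omega> p) / 2) * exp (3/2 * min 0 (s + wmin \<omega>' (p + r)) - (s + walk \<omega>' (p + r))))"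
        by (intro integrable_mult_right, rule integrable_bounded[where B = 1]) (use min_bound_le_1 in auto)
      have "(\<integral>\<omega>'. exp (2 * min 0 (z + wmin (comb_seq p \<omega> \<omega>') n) - (z + walk (comb_seq p \<omega> \<omega>') n)) \<partial>S)
        \<le> (\<integral>\<omega>'. exp (min 0 (z + wmin \<omega> p) / 2) * exp (3/2 * min 0 (s + wmin \<omega>' (p + r)) - (s + walk \<omega>' (p + r))) \<partial>S)"
      proof (rule integral_mono'[OF i2])
        fix \<omega>'
        have "z + wmin (comb_seq p \<omega> \<omega>') n = min (z + wmin \<omega> p) (s + wmin \<omega>' (p + r))"
          unfolding p(3) wmin_comb s_def by (simp add: min_def)
        moreover have "z + walk (comb_seq p \<omega> \<omega>') n = s + walk \<omega>' (p + r)" unfolding p(3) walk_comb s_def by simp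
        \<comment> \<open>The exponent 2 is shared out: 1/2 for the initial piece, which matches
          \<open>first_factor\<close>, and 3/2 for the rest, which matches
          \<open>second_factor\<close>.\<close>
        moreover have "2 * min 0 (min a b) - c \<le> min 0 a / 2 + (3/2 * min 0 b - c)" for a b c :: real by (auto simp: min_def)
        ultimately show "exp (2 * min 0 (z + wmin (comb_seq p \<omega> \<omega>') n) - (z + walk (comb_seq p \<omega> \<omega>') n)) \<le> exp (min 0 (z + wmin \<omega> p) / 2) * exp (3/2 * min 0 (s + wmin \<omega>' (p + r)) - (s + walk \<omega>' (p + r)))"
          unfolding exp_add[symmetric] by (simp only: exp_le_cancel_iff)
      qed simp
      also have "\<dots> = exp (min 0 (z + wmin \<omega> p) / 2) * (\<integral>\<omega>'. exp (3/2 * min 0 (s + wmin \<omega>' (p + r)) - (s + walk \<omega>' (p + r))) \<partial>S)" by simp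
      also have "\<dots> \<le> exp (min 0 (z + wmin \<omega> p) / 2) * (C' / (sqrt (real p) * sqrt (real r)))" by (intro mult_left_mono C'(2) p) auto
      finally show "(\<integral>\<omega>'. exp (2 * min 0 (z + wmin (comb_seq p \<omega> \<omega>') n) - (z + walk (comb_seq p \<omega> \<omega>') n)) \<partial>S) \<le> exp (min 0 (z + wmin \<omega> p) / 2) * (C' / (sqrt (real p) * sqrt (real r)))" .
    qed
    also have "\<dots> = (\<integral>\<omega>. exp (min 0 (z + wmin \<omega> p) / 2) \<partial>S) * (C' / (sqrt (real p) * sqrt (real r)))" by simp
    also have "\<dots> \<le> C * (1 + z) / sqrt (real p) * (C' / (sqrt (real p) * sqrt (real r)))"
      using C(2)[OF p(1) z] C' by (intro mult_right_mono) auto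
    also have "\<dots> = C * C' * (1 + z) / ((sqrt (real p) * sqrt (real p)) * sqrt (real r))"
      by (simp only: times_divide_eq_left times_divide_eq_right divide_divide_eq_left mult.assoc mult.left_commute mult.commute)
    also have "\<dots> = C * C' * (1 + z) / (real p * sqrt (real r))" by simp
    also have "\<dots> \<le> C * C' * (1 + z) / (real n * sqrt (real n) / (5 * sqrt 5))"
    proof (rule divide_left_mono)
      have "real n \<le> 5 * real p" "real n \<le> 5 * real r" using p by linarith+
      hence "real n / 5 \<le> real p" "sqrt (real n / 5) \<le> sqrt (real r)" by (auto intro!: real_sqrt_le_mono)
      hence "real n / 5 * sqrt (real n / 5) \<le> real p * sqrt (real r)" by (intro mult_mono) auto
      thus "real n * sqrt (real n) / (5 * sqrt 5) \<le> real p * sqrt (real r)" by (simp add: real_sqrt_divide)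
    qed (use C C' z p n in auto)
    also have "\<dots> = (C * C' * (5 * sqrt 5)) * (1 + z) / (real n * sqrt (real n))" by simp
    also have "\<dots> \<le> K * (1 + z) / (real n * sqrt (real n))"
      using z by (intro divide_right_mono mult_right_mono) (auto simp: K_def)
    finally show ?thesis .
  qed
  thus ?thesis using K by blast
qed

end

section \<open>Exponential functionals of the walk\<close>

text \<open>For a fractional-linear environment with \<open>a = exp (- S n)\<close> and \<open>b = (\<Sum>k<n. \<eta> k * exp (- S k))\<close>, the probability of
  \<open>Z n = i + 1\<close> given the environment is \<open>a * fl_weight i a b\<close>.\<close>
definition fl_weight :: "nat \<Rightarrow> real \<Rightarrow> real \<Rightarrow> real" where
  "fl_weight i a b = (b / (a + b)) ^ i * (1 / (a + b))\<^sup>2"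

lemma fl_weight_nonneg: "0 \<le> a \<Longrightarrow> 0 < b \<Longrightarrow> 0 \<le> fl_weight i a b"
  unfolding fl_weight_def by (intro mult_nonneg_nonneg zero_le_power) auto

lemma fl_weight_le: assumes "0 \<le> a" "0 < b" shows "fl_weight i a b \<le> 1 / b\<^sup>2"
proof -
  have "(b / (a + b)) ^ i \<le> 1" using assms by (intro power_le_one) auto
  moreover have "(1 / (a + b))\<^sup>2 \<le> (1 / b)\<^sup>2" using assms by (intro power_mono divide_left_mono) auto
  ultimately have "fl_weight i a b \<le> 1 * (1 / b)\<^sup>2" unfolding fl_weight_def by (intro mult_mono) auto
  thus ?thesis by (simp add: power_divide)
qed

text \<open>Both b / (a + b) and 1 / (a + b) are Lipschitz in b as long as b stays above c. The
  first lies in [0, 1], so its i-th power costs only a factor i. No bound on a enters, because a may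
  be arbitrarily large.\<close>

lemma fl_weight_lipschitz:
  assumes a: "0 \<le> a" and c: "0 < c" "c \<le> b" "c \<le> b'"
  shows "\<bar>fl_weight i a b - fl_weight i a b'\<bar> \<le> real (i + 2) / c ^ 3 * \<bar>b - b'\<bar>"
proof -
  define r where "r = b / (a + b)"
  define r' where "r' = b' / (a + b')"
  define t where "t = 1 / (a + b)"
  define t' where "t' = 1 / (a + b')"
  have pos: "a + b \<ge> c" "a + b' \<ge> c" "a + b > 0" "a + b' > 0" using a c by auto
  have r: "0 \<le> r" "r \<le> 1" "0 \<le> r'" "r' \<le> 1" unfolding r_def r'_def using a c by auto
  have t: "0 \<le> t" "t \<le> 1 / c" "0 \<le> t'" "t' \<le> 1 / c" unfolding t_def t'_def using pos c by (auto intro!: divide_left_mono)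
  have dt: "\<bar>t - t'\<bar> \<le> \<bar>b - b'\<bar> / c\<^sup>2"
  proof -
    have "t - t' = (b' - b) * (t * t')" unfolding t_def t'_def using pos by (simp add: field_simps)
    hence "\<bar>t - t'\<bar> = \<bar>b - b'\<bar> * (t * t')" using t by (simp add: abs_mult abs_minus_commute)
    also have "\<dots> \<le> \<bar>b - b'\<bar> * (1 / c * (1 / c))" using t c by (intro mult_left_mono mult_mono) auto
    finally show ?thesis by (simp add: power2_eq_square)
  qed
  have dr: "\<bar>r - r'\<bar> \<le> \<bar>b - b'\<bar> / c"
  proof -
    have e: "r - r' = (b - b') * ((1 - r) * t')"
    proof -
      have "1 - r = a * t" unfolding r_def t_def using pos by (simp add: field_simps)
      moreover have "r - r' = (b - b') * (a * t * t')" unfolding r_def r'_def t_def t'_def using pos by (simp add: field_simps)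
      ultimately show ?thesis by simp
    qed
    have "\<bar>r - r'\<bar> = \<bar>b - b'\<bar> * ((1 - r) * t')" unfolding e abs_mult using r t by simp
    also have "\<dots> \<le> \<bar>b - b'\<bar> * (1 * (1 / c))" using r t by (intro mult_left_mono mult_mono) auto
    finally show ?thesis by simp
  qed
  have rp: "\<bar>r ^ i - r' ^ i\<bar> \<le> real i * \<bar>r - r'\<bar>" using norm_power_diff[of r r' i] r by simp
  have "fl_weight i a b - fl_weight i a b' = (r ^ i - r' ^ i) * t\<^sup>2 + r' ^ i * ((t + t') * (t - t'))"
    unfolding fl_weight_def r_def[symmetric] r'_def[symmetric] t_def[symmetric] t'_def[symmetric] by (simp add: algebra_simps power2_eq_square)
  hence "\<bar>fl_weight i a b - fl_weight i a b'\<bar> \<le> \<bar>r ^ i - r' ^ i\<bar> * t\<^sup>2 + \<bar>r' ^ i\<bar> * (\<bar>t + t'\<bar> * \<bar>t - t'\<bar>)"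
    using abs_triangle_ineq[of "(r ^ i - r' ^ i) * t\<^sup>2" "r' ^ i * ((t + t') * (t - t'))"] by (simp add: abs_mult)
  also have "\<dots> \<le> (real i * (\<bar>b - b'\<bar> / c)) * (1 / c)\<^sup>2 + 1 * ((2 / c) * (\<bar>b - b'\<bar> / c\<^sup>2))"
  proof (intro add_mono mult_mono)
    show "\<bar>r ^ i - r' ^ i\<bar> \<le> real i * (\<bar>b - b'\<bar> / c)" using rp mult_left_mono[OF dr, of "real i"] by simp
    show "t\<^sup>2 \<le> (1 / c)\<^sup>2" using t by (intro power_mono) auto
    show "\<bar>r' ^ i\<bar> \<le> 1" using r by (simp add: power_abs power_le_one)
    show "\<bar>t + t'\<bar> \<le> 2 / c" using t by (simp add: abs_if)
  qed (use dt c r t in auto)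
  also have "\<dots> = real (i + 2) / c ^ 3 * \<bar>b - b'\<bar>" using c by (simp add: power2_eq_square power3_eq_cube field_simps)
  finally show ?thesis .
qed

lemma continuous_on_fl_weight:
  assumes "continuous_on A f" "continuous_on A g" "\<And>z. z \<in> A \<Longrightarrow> 0 \<le> f z" "\<And>z. z \<in> A \<Longrightarrow> (0::real) < g z"
  shows "continuous_on A (\<lambda>z. fl_weight i (f z) (g z))"
proof -
  have "f z + g z \<noteq> 0" if "z \<in> A" for z using assms(3,4)[OF that] by simp
  thus ?thesis unfolding fl_weight_def by (intro continuous_intros assms) auto
qed

lemma fl_weight_measurable [measurable (raw)]:
  assumes [measurable]: "f \<in> borel_measurable N" "g \<in> borel_measurable N"
  shows "(\<lambda>w. fl_weight i (f w) (g w)) \<in> borel_measurable N"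
  unfolding fl_weight_def by measurable

text \<open>A continuous substitute for the indicator of y >= \<delta>, rising from \<delta> / 2 to
  \<delta>: continuity makes polynomial approximation possible, and vanishing below \<delta> / 2
  removes the singularity at 0.\<close>

definition cut :: "real \<Rightarrow> real \<Rightarrow> real" where "cut \<delta> y = max 0 (min 1 (2 * y / \<delta> - 1))"

lemma cut_nonneg: "0 \<le> cut \<delta> y" and cut_le_1: "cut \<delta> y \<le> 1" by (auto simp: cut_def)
lemma cut_eq_1: "\<delta> > 0 \<Longrightarrow> \<delta> \<le> y \<Longrightarrow> cut \<delta> y = 1" by (simp add: cut_def field_simps max_def min_def)
lemma cut_eq_0: "\<delta> > 0 \<Longrightarrow> y \<le> \<delta> / 2 \<Longrightarrow> cut \<delta> y = 0" by (simp add: cut_def field_simps max_def min_def)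
lemma cut_measurable [measurable]: "cut \<delta> \<in> borel_measurable borel" unfolding cut_def by measurable
lemma continuous_on_cut: "continuous_on A f \<Longrightarrow> continuous_on A (\<lambda>z. cut \<delta> (f z))"
  unfolding cut_def by (cases "\<delta> = 0") (auto intro!: continuous_intros)

text \<open>Used where a limit exists but is never identified: sequences that can be approximated by
  convergent ones up to any error are Cauchy.\<close>

lemma convergent_approx:
  fixes a :: "nat \<Rightarrow> real"
  assumes "\<And>\<epsilon>. \<epsilon> > 0 \<Longrightarrow> \<exists>v. convergent v \<and> (\<forall>\<^sub>F n in sequentially. \<bar>a n - v n\<bar> \<le> \<epsilon>)"
  shows "convergent a"
proof -
  have "Cauchy a"
  proof (rule metric_CauchyI)
    fix \<epsilon> :: real assume e: "\<epsilon> > 0"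
    obtain v where v: "convergent v" "\<forall>\<^sub>F n in sequentially. \<bar>a n - v n\<bar> \<le> \<epsilon> / 4" using assms[of "\<epsilon> / 4"] e by auto
    obtain N1 where N1: "\<And>n. n \<ge> N1 \<Longrightarrow> \<bar>a n - v n\<bar> \<le> \<epsilon> / 4" using v(2) unfolding eventually_at_top_linorder by blast
    have "Cauchy v" using v(1) by (simp add: Cauchy_convergent_iff)
    then obtain N2 where N2: "\<And>m n. m \<ge> N2 \<Longrightarrow> n \<ge> N2 \<Longrightarrow> dist (v m) (v n) < \<epsilon> / 4" using e by (metis metric_CauchyD divide_pos_pos zero_less_numeral)
    show "\<exists>M. \<forall>m\<ge>M. \<forall>n\<ge>M. dist (a m) (a n) < \<epsilon>"
    proof (intro exI[of _ "max N1 N2"] allI impI)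
      fix m n assume "m \<ge> max N1 N2" "n \<ge> max N1 N2"
      hence "\<bar>a m - v m\<bar> \<le> \<epsilon> / 4" "\<bar>a n - v n\<bar> \<le> \<epsilon> / 4" "\<bar>v m - v n\<bar> < \<epsilon> / 4"
        using N1[of m] N1[of n] N2[of m n] by (auto simp: dist_real_def)
      thus "dist (a m) (a n) < \<epsilon>" unfolding dist_real_def using e by linarith
    qed
  qed
  thus ?thesis by (simp add: Cauchy_convergent_iff)
qed

text \<open>One of k and n - k is at least n / 2, so its factor is at most 4 f n; the other runs
  over indices at least \<open>K\<close> and sums to at most a tail of a convergent series. Relative
  to n^(-3/2) the middle is thus small for large \<open>K\<close>, uniformly in n.\<close>

lemma middle_sum_bound:
  fixes K n :: nat
  assumes K: "K \<ge> 1"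
  defines "f \<equiv> \<lambda>k::nat. 1 / (real k * sqrt (real k))"
  shows "(\<Sum>k\<in>{K..<n-K}. f k * f (n - k)) \<le> 8 * (suminf (\<lambda>k. f (k + K))) * f n"
proof (cases "n = 0")
  case False
  have fn: "0 \<le> f k" for k by (simp add: f_def)
  have sf: "summable (\<lambda>k. f (k + K))" unfolding summable_iff_shift unfolding f_def by (rule summable_inverse_n_sqrt)
  have big: "f k \<le> 4 * f n" if "n \<le> 2 * k" "k \<ge> 1" for k
  proof -
    have 1: "real n \<le> 2 * real k" using that by linarith
    have "sqrt (real n) \<le> sqrt (4 * real k)" using 1 by (intro real_sqrt_le_mono) simp
    hence 2: "sqrt (real n) \<le> 2 * sqrt (real k)" by (simp add: real_sqrt_mult)
    have "real n * sqrt (real n) \<le> 4 * (real k * sqrt (real k))" using mult_mono[OF 1 2] by simp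
    hence "4 / (4 * (real k * sqrt (real k))) \<le> 4 / (real n * sqrt (real n))" using False that(2) by (intro divide_left_mono) auto
    thus ?thesis by (simp add: f_def)
  qed
  have "(\<Sum>k\<in>{K..<n-K}. f k * f (n - k)) \<le> (\<Sum>k\<in>{K..<n-K}. 4 * f n * (f k + f (n - k)))"
  proof (rule sum_mono)
    fix k assume k: "k \<in> {K..<n-K}"
    show "f k * f (n - k) \<le> 4 * f n * (f k + f (n - k))"
    proof (cases "n \<le> 2 * k")
      case True
      hence "f k * f (n - k) \<le> 4 * f n * f (n - k)" using big[of k] k K fn by (intro mult_right_mono) auto
      also have "\<dots> \<le> 4 * f n * (f k + f (n - k))" using fn by (intro mult_left_mono) auto
      finally show ?thesis .
    next
      case False
      hence "f (n - k) \<le> 4 * f n" using k K by (intro big) auto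
      hence "f k * f (n - k) \<le> f k * (4 * f n)" by (intro mult_left_mono fn)
      also have "\<dots> \<le> 4 * f n * (f k + f (n - k))" using mult_nonneg_nonneg[OF fn[of n] fn[of "n - k"]] by (simp add: algebra_simps)
      finally show ?thesis .
    qed
  qed
  also have "\<dots> = 4 * f n * ((\<Sum>k\<in>{K..<n-K}. f k) + (\<Sum>k\<in>{K..<n-K}. f (n - k)))" by (simp only: sum_distrib_left[symmetric] sum.distrib)
  also have "\<dots> \<le> 4 * f n * ((suminf (\<lambda>k. f (k + K))) + (suminf (\<lambda>k. f (k + K))))"
  proof (intro mult_left_mono add_mono)
    have "(\<Sum>k\<in>{K..<n-K}. f k) = (\<Sum>k<n-K-K. f (k + K))"
      by (rule sum.reindex_bij_witness[where i = "\<lambda>k. k + K" and j = "\<lambda>k. k - K"]) auto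
    also have "\<dots> \<le> (suminf (\<lambda>k. f (k + K)))" by (rule sum_le_suminf[OF sf]) (use fn in auto)
    finally show "(\<Sum>k\<in>{K..<n-K}. f k) \<le> (suminf (\<lambda>k. f (k + K)))" .
    have "(\<Sum>k\<in>{K..<n-K}. f (n - k)) = (\<Sum>k\<in>{1..n-K-K}. f (k + K))"
      by (rule sum.reindex_bij_witness[where i = "\<lambda>k. n - K - k" and j = "\<lambda>k. n - K - k"]) auto
    also have "\<dots> \<le> (suminf (\<lambda>k. f (k + K)))" by (rule sum_le_suminf[OF sf]) (use fn in auto)
    finally show "(\<Sum>k\<in>{K..<n-K}. f (n - k)) \<le> (suminf (\<lambda>k. f (k + K)))" .
  qed (use fn in auto)
  finally show ?thesis by (simp add: mult_ac)
qed (simp add: f_def)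

section \<open>Inserting an independent middle block\<close>

context sequence_space
begin

text \<open>The coordinates are exchangeable, so the middle block may be drawn from a separate
  sequence. Integrating over both end blocks first leaves a function of the middle block
  alone.\<close>

lemma E_insert:
  fixes F :: "(nat \<Rightarrow> 'a) \<Rightarrow> real"
  assumes F: "integrable S F"
  shows "(\<integral>\<omega>. F \<omega> \<partial>S) = (\<integral>\<omega>'. (\<integral>\<omega>. F (comb_seq K \<omega> (comb_seq m \<omega>' (\<lambda>i. \<omega> (i + K)))) \<partial>S) \<partial>S)"
    "integrable S (\<lambda>\<omega>'. \<integral>\<omega>. F (comb_seq K \<omega> (comb_seq m \<omega>' (\<lambda>i. \<omega> (i + K)))) \<partial>S)"
proof -
  \<comment> \<open>Exchanges the first block of length K with the next one of length m, so that the
    middle block occupies the first m coordinates and \<open>E_split\<close> separates it.\<close>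
  define \<pi> where "\<pi> i = (if i < K then i + m else if i < K + m then i - K else i)" for i
  have inj: "inj \<pi>" by (rule injI) (auto simp: \<pi>_def split: if_splits)
  have [measurable]: "F \<in> borel_measurable S" using F by simp
  have d: "distr S S (\<lambda>\<omega>. \<lambda>i\<in>UNIV. \<omega> (\<pi> i)) = S"
    by (rule distr_PiM_reindex) (use M.prob_space_axioms inj in auto)
  have me: "(\<lambda>\<omega>. \<lambda>i\<in>UNIV. \<omega> (\<pi> i)) \<in> S \<rightarrow>\<^sub>M S" by measurable
  have i: "integrable S (\<lambda>\<omega>. F (\<lambda>i. \<omega> (\<pi> i)))"
  proof -
    have "integrable (distr S S (\<lambda>\<omega>. \<lambda>i\<in>UNIV. \<omega> (\<pi> i))) F" unfolding d by (rule F)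
    thus ?thesis by (subst (asm) integrable_distr_eq[OF me]) (auto simp: restrict_UNIV)
  qed
  have "(\<integral>\<omega>. F \<omega> \<partial>S) = (\<integral>\<omega>. F \<omega> \<partial>distr S S (\<lambda>\<omega>. \<lambda>i\<in>UNIV. \<omega> (\<pi> i)))" unfolding d ..
  also have "\<dots> = (\<integral>\<omega>. F (\<lambda>i\<in>UNIV. \<omega> (\<pi> i)) \<partial>S)" by (rule integral_distr[OF me]) measurable
  finally have 1: "(\<integral>\<omega>. F \<omega> \<partial>S) = (\<integral>\<omega>. F (\<lambda>i. \<omega> (\<pi> i)) \<partial>S)" by (simp add: restrict_UNIV)
  have e: "(\<lambda>i. comb_seq m \<omega>' \<omega> (\<pi> i)) = comb_seq K \<omega> (comb_seq m \<omega>' (\<lambda>i. \<omega> (i + K)))" for \<omega> \<omega>'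
    by (auto simp: comb_seq_def \<pi>_def fun_eq_iff)
  show "(\<integral>\<omega>. F \<omega> \<partial>S) = (\<integral>\<omega>'. (\<integral>\<omega>. F (comb_seq K \<omega> (comb_seq m \<omega>' (\<lambda>i. \<omega> (i + K)))) \<partial>S) \<partial>S)"
    unfolding 1 using E_split(3)[OF i, of m] unfolding e .
  show "integrable S (\<lambda>\<omega>'. \<integral>\<omega>. F (comb_seq K \<omega> (comb_seq m \<omega>' (\<lambda>i. \<omega> (i + K)))) \<partial>S)"
    using E_split(2)[OF i, of m] unfolding e .
qed

end

section \<open>The walk together with its exponential functional\<close>

locale affine_walk = env_walk D x s2 x0 for D :: "'b measure" and x s2 x0 +
  fixes e :: "'b \<Rightarrow> real" and c1 c2 :: real
  assumes e_meas [measurable]: "e \<in> borel_measurable D"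
    and e_lower: "\<And>q. c1 \<le> e q" and e_upper: "\<And>q. e q \<le> c2" and c1_pos: "0 < c1"
begin

lemma c2_pos: "0 < c2" using e_lower e_upper c1_pos by (meson less_le_trans)

definition perpetuity :: "(nat \<Rightarrow> 'b) \<Rightarrow> nat \<Rightarrow> real" where "perpetuity \<omega> n = (\<Sum>k<n. e (\<omega> k) * exp (- walk \<omega> k))"

lemma perpetuity_meas [measurable]: "(\<lambda>\<omega>. perpetuity \<omega> n) \<in> borel_measurable S" unfolding perpetuity_def by measurable

lemma e_pos: "0 < e q" using e_lower[of q] c1_pos by linarith

lemma perpetuity_ge_term: "k < n \<Longrightarrow> c1 * exp (- walk \<omega> k) \<le> perpetuity \<omega> n"
proof -
  assume k: "k < n"
  have "c1 * exp (- walk \<omega> k) \<le> e (\<omega> k) * exp (- walk \<omega> k)" by (intro mult_right_mono e_lower) auto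
  also have "\<dots> \<le> perpetuity \<omega> n" unfolding perpetuity_def by (rule member_le_sum) (use k e_pos in \<open>auto intro!: mult_nonneg_nonneg less_imp_le\<close>)
  finally show ?thesis .
qed

lemma perpetuity_ge: "n \<ge> 1 \<Longrightarrow> c1 \<le> perpetuity \<omega> n" using perpetuity_ge_term[of 0 n \<omega>] by simp

lemma perpetuity_nonneg: "0 \<le> perpetuity \<omega> n" unfolding perpetuity_def using e_pos by (intro sum_nonneg mult_nonneg_nonneg) (auto intro: less_imp_le)

definition perp_const :: real where "perp_const = c1 * exp (- x0)"
lemma perp_const_pos: "0 < perp_const" unfolding perp_const_def using c1_pos by simp

text \<open>The sum stops at index n - 1. If the minimum is attained only at time n, the preceding
  summand is at least exp (-x0) times the missing one, because a step goes down by at most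
  \<open>x0\<close>; this is the factor in \<open>perp_const\<close>.\<close>

lemma perpetuity_ge_wmin: assumes n: "n \<ge> 1" shows "perp_const * exp (- wmin \<omega> n) \<le> perpetuity \<omega> n"
proof -
  obtain k where k: "k \<le> n" "wmin \<omega> n = walk \<omega> k" using pL_attained[of n "\<lambda>i. x (\<omega> i)"] by (auto simp: wmin_def walk_def)
  show ?thesis
  proof (cases "k < n")
    case True
    have "perp_const * exp (- wmin \<omega> n) \<le> c1 * exp (- walk \<omega> k)" unfolding k(2) perp_const_def
      using c1_pos x0_nonneg by (intro mult_right_mono) (auto simp: mult_left_le)
    thus ?thesis using perpetuity_ge_term[OF True, of \<omega>] by linarith
  next
    case False
    hence kn: "k = Suc (n - 1)" using k n by simp
    have "- walk \<omega> k \<le> x0 - walk \<omega> (n - 1)" unfolding kn walk_Suc using x_lower[of "\<omega> (n - 1)"] by simp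
    hence "exp (- walk \<omega> k) \<le> exp (x0 - walk \<omega> (n - 1))" by simp
    hence "perp_const * exp (- walk \<omega> k) \<le> perp_const * exp (x0 - walk \<omega> (n - 1))" using perp_const_pos by (intro mult_left_mono) auto
    also have "\<dots> = c1 * exp (- walk \<omega> (n - 1))" unfolding perp_const_def by (simp add: mult.assoc exp_add[symmetric])
    also have "\<dots> \<le> perpetuity \<omega> n" using perpetuity_ge_term[of "n - 1" n \<omega>] n by simp
    finally show ?thesis unfolding k(2) .
  qed
qed

text \<open>The quantity u_i(n) of the overview: the conditional probability of i + 1 individuals at
  time n, averaged over the environment.\<close>

definition survival_weight :: "nat \<Rightarrow> nat \<Rightarrow> real" where
  "survival_weight i n = (\<integral>\<omega>. exp (- walk \<omega> n) * fl_weight i (exp (- walk \<omega> n)) (perpetuity \<omega> n) \<partial>S)"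

text \<open>The weight is at most a / b^2, and b is at least a multiple of exp (-L), so exp (-S + 2
  L) remains. This bound is independent of i and is the functional of
  \<open>wmin_mgf 1 1\<close>.\<close>

lemma survival_weight_integrand_le:
  assumes n: "n \<ge> 1"
  shows "exp (- walk \<omega> n) * fl_weight i (exp (- walk \<omega> n)) (perpetuity \<omega> n) \<le> 1 / perp_const\<^sup>2 * exp (1 * wmin \<omega> n - 1 * (walk \<omega> n - wmin \<omega> n))"
    "0 \<le> exp (- walk \<omega> n) * fl_weight i (exp (- walk \<omega> n)) (perpetuity \<omega> n)"
proof -
  have b: "perpetuity \<omega> n > 0" using perpetuity_ge[OF n] c1_pos by (meson less_le_trans)
  have "fl_weight i (exp (- walk \<omega> n)) (perpetuity \<omega> n) \<le> 1 / (perpetuity \<omega> n)\<^sup>2" by (rule fl_weight_le) (use b in auto)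
  also have "\<dots> \<le> 1 / (perp_const * exp (- wmin \<omega> n))\<^sup>2"
    using perpetuity_ge_wmin[OF n, of \<omega>] perp_const_pos b by (intro divide_left_mono power_mono mult_pos_pos zero_less_power) auto
  finally have "exp (- walk \<omega> n) * fl_weight i (exp (- walk \<omega> n)) (perpetuity \<omega> n) \<le> exp (- walk \<omega> n) * (1 / (perp_const * exp (- wmin \<omega> n))\<^sup>2)" by (intro mult_left_mono) auto
  also have "(perp_const * exp (- wmin \<omega> n))\<^sup>2 = perp_const\<^sup>2 * exp (- (2 * wmin \<omega> n))" by (simp add: power_mult_distrib power2_eq_square exp_add[symmetric])
  also have "exp (- walk \<omega> n) * (1 / (perp_const\<^sup>2 * exp (- (2 * wmin \<omega> n)))) = 1 / perp_const\<^sup>2 * (exp (- walk \<omega> n) * exp (2 * wmin \<omega> n))"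
    by (simp add: exp_minus field_simps)
  also have "exp (- walk \<omega> n) * exp (2 * wmin \<omega> n) = exp (1 * wmin \<omega> n - 1 * (walk \<omega> n - wmin \<omega> n))" by (simp add: exp_add[symmetric])
  finally show "exp (- walk \<omega> n) * fl_weight i (exp (- walk \<omega> n)) (perpetuity \<omega> n) \<le> 1 / perp_const\<^sup>2 * exp (1 * wmin \<omega> n - 1 * (walk \<omega> n - wmin \<omega> n))" .
  show "0 \<le> exp (- walk \<omega> n) * fl_weight i (exp (- walk \<omega> n)) (perpetuity \<omega> n)" using fl_weight_nonneg b by simp
qed

lemma integrable_survival_weight: "n \<ge> 1 \<Longrightarrow> integrable S (\<lambda>\<omega>. exp (- walk \<omega> n) * fl_weight i (exp (- walk \<omega> n)) (perpetuity \<omega> n))"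
  by (rule Bochner_Integration.integrable_bound[OF integrable_mult_right[OF integrable_wmin_mgf[of 1 1 n], of "1 / perp_const\<^sup>2"]])
     (use survival_weight_integrand_le[of n _ i] in \<open>auto intro!: always_eventually simp: abs_of_nonneg\<close>)

lemma survival_weight_le: "n \<ge> 1 \<Longrightarrow> survival_weight i n \<le> 1 / perp_const\<^sup>2 * wmin_mgf 1 1 n"
  unfolding survival_weight_def wmin_mgf_def integral_mult_right_zero[symmetric]
  by (rule integral_mono[OF integrable_survival_weight integrable_mult_right[OF integrable_wmin_mgf]]) (use survival_weight_integrand_le in auto)

text \<open>Given that the minimum stays above -N = ln \<delta>, the path after time k is a
  soft-killed walk from z = S_k + N, of order (1 + z) m^(-3/2). The factor exp (-S_k) more than pays
  for the linear growth in z, and the part up to k yields k^(-3/2): the two rates multiply.\<close>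

lemma two_point_bound:
  assumes d: "0 < \<delta>" "\<delta> \<le> 1"
  shows "\<exists>C>0. \<forall>k\<ge>1. \<forall>m\<ge>1. (\<integral>\<omega>. (if \<delta> \<le> exp (wmin \<omega> (k + m)) then exp (- walk \<omega> (k + m)) * exp (- walk \<omega> k) else 0) \<partial>S)
     \<le> C * (1 / (real k * sqrt (real k)) * (1 / (real m * sqrt (real m))))"
proof -
  obtain C where C: "C > 0" "\<And>n z. n \<ge> 1 \<Longrightarrow> z \<ge> 0 \<Longrightarrow> killed_exp n z \<le> C * (1 + z) / (real n * sqrt (real n))" using killed_exp_upper by blast
  obtain B where B: "B > 0" "\<And>n. n \<ge> 1 \<Longrightarrow> wmin_mgf 1 (1/2) n \<le> B / (real n * sqrt (real n))" using wmin_mgf_asymp(3)[of 1 "1/2"] by auto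
  define N where "N = - ln \<delta>"
  have N: "N \<ge> 0" unfolding N_def using d by simp
  have "\<delta> = exp (- N)" unfolding N_def using d by simp
  hence dN: "\<delta> \<le> exp y \<longleftrightarrow> - N \<le> y" for y by simp
  have "(\<integral>\<omega>. (if \<delta> \<le> exp (wmin \<omega> (k + m)) then exp (- walk \<omega> (k + m)) * exp (- walk \<omega> k) else 0) \<partial>S)
     \<le> (2 * C * exp (3 * N) * B) * (1 / (real k * sqrt (real k)) * (1 / (real m * sqrt (real m))))" if km: "k \<ge> 1" "m \<ge> 1" for k m
  proof -
    define F where "F \<omega> = (if \<delta> \<le> exp (wmin \<omega> (k + m)) then exp (- walk \<omega> (k + m)) * exp (- walk \<omega> k) else 0)" for \<omega>
    have [measurable]: "F \<in> borel_measurable S" unfolding F_def by measurable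
    have iF: "integrable S F"
    proof (rule integrable_bounded[where B = "exp N * exp N"])
      fix \<omega>
      have "exp (- walk \<omega> (k + m)) * exp (- walk \<omega> k) \<le> exp N * exp N" if "- N \<le> wmin \<omega> (k + m)"
        using that wmin_le[of "k+m" "k+m" \<omega>] wmin_le[of k "k+m" \<omega>] by (intro mult_mono) auto
      thus "norm (F \<omega>) \<le> exp N * exp N" unfolding F_def dN by auto
    qed measurable
    define f where "f = 1 / (real m * sqrt (real m))"
    have "(\<integral>\<omega>. F \<omega> \<partial>S) \<le> (\<integral>\<omega>. (2 * C * exp (3 * N) * f) * exp (1 * wmin \<omega> k - 1/2 * (walk \<omega> k - wmin \<omega> k)) \<partial>S)"
    proof (rule E_split_le[OF iF, where k = k])
      show "integrable S (\<lambda>\<omega>. (2 * C * exp (3 * N) * f) * exp (1 * wmin \<omega> k - 1/2 * (walk \<omega> k - wmin \<omega> k)))"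
        by (intro integrable_mult_right integrable_wmin_mgf) auto
      fix \<omega>
      define z where "z = walk \<omega> k + N"
      show "(\<integral>\<omega>'. F (comb_seq k \<omega> \<omega>') \<partial>S) \<le> (2 * C * exp (3 * N) * f) * exp (1 * wmin \<omega> k - 1/2 * (walk \<omega> k - wmin \<omega> k))"
      proof (cases "- N \<le> wmin \<omega> k")
        case False
        have "F (comb_seq k \<omega> \<omega>') = 0" for \<omega>' unfolding F_def dN wmin_comb using False by auto
        thus ?thesis using C N by (simp add: f_def)
      next
        case True
        have z: "z \<ge> 0" using True wmin_le_walk[of \<omega> k] by (simp add: z_def)
        have "(\<integral>\<omega>'. F (comb_seq k \<omega> \<omega>') \<partial>S) \<le> (\<integral>\<omega>'. (exp N * exp (- walk \<omega> k)) * exp (2 * min 0 (z + wmin \<omega>' m) - (z + walk \<omega>' m)) \<partial>S)"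
        proof (rule integral_mono'[OF integrable_mult_right[OF integrable_killed_exp]])
          fix \<omega>'
          show "F (comb_seq k \<omega> \<omega>') \<le> (exp N * exp (- walk \<omega> k)) * exp (2 * min 0 (z + wmin \<omega>' m) - (z + walk \<omega>' m))"
          proof (cases "0 \<le> z + wmin \<omega>' m")
            case True
            thus ?thesis unfolding F_def walk_comb walk_comb_left[OF order_refl] exp_add[symmetric] z_def by (simp add: exp_add[symmetric] min_absorb1)
          next
            case False
            thus ?thesis unfolding F_def dN wmin_comb z_def by auto
          qed
        qed simp
        also have "\<dots> = (exp N * exp (- walk \<omega> k)) * killed_exp m z" by (simp add: killed_exp_def)
        also have "\<dots> \<le> (exp N * exp (- walk \<omega> k)) * (C * (2 * exp (z / 2)) * f)"
        proof (rule mult_left_mono)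
          have "1 + z \<le> 2 * exp (z / 2)" using exp_ge_add_one_self[of "z / 2"] by linarith
          hence "C * (1 + z) / (real m * sqrt (real m)) \<le> C * (2 * exp (z / 2)) / (real m * sqrt (real m))"
            using C by (intro divide_right_mono mult_left_mono) auto
          thus "killed_exp m z \<le> C * (2 * exp (z / 2)) * f" using C(2)[OF km(2) z] unfolding f_def by simp
        qed simp
        also have "\<dots> = (2 * C * f) * exp (N - walk \<omega> k + z / 2)" by (simp add: exp_add[symmetric] exp_diff exp_minus field_simps)
        \<comment> \<open>Inserting z leaves exp (3N/2 - S_k/2); since L_k >= -N, raising the
          constant to 3N makes room for the additional 3/2 L_k and gives the functional of
          \<open>wmin_mgf 1 (1/2)\<close>.\<close>
        also have "\<dots> \<le> (2 * C * f) * exp (3 * N + (1 * wmin \<omega> k - 1/2 * (walk \<omega> k - wmin \<omega> k)))"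
          using True C unfolding z_def f_def by (intro mult_left_mono) (auto simp: field_simps)
        also have "\<dots> = (2 * C * exp (3 * N) * f) * exp (1 * wmin \<omega> k - 1/2 * (walk \<omega> k - wmin \<omega> k))" unfolding exp_add by simp
        finally show ?thesis .
      qed
    qed
    also have "\<dots> = (2 * C * exp (3 * N) * f) * wmin_mgf 1 (1/2) k" unfolding wmin_mgf_def by (rule integral_mult_right_zero)
    also have "\<dots> \<le> (2 * C * exp (3 * N) * f) * (B / (real k * sqrt (real k)))" using C by (intro mult_left_mono B km) (auto simp: f_def)
    finally show ?thesis unfolding F_def f_def by (simp add: mult_ac)
  qed
  thus ?thesis using C B by (intro exI[of _ "2 * C * exp (3 * N) * B"]) auto
qed

end

text \<open>Generated from monomials by addition alone: the expectation of a monomial in exp L and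
  exp (-(S - L)) is a value of \<open>wmin_mgf\<close> with integer parameters, and limits add.
  Closure under products is then a lemma.\<close>

inductive bipoly :: "(real \<times> real \<Rightarrow> real) \<Rightarrow> bool" where
  monom: "bipoly (\<lambda>p. c * (fst p ^ j * snd p ^ k))"
| add: "bipoly f \<Longrightarrow> bipoly g \<Longrightarrow> bipoly (\<lambda>p. f p + g p)"

lemma bipoly_mult: "bipoly f \<Longrightarrow> bipoly g \<Longrightarrow> bipoly (\<lambda>p. f p * g p)"
proof (induction f rule: bipoly.induct)
  case (monom c j k)
  from monom.prems show ?case
  proof (induction g rule: bipoly.induct)
    case (monom c' j' k')
    have "(\<lambda>p. c * (fst p ^ j * snd p ^ k) * (c' * (fst p ^ j' * snd p ^ k'))) = (\<lambda>p. (c * c') * (fst p ^ (j + j') * snd p ^ (k + k')))"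
      by (auto simp: power_add fun_eq_iff)
    thus ?case using bipoly.monom by metis
  next
    case (add f g)
    thus ?case using bipoly.add[OF add.IH] by (simp add: distrib_left)
  qed
next
  case (add f1 f2)
  thus ?case using bipoly.add[OF add.IH(1)[OF add.prems] add.IH(2)[OF add.prems]] by (simp add: distrib_right)
qed

lemma bipoly_real_polynomial: "real_polynomial_function f \<Longrightarrow> bipoly (f :: real \<times> real \<Rightarrow> real)"
proof (induction f rule: real_polynomial_function.induct)
  case (linear f)
  then interpret bounded_linear f .
  have "f p = f (1, 0) * (fst p ^ 1 * snd p ^ 0) + f (0, 1) * (fst p ^ 0 * snd p ^ 1)" for p
  proof -
    have "p = fst p *\<^sub>R (1, 0) + snd p *\<^sub>R (0, 1)" by (cases p) simp
    hence "f p = fst p *\<^sub>R f (1, 0) + snd p *\<^sub>R f (0, 1)" by (metis add scaleR)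
    thus ?thesis by simp
  qed
  hence eq: "f = (\<lambda>p. f (1, 0) * (fst p ^ 1 * snd p ^ 0) + f (0, 1) * (fst p ^ 0 * snd p ^ 1))" by blast
  show ?case by (rule iffD2[OF arg_cong[of _ _ bipoly, OF eq] bipoly.add[OF bipoly.monom bipoly.monom]])
next
  case (const c)
  show ?case using bipoly.monom[of c 0 0] by simp
next
  case (add f g)
  thus ?case by (intro bipoly.add)
next
  case (mult f g)
  thus ?case by (intro bipoly_mult)
qed

lemma exp_min: "exp (min a b) = min (exp a) (exp (b::real))"
  by (simp add: min_def)

definition r32 :: "nat \<Rightarrow> real" where "r32 n = real n * sqrt (real n)"

lemma r32_nonneg: "0 \<le> r32 n" by (simp add: r32_def)
lemma r32_pos: "n \<ge> 1 \<Longrightarrow> 0 < r32 n" by (simp add: r32_def)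
lemma r32_double: "n \<le> 2 * m \<Longrightarrow> r32 n \<le> 4 * r32 m"
proof -
  assume "n \<le> 2 * m"
  hence 1: "real n \<le> 2 * real m" by linarith
  have "sqrt (real n) \<le> sqrt (4 * real m)" using 1 by (intro real_sqrt_le_mono) simp
  hence "sqrt (real n) \<le> 2 * sqrt (real m)" by (simp add: real_sqrt_mult)
  from mult_mono[OF 1 this] show ?thesis by (simp add: r32_def)
qed

section \<open>The block approximation and its limit\<close>

context affine_walk
begin

lemma walk_lower: "- (real n * x0) \<le> walk \<omega> n"
proof (induction n)
  case (Suc n)
  thus ?case using x_lower[of "\<omega> n"] by (simp add: walk_Suc algebra_simps)
qed simp

lemma walk_shift: "walk \<omega> (k + m) = walk \<omega> k + walk (\<lambda>i. \<omega> (i + k)) m"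
  by (induction m) (auto simp: walk_Suc add.commute)

lemma perpetuity_shift: "perpetuity \<omega> (k + m) = perpetuity \<omega> k + exp (- walk \<omega> k) * perpetuity (\<lambda>i. \<omega> (i + k)) m"
proof (induction m)
  case 0
  show ?case by (simp add: perpetuity_def)
next
  case (Suc m)
  have "perpetuity \<omega> (k + Suc m) = perpetuity \<omega> (k + m) + e (\<omega> (k + m)) * exp (- walk \<omega> (k + m))" by (simp add: perpetuity_def)
  also have "exp (- walk \<omega> (k + m)) = exp (- walk \<omega> k) * exp (- walk (\<lambda>i. \<omega> (i + k)) m)" by (simp add: walk_shift exp_add[symmetric])
  finally show ?case using Suc by (simp add: perpetuity_def algebra_simps)
qed

lemma perpetuity_comb_left: "n \<le> k \<Longrightarrow> perpetuity (comb_seq k \<omega> \<omega>') n = perpetuity \<omega> n"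
  unfolding perpetuity_def by (intro sum.cong refl) (auto simp: walk_comb_left comb_seq_def)

lemma shift_meas [measurable]:
  "(\<lambda>\<omega>. walk (\<lambda>i. \<omega> (i + k)) n) \<in> borel_measurable S" "(\<lambda>\<omega>. wmin (\<lambda>i. \<omega> (i + k)) n) \<in> borel_measurable S"
  "(\<lambda>\<omega>. perpetuity (\<lambda>i. \<omega> (i + k)) n) \<in> borel_measurable S"
  unfolding perpetuity_def unfolding walk_def wmin_def by measurable

text \<open>The sum \<open>perpetuity\<close> is dominated by the indices near the two ends of the time interval. Here \<open>n = K + m + K\<close>, only the
  first and last \<open>K\<close> summands are kept, and paths with a deep minimum or a high level at time \<open>K\<close> are discarded, so that the middle
  \<open>m\<close> steps enter only through their final value and their minimum.\<close>
definition block_approx :: "nat \<Rightarrow> real \<Rightarrow> real \<Rightarrow> nat \<Rightarrow> nat \<Rightarrow> (nat \<Rightarrow> 'b) \<Rightarrow> real" where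
  "block_approx i \<delta> R K m \<omega> = (if walk \<omega> K \<le> R then cut \<delta> (exp (wmin \<omega> (K + (m + K)))) * (exp (- walk \<omega> (K + (m + K))) *
     fl_weight i (exp (- walk \<omega> (K + (m + K)))) (perpetuity \<omega> K + exp (- walk \<omega> (K + m)) * perpetuity (\<lambda>i. \<omega> (i + (K + m))) K)) else 0)"

text \<open>What remains of \<open>block_approx\<close>, given the end blocks, as a function of p =
  (exp L, exp (-(S - L))) of the middle block, once the factor \<open>fst p * snd p\<close> is
  extracted. Replacing \<open>fst p\<close> by its maximum with \<delta> exp (-R) / 2 changes
  nothing, since below that value the cutoff vanishes, but it keeps all quotients continuous at
  0.\<close>

definition block_kernel :: "nat \<Rightarrow> real \<Rightarrow> real \<Rightarrow> nat \<Rightarrow> (nat \<Rightarrow> 'b) \<Rightarrow> real \<times> real \<Rightarrow> real" where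
  "block_kernel i \<delta> R K \<omega> p = (if walk \<omega> K \<le> R then
     cut \<delta> (min (exp (wmin \<omega> K)) (exp (walk \<omega> K) * fst p / max 1 (snd p * exp (- wmin (\<lambda>i. \<omega> (i + K)) K)))) *
     (exp (- walk \<omega> K) * exp (- walk (\<lambda>i. \<omega> (i + K)) K) / (max (\<delta> * exp (- R) / 2) (fst p))\<^sup>2) *
     fl_weight i (exp (- walk \<omega> K) * exp (- walk (\<lambda>i. \<omega> (i + K)) K) * (snd p / max (\<delta> * exp (- R) / 2) (fst p)))
       (perpetuity \<omega> K + exp (- walk \<omega> K) * (snd p / max (\<delta> * exp (- R) / 2) (fst p)) * perpetuity (\<lambda>i. \<omega> (i + K)) K) else 0)"

lemma block_approx_meas [measurable]: "block_approx i \<delta> R K m \<in> borel_measurable S" unfolding block_approx_def by measurable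
lemma block_kernel_meas [measurable]: "(\<lambda>\<omega>. block_kernel i \<delta> R K \<omega> p) \<in> borel_measurable S" unfolding block_kernel_def by measurable

lemma BT_ge: "K \<ge> 1 \<Longrightarrow> c1 \<le> perpetuity \<omega> K + exp (- walk \<omega> (K + m)) * perpetuity (\<lambda>i. \<omega> (i + (K + m))) K"
  using perpetuity_ge[of K \<omega>] perpetuity_nonneg[of "\<lambda>i. \<omega> (i + (K + m))" K] by (simp add: add_increasing2)

lemma fl_weight_le_c1: assumes "0 \<le> a" "c1 \<le> b" shows "fl_weight i a b \<le> 1 / c1\<^sup>2" "0 \<le> fl_weight i a b"
proof -
  have b: "0 < b" using assms c1_pos by linarith
  have "fl_weight i a b \<le> 1 / b\<^sup>2" by (rule fl_weight_le[OF assms(1) b])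
  also have "\<dots> \<le> 1 / c1\<^sup>2" using assms c1_pos b by (intro divide_left_mono power_mono) auto
  finally show "fl_weight i a b \<le> 1 / c1\<^sup>2" .
  show "0 \<le> fl_weight i a b" by (rule fl_weight_nonneg[OF assms(1) b])
qed

lemma block_approx_bounds:
  assumes K: "K \<ge> 1" and d: "\<delta> > 0"
  shows "0 \<le> block_approx i \<delta> R K m \<omega>" "block_approx i \<delta> R K m \<omega> \<le> 2 / \<delta> * (1 / c1\<^sup>2)"
proof -
  define n where "n = K + (m + K)"
  define b where "b = perpetuity \<omega> K + exp (- walk \<omega> (K + m)) * perpetuity (\<lambda>i. \<omega> (i + (K + m))) K"
  note k = fl_weight_le_c1[of "exp (- walk \<omega> n)" b i, OF less_imp_le[OF exp_gt_zero] BT_ge[OF K, of \<omega> m, folded b_def]]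
  show "0 \<le> block_approx i \<delta> R K m \<omega>" unfolding block_approx_def n_def[symmetric] b_def[symmetric] using k cut_nonneg by auto
  have "cut \<delta> (exp (wmin \<omega> n)) * (exp (- walk \<omega> n) * fl_weight i (exp (- walk \<omega> n)) b) \<le> 2 / \<delta> * (1 / c1\<^sup>2)"
  proof (cases "exp (wmin \<omega> n) \<le> \<delta> / 2")
    case True
    thus ?thesis using cut_eq_0[OF d True] d by simp
  next
    case False
    have "exp (- walk \<omega> n) \<le> exp (- wmin \<omega> n)" using wmin_le_walk by simp
    also have "\<dots> \<le> 2 / \<delta>" using False d by (simp add: exp_minus field_simps)
    finally have "exp (- walk \<omega> n) * fl_weight i (exp (- walk \<omega> n)) b \<le> 2 / \<delta> * (1 / c1\<^sup>2)" using k d by (intro mult_mono) auto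
    moreover have "cut \<delta> (exp (wmin \<omega> n)) * (exp (- walk \<omega> n) * fl_weight i (exp (- walk \<omega> n)) b) \<le> exp (- walk \<omega> n) * fl_weight i (exp (- walk \<omega> n)) b"
      using k cut_nonneg cut_le_1 by (intro mult_left_le_one_le) auto
    ultimately show ?thesis by linarith
  qed
  thus "block_approx i \<delta> R K m \<omega> \<le> 2 / \<delta> * (1 / c1\<^sup>2)" unfolding block_approx_def n_def[symmetric] b_def[symmetric] using d by auto
qed

lemma integrable_block_approx: "K \<ge> 1 \<Longrightarrow> \<delta> > 0 \<Longrightarrow> integrable S (block_approx i \<delta> R K m)"
  by (rule integrable_bounded[where B = "2 / \<delta> * (1 / c1\<^sup>2)"]) (use block_approx_bounds in \<open>auto simp: abs_of_nonneg\<close>)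

text \<open>The increment of the middle block satisfies exp (-S) = \<zeta> / \<xi> = \<xi> \<zeta> /
  \<xi>^2. The extracted \<xi> \<zeta> = exp (L - (S - L)) is the weight whose mean is
  \<open>wmin_mgf 1 1\<close>, hence of order m^(-3/2).\<close>

lemma block_approx_insert:
  fixes \<omega> \<omega>' :: "nat \<Rightarrow> 'b" and m :: nat
  assumes d: "\<delta> > 0"
  defines "\<xi> \<equiv> exp (wmin \<omega>' m)" and "\<zeta> \<equiv> exp (- (walk \<omega>' m - wmin \<omega>' m))"
  shows "block_approx i \<delta> R K m (comb_seq K \<omega> (comb_seq m \<omega>' (\<lambda>i. \<omega> (i + K)))) = \<xi> * \<zeta> * block_kernel i \<delta> R K \<omega> (\<xi>, \<zeta>)"
proof (cases "walk \<omega> K \<le> R")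
  case False
  thus ?thesis by (simp add: block_approx_def block_kernel_def walk_comb_left)
next
  case True
  define v where "v = (\<lambda>i. \<omega> (i + K))"
  define c where "c = comb_seq K \<omega> (comb_seq m \<omega>' v)"
  define y where "y = min (exp (wmin \<omega> K)) (exp (walk \<omega> K) * \<xi> / max 1 (\<zeta> * exp (- wmin v K)))"
  have pos: "\<xi> > 0" "\<zeta> > 0" by (auto simp: \<xi>_def \<zeta>_def)
  have zx: "exp (- walk \<omega>' m) = \<zeta> / \<xi>" by (simp add: \<xi>_def \<zeta>_def exp_diff[symmetric])
  have S1: "walk c (K + (m + K)) = walk \<omega> K + (walk \<omega>' m + walk v K)" by (simp only: c_def walk_comb)
  have S2: "walk c (K + m) = walk \<omega> K + walk \<omega>' m" by (simp only: c_def walk_comb walk_comb_left[OF order_refl])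
  have S3: "walk c K = walk \<omega> K" by (simp add: c_def walk_comb_left)
  have B1: "perpetuity c K = perpetuity \<omega> K" by (simp add: c_def perpetuity_comb_left)
  have B2: "(\<lambda>i. c (i + (K + m))) = v" by (auto simp: c_def comb_seq_def fun_eq_iff)
  have L: "exp (wmin c (K + (m + K))) = y"
  proof -
    have "wmin c (K + (m + K)) = min (wmin \<omega> K) (walk \<omega> K + min (wmin \<omega>' m) (walk \<omega>' m + wmin v K))" by (simp only: c_def wmin_comb)
    hence "exp (wmin c (K + (m + K))) = min (exp (wmin \<omega> K)) (exp (walk \<omega> K) * min \<xi> (exp (walk \<omega>' m + wmin v K)))"
      by (simp only: exp_min exp_add \<xi>_def)
    \<comment> \<open>The minimum contributed by the last block, written with \<xi> and \<zeta> only
      and without dividing by \<zeta>, so that the formula extends continuously to \<zeta> =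
      0.\<close>
    also have "min \<xi> (exp (walk \<omega>' m + wmin v K)) = \<xi> / max 1 (\<zeta> * exp (- wmin v K))"
    proof -
      have e: "exp (walk \<omega>' m + wmin v K) * (\<zeta> * exp (- wmin v K)) = \<xi>" unfolding \<xi>_def \<zeta>_def exp_add[symmetric] by simp
      have p: "0 < \<zeta> * exp (- wmin v K)" using pos by simp
      show ?thesis
      proof (cases "1 \<le> \<zeta> * exp (- wmin v K)")
        case True
        hence "exp (walk \<omega>' m + wmin v K) * 1 \<le> \<xi>" unfolding e[symmetric] by (intro mult_left_mono) auto
        moreover have "exp (walk \<omega>' m + wmin v K) = \<xi> / (\<zeta> * exp (- wmin v K))" by (rule eq_divide_imp[OF less_imp_neq[OF p, symmetric] e])
        ultimately show ?thesis using True by (simp add: max_def min_def)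
      next
        case False
        hence "\<xi> \<le> exp (walk \<omega>' m + wmin v K) * 1" unfolding e[symmetric] by (intro mult_left_mono) auto
        thus ?thesis using False by (simp add: max_def min_def)
      qed
    qed
    finally show ?thesis by (simp add: y_def)
  qed
  have "cut \<delta> y * (exp (- walk c (K + (m + K))) * fl_weight i (exp (- walk c (K + (m + K)))) (perpetuity \<omega> K + exp (- walk c (K + m)) * perpetuity v K)) = \<xi> * \<zeta> * block_kernel i \<delta> R K \<omega> (\<xi>, \<zeta>)"
  proof (cases "\<xi> \<ge> \<delta> * exp (- R) / 2")
    case True
    hence wmax_mgf: "max (\<delta> * exp (- R) / 2) \<xi> = \<xi>" by simp
    have a: "exp (- walk c (K + (m + K))) = exp (- walk \<omega> K) * exp (- walk v K) * (\<zeta> / \<xi>)" unfolding S1 zx[symmetric] exp_add[symmetric] by (simp add: algebra_simps)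
    have b: "exp (- walk c (K + m)) = exp (- walk \<omega> K) * (\<zeta> / \<xi>)" unfolding S2 zx[symmetric] exp_add[symmetric] by (simp add: algebra_simps)
    show ?thesis unfolding block_kernel_def fst_conv snd_conv wmax_mgf v_def[symmetric] a b y_def[symmetric] using \<open>walk \<omega> K \<le> R\<close> pos
      by (simp add: power2_eq_square mult_ac)
  next
    case False
    \<comment> \<open>The total minimum is at most the middle one, and S_K <= R bounds the level
      where the middle block starts; so a small \<xi> forces \<open>y\<close> below \<delta> /
      2.\<close>
    have "y \<le> exp (walk \<omega> K) * \<xi> / max 1 (\<zeta> * exp (- wmin v K))" by (simp add: y_def)
    also have "\<dots> \<le> exp (walk \<omega> K) * \<xi> / 1" using pos by (intro divide_left_mono) auto
    also have "\<dots> \<le> exp R * (\<delta> * exp (- R) / 2)" using \<open>walk \<omega> K \<le> R\<close> False pos unfolding div_by_1 by (intro mult_mono) auto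
    also have "\<dots> = \<delta> / 2" by (simp add: exp_minus)
    finally have "cut \<delta> y = 0" by (rule cut_eq_0[OF d])
    thus ?thesis unfolding block_kernel_def fst_conv snd_conv v_def[symmetric] y_def[symmetric] by simp
  qed
  thus ?thesis unfolding block_approx_def v_def[symmetric] c_def[symmetric] L B1 B2 S3 using True by simp
qed

lemma block_kernel_bound:
  assumes K: "K \<ge> 1" and d: "\<delta> > 0" and p: "0 \<le> snd p"
  shows "\<bar>block_kernel i \<delta> R K \<omega> p\<bar> \<le> exp (real K * x0) * exp (real K * x0) / (\<delta> * exp (- R) / 2)\<^sup>2 * (1 / c1\<^sup>2)"
proof -
  define v where "v = (\<lambda>i. \<omega> (i + K))"
  define \<xi>0 where "\<xi>0 = \<delta> * exp (- R) / 2"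
  have \<xi>0: "\<xi>0 > 0" using d by (simp add: \<xi>0_def)
  define q where "q = snd p / max \<xi>0 (fst p)"
  have q: "q \<ge> 0" unfolding q_def using p \<xi>0 by (intro divide_nonneg_pos) auto
  define a where "a = exp (- walk \<omega> K) * exp (- walk v K)"
  have a: "0 \<le> a" "a \<le> exp (real K * x0) * exp (real K * x0)" unfolding a_def
    using walk_lower[of K \<omega>] walk_lower[of K v] by (auto intro!: mult_mono)
  have b: "c1 \<le> perpetuity \<omega> K + exp (- walk \<omega> K) * q * perpetuity v K" using perpetuity_ge[OF K, of \<omega>] perpetuity_nonneg[of v K] q by (simp add: add_increasing2)
  have k: "fl_weight i (a * q) (perpetuity \<omega> K + exp (- walk \<omega> K) * q * perpetuity v K) \<le> 1 / c1\<^sup>2" "0 \<le> fl_weight i (a * q) (perpetuity \<omega> K + exp (- walk \<omega> K) * q * perpetuity v K)"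
    using fl_weight_le_c1[OF _ b, of "a * q" i] a q by auto
  have m: "a / (max \<xi>0 (fst p))\<^sup>2 \<le> exp (real K * x0) * exp (real K * x0) / \<xi>0\<^sup>2"
    using a \<xi>0 by (intro frac_le power_mono) auto
  have "cut \<delta> z * (a / (max \<xi>0 (fst p))\<^sup>2) * fl_weight i (a * q) (perpetuity \<omega> K + exp (- walk \<omega> K) * q * perpetuity v K) \<le> 1 * (exp (real K * x0) * exp (real K * x0) / \<xi>0\<^sup>2) * (1 / c1\<^sup>2)" for z
    using k m a cut_nonneg cut_le_1 by (intro mult_mono mult_nonneg_nonneg) auto
  moreover have "0 \<le> cut \<delta> z * (a / (max \<xi>0 (fst p))\<^sup>2) * fl_weight i (a * q) (perpetuity \<omega> K + exp (- walk \<omega> K) * q * perpetuity v K)" for z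
    using k a cut_nonneg by (intro mult_nonneg_nonneg) auto
  ultimately show ?thesis unfolding block_kernel_def v_def[symmetric] \<xi>0_def[symmetric] q_def[symmetric] a_def[symmetric] by auto
qed

lemma continuous_on_block_kernel:
  assumes K: "K \<ge> 1" and d: "\<delta> > 0"
  shows "continuous_on {p. 0 \<le> snd p} (block_kernel i \<delta> R K \<omega>)"
proof (cases "walk \<omega> K \<le> R")
  case True
  have \<xi>0: "\<delta> * exp (- R) / 2 > 0" using d by simp
  hence m: "max (\<delta> * exp (- R) / 2) z > 0" for z by (simp add: less_max_iff_disj)
  have m1: "max 1 z \<noteq> (0::real)" for z by (simp add: max_def)
  have b: "0 < perpetuity \<omega> K" using perpetuity_ge[OF K, of \<omega>] c1_pos by linarith
  define v where "v = (\<lambda>i. \<omega> (i + K))"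
  define q where "q p = snd p / max (\<delta> * exp (- R) / 2) (fst p)" for p :: "real \<times> real"
  define y where "y p = min (exp (wmin \<omega> K)) (exp (walk \<omega> K) * fst p / max 1 (snd p * exp (- wmin v K)))" for p :: "real \<times> real"
  have q: "continuous_on {p. 0 \<le> snd p} q" unfolding q_def using m by (intro continuous_intros) (auto simp: less_imp_neq[OF m, symmetric])
  have q0: "0 \<le> q p" if "0 \<le> snd p" for p unfolding q_def using m[of "fst p"] that by simp
  have y: "continuous_on {p. 0 \<le> snd p} y" unfolding y_def using m1 by (intro continuous_intros) auto
  have c: "continuous_on {p. 0 \<le> snd p} (\<lambda>p. cut \<delta> (y p))" by (rule continuous_on_cut[OF y])
  have d: "continuous_on {p. 0 \<le> snd p} (\<lambda>p. exp (- walk \<omega> K) * exp (- walk v K) / (max (\<delta> * exp (- R) / 2) (fst p))\<^sup>2)"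
    by (intro continuous_intros) (auto simp: less_imp_neq[OF m, symmetric])
  have k: "continuous_on {p. 0 \<le> snd p} (\<lambda>p. fl_weight i (exp (- walk \<omega> K) * exp (- walk v K) * q p) (perpetuity \<omega> K + exp (- walk \<omega> K) * q p * perpetuity v K))"
    by (intro continuous_on_fl_weight continuous_intros q) (auto intro!: mult_nonneg_nonneg add_pos_nonneg q0 b perpetuity_nonneg)
  show ?thesis unfolding block_kernel_def v_def[symmetric] using continuous_on_mult[OF continuous_on_mult[OF c d] k] True
    unfolding q_def y_def by simp
next
  case False
  thus ?thesis by (simp add: block_kernel_def)
qed

lemma bipoly_limit:
  assumes "bipoly f"
  shows "(\<forall>m. integrable S (\<lambda>\<omega>. exp (wmin \<omega> m) * exp (- (walk \<omega> m - wmin \<omega> m)) * f (exp (wmin \<omega> m), exp (- (walk \<omega> m - wmin \<omega> m))))) \<and>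
    convergent (\<lambda>m. r32 m * (\<integral>\<omega>. exp (wmin \<omega> m) * exp (- (walk \<omega> m - wmin \<omega> m)) * f (exp (wmin \<omega> m), exp (- (walk \<omega> m - wmin \<omega> m))) \<partial>S))"
  using assms
proof (induction f rule: bipoly.induct)
  case (monom c j k)
  have e: "exp (wmin \<omega> m) * exp (- (walk \<omega> m - wmin \<omega> m)) * (c * (exp (wmin \<omega> m) ^ j * exp (- (walk \<omega> m - wmin \<omega> m)) ^ k))
     = c * exp (real (Suc j) * wmin \<omega> m - real (Suc k) * (walk \<omega> m - wmin \<omega> m))" for \<omega> m
  proof -
    have "exp (real (Suc j) * wmin \<omega> m - real (Suc k) * (walk \<omega> m - wmin \<omega> m)) = exp (real (Suc j) * wmin \<omega> m) * exp (real (Suc k) * (- (walk \<omega> m - wmin \<omega> m)))"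
      unfolding exp_add[symmetric] by (rule arg_cong[of _ _ exp]) (simp only: mult_minus_right add_uminus_conv_diff)
    also have "\<dots> = exp (wmin \<omega> m) ^ Suc j * exp (- (walk \<omega> m - wmin \<omega> m)) ^ Suc k" by (simp only: exp_of_nat_mult)
    finally show ?thesis by simp
  qed
  obtain l where "(\<lambda>n. real n * sqrt (real n) * wmin_mgf (real (Suc j)) (real (Suc k)) n) \<longlonglongrightarrow> l"
    using wmin_mgf_asymp(2)[of "real (Suc j)" "real (Suc k)"] by auto
  hence "(\<lambda>n. c * (r32 n * wmin_mgf (real (Suc j)) (real (Suc k)) n)) \<longlonglongrightarrow> c * l" unfolding r32_def by (intro tendsto_mult tendsto_const)
  moreover have "c * (r32 m * wmin_mgf (real (Suc j)) (real (Suc k)) m) = r32 m * (\<integral>\<omega>. c * exp (real (Suc j) * wmin \<omega> m - real (Suc k) * (walk \<omega> m - wmin \<omega> m)) \<partial>S)" for m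
    unfolding wmin_mgf_def integral_mult_right_zero by (rule mult.left_commute)
  ultimately have "(\<lambda>m. r32 m * (\<integral>\<omega>. c * exp (real (Suc j) * wmin \<omega> m - real (Suc k) * (walk \<omega> m - wmin \<omega> m)) \<partial>S)) \<longlonglongrightarrow> c * l"
    by (simp only:)
  thus ?case unfolding fst_conv snd_conv e
    by (intro conjI allI integrable_mult_right integrable_wmin_mgf convergentI) auto
next
  case (add f g)
  define A where "A m \<omega> = exp (wmin \<omega> m) * exp (- (walk \<omega> m - wmin \<omega> m))" for m \<omega>
  define P where "P m \<omega> = (exp (wmin \<omega> m), exp (- (walk \<omega> m - wmin \<omega> m)))" for m \<omega>
  note IH = add.IH[folded A_def P_def]
  have i: "integrable S (\<lambda>\<omega>. A m \<omega> * f (P m \<omega>))" "integrable S (\<lambda>\<omega>. A m \<omega> * g (P m \<omega>))" for m using IH by auto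
  have "r32 m * (\<integral>\<omega>. A m \<omega> * (f (P m \<omega>) + g (P m \<omega>)) \<partial>S) = r32 m * (\<integral>\<omega>. A m \<omega> * f (P m \<omega>) \<partial>S) + r32 m * (\<integral>\<omega>. A m \<omega> * g (P m \<omega>) \<partial>S)" for m
    unfolding distrib_left Bochner_Integration.integral_add[OF i] by (rule refl)
  moreover have "convergent (\<lambda>m. r32 m * (\<integral>\<omega>. A m \<omega> * f (P m \<omega>) \<partial>S) + r32 m * (\<integral>\<omega>. A m \<omega> * g (P m \<omega>) \<partial>S))"
    using IH by (intro convergent_add) auto
  moreover have "integrable S (\<lambda>\<omega>. A m \<omega> * (f (P m \<omega>) + g (P m \<omega>)))" for m
    unfolding distrib_left by (intro Bochner_Integration.integrable_add i)
  ultimately show ?case unfolding A_def[symmetric] P_def[symmetric] by simp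
qed

text \<open>Integrating out the end blocks leaves a continuous function \<Gamma> on the unit square,
  evaluated under the weight \<open>A\<close>. Polynomials approximate \<Gamma> uniformly; their
  limits exist by \<open>bipoly_limit\<close>, and the error is controlled since \<open>A\<close>
  has mean at most C m^(-3/2).\<close>

lemma block_approx_convergent:
  assumes K: "K \<ge> 1" and d: "\<delta> > 0"
  shows "convergent (\<lambda>m. r32 m * (\<integral>\<omega>. block_approx i \<delta> R K m \<omega> \<partial>S))"
proof -
  define Q where "Q = (cbox (0, 0) (1, 1) :: (real \<times> real) set)"
  define \<Gamma> where "\<Gamma> p = (\<integral>\<omega>. block_kernel i \<delta> R K \<omega> p \<partial>S)" for p
  define Bd where "Bd = exp (real K * x0) * exp (real K * x0) / (\<delta> * exp (- R) / 2)\<^sup>2 * (1 / c1\<^sup>2)"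
  have Q: "p \<in> Q \<longleftrightarrow> 0 \<le> fst p \<and> fst p \<le> 1 \<and> 0 \<le> snd p \<and> snd p \<le> 1" for p by (cases p) (auto simp: Q_def)
  have cont: "continuous_on Q \<Gamma>" unfolding continuous_on_sequentially
  proof (intro allI ballI impI)
    fix u a assume a: "a \<in> Q" and u: "(\<forall>n. u n \<in> Q) \<and> u \<longlonglongrightarrow> a"
    have "(\<lambda>n. \<integral>\<omega>. block_kernel i \<delta> R K \<omega> (u n) \<partial>S) \<longlonglongrightarrow> (\<integral>\<omega>. block_kernel i \<delta> R K \<omega> a \<partial>S)"
    proof (rule integral_dominated_convergence[where w = "\<lambda>_. Bd"])
      show "AE \<omega> in S. (\<lambda>n. block_kernel i \<delta> R K \<omega> (u n)) \<longlonglongrightarrow> block_kernel i \<delta> R K \<omega> a"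
      proof (intro always_eventually allI)
        fix \<omega>
        have "continuous_on Q (block_kernel i \<delta> R K \<omega>)" by (rule continuous_on_subset[OF continuous_on_block_kernel[OF K d]]) (auto simp: Q)
        thus "(\<lambda>n. block_kernel i \<delta> R K \<omega> (u n)) \<longlonglongrightarrow> block_kernel i \<delta> R K \<omega> a"
          using a u unfolding continuous_on_sequentially by (auto simp: o_def)
      qed
      show "AE \<omega> in S. norm (block_kernel i \<delta> R K \<omega> (u n)) \<le> Bd" for n
        using block_kernel_bound[OF K d, of "u n" i R] u Q[of "u n"] unfolding Bd_def by (intro always_eventually allI) auto
    qed auto
    thus "(\<Gamma> \<circ> u) \<longlonglongrightarrow> \<Gamma> a" by (simp add: \<Gamma>_def o_def)
  qed
  define A where "A m \<omega> = exp (wmin \<omega> m) * exp (- (walk \<omega> m - wmin \<omega> m))" for m \<omega>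
  define P where "P m \<omega> = (exp (wmin \<omega> m), exp (- (walk \<omega> m - wmin \<omega> m)))" for m \<omega>
  have A': "A m = (\<lambda>\<omega>. exp (1 * wmin \<omega> m - 1 * (walk \<omega> m - wmin \<omega> m)))" for m
    unfolding A_def exp_add[symmetric] by simp
  have Abb: "(\<integral>\<omega>. A m \<omega> \<partial>S) = wmin_mgf 1 1 m" "integrable S (A m)" for m
    unfolding A' wmin_mgf_def by (rule refl, rule integrable_wmin_mgf) auto
  have PQ: "P m \<omega> \<in> Q" for m \<omega> using wmin_nonpos[of \<omega> m] wmin_le_walk[of \<omega> m] by (simp add: Q P_def)
  have e: "(\<integral>\<omega>. block_approx i \<delta> R K m (comb_seq K \<omega> (comb_seq m \<omega>' (\<lambda>i. \<omega> (i + K)))) \<partial>S) = A m \<omega>' * \<Gamma> (P m \<omega>')" for m \<omega>'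
    unfolding block_approx_insert[OF d] \<Gamma>_def A_def P_def by (rule integral_mult_right_zero)
  have EW: "(\<integral>\<omega>. block_approx i \<delta> R K m \<omega> \<partial>S) = (\<integral>\<omega>. A m \<omega> * \<Gamma> (P m \<omega>) \<partial>S)" "integrable S (\<lambda>\<omega>. A m \<omega> * \<Gamma> (P m \<omega>))" for m
    using E_insert[OF integrable_block_approx[OF K d], of i R m K m] unfolding e by auto
  obtain C where C: "C > 0" "\<And>n. n \<ge> 1 \<Longrightarrow> wmin_mgf 1 1 n \<le> C / (real n * sqrt (real n))" using wmin_mgf_asymp(3)[of 1 1] by auto
  show ?thesis
  proof (rule convergent_approx)
    fix \<epsilon> :: real assume eps: "\<epsilon> > 0"
    obtain g where g: "real_polynomial_function g" "\<And>p. p \<in> Q \<Longrightarrow> \<bar>\<Gamma> p - g p\<bar> < \<epsilon> / C"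
      using Stone_Weierstrass_real_polynomial_function[OF _ cont, of "\<epsilon> / C"] eps C unfolding Q_def by auto
    note bl = bipoly_limit[OF bipoly_real_polynomial[OF g(1)], folded A_def P_def]
    define v where "v m = r32 m * (\<integral>\<omega>. A m \<omega> * g (P m \<omega>) \<partial>S)" for m
    have "\<bar>r32 m * (\<integral>\<omega>. block_approx i \<delta> R K m \<omega> \<partial>S) - v m\<bar> \<le> \<epsilon>" if m: "m \<ge> 1" for m
    proof -
      have "(\<integral>\<omega>. A m \<omega> * \<Gamma> (P m \<omega>) \<partial>S) - (\<integral>\<omega>. A m \<omega> * g (P m \<omega>) \<partial>S) = (\<integral>\<omega>. A m \<omega> * \<Gamma> (P m \<omega>) - A m \<omega> * g (P m \<omega>) \<partial>S)"
        using EW(2) bl by (intro Bochner_Integration.integral_diff[symmetric]) auto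
      hence "\<bar>(\<integral>\<omega>. A m \<omega> * \<Gamma> (P m \<omega>) \<partial>S) - (\<integral>\<omega>. A m \<omega> * g (P m \<omega>) \<partial>S)\<bar> \<le> (\<integral>\<omega>. \<bar>A m \<omega> * \<Gamma> (P m \<omega>) - A m \<omega> * g (P m \<omega>)\<bar> \<partial>S)"
        by (simp only: integral_abs_bound)
      also have "\<dots> \<le> (\<integral>\<omega>. A m \<omega> * (\<epsilon> / C) \<partial>S)"
      proof (rule integral_mono')
        show "integrable S (\<lambda>\<omega>. A m \<omega> * (\<epsilon> / C))" using Abb(2) by (intro integrable_mult_left)
        fix \<omega>
        have "\<bar>A m \<omega> * \<Gamma> (P m \<omega>) - A m \<omega> * g (P m \<omega>)\<bar> = A m \<omega> * \<bar>\<Gamma> (P m \<omega>) - g (P m \<omega>)\<bar>"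
          by (simp add: right_diff_distrib[symmetric] abs_mult A_def)
        also have "\<dots> \<le> A m \<omega> * (\<epsilon> / C)" using g(2)[OF PQ, of m \<omega>] by (intro mult_left_mono) (auto simp: A_def)
        finally show "\<bar>A m \<omega> * \<Gamma> (P m \<omega>) - A m \<omega> * g (P m \<omega>)\<bar> \<le> A m \<omega> * (\<epsilon> / C)" .
        show "0 \<le> A m \<omega> * (\<epsilon> / C)" using eps C by (simp add: A_def)
      qed
      also have "\<dots> = wmin_mgf 1 1 m * (\<epsilon> / C)" by (simp add: Abb)
      finally have "\<bar>r32 m * (\<integral>\<omega>. block_approx i \<delta> R K m \<omega> \<partial>S) - v m\<bar> \<le> r32 m * (wmin_mgf 1 1 m * (\<epsilon> / C))"
        unfolding EW v_def right_diff_distrib[symmetric] abs_mult abs_of_nonneg[OF r32_nonneg] by (intro mult_left_mono r32_nonneg)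
      also have "\<dots> \<le> r32 m * (C / (real m * sqrt (real m)) * (\<epsilon> / C))" using C eps m r32_nonneg by (intro mult_left_mono mult_right_mono) auto
      also have "\<dots> = \<epsilon>" using C m by (simp add: r32_def)
      finally show ?thesis .
    qed
    thus "\<exists>v. convergent v \<and> (\<forall>\<^sub>F m in sequentially. \<bar>r32 m * (\<integral>\<omega>. block_approx i \<delta> R K m \<omega> \<partial>S) - v m\<bar> \<le> \<epsilon>)"
      using bl unfolding eventually_at_top_linorder v_def by (intro exI[of _ "\<lambda>m. r32 m * (\<integral>\<omega>. A m \<omega> * g (P m \<omega>) \<partial>S)"]) auto
  qed
qed

end

lemma r32_shift_ratio: "(\<lambda>m. r32 (m + K) / r32 m) \<longlonglongrightarrow> 1"
  unfolding r32_def of_nat_add by real_asymp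

section \<open>Error of the block approximation\<close>

context affine_walk
begin

text \<open>The contribution of time k to the functional, up to its bounded coefficient, weighted by
  exp (-S_n) on paths without a deep minimum. For k = 0 it is the weight itself.\<close>

definition two_time :: "real \<Rightarrow> nat \<Rightarrow> nat \<Rightarrow> real" where
  "two_time \<delta> k n = (\<integral>\<omega>. (if \<delta> \<le> exp (wmin \<omega> n) then exp (- walk \<omega> n) * exp (- walk \<omega> k) else 0) \<partial>S)"

lemma exp_neg_walk_le:
  assumes "0 < \<delta>" "\<delta> \<le> exp (wmin \<omega> n)" "k \<le> n"
  shows "exp (- walk \<omega> k) \<le> 1 / \<delta>"
proof -
  have "\<delta> \<le> exp (walk \<omega> k)" using assms(2) wmin_le[OF assms(3), of \<omega>] by (meson exp_le_cancel_iff order_trans)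
  thus ?thesis using assms(1) by (simp add: exp_minus field_simps)
qed

lemma integrable_two_time:
  assumes d: "0 < \<delta>" and k: "k \<le> n"
  shows "integrable S (\<lambda>\<omega>. if \<delta> \<le> exp (wmin \<omega> n) then exp (- walk \<omega> n) * exp (- walk \<omega> k) else 0)"
proof (rule integrable_bounded[where B = "1 / \<delta> * (1 / \<delta>)"])
  show "norm (if \<delta> \<le> exp (wmin \<omega> n) then exp (- walk \<omega> n) * exp (- walk \<omega> k) else 0) \<le> 1 / \<delta> * (1 / \<delta>)" for \<omega>
    using mult_mono[OF exp_neg_walk_le[OF d _ order_refl, of \<omega> n] exp_neg_walk_le[OF d _ k, of \<omega>]] d by auto
qed measurable

text \<open>Half of the exponent in the minimum is traded for the small factor sqrt \<delta>; the
  remaining half still has rate n^(-3/2), because \<open>wmin_mgf_asymp\<close> covers every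
  positive parameter.\<close>

lemma exp_split_cut:
  assumes d: "0 < \<delta>" and s: "exp (wmin \<omega> n) \<le> \<delta>"
  shows "exp (1 * wmin \<omega> n - 1 * (walk \<omega> n - wmin \<omega> n)) \<le> sqrt \<delta> * exp (1/2 * wmin \<omega> n - 1 * (walk \<omega> n - wmin \<omega> n))"
proof -
  have "exp (wmin \<omega> n / 2) = sqrt (exp (wmin \<omega> n))"
    by (rule real_sqrt_unique[symmetric]) (auto simp: power2_eq_square exp_add[symmetric])
  also have "\<dots> \<le> sqrt \<delta>" using s by simp
  finally have "exp (wmin \<omega> n / 2) * exp (1/2 * wmin \<omega> n - 1 * (walk \<omega> n - wmin \<omega> n)) \<le> sqrt \<delta> * exp (1/2 * wmin \<omega> n - 1 * (walk \<omega> n - wmin \<omega> n))"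
    by (intro mult_right_mono) auto
  thus ?thesis unfolding exp_add[symmetric] by simp
qed

lemma exp_cut_le:
  assumes d: "0 < \<delta>" and s: "\<delta> \<le> exp (wmin \<omega> n)"
  shows "exp (- walk \<omega> n) \<le> (1 / \<delta>)\<^sup>2 * exp (2 * wmin \<omega> n - walk \<omega> n)"
proof -
  have "1 \<le> (1 / \<delta>) * exp (wmin \<omega> n)" using s d by (simp add: field_simps)
  hence "1\<^sup>2 \<le> ((1 / \<delta>) * exp (wmin \<omega> n))\<^sup>2" by (intro power_mono) auto
  hence "1 \<le> (1 / \<delta>)\<^sup>2 * exp (2 * wmin \<omega> n)" by (simp add: power_mult_distrib power2_eq_square exp_add[symmetric])
  hence "1 * exp (- walk \<omega> n) \<le> (1 / \<delta>)\<^sup>2 * exp (2 * wmin \<omega> n) * exp (- walk \<omega> n)" by (intro mult_right_mono) auto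
  thus ?thesis by (simp add: mult.assoc exp_add[symmetric])
qed

text \<open>The three terms are the prices of the three simplifications: cutting off deep minima,
  dropping the middle summands (Lipschitz dependence of \<open>fl_weight\<close> on b), and
  discarding high levels at time \<open>K\<close>.\<close>

lemma approx_pointwise:
  fixes m :: nat
  assumes K: "K \<ge> 1" and d: "0 < \<delta>"
  defines "n \<equiv> K + (m + K)"
  shows "\<bar>exp (- walk \<omega> n) * fl_weight i (exp (- walk \<omega> n)) (perpetuity \<omega> n) - block_approx i \<delta> R K m \<omega>\<bar> \<le>
    1 / perp_const\<^sup>2 * (sqrt \<delta> * exp (1/2 * wmin \<omega> n - 1 * (walk \<omega> n - wmin \<omega> n)))
    + real (i + 2) / c1 ^ 3 * c2 * (\<Sum>k\<in>{K..<K+m}. if \<delta> / 2 \<le> exp (wmin \<omega> n) then exp (- walk \<omega> n) * exp (- walk \<omega> k) else 0)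
    + 1 / c1\<^sup>2 * ((2 / \<delta>)\<^sup>2 * (if R < walk \<omega> K then exp (2 * wmin \<omega> n - walk \<omega> n) else 0))"
proof -
  define a where "a = exp (- walk \<omega> n)"
  define b where "b = perpetuity \<omega> n"
  define b' where "b' = perpetuity \<omega> K + exp (- walk \<omega> (K + m)) * perpetuity (\<lambda>i. \<omega> (i + (K + m))) K"
  define c where "c = cut \<delta> (exp (wmin \<omega> n))"
  define I where "I = (if walk \<omega> K \<le> R then 1 else (0::real))"
  have W: "block_approx i \<delta> R K m \<omega> = I * (c * (a * fl_weight i a b'))" by (simp add: block_approx_def I_def c_def a_def b'_def n_def)
  have a: "a > 0" by (simp add: a_def)
  have c: "0 \<le> c" "c \<le> 1" by (auto simp: c_def cut_nonneg cut_le_1)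
  have n1: "n \<ge> 1" using K by (simp add: n_def)
  have b: "c1 \<le> b" "c1 \<le> b'" using perpetuity_ge[OF n1] BT_ge[OF K, of \<omega> m] by (auto simp: b_def b'_def)
  have wmin_mgf: "b - b' = (\<Sum>k\<in>{K..<K+m}. e (\<omega> k) * exp (- walk \<omega> k))"
  proof -
    have "b = perpetuity \<omega> (K + m) + exp (- walk \<omega> (K + m)) * perpetuity (\<lambda>i. \<omega> (i + (K + m))) K"
      unfolding b_def n_def using perpetuity_shift[of \<omega> "K + m" K] by (simp add: ac_simps)
    moreover have "perpetuity \<omega> (K + m) = perpetuity \<omega> K + (\<Sum>k\<in>{K..<K+m}. e (\<omega> k) * exp (- walk \<omega> k))"
      unfolding perpetuity_def atLeast0LessThan[symmetric] by (rule sum.atLeastLessThan_concat[symmetric]) auto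
    ultimately show ?thesis by (simp add: b'_def)
  qed
  have wmin_mgf_abs: "\<bar>b - b'\<bar> \<le> c2 * (\<Sum>k\<in>{K..<K+m}. exp (- walk \<omega> k))"
  proof -
    have "0 \<le> b - b'" unfolding wmin_mgf using e_pos by (intro sum_nonneg mult_nonneg_nonneg) (auto intro: less_imp_le)
    moreover have "b - b' \<le> c2 * (\<Sum>k\<in>{K..<K+m}. exp (- walk \<omega> k))" unfolding wmin_mgf sum_distrib_left
      by (intro sum_mono mult_right_mono e_upper) auto
    ultimately show ?thesis by simp
  qed
  \<comment> \<open>Telescoping over the intermediate quantities: insert the cutoff
    \<open>c\<close>, then replace \<open>b\<close> by \<open>b'\<close>, then insert the indicator
    \<open>I\<close>.\<close>
  have "\<bar>a * fl_weight i a b - block_approx i \<delta> R K m \<omega>\<bar> = \<bar>a * fl_weight i a b * (1 - c) + c * a * (fl_weight i a b - fl_weight i a b') + (1 - I) * (c * a * fl_weight i a b')\<bar>"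
    unfolding W by (simp add: algebra_simps)
  also have "\<dots> \<le> \<bar>a * fl_weight i a b * (1 - c)\<bar> + \<bar>c * a * (fl_weight i a b - fl_weight i a b')\<bar> + \<bar>(1 - I) * (c * a * fl_weight i a b')\<bar>" by linarith
  also have "\<dots> \<le> 1 / perp_const\<^sup>2 * (sqrt \<delta> * exp (1/2 * wmin \<omega> n - 1 * (walk \<omega> n - wmin \<omega> n)))
    + real (i + 2) / c1 ^ 3 * c2 * (\<Sum>k\<in>{K..<K+m}. if \<delta> / 2 \<le> exp (wmin \<omega> n) then exp (- walk \<omega> n) * exp (- walk \<omega> k) else 0)
    + 1 / c1\<^sup>2 * ((2 / \<delta>)\<^sup>2 * (if R < walk \<omega> K then exp (2 * wmin \<omega> n - walk \<omega> n) else 0))"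
  proof (intro add_mono)
    show "\<bar>a * fl_weight i a b * (1 - c)\<bar> \<le> 1 / perp_const\<^sup>2 * (sqrt \<delta> * exp (1/2 * wmin \<omega> n - 1 * (walk \<omega> n - wmin \<omega> n)))"
    proof (cases "\<delta> \<le> exp (wmin \<omega> n)")
      case True
      thus ?thesis using cut_eq_1[OF d True] d by (simp add: c_def)
    next
      case False
      have h: "a * fl_weight i a b \<le> 1 / perp_const\<^sup>2 * exp (1 * wmin \<omega> n - 1 * (walk \<omega> n - wmin \<omega> n))" "0 \<le> a * fl_weight i a b"
        unfolding a_def b_def by (rule survival_weight_integrand_le[OF n1])+
      have "\<bar>a * fl_weight i a b * (1 - c)\<bar> \<le> a * fl_weight i a b" using h(2) c abs_of_nonneg[OF mult_nonneg_nonneg[OF h(2), of "1 - c"]] mult_left_le[OF _ h(2), of "1 - c"] by simp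
      also have "\<dots> \<le> 1 / perp_const\<^sup>2 * (sqrt \<delta> * exp (1/2 * wmin \<omega> n - 1 * (walk \<omega> n - wmin \<omega> n)))"
        by (rule order_trans[OF h(1)], rule mult_left_mono[OF exp_split_cut[OF d]]) (use False in auto)
      finally show ?thesis .
    qed
    show "\<bar>c * a * (fl_weight i a b - fl_weight i a b')\<bar> \<le> real (i + 2) / c1 ^ 3 * c2 * (\<Sum>k\<in>{K..<K+m}. if \<delta> / 2 \<le> exp (wmin \<omega> n) then exp (- walk \<omega> n) * exp (- walk \<omega> k) else 0)"
    proof (cases "\<delta> / 2 \<le> exp (wmin \<omega> n)")
      case True
      have "\<bar>c * a * (fl_weight i a b - fl_weight i a b')\<bar> = c * (a * \<bar>fl_weight i a b - fl_weight i a b'\<bar>)" using a c by (simp add: abs_mult)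
      also have "\<dots> \<le> a * \<bar>fl_weight i a b - fl_weight i a b'\<bar>" using a c by (intro mult_left_le_one_le) auto
      also have "\<dots> \<le> a * (real (i + 2) / c1 ^ 3 * (c2 * (\<Sum>k\<in>{K..<K+m}. exp (- walk \<omega> k))))"
        by (intro mult_left_mono order_trans[OF fl_weight_lipschitz[OF less_imp_le[OF a] c1_pos b]] wmin_mgf_abs) (use a c1_pos in auto)
      also have "\<dots> = real (i + 2) / c1 ^ 3 * c2 * (\<Sum>k\<in>{K..<K+m}. a * exp (- walk \<omega> k))" by (simp add: sum_distrib_left[symmetric])
      finally show ?thesis using True by (simp add: a_def)
    next
      case False
      thus ?thesis using cut_eq_0[OF d, of "exp (wmin \<omega> n)"] by (simp add: c_def)
    qed
    show "\<bar>(1 - I) * (c * a * fl_weight i a b')\<bar> \<le> 1 / c1\<^sup>2 * ((2 / \<delta>)\<^sup>2 * (if R < walk \<omega> K then exp (2 * wmin \<omega> n - walk \<omega> n) else 0))"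
    proof (cases "R < walk \<omega> K \<and> \<delta> / 2 \<le> exp (wmin \<omega> n)")
      case True
      have k: "fl_weight i a b' \<le> 1 / c1\<^sup>2" "0 \<le> fl_weight i a b'" using fl_weight_le_c1[OF less_imp_le[OF a] b(2)] by auto
      have "\<bar>(1 - I) * (c * a * fl_weight i a b')\<bar> = c * (a * fl_weight i a b')" using True a c k by (simp add: I_def abs_mult)
      also have "\<dots> \<le> a * fl_weight i a b'" using a c k by (intro mult_left_le_one_le) auto
      also have "\<dots> \<le> ((1 / (\<delta>/2))\<^sup>2 * exp (2 * wmin \<omega> n - walk \<omega> n)) * (1 / c1\<^sup>2)"
        unfolding a_def[symmetric] using exp_cut_le[of "\<delta>/2" \<omega> n] True d k a by (intro mult_mono) (auto simp: a_def)
      finally show ?thesis using True by (simp add: mult_ac)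
    next
      case False
      thus ?thesis using cut_eq_0[OF d, of "exp (wmin \<omega> n)"] by (auto simp: c_def I_def not_less)
    qed
  qed
  finally show ?thesis unfolding a_def b_def .
qed

lemma integrable_2LL: "integrable S (\<lambda>\<omega>. if R < walk \<omega> K then exp (2 * wmin \<omega> n - walk \<omega> n) else 0)"
proof (rule integrable_bounded[where B = 1])
  show "norm (if R < walk \<omega> K then exp (2 * wmin \<omega> n - walk \<omega> n) else 0) \<le> 1" for \<omega>
    using wmin_le_walk[of \<omega> n] wmin_nonpos[of \<omega> n] by auto
qed measurable

text \<open>Restart at time \<open>K\<close>: the remaining path is soft-killed from the level S_K >
  R >= 0, whose bound is linear in that level and hence integrable against the law of S_K.\<close>

lemma far_start_bound:
  assumes C: "\<And>n z. n \<ge> 1 \<Longrightarrow> z \<ge> 0 \<Longrightarrow> killed_exp n z \<le> C * (1 + z) / (real n * sqrt (real n))" and q: "q \<ge> 1" and R: "R \<ge> 0"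
  shows "(\<integral>\<omega>. (if R < walk \<omega> K then exp (2 * wmin \<omega> (K + q) - walk \<omega> (K + q)) else 0) \<partial>S)
    \<le> C / r32 q * (\<integral>\<omega>. (if R < walk \<omega> K then 1 + walk \<omega> K else 0) \<partial>S)"
proof -
  have iS: "integrable S (\<lambda>\<omega>. if R < walk \<omega> K then 1 + walk \<omega> K else 0)"
    by (rule Bochner_Integration.integrable_bound[where f = "\<lambda>\<omega>. 1 + walk \<omega> K"]) (auto intro!: walk_integrable)
  have "(\<integral>\<omega>. (if R < walk \<omega> K then exp (2 * wmin \<omega> (K + q) - walk \<omega> (K + q)) else 0) \<partial>S)
    \<le> (\<integral>\<omega>. C / r32 q * (if R < walk \<omega> K then 1 + walk \<omega> K else 0) \<partial>S)"
  proof (rule E_split_le[OF integrable_2LL integrable_mult_right[OF iS], where k = K])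
    fix \<omega>
    show "(\<integral>\<omega>'. (if R < walk (comb_seq K \<omega> \<omega>') K then exp (2 * wmin (comb_seq K \<omega> \<omega>') (K + q) - walk (comb_seq K \<omega> \<omega>') (K + q)) else 0) \<partial>S)
      \<le> C / r32 q * (if R < walk \<omega> K then 1 + walk \<omega> K else 0)"
    proof (cases "R < walk \<omega> K")
      case True
      have "(\<integral>\<omega>'. exp (2 * wmin (comb_seq K \<omega> \<omega>') (K + q) - walk (comb_seq K \<omega> \<omega>') (K + q)) \<partial>S)
        \<le> (\<integral>\<omega>'. exp (2 * min 0 (walk \<omega> K + wmin \<omega>' q) - (walk \<omega> K + walk \<omega>' q)) \<partial>S)"
      proof (rule integral_mono'[OF integrable_killed_exp])
        show "exp (2 * wmin (comb_seq K \<omega> \<omega>') (K + q) - walk (comb_seq K \<omega> \<omega>') (K + q)) \<le> exp (2 * min 0 (walk \<omega> K + wmin \<omega>' q) - (walk \<omega> K + walk \<omega>' q))" for \<omega>'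
          unfolding wmin_comb walk_comb using wmin_nonpos[of \<omega> K] by auto
      qed simp
      also have "\<dots> = killed_exp q (walk \<omega> K)" by (simp add: killed_exp_def)
      also have "\<dots> \<le> C * (1 + walk \<omega> K) / (real q * sqrt (real q))" using True R by (intro C q) simp
      finally show ?thesis using True by (simp add: walk_comb_left r32_def)
    qed (simp add: walk_comb_left)
  qed
  thus ?thesis by simp
qed

lemma far_start_small: "(\<lambda>N. \<integral>\<omega>. (if real N < walk \<omega> K then 1 + walk \<omega> K else 0) \<partial>S) \<longlonglongrightarrow> 0"
proof -
  have "(\<lambda>N. \<integral>\<omega>. (if real N < walk \<omega> K then 1 + walk \<omega> K else 0) \<partial>S) \<longlonglongrightarrow> (\<integral>\<omega>. 0 \<partial>S)"
  proof (rule integral_dominated_convergence[where w = "\<lambda>\<omega>. 1 + \<bar>walk \<omega> K\<bar>"])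
    show "AE \<omega> in S. (\<lambda>N. if real N < walk \<omega> K then 1 + walk \<omega> K else 0) \<longlonglongrightarrow> 0"
    proof (intro always_eventually allI)
      fix \<omega>
      obtain N0 :: nat where "walk \<omega> K \<le> real N0" using real_arch_simple by blast
      hence "\<forall>\<^sub>F N in sequentially. (if real N < walk \<omega> K then 1 + walk \<omega> K else 0) = 0"
        unfolding eventually_at_top_linorder by (intro exI[of _ N0]) auto
      thus "(\<lambda>N. if real N < walk \<omega> K then 1 + walk \<omega> K else 0) \<longlonglongrightarrow> 0" by (rule tendsto_eventually)
    qed
  qed (auto intro!: walk_integrable)
  thus ?thesis by simp
qed

lemma approx_bound:
  assumes K: "K \<ge> 1" and d: "0 < \<delta>"
  shows "\<bar>survival_weight i (K + (m + K)) - (\<integral>\<omega>. block_approx i \<delta> R K m \<omega> \<partial>S)\<bar> \<le>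
    1 / perp_const\<^sup>2 * (sqrt \<delta> * wmin_mgf (1/2) 1 (K + (m + K)))
    + real (i + 2) / c1 ^ 3 * c2 * (\<Sum>k\<in>{K..<K+m}. two_time (\<delta> / 2) k (K + (m + K)))
    + 1 / c1\<^sup>2 * ((2 / \<delta>)\<^sup>2 * (\<integral>\<omega>. (if R < walk \<omega> K then exp (2 * wmin \<omega> (K + (m + K)) - walk \<omega> (K + (m + K))) else 0) \<partial>S))"
proof -
  define n where "n = K + (m + K)"
  have n1: "n \<ge> 1" using K by (simp add: n_def)
  have i1: "integrable S (\<lambda>\<omega>. 1 / perp_const\<^sup>2 * (sqrt \<delta> * exp (1/2 * wmin \<omega> n - 1 * (walk \<omega> n - wmin \<omega> n))))"
    by (intro integrable_mult_right integrable_wmin_mgf) auto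
  have i2': "integrable S (\<lambda>\<omega>. if \<delta> / 2 \<le> exp (wmin \<omega> n) then exp (- walk \<omega> n) * exp (- walk \<omega> k) else 0)" if "k \<in> {K..<K+m}" for k
    using that d by (intro integrable_two_time) (auto simp: n_def)
  have i2: "integrable S (\<lambda>\<omega>. real (i + 2) / c1 ^ 3 * c2 * (\<Sum>k\<in>{K..<K+m}. if \<delta> / 2 \<le> exp (wmin \<omega> n) then exp (- walk \<omega> n) * exp (- walk \<omega> k) else 0))"
    by (intro integrable_mult_right Bochner_Integration.integrable_sum i2')
  have i3: "integrable S (\<lambda>\<omega>. 1 / c1\<^sup>2 * ((2 / \<delta>)\<^sup>2 * (if R < walk \<omega> K then exp (2 * wmin \<omega> n - walk \<omega> n) else 0)))"
    by (intro integrable_mult_right integrable_2LL)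
  have "\<bar>survival_weight i n - (\<integral>\<omega>. block_approx i \<delta> R K m \<omega> \<partial>S)\<bar> = \<bar>\<integral>\<omega>. exp (- walk \<omega> n) * fl_weight i (exp (- walk \<omega> n)) (perpetuity \<omega> n) - block_approx i \<delta> R K m \<omega> \<partial>S\<bar>"
    unfolding survival_weight_def Bochner_Integration.integral_diff[OF integrable_survival_weight[OF n1] integrable_block_approx[OF K d]] by (rule refl)
  also have "\<dots> \<le> (\<integral>\<omega>. \<bar>exp (- walk \<omega> n) * fl_weight i (exp (- walk \<omega> n)) (perpetuity \<omega> n) - block_approx i \<delta> R K m \<omega>\<bar> \<partial>S)" by (rule integral_abs_bound)
  also have "\<dots> \<le> (\<integral>\<omega>. 1 / perp_const\<^sup>2 * (sqrt \<delta> * exp (1/2 * wmin \<omega> n - 1 * (walk \<omega> n - wmin \<omega> n)))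
    + real (i + 2) / c1 ^ 3 * c2 * (\<Sum>k\<in>{K..<K+m}. if \<delta> / 2 \<le> exp (wmin \<omega> n) then exp (- walk \<omega> n) * exp (- walk \<omega> k) else 0)
    + 1 / c1\<^sup>2 * ((2 / \<delta>)\<^sup>2 * (if R < walk \<omega> K then exp (2 * wmin \<omega> n - walk \<omega> n) else 0)) \<partial>S)"
    by (rule integral_mono[OF integrable_abs[OF Bochner_Integration.integrable_diff[OF integrable_survival_weight[OF n1] integrable_block_approx[OF K d]]]
        Bochner_Integration.integrable_add[OF Bochner_Integration.integrable_add[OF i1 i2] i3]])
       (unfold n_def, rule approx_pointwise[OF K d])
  also have "\<dots> = (\<integral>\<omega>. 1 / perp_const\<^sup>2 * (sqrt \<delta> * exp (1/2 * wmin \<omega> n - 1 * (walk \<omega> n - wmin \<omega> n))) \<partial>S)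
    + (\<integral>\<omega>. real (i + 2) / c1 ^ 3 * c2 * (\<Sum>k\<in>{K..<K+m}. if \<delta> / 2 \<le> exp (wmin \<omega> n) then exp (- walk \<omega> n) * exp (- walk \<omega> k) else 0) \<partial>S)
    + (\<integral>\<omega>. 1 / c1\<^sup>2 * ((2 / \<delta>)\<^sup>2 * (if R < walk \<omega> K then exp (2 * wmin \<omega> n - walk \<omega> n) else 0)) \<partial>S)"
    unfolding Bochner_Integration.integral_add[OF Bochner_Integration.integrable_add[OF i1 i2] i3] Bochner_Integration.integral_add[OF i1 i2] by (rule refl)
  also have "\<dots> = 1 / perp_const\<^sup>2 * (sqrt \<delta> * wmin_mgf (1/2) 1 n)
    + real (i + 2) / c1 ^ 3 * c2 * (\<Sum>k\<in>{K..<K+m}. two_time (\<delta> / 2) k n)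
    + 1 / c1\<^sup>2 * ((2 / \<delta>)\<^sup>2 * (\<integral>\<omega>. (if R < walk \<omega> K then exp (2 * wmin \<omega> n - walk \<omega> n) else 0) \<partial>S))"
  proof -
    have "(\<integral>\<omega>. (\<Sum>k\<in>{K..<K+m}. if \<delta> / 2 \<le> exp (wmin \<omega> n) then exp (- walk \<omega> n) * exp (- walk \<omega> k) else 0) \<partial>S) = (\<Sum>k\<in>{K..<K+m}. two_time (\<delta> / 2) k n)"
      unfolding two_time_def by (rule Bochner_Integration.integral_sum[OF i2'])
    thus ?thesis unfolding integral_mult_right_zero wmin_mgf_def by (simp only:)
  qed
  finally show ?thesis unfolding n_def .
qed

text \<open>The order of the choices matters. First \<delta>, whose error is uniform in all else;
  then \<open>K\<close>, from the tail of the series k^(-3/2), with constants depending on \<delta>;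
  finally the level \<open>R\<close>, depending on \<delta> and \<open>K\<close>. Each error is at
  most a third of \<epsilon> after multiplication by n^(3/2).\<close>

lemma survival_weight_convergent: "convergent (\<lambda>n. r32 n * survival_weight i n)"
proof (rule convergent_approx)
  fix \<epsilon> :: real assume eps: "\<epsilon> > 0"
  define f where "f k = 1 / (real k * sqrt (real k))" for k :: nat
  have rf: "r32 n * f n = 1" if "n \<ge> 1" for n using that by (simp add: r32_def f_def)
  have sf: "summable f" unfolding f_def by (rule summable_inverse_n_sqrt)
  obtain B where B: "B > 0" "\<And>n. n \<ge> 1 \<Longrightarrow> wmin_mgf (1/2) 1 n \<le> B / (real n * sqrt (real n))" using wmin_mgf_asymp(3)[of "1/2" 1] by auto
  \<comment> \<open>Makes sqrt \<delta> times B / perp_const^2 at most \<epsilon> / 3; the cap at 1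
    is required by \<open>two_point_bound\<close>.\<close>
  define \<delta> where "\<delta> = min 1 ((\<epsilon> * perp_const\<^sup>2 / (3 * B))\<^sup>2)"
  have d: "0 < \<delta>" "\<delta> \<le> 1" using eps perp_const_pos B by (auto simp: \<delta>_def)
  have sd: "sqrt \<delta> \<le> \<epsilon> * perp_const\<^sup>2 / (3 * B)" by (rule real_le_lsqrt) (use eps B in \<open>auto simp: \<delta>_def\<close>)
  obtain C2 where C2: "C2 > 0" "\<And>k m. k \<ge> 1 \<Longrightarrow> m \<ge> 1 \<Longrightarrow> two_time (\<delta> / 2) k (k + m) \<le> C2 * (f k * f m)"
    using two_point_bound[of "\<delta> / 2"] d unfolding two_time_def f_def by auto
  define D2 where "D2 = real (i + 2) / c1 ^ 3 * c2"
  have D2: "D2 > 0" unfolding D2_def using c1_pos c2_pos by simp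
  obtain K0 where K0: "\<And>n. n \<ge> K0 \<Longrightarrow> norm (suminf (\<lambda>i. f (i + n))) < \<epsilon> / 3 / (D2 * C2 * 8)"
    using suminf_exist_split[OF _ sf, of "\<epsilon> / 3 / (D2 * C2 * 8)"] eps D2 C2 by auto
  define K where "K = max 1 K0"
  define \<tau> where "\<tau> = suminf (\<lambda>i. f (i + K))"
  have K: "K \<ge> 1" by (simp add: K_def)
  have "\<tau> < \<epsilon> / 3 / (D2 * C2 * 8)" using K0[of K] unfolding \<tau>_def by (simp add: K_def)
  hence tau: "D2 * C2 * 8 * \<tau> \<le> \<epsilon> / 3" using D2 C2(1) by (simp add: field_simps)
  obtain C3 where C3: "C3 > 0" "\<And>n z. n \<ge> 1 \<Longrightarrow> z \<ge> 0 \<Longrightarrow> killed_exp n z \<le> C3 * (1 + z) / (real n * sqrt (real n))" using killed_exp_upper by blast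
  define D3 where "D3 = 1 / c1\<^sup>2 * (2 / \<delta>)\<^sup>2 * C3 * 4"
  have D3: "D3 > 0" unfolding D3_def using c1_pos d C3 by simp
  have "\<forall>\<^sub>F N in sequentially. (\<integral>\<omega>. (if real N < walk \<omega> K then 1 + walk \<omega> K else 0) \<partial>S) < \<epsilon> / 3 / D3"
    by (rule order_tendstoD(2)[OF far_start_small]) (use eps D3 in simp)
  then obtain N where N: "(\<integral>\<omega>. (if real N < walk \<omega> K then 1 + walk \<omega> K else 0) \<partial>S) < \<epsilon> / 3 / D3"
    unfolding eventually_at_top_linorder by auto
  define R where "R = real N"
  define q where "q = (\<integral>\<omega>. (if R < walk \<omega> K then 1 + walk \<omega> K else 0) \<partial>S)"
  have R: "R \<ge> 0" and q: "D3 * q \<le> \<epsilon> / 3" using N D3 by (auto simp: R_def q_def field_simps)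
  have main: "\<bar>r32 n * survival_weight i n - r32 n * (\<integral>\<omega>. block_approx i \<delta> R K m \<omega> \<partial>S)\<bar> \<le> \<epsilon>" if n: "n = K + (m + K)" for n m
  proof -
    have n1: "n \<ge> 1" "m + K \<ge> 1" using n K by auto
    have t1: "r32 n * (1 / perp_const\<^sup>2 * (sqrt \<delta> * wmin_mgf (1/2) 1 n)) \<le> \<epsilon> / 3"
    proof -
      have "r32 n * wmin_mgf (1/2) 1 n \<le> r32 n * (B / (real n * sqrt (real n)))" by (intro mult_left_mono B n1 r32_nonneg)
      also have "\<dots> = B" using n1 by (simp add: r32_def)
      finally have "1 / perp_const\<^sup>2 * sqrt \<delta> * (r32 n * wmin_mgf (1/2) 1 n) \<le> 1 / perp_const\<^sup>2 * (\<epsilon> * perp_const\<^sup>2 / (3 * B)) * B"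
        using sd eps B d n1 r32_nonneg[of n] perp_const_pos by (intro mult_mono) (auto simp: wmin_mgf_def)
      also have "\<dots> = \<epsilon> / 3" using B perp_const_pos by simp
      finally show ?thesis by (simp add: mult_ac)
    qed
    have t2: "r32 n * (D2 * (\<Sum>k\<in>{K..<K+m}. two_time (\<delta> / 2) k n)) \<le> \<epsilon> / 3"
    proof -
      have "(\<Sum>k\<in>{K..<K+m}. two_time (\<delta> / 2) k n) \<le> (\<Sum>k\<in>{K..<K+m}. C2 * (f k * f (n - k)))"
      proof (rule sum_mono)
        fix k assume "k \<in> {K..<K+m}"
        thus "two_time (\<delta> / 2) k n \<le> C2 * (f k * f (n - k))" using C2(2)[of k "n - k"] n K by auto
      qed
      also have "\<dots> = C2 * (\<Sum>k\<in>{K..<n-K}. f k * f (n - k))" using n by (simp add: sum_distrib_left add.assoc[symmetric])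
      also have "\<dots> \<le> C2 * (8 * \<tau> * f n)" unfolding \<tau>_def using C2 middle_sum_bound[OF K, of n] unfolding f_def by (intro mult_left_mono) auto
      finally have "r32 n * (D2 * (\<Sum>k\<in>{K..<K+m}. two_time (\<delta> / 2) k n)) \<le> r32 n * (D2 * (C2 * (8 * \<tau> * f n)))"
        using D2 r32_nonneg by (intro mult_left_mono) auto
      also have "\<dots> = D2 * C2 * 8 * \<tau> * (r32 n * f n)" by (simp add: mult_ac)
      finally show ?thesis using tau rf[OF n1(1)] by simp
    qed
    have t3: "r32 n * (1 / c1\<^sup>2 * ((2 / \<delta>)\<^sup>2 * (\<integral>\<omega>. (if R < walk \<omega> K then exp (2 * wmin \<omega> n - walk \<omega> n) else 0) \<partial>S))) \<le> \<epsilon> / 3"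
    proof -
      define E where "E = (\<integral>\<omega>. (if R < walk \<omega> K then exp (2 * wmin \<omega> n - walk \<omega> n) else 0) \<partial>S)"
      have q0: "q \<ge> 0" unfolding q_def using R by (intro integral_nonneg_AE) auto
      have "E \<le> C3 / r32 (m + K) * q" unfolding E_def q_def n by (rule far_start_bound[OF C3(2) n1(2) R])
      hence "r32 n * E \<le> r32 n * (C3 / r32 (m + K) * q)" by (intro mult_left_mono r32_nonneg)
      also have "\<dots> \<le> (4 * r32 (m + K)) * (C3 / r32 (m + K) * q)"
        using C3 q0 r32_nonneg by (intro mult_right_mono r32_double) (auto simp: n)
      also have "\<dots> = 4 * C3 * q" using r32_pos[OF n1(2)] by simp
      finally have "1 / c1\<^sup>2 * (2 / \<delta>)\<^sup>2 * (r32 n * E) \<le> 1 / c1\<^sup>2 * (2 / \<delta>)\<^sup>2 * (4 * C3 * q)" by (intro mult_left_mono) auto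
      also have "\<dots> = D3 * q" by (simp add: D3_def)
      finally have "1 / c1\<^sup>2 * (2 / \<delta>)\<^sup>2 * (r32 n * E) \<le> \<epsilon> / 3" using q by linarith
      moreover have "r32 n * (1 / c1\<^sup>2 * ((2 / \<delta>)\<^sup>2 * E)) = 1 / c1\<^sup>2 * (2 / \<delta>)\<^sup>2 * (r32 n * E)" by (simp only: mult_ac)
      ultimately show ?thesis unfolding E_def by (simp only:)
    qed
    have "\<bar>r32 n * survival_weight i n - r32 n * (\<integral>\<omega>. block_approx i \<delta> R K m \<omega> \<partial>S)\<bar> = r32 n * \<bar>survival_weight i n - (\<integral>\<omega>. block_approx i \<delta> R K m \<omega> \<partial>S)\<bar>"
      unfolding right_diff_distrib[symmetric] abs_mult abs_of_nonneg[OF r32_nonneg] by (rule refl)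
    also have "\<dots> \<le> r32 n * (1 / perp_const\<^sup>2 * (sqrt \<delta> * wmin_mgf (1/2) 1 n) + D2 * (\<Sum>k\<in>{K..<K+m}. two_time (\<delta> / 2) k n)
       + 1 / c1\<^sup>2 * ((2 / \<delta>)\<^sup>2 * (\<integral>\<omega>. (if R < walk \<omega> K then exp (2 * wmin \<omega> n - walk \<omega> n) else 0) \<partial>S)))"
      unfolding n D2_def by (rule mult_left_mono[OF approx_bound[OF K d(1)] r32_nonneg])
    also have "\<dots> \<le> \<epsilon>" unfolding distrib_left using t1 t2 t3 by linarith
    finally show ?thesis .
  qed
  \<comment> \<open>The block limit is in terms of the middle length m = n - 2 K; the ratio of the
    two normalisations tends to 1.\<close>
  define v where "v n = r32 n * (\<integral>\<omega>. block_approx i \<delta> R K (n - 2 * K) \<omega> \<partial>S)" for n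
  obtain L where L: "(\<lambda>m. r32 m * (\<integral>\<omega>. block_approx i \<delta> R K m \<omega> \<partial>S)) \<longlonglongrightarrow> L" using block_approx_convergent[OF K d(1)] unfolding convergent_def by blast
  have "(\<lambda>m. v (m + 2 * K)) \<longlonglongrightarrow> 1 * L"
  proof (rule Lim_transform_eventually[OF tendsto_mult[OF r32_shift_ratio[of "2 * K"] L]])
    show "\<forall>\<^sub>F m in sequentially. r32 (m + 2 * K) / r32 m * (r32 m * (\<integral>\<omega>. block_approx i \<delta> R K m \<omega> \<partial>S)) = v (m + 2 * K)"
      using eventually_ge_at_top[of 1] by eventually_elim (use r32_pos in \<open>auto simp: v_def less_imp_neq[symmetric]\<close>)
  qed
  hence "convergent v" using LIMSEQ_offset convergentI by blast
  moreover have "\<forall>\<^sub>F n in sequentially. \<bar>r32 n * survival_weight i n - v n\<bar> \<le> \<epsilon>"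
    using eventually_ge_at_top[of "2 * K"] by eventually_elim (auto simp: v_def intro!: main)
  ultimately show "\<exists>v. convergent v \<and> (\<forall>\<^sub>F n in sequentially. \<bar>r32 n * survival_weight i n - v n\<bar> \<le> \<epsilon>)" by blast
qed

end

section \<open>Positivity of the limits\<close>

context affine_walk
begin

lemma two_time_0_upper:
  assumes d: "0 < \<delta>"
  shows "two_time \<delta> 0 n \<le> (1 / \<delta>)\<^sup>2 * wmin_mgf 1 1 n"
proof -
  have "two_time \<delta> 0 n \<le> (\<integral>\<omega>. (1 / \<delta>)\<^sup>2 * exp (1 * wmin \<omega> n - 1 * (walk \<omega> n - wmin \<omega> n)) \<partial>S)" unfolding two_time_def
  proof (rule integral_mono')
    show "integrable S (\<lambda>\<omega>. (1 / \<delta>)\<^sup>2 * exp (1 * wmin \<omega> n - 1 * (walk \<omega> n - wmin \<omega> n)))" by (intro integrable_mult_right integrable_wmin_mgf) auto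
    show "(if \<delta> \<le> exp (wmin \<omega> n) then exp (- walk \<omega> n) * exp (- walk \<omega> 0) else 0) \<le> (1 / \<delta>)\<^sup>2 * exp (1 * wmin \<omega> n - 1 * (walk \<omega> n - wmin \<omega> n))" for \<omega>
      using exp_cut_le[OF d, of \<omega> n] by auto
  qed auto
  thus ?thesis by (simp add: wmin_mgf_def)
qed

text \<open>Paths with a deep minimum account for at most a fraction of order sqrt \<delta>, so the
  truncated weight keeps the full rate.\<close>

lemma two_time_0_lower:
  assumes d: "0 < \<delta>"
  shows "wmin_mgf 1 1 n - sqrt \<delta> * wmin_mgf (1/2) 1 n \<le> two_time \<delta> 0 n"
proof -
  have i: "integrable S (\<lambda>\<omega>. sqrt \<delta> * exp (1/2 * wmin \<omega> n - 1 * (walk \<omega> n - wmin \<omega> n)))" by (intro integrable_mult_right integrable_wmin_mgf) auto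
  have j: "integrable S (\<lambda>\<omega>. exp (1 * wmin \<omega> n - 1 * (walk \<omega> n - wmin \<omega> n)))" by (intro integrable_wmin_mgf) auto
  have "wmin_mgf 1 1 n \<le> (\<integral>\<omega>. (if \<delta> \<le> exp (wmin \<omega> n) then exp (- walk \<omega> n) * exp (- walk \<omega> 0) else 0) + sqrt \<delta> * exp (1/2 * wmin \<omega> n - 1 * (walk \<omega> n - wmin \<omega> n)) \<partial>S)"
    unfolding wmin_mgf_def
  proof (rule integral_mono[OF j Bochner_Integration.integrable_add[OF integrable_two_time[OF d] i]])
    fix \<omega>
    show "exp (1 * wmin \<omega> n - 1 * (walk \<omega> n - wmin \<omega> n))
      \<le> (if \<delta> \<le> exp (wmin \<omega> n) then exp (- walk \<omega> n) * exp (- walk \<omega> 0) else 0) + sqrt \<delta> * exp (1/2 * wmin \<omega> n - 1 * (walk \<omega> n - wmin \<omega> n))"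
    proof (cases "\<delta> \<le> exp (wmin \<omega> n)")
      case True
      have "0 \<le> sqrt \<delta> * exp (1/2 * wmin \<omega> n - 1 * (walk \<omega> n - wmin \<omega> n))" using d by simp
      moreover have "exp (1 * wmin \<omega> n - 1 * (walk \<omega> n - wmin \<omega> n)) \<le> exp (- walk \<omega> n)" using wmin_nonpos[of \<omega> n] by simp
      ultimately have "exp (1 * wmin \<omega> n - 1 * (walk \<omega> n - wmin \<omega> n)) \<le> exp (- walk \<omega> n) + sqrt \<delta> * exp (1/2 * wmin \<omega> n - 1 * (walk \<omega> n - wmin \<omega> n))" by linarith
      thus ?thesis using True by (simp only: if_True walk_0 minus_zero exp_zero mult_1_right)
    next
      case False
      have "exp (1 * wmin \<omega> n - 1 * (walk \<omega> n - wmin \<omega> n)) \<le> sqrt \<delta> * exp (1/2 * wmin \<omega> n - 1 * (walk \<omega> n - wmin \<omega> n))"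
        by (rule exp_split_cut[OF d]) (use False in simp)
      thus ?thesis using False by (simp only: if_False add_0)
    qed
  qed simp
  also have "\<dots> = two_time \<delta> 0 n + sqrt \<delta> * wmin_mgf (1/2) 1 n"
    unfolding Bochner_Integration.integral_add[OF integrable_two_time[OF d le0] i] by (simp add: two_time_def wmin_mgf_def)
  finally show ?thesis by simp
qed

text \<open>The middle indices fall under \<open>middle_sum_bound\<close> with K = 1. The ends k = 0
  and k = n both reduce to \<open>two_time \<delta> 0 n\<close>, since exp (-S_n) is at most 1 /
  \<delta> on the event.\<close>

lemma two_time_sum_upper:
  assumes d: "0 < \<delta>" "\<delta> \<le> 1"
  shows "\<exists>C>0. \<forall>n\<ge>2. (\<Sum>k\<le>n. two_time \<delta> k n) \<le> C / r32 n"
proof -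
  define f where "f k = 1 / (real k * sqrt (real k))" for k :: nat
  have fr: "f k = 1 / r32 k" for k by (simp add: f_def r32_def)
  have f0: "f k \<ge> 0" for k by (simp add: f_def)
  obtain B where B: "B > 0" "\<And>n. n \<ge> 1 \<Longrightarrow> wmin_mgf 1 1 n \<le> B / (real n * sqrt (real n))" using wmin_mgf_asymp(3)[of 1 1] by auto
  obtain C2 where C2: "C2 > 0" "\<And>k m. k \<ge> 1 \<Longrightarrow> m \<ge> 1 \<Longrightarrow> two_time \<delta> k (k + m) \<le> C2 * (f k * f m)"
    using two_point_bound[OF d] unfolding two_time_def f_def by auto
  define \<tau> where "\<tau> = suminf (\<lambda>k. f (k + 1))"
  have sf: "summable (\<lambda>k. f (k + 1))" unfolding summable_iff_shift unfolding f_def by (rule summable_inverse_n_sqrt)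
  have tau: "\<tau> \<ge> 0" unfolding \<tau>_def by (rule suminf_nonneg[OF sf f0])
  define C where "C = (1 / \<delta>)\<^sup>2 * B + C2 * (8 * \<tau> + 4) + 1 / \<delta> * ((1 / \<delta>)\<^sup>2 * B)"
  have "(\<Sum>k\<le>n. two_time \<delta> k n) \<le> C / r32 n" if n: "n \<ge> 2" for n
  proof -
    have g0: "two_time \<delta> 0 n \<le> (1 / \<delta>)\<^sup>2 * B * f n"
      using two_time_0_upper[OF d(1), of n] B(2)[of n] mult_left_mono[of "wmin_mgf 1 1 n" "B / (real n * sqrt (real n))" "(1 / \<delta>)\<^sup>2"] n by (simp add: f_def)
    have gn: "two_time \<delta> n n \<le> 1 / \<delta> * two_time \<delta> 0 n"
      unfolding two_time_def integral_mult_right_zero[symmetric]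
    proof (rule integral_mono[OF integrable_two_time[OF d(1) order_refl] integrable_mult_right[OF integrable_two_time[OF d(1) le0]]])
      show "(if \<delta> \<le> exp (wmin \<omega> n) then exp (- walk \<omega> n) * exp (- walk \<omega> n) else 0) \<le> 1 / \<delta> * (if \<delta> \<le> exp (wmin \<omega> n) then exp (- walk \<omega> n) * exp (- walk \<omega> 0) else 0)" for \<omega>
        using exp_neg_walk_le[OF d(1) _ order_refl, of \<omega> n] mult_right_mono[of "exp (- walk \<omega> n)" "1 / \<delta>" "exp (- walk \<omega> n)"] by auto
    qed
    have mid: "(\<Sum>k\<in>{1..<n}. two_time \<delta> k n) \<le> C2 * (8 * \<tau> + 4) * f n"
    proof -
      have "(\<Sum>k\<in>{1..<n}. two_time \<delta> k n) \<le> (\<Sum>k\<in>{1..<n}. C2 * (f k * f (n - k)))"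
      proof (rule sum_mono)
        fix k assume "k \<in> {1..<n}"
        thus "two_time \<delta> k n \<le> C2 * (f k * f (n - k))" using C2(2)[of k "n - k"] by auto
      qed
      \<comment> \<open>With K = 1 the middle range stops before n - 1, so the index n - 1 is split
        off; its partner value f 1 is 1.\<close>
      also have "\<dots> = C2 * ((\<Sum>k\<in>{1..<n-1}. f k * f (n - k)) + f (n - 1))"
      proof -
        have "{1..<n} = insert (n - 1) {1..<n-1}" using n by auto
        hence "(\<Sum>k\<in>{1..<n}. C2 * (f k * f (n - k))) = C2 * (f (n - 1) * f (n - (n - 1))) + (\<Sum>k\<in>{1..<n-1}. C2 * (f k * f (n - k)))"
          by simp
        moreover have "f (n - (n - 1)) = 1" using n by (simp add: f_def)
        ultimately show ?thesis by (simp add: sum_distrib_left[symmetric] algebra_simps)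
      qed
      also have "\<dots> \<le> C2 * (8 * \<tau> * f n + 4 * f n)"
      proof (intro mult_left_mono add_mono)
        show "(\<Sum>k\<in>{1..<n-1}. f k * f (n - k)) \<le> 8 * \<tau> * f n" unfolding \<tau>_def f_def by (rule middle_sum_bound) simp
        have "r32 n \<le> 4 * r32 (n - 1)" using n by (intro r32_double) auto
        hence "1 / (4 * r32 (n - 1)) \<le> 1 / r32 n" using n r32_pos by (intro divide_left_mono mult_pos_pos) auto
        thus "f (n - 1) \<le> 4 * f n" unfolding fr by simp
      qed (use C2 in auto)
      finally show ?thesis by (simp add: algebra_simps)
    qed
    have "{..n} = insert 0 (insert n {1..<n})" using n by auto
    hence "(\<Sum>k\<le>n. two_time \<delta> k n) = two_time \<delta> 0 n + (two_time \<delta> n n + (\<Sum>k\<in>{1..<n}. two_time \<delta> k n))" using n by simp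
    moreover have "two_time \<delta> n n \<le> 1 / \<delta> * ((1 / \<delta>)\<^sup>2 * B * f n)" by (rule order_trans[OF gn mult_left_mono[OF g0]]) (use d in simp)
    ultimately have "(\<Sum>k\<le>n. two_time \<delta> k n) \<le> (1 / \<delta>)\<^sup>2 * B * f n + (1 / \<delta> * ((1 / \<delta>)\<^sup>2 * B * f n) + C2 * (8 * \<tau> + 4) * f n)"
      using g0 mid by linarith
    also have "\<dots> = C * f n" unfolding C_def by (simp add: algebra_simps)
    finally show ?thesis by (simp add: fr)
  qed
  moreover have "C > 0" unfolding C_def using d(1) B(1) C2(1) tau by (intro add_pos_nonneg mult_pos_pos mult_nonneg_nonneg) simp_all
  ultimately show ?thesis by blast
qed

text \<open>For i = 0 the weight is (a + b)^(-2), and a + b is at most a multiple of the sum of exp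
  (-S_k). Under the truncated measure with density exp (-S_n) this sum has bounded mean relative to
  the total mass, so by Markov's inequality it is bounded on a positive fraction of the
  mass.\<close>

lemma survival_weight_0_lower: "\<exists>c>0. \<forall>\<^sub>F n in sequentially. c \<le> r32 n * survival_weight 0 n"
proof -
  obtain l where l: "l > 0" "(\<lambda>n. real n * sqrt (real n) * wmin_mgf 1 1 n) \<longlonglongrightarrow> l" using wmin_mgf_asymp(2)[of 1 1] by auto
  obtain B where B: "B > 0" "\<And>n. n \<ge> 1 \<Longrightarrow> wmin_mgf (1/2) 1 n \<le> B / (real n * sqrt (real n))" using wmin_mgf_asymp(3)[of "1/2" 1] by auto
  \<comment> \<open>Chosen so that the truncated part has rescaled mass at most l / 4; the total
    eventually exceeds l / 2, which leaves l / 4.\<close>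
  define \<delta> where "\<delta> = min 1 ((l / (4 * B))\<^sup>2)"
  have d: "0 < \<delta>" "\<delta> \<le> 1" using l B by (auto simp: \<delta>_def)
  have sd: "sqrt \<delta> \<le> l / (4 * B)" by (rule real_le_lsqrt) (use l B in \<open>auto simp: \<delta>_def\<close>)
  obtain C where C: "C > 0" "\<And>n. n \<ge> 2 \<Longrightarrow> (\<Sum>k\<le>n. two_time \<delta> k n) \<le> C / r32 n" using two_time_sum_upper[OF d] by blast
  define m where "m = max 1 c2"
  \<comment> \<open>The Markov threshold: beyond \<open>A\<close> there is rescaled mass at most m C
    / A = l / 8, half of what the truncation left.\<close>
  define A where "A = 8 * m * C / l"
  have m: "m \<ge> 1" "m \<ge> c2" by (auto simp: m_def)
  have A: "A > 0" using l C m by (simp add: A_def)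
  define c where "c = 1 / A\<^sup>2 * (l / 8)"
  have "c \<le> r32 n * survival_weight 0 n" if n: "n \<ge> 2" and big: "l / 2 < r32 n * wmin_mgf 1 1 n" for n
  proof -
    define w where "w \<omega> = (if \<delta> \<le> exp (wmin \<omega> n) then exp (- walk \<omega> n) * exp (- walk \<omega> 0) else 0)" for \<omega>
    define s where "s \<omega> = (\<Sum>k\<le>n. exp (- walk \<omega> k))" for \<omega>
    have ws: "w \<omega> * s \<omega> = (\<Sum>k\<le>n. if \<delta> \<le> exp (wmin \<omega> n) then exp (- walk \<omega> n) * exp (- walk \<omega> k) else 0)" for \<omega>
      by (auto simp: w_def s_def sum_distrib_left)
    have iw: "integrable S w" unfolding w_def using integrable_two_time[OF d(1) le0] .
    have iws: "integrable S (\<lambda>\<omega>. w \<omega> * s \<omega>)" unfolding ws using integrable_two_time[OF d(1)] by (intro Bochner_Integration.integrable_sum) auto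
    have Ew: "(\<integral>\<omega>. w \<omega> \<partial>S) = two_time \<delta> 0 n" by (simp add: w_def two_time_def)
    have Ews: "(\<integral>\<omega>. w \<omega> * s \<omega> \<partial>S) = (\<Sum>k\<le>n. two_time \<delta> k n)" unfolding ws two_time_def using integrable_two_time[OF d(1)] by (intro Bochner_Integration.integral_sum) auto
    have "(\<integral>\<omega>. 1 / A\<^sup>2 * (w \<omega> - m / A * (w \<omega> * s \<omega>)) \<partial>S) \<le> survival_weight 0 n" unfolding survival_weight_def
    proof (rule integral_mono[OF _ integrable_survival_weight])
      show "integrable S (\<lambda>\<omega>. 1 / A\<^sup>2 * (w \<omega> - m / A * (w \<omega> * s \<omega>)))" by (intro integrable_mult_right Bochner_Integration.integrable_diff iw iws)
      fix \<omega>
      define t where "t = exp (- walk \<omega> n) + perpetuity \<omega> n"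
      have b: "perpetuity \<omega> n > 0" using perpetuity_ge[of n \<omega>] n c1_pos by simp
      have t: "t > 0" using b by (simp add: t_def add_pos_pos)
      have ts: "t \<le> m * s \<omega>"
      proof -
        have "perpetuity \<omega> n \<le> (\<Sum>k<n. m * exp (- walk \<omega> k))" unfolding perpetuity_def
          by (intro sum_mono mult_right_mono order_trans[OF e_upper m(2)]) auto
        moreover have "exp (- walk \<omega> n) \<le> m * exp (- walk \<omega> n)" using m(1) by simp
        moreover have "m * s \<omega> = (\<Sum>k<n. m * exp (- walk \<omega> k)) + m * exp (- walk \<omega> n)"
          unfolding s_def lessThan_Suc_atMost[symmetric] by (simp add: sum_distrib_left distrib_left)
        ultimately show ?thesis unfolding t_def by linarith
      qed
      have w0: "0 \<le> w \<omega>" "w \<omega> \<le> exp (- walk \<omega> n)" by (auto simp: w_def)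
      have key: "1 / A\<^sup>2 * (1 - t / A) \<le> 1 / t\<^sup>2"
      proof (cases "t \<le> A")
        case True
        have "1 / A\<^sup>2 * (1 - t / A) \<le> 1 / A\<^sup>2 * 1" using t A by (intro mult_left_mono) auto
        also have "\<dots> \<le> 1 / t\<^sup>2" using t A True by (simp add: divide_left_mono power_mono)
        finally show ?thesis .
      next
        case False
        hence "1 / A\<^sup>2 * (1 - t / A) \<le> 0" using A by (intro mult_nonneg_nonpos) auto
        also have "\<dots> \<le> 1 / t\<^sup>2" by simp
        finally show ?thesis .
      qed
      have "1 / A\<^sup>2 * (w \<omega> - m / A * (w \<omega> * s \<omega>)) = w \<omega> * (1 / A\<^sup>2 * (1 - m * s \<omega> / A))" by (simp add: algebra_simps)
      also have "\<dots> \<le> w \<omega> * (1 / A\<^sup>2 * (1 - t / A))" using ts A w0 by (intro mult_left_mono diff_left_mono divide_right_mono) auto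
      also have "\<dots> \<le> w \<omega> * (1 / t\<^sup>2)" by (rule mult_left_mono[OF key w0(1)])
      also have "\<dots> \<le> exp (- walk \<omega> n) * (1 / t\<^sup>2)" using w0 by (intro mult_right_mono) auto
      also have "\<dots> = exp (- walk \<omega> n) * fl_weight 0 (exp (- walk \<omega> n)) (perpetuity \<omega> n)" by (simp add: fl_weight_def t_def power_divide)
      finally show "1 / A\<^sup>2 * (w \<omega> - m / A * (w \<omega> * s \<omega>)) \<le> exp (- walk \<omega> n) * fl_weight 0 (exp (- walk \<omega> n)) (perpetuity \<omega> n)" .
    qed (use n in simp)
    moreover have "(\<integral>\<omega>. 1 / A\<^sup>2 * (w \<omega> - m / A * (w \<omega> * s \<omega>)) \<partial>S) = 1 / A\<^sup>2 * (two_time \<delta> 0 n - m / A * (\<Sum>k\<le>n. two_time \<delta> k n))"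
      unfolding integral_mult_right_zero Bochner_Integration.integral_diff[OF iw integrable_mult_right[OF iws]] Ew Ews by (rule refl)
    ultimately have 1: "1 / A\<^sup>2 * (two_time \<delta> 0 n - m / A * (\<Sum>k\<le>n. two_time \<delta> k n)) \<le> survival_weight 0 n" by (simp only:)
    have rn: "r32 n > 0" using n by (intro r32_pos) auto
    have 2: "l / 4 \<le> r32 n * two_time \<delta> 0 n"
    proof -
      have "r32 n * wmin_mgf (1/2) 1 n \<le> B" using B(2)[of n] n rn by (simp add: r32_def field_simps)
      hence "sqrt \<delta> * (r32 n * wmin_mgf (1/2) 1 n) \<le> l / (4 * B) * B" using sd d B l rn by (intro mult_mono) (auto simp: wmin_mgf_def)
      hence "sqrt \<delta> * (r32 n * wmin_mgf (1/2) 1 n) \<le> l / 4" using B by simp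
      moreover have "r32 n * (wmin_mgf 1 1 n - sqrt \<delta> * wmin_mgf (1/2) 1 n) \<le> r32 n * two_time \<delta> 0 n" using rn by (intro mult_left_mono two_time_0_lower d) auto
      ultimately show ?thesis using big by (simp add: algebra_simps)
    qed
    have 3: "m / A * (r32 n * (\<Sum>k\<le>n. two_time \<delta> k n)) \<le> l / 8"
    proof -
      have "r32 n * (\<Sum>k\<le>n. two_time \<delta> k n) \<le> C" using C(2)[OF n] rn by (simp add: field_simps)
      hence "m / A * (r32 n * (\<Sum>k\<le>n. two_time \<delta> k n)) \<le> m / A * C" using m A by (intro mult_left_mono) auto
      also have "\<dots> = l / 8" using m C l by (simp add: A_def)
      finally show ?thesis .
    qed
    have "c \<le> 1 / A\<^sup>2 * (r32 n * two_time \<delta> 0 n - m / A * (r32 n * (\<Sum>k\<le>n. two_time \<delta> k n)))" unfolding c_def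
      using 2 3 by (intro mult_left_mono) auto
    also have "\<dots> = r32 n * (1 / A\<^sup>2 * (two_time \<delta> 0 n - m / A * (\<Sum>k\<le>n. two_time \<delta> k n)))" by (simp only: right_diff_distrib mult_ac)
    also have "\<dots> \<le> r32 n * survival_weight 0 n" using 1 rn by (intro mult_left_mono) auto
    finally show ?thesis .
  qed
  moreover have ev: "\<forall>\<^sub>F n in sequentially. l / 2 < r32 n * wmin_mgf 1 1 n" unfolding r32_def by (rule order_tendstoD(1)[OF l(2)]) (use l in simp)
  ultimately have "\<forall>\<^sub>F n in sequentially. c \<le> r32 n * survival_weight 0 n" 
    by - (rule eventually_mono[OF eventually_conj[OF eventually_ge_at_top[of 2] ev]], blast)
  moreover have "c > 0" using A l by (simp add: c_def)
  ultimately show ?thesis by blast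
qed

text \<open>Consecutive weights differ by the factor b / (a + b). As b is at least perp_const * exp
  (-L) and L <= S, it is at least perp_const * a, which bounds the factor below and carries
  positivity from i to i + 1.\<close>

lemma survival_weight_Suc_lower: assumes n: "n \<ge> 1" shows "perp_const / (1 + perp_const) * survival_weight i n \<le> survival_weight (Suc i) n"
  unfolding survival_weight_def integral_mult_right_zero[symmetric]
proof (rule integral_mono[OF integrable_mult_right[OF integrable_survival_weight[OF n]] integrable_survival_weight[OF n]])
  fix \<omega>
  define a where "a = exp (- walk \<omega> n)"
  define b where "b = perpetuity \<omega> n"
  have a: "a > 0" and b: "b > 0" using perpetuity_ge[OF n, of \<omega>] c1_pos by (auto simp: a_def b_def)
  have "perp_const * a \<le> perp_const * exp (- wmin \<omega> n)" unfolding a_def using perp_const_pos wmin_le_walk[of \<omega> n] by (intro mult_left_mono) auto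
  hence ab: "perp_const * a \<le> b" using perpetuity_ge_wmin[OF n, of \<omega>] by (simp add: b_def)
  have "perp_const / (1 + perp_const) \<le> b / (a + b)" using ab a b perp_const_pos by (simp add: field_simps)
  hence "perp_const / (1 + perp_const) * (a * fl_weight i a b) \<le> b / (a + b) * (a * fl_weight i a b)" using a b fl_weight_nonneg[of a b i] by (intro mult_right_mono) auto
  also have "\<dots> = a * fl_weight (Suc i) a b" by (simp add: fl_weight_def)
  finally show "perp_const / (1 + perp_const) * (exp (- walk \<omega> n) * fl_weight i (exp (- walk \<omega> n)) (perpetuity \<omega> n)) \<le> exp (- walk \<omega> n) * fl_weight (Suc i) (exp (- walk \<omega> n)) (perpetuity \<omega> n)"
    unfolding a_def b_def .
qed

theorem survival_weight_asymp:
  obtains p C where "\<And>i. (\<lambda>n. r32 n * survival_weight i n) \<longlonglongrightarrow> p i" "\<And>i. 0 < p i" "\<And>i n. n \<ge> 1 \<Longrightarrow> r32 n * survival_weight i n \<le> C" "\<And>i n. 0 \<le> r32 n * survival_weight i n"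
proof -
  define p where "p i = Topological_Spaces.lim (\<lambda>n. r32 n * survival_weight i n)" for i
  have p: "(\<lambda>n. r32 n * survival_weight i n) \<longlonglongrightarrow> p i" for i unfolding p_def using survival_weight_convergent by (simp add: convergent_LIMSEQ_iff)
  have p0: "p i > 0" for i
  proof (induction i)
    case 0
    obtain c where "c > 0" "\<forall>\<^sub>F n in sequentially. c \<le> r32 n * survival_weight 0 n" using survival_weight_0_lower by blast
    thus ?case using tendsto_lowerbound[OF p] by fastforce
  next
    case (Suc i)
    have "perp_const / (1 + perp_const) * p i \<le> p (Suc i)"
    proof (rule tendsto_le[OF trivial_limit_sequentially p tendsto_mult_left[OF p]])
      show "\<forall>\<^sub>F n in sequentially. perp_const / (1 + perp_const) * (r32 n * survival_weight i n) \<le> r32 n * survival_weight (Suc i) n"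
        using eventually_ge_at_top[of 1]
      proof eventually_elim
        case (elim n)
        show ?case using mult_left_mono[OF survival_weight_Suc_lower[OF elim, of i] r32_nonneg[of n]] by (simp only: mult_ac)
      qed
    qed
    moreover have "perp_const / (1 + perp_const) * p i > 0" using perp_const_pos Suc by simp
    ultimately show ?case by linarith
  qed
  obtain B where B: "B > 0" "\<And>n. n \<ge> 1 \<Longrightarrow> wmin_mgf 1 1 n \<le> B / (real n * sqrt (real n))" using wmin_mgf_asymp(3)[of 1 1] by auto
  have "r32 n * survival_weight i n \<le> 1 / perp_const\<^sup>2 * B" if n: "n \<ge> 1" for i n
  proof -
    have "survival_weight i n \<le> 1 / perp_const\<^sup>2 * (B / r32 n)" unfolding r32_def
      by (rule order_trans[OF survival_weight_le[OF n]], intro mult_left_mono B n) auto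
    hence "r32 n * survival_weight i n \<le> r32 n * (1 / perp_const\<^sup>2 * (B / r32 n))" by (intro mult_left_mono r32_nonneg)
    thus ?thesis using r32_pos[OF n] by simp
  qed
  moreover have "0 \<le> r32 n * survival_weight i n" for i n
  proof (cases "n \<ge> 1")
    case True
    thus ?thesis unfolding survival_weight_def by (intro mult_nonneg_nonneg r32_nonneg integral_nonneg_AE always_eventually allI survival_weight_integrand_le(2)) auto
  next
    case False
    hence "n = 0" by simp
    thus ?thesis by (simp add: r32_def)
  qed
  ultimately show ?thesis using that[of p "1 / perp_const\<^sup>2 * B"] p p0 by blast
qed

end

section \<open>Branching in a fixed environment\<close>

text \<open>The difference series vanishes on all of [0, 1), so its zero at 0 is not isolated, which
  is impossible for a series with a nonzero coefficient.\<close>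

lemma powser_unique:
  fixes a b :: "nat \<Rightarrow> real"
  assumes a: "\<And>s. 0 \<le> s \<Longrightarrow> s < 1 \<Longrightarrow> (\<lambda>j. a j * s ^ j) sums f s"
    and b: "\<And>s. 0 \<le> s \<Longrightarrow> s < 1 \<Longrightarrow> (\<lambda>j. b j * s ^ j) sums f s"
  shows "a = b"
proof (rule ccontr)
  assume "a \<noteq> b"
  define d where "d j = a j - b j" for j
  have d: "(\<lambda>j. d j * s ^ j) sums 0" if "0 \<le> s" "s < 1" for s
    using sums_diff[OF a[OF that] b[OF that]] by (simp add: d_def left_diff_distrib)
  have d0: "d 0 = 0" using sums_unique2[OF d[of 0] powser_sums_zero[of d]] by simp
  obtain m where "d m \<noteq> 0" using \<open>a \<noteq> b\<close> by (auto simp: d_def fun_eq_iff)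
  moreover from this have "m > 0" using d0 by (cases m) auto
  ultimately obtain m where m: "d m \<noteq> 0" "m > 0" by blast
  define F where "F z = suminf (\<lambda>j. d j * z ^ j)" for z :: real
  have F: "(\<lambda>j. d j * (z - 0) ^ j) sums F z" if "norm (z - 0) < 1" for z
  proof -
    have "\<bar>z\<bar> < 1" using that by simp
    then obtain s where s: "\<bar>z\<bar> < s" "s < 1" using dense by blast
    have "summable (\<lambda>j. d j * s ^ j)" by (rule sums_summable[OF d]) (use s in linarith)+
    hence "summable (\<lambda>j. d j * z ^ j)" by (rule powser_inside) (use s in auto)
    thus ?thesis unfolding F_def by (simp add: summable_sums)
  qed
  have F0: "F z = 0" if "0 \<le> z" "z < 1" for z using sums_unique2[OF F[of z] ] d[OF that] that by simp
  obtain s where s: "0 < s" "\<And>z. z \<in> cball 0 s - {0} \<Longrightarrow> F z \<noteq> 0"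
    using powser_0_nonzero[of 1 0 d F m, OF _ F F0 m] by auto
  define z where "z = min s (1/2)"
  have "0 < z" "z < 1" "z \<le> s" using s(1) by (auto simp: z_def)
  thus False using s(2)[of z] F0[of z] by simp
qed

text \<open>Tonelli's theorem for double series, phrased for iterated \<open>sums\<close>; it turns
  the law of a random sum into a composition of generating functions.\<close>

lemma sums_exchange:
  fixes a :: "nat \<Rightarrow> nat \<Rightarrow> real"
  assumes nn: "\<And>i j. 0 \<le> a i j" and a: "\<And>i. (\<lambda>j. a i j) sums b i" and b: "b sums c"
  shows "(\<lambda>j. suminf (\<lambda>i. a i j)) sums c"
proof -
  have le: "a i j \<le> b i" for i j
    using sum_le_suminf[OF sums_summable[OF a[of i]], of "{j}"] nn sums_unique[OF a[of i]] by simp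
  have sa: "summable (\<lambda>i. a i j)" for j
    by (rule summable_comparison_test'[OF sums_summable[OF b], of 0]) (use nn le in auto)
  have hs: "(a i has_sum b i) UNIV" for i by (rule sums_nonneg_imp_has_sum[OF a nn])
  have b0: "0 \<le> b i" for i using order_trans[OF nn le] .
  have hb: "(b has_sum c) UNIV" by (rule sums_nonneg_imp_has_sum[OF b b0])
  have "(\<lambda>(i, j). a i j) summable_on (UNIV \<times> UNIV)"
    by (rule summable_on_SigmaI[where g = b]) (use hs hb nn in \<open>auto simp: summable_on_def\<close>)
  hence "((\<lambda>(i, j). a i j) has_sum c) (UNIV \<times> UNIV)"
    by (intro has_sum_SigmaI[where g = b]) (use hs hb in auto)
  hence "((\<lambda>(x, y). (\<lambda>(i, j). a i j) (y, x)) has_sum c) (UNIV \<times> UNIV)" by (subst (asm) has_sum_swap)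
  hence "((\<lambda>j. suminf (\<lambda>i. a i j)) has_sum c) UNIV"
    by (rule has_sum_SigmaD) (use sums_nonneg_imp_has_sum[OF summable_sums[OF sa] nn] in auto)
  thus ?thesis by (rule has_sum_imp_sums)
qed

primrec conv :: "(nat \<Rightarrow> real) \<Rightarrow> nat \<Rightarrow> nat \<Rightarrow> real" where
  "conv q 0 = (\<lambda>j. if j = 0 then 1 else 0)"
| "conv q (Suc r) = (\<lambda>j. \<Sum>l\<le>j. q l * conv q r (j - l))"

primrec zlaw :: "nat \<Rightarrow> (nat \<Rightarrow> nat \<Rightarrow> real) \<Rightarrow> nat \<Rightarrow> real" where
  "zlaw 0 q = (\<lambda>j. if j = 1 then 1 else 0)"
| "zlaw (Suc n) q = (\<lambda>j. suminf (\<lambda>i. zlaw n q i * conv (q n) i j))"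

primrec zgf :: "nat \<Rightarrow> (nat \<Rightarrow> nat \<Rightarrow> real) \<Rightarrow> real \<Rightarrow> real" where
  "zgf 0 q = (\<lambda>s. s)"
| "zgf (Suc n) q = (\<lambda>s. zgf n q (gf (q n) s))"

lemma conv_0: "conv q r 0 = q 0 ^ r" by (induction r) auto

lemma gf_0: "gf q 0 = q 0" unfolding gf_def using powser_sums_zero[of q] by (simp add: sums_iff)

lemma gf_sums:
  assumes q: "is_offspring_law q" and s: "0 \<le> s" "s \<le> 1"
  shows "(\<lambda>k. q k * s ^ k) sums gf q s" "0 \<le> gf q s" "gf q s \<le> 1"
proof -
  have q0: "\<And>k. 0 \<le> q k" and q1: "q sums 1" using q by (auto simp: is_offspring_law_def)
  have le: "q k * s ^ k \<le> q k" for k using q0 s by (intro mult_left_le power_le_one) auto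
  have "summable (\<lambda>k. q k * s ^ k)"
    by (rule summable_comparison_test'[OF sums_summable[OF q1], of 0]) (use q0 s le in auto)
  thus *: "(\<lambda>k. q k * s ^ k) sums gf q s" unfolding gf_def by (rule summable_sums)
  show "0 \<le> gf q s" by (rule sums_le[OF _ sums_zero *]) (use q0 s in simp)
  show "gf q s \<le> 1" by (rule sums_le[OF le * q1])
qed

lemma conv_nonneg: "is_offspring_law q \<Longrightarrow> 0 \<le> conv q r j"
  by (induction r arbitrary: j) (auto intro!: sum_nonneg simp: is_offspring_law_def)

lemma conv_gf:
  assumes q: "is_offspring_law q" and s: "0 \<le> s" "s \<le> 1"
  shows "(\<lambda>j. conv q r j * s ^ j) sums gf q s ^ r"
proof (induction r)
  case 0
  have "(\<lambda>j. conv q 0 j * s ^ j) = (\<lambda>j. if j = 0 then 1 else 0)" by auto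
  thus ?case using sums_single[of 0 "\<lambda>_. 1 :: real"] by simp
next
  case (Suc r)
  have q0: "0 \<le> q k" for k using q by (auto simp: is_offspring_law_def)
  have "(\<lambda>j. \<Sum>l\<le>j. (q l * s ^ l) * (conv q r (j - l) * s ^ (j - l))) sums
      (suminf (\<lambda>l. q l * s ^ l) * suminf (\<lambda>j. conv q r j * s ^ j))"
    by (rule Cauchy_product_sums) (use gf_sums(1)[OF q s] Suc q0 conv_nonneg[OF q] s in \<open>auto simp: sums_iff abs_mult\<close>)
  moreover have "(\<Sum>l\<le>j. (q l * s ^ l) * (conv q r (j - l) * s ^ (j - l))) = conv q (Suc r) j * s ^ j" for j
    unfolding conv.simps sum_distrib_right
  proof (rule sum.cong[OF refl])
    fix l assume "l \<in> {..j}"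
    hence "s ^ j = s ^ l * s ^ (j - l)" by (simp add: power_add[symmetric])
    thus "(q l * s ^ l) * (conv q r (j - l) * s ^ (j - l)) = q l * conv q r (j - l) * s ^ j" by simp
  qed
  ultimately show ?case using sums_unique[OF gf_sums(1)[OF q s]] sums_unique[OF Suc] by simp
qed

lemma conv_le_1: assumes q: "is_offspring_law q" shows "conv q r j \<le> 1"
proof -
  have g1: "gf q 1 = 1" using q by (simp add: gf_def is_offspring_law_def sums_iff)
  have "conv q r sums 1" using conv_gf[OF q, of 1 r] g1 by simp
  thus ?thesis using sum_le_suminf[of "conv q r" "{j}"] conv_nonneg[OF q] by (auto simp: sums_iff)
qed

lemma zlaw_gf:
  assumes q: "\<And>n. is_offspring_law (q n)"
  shows "0 \<le> zlaw n q j" "0 \<le> s \<Longrightarrow> s \<le> 1 \<Longrightarrow> (\<lambda>j. zlaw n q j * s ^ j) sums zgf n q s"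
    "summable (\<lambda>i. zlaw n q i * conv (q n) i j)" "zgf n q 1 = 1"
proof -
  have g1: "gf (q n) 1 = 1" for n using q[of n] by (simp add: gf_def is_offspring_law_def sums_iff)
  show zg1: "zgf n q 1 = 1" for n by (induction n) (auto simp: g1)
  have step: "summable (\<lambda>i. zlaw n q i * conv (q n) i j)"
    if "\<And>j. 0 \<le> zlaw n q j" "\<And>s. 0 \<le> s \<Longrightarrow> s \<le> 1 \<Longrightarrow> (\<lambda>j. zlaw n q j * s ^ j) sums zgf n q s" for n j
  proof (rule summable_comparison_test')
    show "summable (zlaw n q)" using sums_summable[OF that(2)[of 1]] by simp
    show "norm (zlaw n q i * conv (q n) i j) \<le> zlaw n q i" if "i \<ge> 0" for i
      using \<open>\<And>j. 0 \<le> zlaw n q j\<close>[of i] conv_nonneg[OF q, of n i j] conv_le_1[OF q, of n i j] by (simp add: abs_mult mult_left_le)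
  qed
  have main: "(\<forall>j. 0 \<le> zlaw n q j) \<and> (\<forall>s. 0 \<le> s \<and> s \<le> 1 \<longrightarrow> (\<lambda>j. zlaw n q j * s ^ j) sums zgf n q s)" for n
  proof (induction n)
    case 0
    have "(\<lambda>j. (if j = 1 then 1 else 0) * s ^ j) sums s" for s :: real
    proof -
      have "(\<lambda>j. (if j = 1 then 1 else 0) * s ^ j) = (\<lambda>j. if j = 1 then s ^ j else 0)" by auto
      thus ?thesis using sums_single[of 1 "\<lambda>j. s ^ j"] by simp
    qed
    thus ?case by simp
  next
    case (Suc n)
    have nn: "0 \<le> zlaw n q i * conv (q n) i j" for i j using Suc conv_nonneg[OF q] by (intro mult_nonneg_nonneg) auto
    have sm: "summable (\<lambda>i. zlaw n q i * conv (q n) i j)" for j by (rule step) (use Suc in auto)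
    show ?case
    proof (intro conjI allI impI)
      show "0 \<le> zlaw (Suc n) q j" for j using suminf_nonneg[OF sm nn] by simp
      fix s :: real assume s: "0 \<le> s \<and> s \<le> 1"
      have "(\<lambda>j. suminf (\<lambda>i. zlaw n q i * (conv (q n) i j * s ^ j))) sums zgf n q (gf (q n) s)"
      proof (rule sums_exchange[where b = "\<lambda>i. zlaw n q i * gf (q n) s ^ i"])
        show "0 \<le> zlaw n q i * (conv (q n) i j * s ^ j)" for i j using nn[of i j] s by (simp add: mult.assoc[symmetric])
        show "(\<lambda>j. zlaw n q i * (conv (q n) i j * s ^ j)) sums (zlaw n q i * gf (q n) s ^ i)" for i
          by (intro sums_mult conv_gf q) (use s in auto)
        show "(\<lambda>i. zlaw n q i * gf (q n) s ^ i) sums zgf n q (gf (q n) s)"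
          using Suc gf_sums(2,3)[OF q[of n]] s by auto
      qed
      moreover have "suminf (\<lambda>i. zlaw n q i * (conv (q n) i j * s ^ j)) = zlaw (Suc n) q j * s ^ j" for j
        unfolding zlaw.simps suminf_mult2[OF sm] by (simp add: mult.assoc)
      ultimately show "(\<lambda>j. zlaw (Suc n) q j * s ^ j) sums zgf (Suc n) q s" by simp
    qed
  qed
  show "0 \<le> zlaw n q j" using main by simp
  show "0 \<le> s \<Longrightarrow> s \<le> 1 \<Longrightarrow> (\<lambda>j. zlaw n q j * s ^ j) sums zgf n q s" using main by simp
  show "summable (\<lambda>i. zlaw n q i * conv (q n) i j)" by (rule step) (use main in auto)
qed

lemma zlaw_le_1: assumes q: "\<And>n. is_offspring_law (q n)" shows "zlaw n q j \<le> 1"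
  using sum_le_suminf[of "zlaw n q" "{j}"] zlaw_gf(1)[of q, OF q] zlaw_gf(2)[of q 1 n, OF q] zlaw_gf(4)[of q n, OF q]
  by (auto simp: sums_iff)

text \<open>In the coordinate 1 / (1 - s) every fractional-linear generating function is affine, so
  composing n of them produces one affine map with slope \<open>a n\<close> and intercept
  \<open>b n\<close>. Transforming back gives a quotient of linear functions, whose coefficients
  come from a geometric series.\<close>

lemma zlaw_explicit:
  assumes q: "\<And>n. is_offspring_law (q n)" and fl: "\<And>n. fractional_linear (q n)" and eta: "\<And>n. 0 < off_eta (q n)"
  defines "a \<equiv> \<lambda>n. exp (- (\<Sum>k<n. off_X (q k)))" and "b \<equiv> \<lambda>n. \<Sum>k<n. off_eta (q k) * exp (- (\<Sum>l<k. off_X (q l)))"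
  assumes n: "n \<ge> 1" and j: "j \<ge> 1"
  shows "zlaw n q j = a n * fl_weight (j - 1) (a n) (b n)"
proof -
  have a0: "a n > 0" for n by (simp add: a_def)
  have g: "1 / (1 - gf (q n) s) = exp (- off_X (q n)) / (1 - s) + off_eta (q n)" if "0 \<le> s" "s < 1" for n s
    using fl[of n] that by (auto simp: fractional_linear_def)
  have g1: "0 \<le> gf (q n) s" "gf (q n) s < 1" if "0 \<le> s" "s < 1" for n s
  proof -
    show "0 \<le> gf (q n) s" using gf_sums(2)[OF q, of s n] that by simp
    have "0 < 1 / (1 - gf (q n) s)" unfolding g[OF that] using eta[of n] that by (intro add_pos_pos) auto
    thus "gf (q n) s < 1" by simp
  qed
  have G: "zgf n q s < 1 \<and> 1 / (1 - zgf n q s) = a n / (1 - s) + b n" if "0 \<le> s" "s < 1" for n s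
    using that
  proof (induction n arbitrary: s)
    case 0
    thus ?case by (simp add: a_def b_def)
  next
    case (Suc n)
    have "1 / (1 - zgf (Suc n) q s) = a n * (1 / (1 - gf (q n) s)) + b n" using Suc.IH[OF g1[OF Suc.prems]] by simp
    also have "\<dots> = a (Suc n) / (1 - s) + b (Suc n)" 
    proof -
      have "a (Suc n) = a n * exp (- off_X (q n))" by (simp add: a_def exp_add[symmetric])
      moreover have "b (Suc n) = b n + off_eta (q n) * a n" by (simp add: a_def b_def)
      ultimately show ?thesis unfolding g[OF Suc.prems] by (simp add: algebra_simps)
    qed
    finally show ?case using Suc.IH[OF g1[OF Suc.prems]] by simp
  qed
  define A where "A = a n"
  define B where "B = b n"
  define c where "c = A + B"
  have A: "A > 0" by (simp add: A_def a0)
  have B: "B > 0" unfolding B_def b_def using n eta by (intro sum_pos mult_pos_pos) (auto simp: lessThan_empty_iff)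
  \<comment> \<open>The entry at 0 is the probability of extinction by time n; the other entries are
    geometric with ratio B / (A + B).\<close>
  define t where "t i = (if i = 0 then 1 - 1 / c else A * fl_weight (i - 1) A B)" for i
  have "zlaw n q = t"
  proof (rule powser_unique)
    fix s :: real assume s: "0 \<le> s" "s < 1"
    show "(\<lambda>j. zlaw n q j * s ^ j) sums zgf n q s" using s by (intro zlaw_gf(2) q) auto
    have c: "c > 0" "B < c" using A B by (auto simp: c_def)
    have cs: "c - B * s > 0"
    proof -
      have "B * s \<le> B" using B s by simp
      thus ?thesis using c by linarith
    qed
    have "1 / (1 - zgf n q s) = (c - B * s) / (1 - s)" using G[OF s, of n] s by (simp add: A_def[symmetric] B_def[symmetric] c_def field_simps)
    moreover have "1 - zgf n q s = 1 / (1 / (1 - zgf n q s))" by simp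
    ultimately have z: "zgf n q s = 1 - (1 - s) / (c - B * s)" by simp
    have r: "\<bar>B * s / c\<bar> < 1" using B s c mult_le_less_imp_less[of B c s 1] cs by (simp add: abs_mult)
    have "(\<lambda>i. A * s / c\<^sup>2 * (B * s / c) ^ i) sums (A * s / c\<^sup>2 * (1 / (1 - B * s / c)))" by (intro sums_mult geometric_sums) (use r in simp)
    moreover have "A * s / c\<^sup>2 * (B * s / c) ^ i = t (Suc i) * s ^ Suc i" for i
      by (simp add: t_def fl_weight_def c_def power_divide power_mult_distrib power2_eq_square mult_ac)
    moreover have "A * s / c\<^sup>2 * (1 / (1 - B * s / c)) = A * s / (c * (c - B * s))" using c cs by (simp add: field_simps power2_eq_square)
    ultimately have "(\<lambda>i. t (Suc i) * s ^ Suc i) sums (A * s / (c * (c - B * s)))" by (simp only:)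
    hence "(\<lambda>i. t i * s ^ i) sums (A * s / (c * (c - B * s)) + t 0 * s ^ 0)" by (subst sums_Suc_iff[symmetric]) simp
    moreover have "A * s / (c * (c - B * s)) + t 0 * s ^ 0 = zgf n q s"
    proof -
      define d where "d = c - B * s"
      have d: "d > 0" using cs by (simp add: d_def)
      have e: "A * s = d - c * (1 - s)" by (simp add: d_def c_def algebra_simps)
      have "A * s / (c * d) = 1 / c - (1 - s) / d" unfolding e using c d by (simp add: diff_divide_distrib)
      thus ?thesis unfolding z t_def d_def[symmetric] by simp
    qed
    ultimately show "(\<lambda>i. t i * s ^ i) sums zgf n q s" by simp
  qed
  thus ?thesis using j by (simp add: t_def A_def B_def)
qed

lemma conv_meas [measurable (raw)]:
  assumes [measurable]: "\<And>k. (\<lambda>\<omega>. f \<omega> k) \<in> borel_measurable N"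
  shows "(\<lambda>\<omega>. conv (f \<omega>) r j) \<in> borel_measurable N"
proof (induction r arbitrary: j)
  case (Suc r)
  note [measurable] = Suc
  show ?case by simp
qed simp

lemma zlaw_meas [measurable (raw)]:
  assumes [measurable]: "\<And>n k. (\<lambda>\<omega>. f \<omega> n k) \<in> borel_measurable N"
  shows "(\<lambda>\<omega>. zlaw n (f \<omega>) j) \<in> borel_measurable N"
proof (induction n arbitrary: j)
  case (Suc n)
  note [measurable] = Suc
  show ?case by simp
qed simp

section \<open>The population law averaged over the environment\<close>

locale bpre = prob_space M for M :: "'a measure" +
  fixes Q :: "nat \<Rightarrow> 'a \<Rightarrow> nat \<Rightarrow> real" and \<xi> :: "nat \<Rightarrow> nat \<Rightarrow> 'a \<Rightarrow> nat" and Z :: "nat \<Rightarrow> 'a \<Rightarrow> nat"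
  assumes Q_meas: "\<And>n. Q n \<in> M \<rightarrow>\<^sub>M PiM UNIV (\<lambda>_. borel)"
    and Q_law: "\<And>n \<omega>. \<omega> \<in> space M \<Longrightarrow> is_offspring_law (Q n \<omega>)"
    and xi_meas [measurable]: "\<And>n i. \<xi> n i \<in> M \<rightarrow>\<^sub>M count_space UNIV"
    and xi_law: "\<And>F k. finite F \<Longrightarrow> measure M {\<omega> \<in> space M. \<forall>p\<in>F. \<xi> (fst p) (snd p) \<omega> = k p}
        = (\<integral>\<omega>. (\<Prod>p\<in>F. Q (fst p) \<omega> (k p)) \<partial>M)"
    and Z0: "\<And>\<omega>. Z 0 \<omega> = 1"
    and ZSuc: "\<And>n \<omega>. Z (Suc n) \<omega> = (\<Sum>i<Z n \<omega>. \<xi> n i \<omega>)"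
begin

lemma Q_meas' [measurable]: "(\<lambda>\<omega>. Q n \<omega> k) \<in> borel_measurable M"
  using measurable_compose[OF Q_meas measurable_component_singleton[of k UNIV "\<lambda>_. borel"]] by simp

lemma Z_meas [measurable]: "Z n \<in> M \<rightarrow>\<^sub>M count_space UNIV"
proof (induction n)
  case 0
  show ?case by (simp add: Z0)
next
  case (Suc n)
  have m: "(\<lambda>\<omega>. \<Sum>i<r. \<xi> n i \<omega>) \<in> M \<rightarrow>\<^sub>M count_space UNIV" for r
    by (induction r) (auto intro!: measurable_compose_countable'[where I = UNIV])
  have "(\<lambda>\<omega>. (\<lambda>r \<omega>. \<Sum>i<r. \<xi> n i \<omega>) (Z n \<omega>) \<omega>) \<in> M \<rightarrow>\<^sub>M count_space UNIV"
    by (rule measurable_compose_countable[OF m Suc])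
  thus ?case by (simp add: ZSuc)
qed

lemma sum_xi_meas [measurable]: "(\<lambda>\<omega>. \<Sum>i<r. \<xi> n i \<omega>) \<in> M \<rightarrow>\<^sub>M count_space UNIV"
  by (induction r) (auto intro!: measurable_compose_countable'[where I = UNIV])

lemma Q_bounds: assumes "\<omega> \<in> space M" shows "0 \<le> Q n \<omega> k" "Q n \<omega> k \<le> 1"
proof -
  have q: "\<And>k. 0 \<le> Q n \<omega> k" "Q n \<omega> sums 1" using Q_law[OF assms] by (auto simp: is_offspring_law_def)
  show "0 \<le> Q n \<omega> k" by (rule q)
  show "Q n \<omega> k \<le> 1" using sum_le_suminf[OF sums_summable[OF q(2)], of "{k}"] q by (auto simp: sums_iff)
qed

lemma prod_Q_bounds: assumes "\<omega> \<in> space M" shows "0 \<le> (\<Prod>p\<in>F. Q (fst p) \<omega> (k p))" "(\<Prod>p\<in>F. Q (fst p) \<omega> (k p)) \<le> 1"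
  using Q_bounds[OF assms] by (auto intro!: prod_nonneg prod_le_1)

lemma zlaw_bounds: assumes "\<omega> \<in> space M" shows "0 \<le> zlaw n (\<lambda>m. Q m \<omega>) i" "zlaw n (\<lambda>m. Q m \<omega>) i \<le> 1"
  using zlaw_gf(1)[of "\<lambda>m. Q m \<omega>"] zlaw_le_1[of "\<lambda>m. Q m \<omega>"] Q_law[OF assms] by auto

lemma integrable_term: "integrable M (\<lambda>\<omega>. zlaw n (\<lambda>m. Q m \<omega>) i * conv (Q n \<omega>) r j * (\<Prod>p\<in>F. Q (fst p) \<omega> (k p)))"
proof (rule integrable_const_bound[where B = 1])
  show "AE \<omega> in M. norm (zlaw n (\<lambda>m. Q m \<omega>) i * conv (Q n \<omega>) r j * (\<Prod>p\<in>F. Q (fst p) \<omega> (k p))) \<le> 1"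
  proof (rule AE_I2)
    fix \<omega> assume w: "\<omega> \<in> space M"
    note b = zlaw_bounds[OF w] prod_Q_bounds[OF w] conv_nonneg[OF Q_law[OF w]] conv_le_1[OF Q_law[OF w]]
    show "norm (zlaw n (\<lambda>m. Q m \<omega>) i * conv (Q n \<omega>) r j * (\<Prod>p\<in>F. Q (fst p) \<omega> (k p))) \<le> 1"
      unfolding real_norm_def by (subst abs_of_nonneg) (intro mult_nonneg_nonneg mult_le_one b)+
  qed
qed measurable

text \<open>The set \<open>F\<close> of prescribed offspring numbers is what makes the induction on
  r run: the r-th summand is moved into \<open>F\<close>, and its law joins the product. The side
  condition guarantees that it was not prescribed before.\<close>

lemma generation_sum_law:
  assumes gen: "\<And>F k. finite F \<Longrightarrow> F \<subseteq> {n..} \<times> UNIV \<Longrightarrow>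
      measure M {\<omega> \<in> space M. Z n \<omega> = i \<and> (\<forall>p\<in>F. \<xi> (fst p) (snd p) \<omega> = k p)}
      = (\<integral>\<omega>. zlaw n (\<lambda>m. Q m \<omega>) i * (\<Prod>p\<in>F. Q (fst p) \<omega> (k p)) \<partial>M)"
    and F: "finite F" "F \<subseteq> {n..} \<times> UNIV" "\<And>l. l < r \<Longrightarrow> (n, l) \<notin> F"
  shows "measure M {\<omega> \<in> space M. Z n \<omega> = i \<and> (\<Sum>l<r. \<xi> n l \<omega>) = j \<and> (\<forall>p\<in>F. \<xi> (fst p) (snd p) \<omega> = k p)}
      = (\<integral>\<omega>. zlaw n (\<lambda>m. Q m \<omega>) i * conv (Q n \<omega>) r j * (\<Prod>p\<in>F. Q (fst p) \<omega> (k p)) \<partial>M)"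
  using F
proof (induction r arbitrary: j F k)
  case 0
  show ?case using gen[OF 0(1,2), of k] by (cases "j = 0") auto
next
  case (Suc r)
  define A where "A l = {\<omega> \<in> space M. Z n \<omega> = i \<and> (\<Sum>l<r. \<xi> n l \<omega>) = j - l \<and> (\<forall>p\<in>insert (n, r) F. \<xi> (fst p) (snd p) \<omega> = (k((n, r) := l)) p)}" for l
  have nF: "(n, r) \<notin> F" using Suc.prems(3)[of r] by simp
  have A_eq: "A l = {\<omega> \<in> space M. Z n \<omega> = i \<and> (\<Sum>l<r. \<xi> n l \<omega>) = j - l \<and> \<xi> n r \<omega> = l \<and> (\<forall>p\<in>F. \<xi> (fst p) (snd p) \<omega> = k p)}" for l
    unfolding A_def using nF by auto
  have As: "A l \<in> sets M" for l unfolding A_eq using Suc.prems(1) by measurable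
  have "{\<omega> \<in> space M. Z n \<omega> = i \<and> (\<Sum>l<Suc r. \<xi> n l \<omega>) = j \<and> (\<forall>p\<in>F. \<xi> (fst p) (snd p) \<omega> = k p)} = (\<Union>l\<in>{..j}. A l)"
    unfolding A_eq by auto
  also have "measure M \<dots> = (\<Sum>l\<le>j. measure M (A l))"
    by (rule finite_measure_finite_Union) (use As in \<open>auto simp: disjoint_family_on_def A_eq\<close>)
  also have "\<dots> = (\<Sum>l\<le>j. \<integral>\<omega>. zlaw n (\<lambda>m. Q m \<omega>) i * conv (Q n \<omega>) r (j - l) * (\<Prod>p\<in>insert (n, r) F. Q (fst p) \<omega> ((k((n, r) := l)) p)) \<partial>M)"
    unfolding A_def using Suc.prems by (intro sum.cong refl Suc.IH) auto
  also have "\<dots> = (\<integral>\<omega>. (\<Sum>l\<le>j. zlaw n (\<lambda>m. Q m \<omega>) i * conv (Q n \<omega>) r (j - l) * (\<Prod>p\<in>insert (n, r) F. Q (fst p) \<omega> ((k((n, r) := l)) p))) \<partial>M)"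
    by (rule Bochner_Integration.integral_sum[symmetric]) (rule integrable_term)
  also have "\<dots> = (\<integral>\<omega>. zlaw n (\<lambda>m. Q m \<omega>) i * conv (Q n \<omega>) (Suc r) j * (\<Prod>p\<in>F. Q (fst p) \<omega> (k p)) \<partial>M)"
  proof (rule Bochner_Integration.integral_cong[OF refl])
    fix \<omega>
    have "(\<Prod>p\<in>insert (n, r) F. Q (fst p) \<omega> ((k((n, r) := l)) p)) = Q n \<omega> l * (\<Prod>p\<in>F. Q (fst p) \<omega> (k p))" for l
    proof -
      have "(\<Prod>p\<in>F. Q (fst p) \<omega> ((k((n, r) := l)) p)) = (\<Prod>p\<in>F. Q (fst p) \<omega> (k p))" by (rule prod.cong[OF refl]) (use nF in auto)
      thus ?thesis using Suc.prems(1) nF by simp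
    qed
    thus "(\<Sum>l\<le>j. zlaw n (\<lambda>m. Q m \<omega>) i * conv (Q n \<omega>) r (j - l) * (\<Prod>p\<in>insert (n, r) F. Q (fst p) \<omega> ((k((n, r) := l)) p)))
       = zlaw n (\<lambda>m. Q m \<omega>) i * conv (Q n \<omega>) (Suc r) j * (\<Prod>p\<in>F. Q (fst p) \<omega> (k p))"
      by (simp only: conv.simps sum_distrib_left sum_distrib_right mult_ac)
  qed
  finally show ?case .
qed

lemma generation_law:
  assumes F: "finite F" "F \<subseteq> {n..} \<times> UNIV"
  shows "measure M {\<omega> \<in> space M. Z n \<omega> = i \<and> (\<forall>p\<in>F. \<xi> (fst p) (snd p) \<omega> = k p)}
      = (\<integral>\<omega>. zlaw n (\<lambda>m. Q m \<omega>) i * (\<Prod>p\<in>F. Q (fst p) \<omega> (k p)) \<partial>M)"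
  using F
proof (induction n arbitrary: i F k)
  case 0
  show ?case using xi_law[OF 0(1), of k] by (cases "i = 1") (auto simp: Z0)
next
  case (Suc n)
  define A where "A l = {\<omega> \<in> space M. Z n \<omega> = l \<and> (\<Sum>m<l. \<xi> n m \<omega>) = i \<and> (\<forall>p\<in>F. \<xi> (fst p) (snd p) \<omega> = k p)}" for l
  have As: "A l \<in> sets M" for l unfolding A_def using Suc.prems(1) by measurable
  have mA: "measure M (A l) = (\<integral>\<omega>. zlaw n (\<lambda>m. Q m \<omega>) l * conv (Q n \<omega>) l i * (\<Prod>p\<in>F. Q (fst p) \<omega> (k p)) \<partial>M)" for l
    unfolding A_def by (rule generation_sum_law[OF Suc.IH]) (use Suc.prems in auto)
  have "{\<omega> \<in> space M. Z (Suc n) \<omega> = i \<and> (\<forall>p\<in>F. \<xi> (fst p) (snd p) \<omega> = k p)} = (\<Union>l. A l)"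
    unfolding A_def ZSuc by auto
  moreover have "(\<lambda>l. measure M (A l)) sums measure M (\<Union>l. A l)"
    by (rule finite_measure_UNION) (use As in \<open>auto simp: disjoint_family_on_def A_def\<close>)
  ultimately have s: "(\<lambda>l. \<integral>\<omega>. zlaw n (\<lambda>m. Q m \<omega>) l * conv (Q n \<omega>) l i * (\<Prod>p\<in>F. Q (fst p) \<omega> (k p)) \<partial>M) sums
    measure M {\<omega> \<in> space M. Z (Suc n) \<omega> = i \<and> (\<forall>p\<in>F. \<xi> (fst p) (snd p) \<omega> = k p)}" by (simp add: mA)
  have nn: "0 \<le> zlaw n (\<lambda>m. Q m \<omega>) l * conv (Q n \<omega>) l i * (\<Prod>p\<in>F. Q (fst p) \<omega> (k p))" if "\<omega> \<in> space M" for l \<omega>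
    by (intro mult_nonneg_nonneg zlaw_bounds[OF that] conv_nonneg[OF Q_law[OF that]] prod_Q_bounds[OF that])
  have sm: "summable (\<lambda>l. zlaw n (\<lambda>m. Q m \<omega>) l * conv (Q n \<omega>) l i)" if "\<omega> \<in> space M" for \<omega>
    by (rule zlaw_gf(3)) (rule Q_law[OF that])
  have "(\<integral>\<omega>. suminf (\<lambda>l. zlaw n (\<lambda>m. Q m \<omega>) l * conv (Q n \<omega>) l i * (\<Prod>p\<in>F. Q (fst p) \<omega> (k p))) \<partial>M)
    = suminf (\<lambda>l. \<integral>\<omega>. zlaw n (\<lambda>m. Q m \<omega>) l * conv (Q n \<omega>) l i * (\<Prod>p\<in>F. Q (fst p) \<omega> (k p)) \<partial>M)"
  proof (rule integral_suminf[OF integrable_term])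
    show "AE \<omega> in M. summable (\<lambda>l. norm (zlaw n (\<lambda>m. Q m \<omega>) l * conv (Q n \<omega>) l i * (\<Prod>p\<in>F. Q (fst p) \<omega> (k p))))"
    proof (rule AE_I2)
      fix \<omega> assume w: "\<omega> \<in> space M"
      show "summable (\<lambda>l. norm (zlaw n (\<lambda>m. Q m \<omega>) l * conv (Q n \<omega>) l i * (\<Prod>p\<in>F. Q (fst p) \<omega> (k p))))"
        unfolding real_norm_def abs_of_nonneg[OF nn[OF w]] by (rule summable_mult2[OF sm[OF w]])
    qed
    have "(\<integral>\<omega>. norm (zlaw n (\<lambda>m. Q m \<omega>) l * conv (Q n \<omega>) l i * (\<Prod>p\<in>F. Q (fst p) \<omega> (k p))) \<partial>M)
       = (\<integral>\<omega>. zlaw n (\<lambda>m. Q m \<omega>) l * conv (Q n \<omega>) l i * (\<Prod>p\<in>F. Q (fst p) \<omega> (k p)) \<partial>M)" for l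
      by (rule Bochner_Integration.integral_cong[OF refl]) (simp only: real_norm_def abs_of_nonneg[OF nn])
    thus "summable (\<lambda>l. \<integral>\<omega>. norm (zlaw n (\<lambda>m. Q m \<omega>) l * conv (Q n \<omega>) l i * (\<Prod>p\<in>F. Q (fst p) \<omega> (k p))) \<partial>M)"
      using sums_summable[OF s] by simp
  qed
  also have "\<dots> = measure M {\<omega> \<in> space M. Z (Suc n) \<omega> = i \<and> (\<forall>p\<in>F. \<xi> (fst p) (snd p) \<omega> = k p)}" by (rule sums_unique[OF s, symmetric])
  finally have "measure M {\<omega> \<in> space M. Z (Suc n) \<omega> = i \<and> (\<forall>p\<in>F. \<xi> (fst p) (snd p) \<omega> = k p)}
    = (\<integral>\<omega>. suminf (\<lambda>l. zlaw n (\<lambda>m. Q m \<omega>) l * conv (Q n \<omega>) l i * (\<Prod>p\<in>F. Q (fst p) \<omega> (k p))) \<partial>M)" by (rule sym)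
  also have "\<dots> = (\<integral>\<omega>. zlaw (Suc n) (\<lambda>m. Q m \<omega>) i * (\<Prod>p\<in>F. Q (fst p) \<omega> (k p)) \<partial>M)"
    by (rule Bochner_Integration.integral_cong[OF refl]) (simp add: suminf_mult2[OF sm])
  finally show ?case .
qed

lemma extinct_next_law:
  "measure M {\<omega> \<in> space M. Z n \<omega> = j \<and> Z (Suc n) \<omega> = 0} = (\<integral>\<omega>. zlaw n (\<lambda>m. Q m \<omega>) j * Q n \<omega> 0 ^ j \<partial>M)"
proof -
  have "{\<omega> \<in> space M. Z n \<omega> = j \<and> Z (Suc n) \<omega> = 0} = {\<omega> \<in> space M. Z n \<omega> = j \<and> (\<Sum>l<j. \<xi> n l \<omega>) = 0 \<and> (\<forall>p\<in>{}. \<xi> (fst p) (snd p) \<omega> = k p)}" for k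
    by (auto simp: ZSuc)
  thus ?thesis using generation_sum_law[where F = "{}" and n = n and i = j and r = j and j = 0, OF generation_law] by (simp add: conv_0)
qed

lemma extinction_time_iff: "extinction_time Z \<omega> = enat (Suc n) \<longleftrightarrow> Z n \<omega> \<noteq> 0 \<and> Z (Suc n) \<omega> = 0"
proof -
  have absorb: "Z (k + m) \<omega> = 0" if "Z k \<omega> = 0" for k m using that by (induction m) (auto simp: ZSuc)
  show ?thesis
  proof
    assume a: "extinction_time Z \<omega> = enat (Suc n)"
    hence e: "\<exists>k. Z k \<omega> = 0" "(LEAST k. Z k \<omega> = 0) = Suc n" by (auto simp: extinction_time_def split: if_splits)
    thus "Z n \<omega> \<noteq> 0 \<and> Z (Suc n) \<omega> = 0" using LeastI_ex[OF e(1)] not_less_Least[of n "\<lambda>k. Z k \<omega> = 0"] by auto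
  next
    assume a: "Z n \<omega> \<noteq> 0 \<and> Z (Suc n) \<omega> = 0"
    have "(LEAST k. Z k \<omega> = 0) = Suc n"
    proof (rule Least_equality)
      fix k assume k: "Z k \<omega> = 0"
      show "Suc n \<le> k"
      proof (rule ccontr)
        assume "\<not> Suc n \<le> k"
        thus False using absorb[OF k, of "n - k"] a by simp
      qed
    qed (use a in simp)
    thus "extinction_time Z \<omega> = enat (Suc n)" using a by (auto simp: extinction_time_def)
  qed
qed

end

section \<open>The environment walk of the branching process\<close>

text \<open>If the modulus were 1, a rotation by \<theta> would make the mean real and equal to 1.
  Then 1 - cos (\<theta> + t X) is nonnegative with mean 0, so \<theta> + t X is almost surely a
  multiple of 2 pi and X is lattice.\<close>

lemma (in prob_space) nonlattice_char:
  assumes X [measurable]: "X \<in> borel_measurable M" and nl: "\<not> lattice_rv M X" and t: "t \<noteq> 0"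
  shows "cmod (\<integral>\<omega>. iexp (t * X \<omega>) \<partial>M) < 1"
proof (rule ccontr)
  assume ge: "\<not> cmod (\<integral>\<omega>. iexp (t * X \<omega>) \<partial>M) < 1"
  define z where "z = (\<integral>\<omega>. iexp (t * X \<omega>) \<partial>M)"
  have i: "integrable M (\<lambda>\<omega>. iexp (t * X \<omega>))" by (rule integrable_const_bound[where B = 1]) auto
  define u where "u = cnj (sgn z)"
  have z0: "z \<noteq> 0" using ge by (auto simp: z_def)
  have nu: "cmod u = 1" using z0 by (simp add: u_def norm_sgn)
  then obtain \<theta> where th: "u = iexp \<theta>" by (metis complex_norm_eq_1_exp mult.commute)
  have uz: "u * z = complex_of_real (cmod z)"
  proof -
    have "u * z = cnj z * z / complex_of_real (cmod z)" by (simp add: u_def sgn_eq)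
    also have "\<dots> = complex_of_real (cmod z)" using z0 by (simp add: complex_norm_square[symmetric] mult.commute power2_eq_square)
    finally show ?thesis .
  qed
  have iu: "integrable M (\<lambda>\<omega>. u * iexp (t * X \<omega>))" using i by simp
  have "(\<integral>\<omega>. Re (u * iexp (t * X \<omega>)) \<partial>M) = Re (\<integral>\<omega>. u * iexp (t * X \<omega>) \<partial>M)" by (rule integral_Re[OF iu])
  also have "(\<integral>\<omega>. u * iexp (t * X \<omega>) \<partial>M) = u * z" unfolding z_def by (rule integral_mult_right_zero)
  also have "Re (u * z) = cmod z" unfolding uz by simp
  finally have eRe: "(\<integral>\<omega>. Re (u * iexp (t * X \<omega>)) \<partial>M) = cmod z" .
  have Re: "Re (u * iexp (t * X \<omega>)) = cos (\<theta> + t * X \<omega>)" for \<omega>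
    unfolding th exp_add[symmetric] by (simp add: distrib_left[symmetric] of_real_add[symmetric] Re_exp del: of_real_add)
  have ic: "integrable M (\<lambda>\<omega>. cos (\<theta> + t * X \<omega>))" by (rule integrable_const_bound[where B = 1]) auto
  have "(\<integral>\<omega>. 1 - cos (\<theta> + t * X \<omega>) \<partial>M) = 1 - cmod z" using ic eRe unfolding Re by (simp add: prob_space)
  moreover have "0 \<le> (\<integral>\<omega>. 1 - cos (\<theta> + t * X \<omega>) \<partial>M)" by (intro integral_nonneg_AE) simp
  ultimately have "(\<integral>\<omega>. 1 - cos (\<theta> + t * X \<omega>) \<partial>M) = 0" using ge by (simp add: z_def)
  hence "AE \<omega> in M. 1 - cos (\<theta> + t * X \<omega>) = 0" using ic by (subst (asm) integral_nonneg_eq_0_iff_AE) auto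
  hence "AE \<omega> in M. \<exists>k::int. X \<omega> = (- \<theta> / t) + (2 * pi / \<bar>t\<bar>) * of_int k"
  proof eventually_elim
    case (elim \<omega>)
    hence "cos (\<theta> + t * X \<omega>) = 1" by simp
    then obtain k :: int where k: "\<theta> + t * X \<omega> = of_int k * 2 * pi" using cos_one_2pi_int by auto
    hence "X \<omega> = (of_int k * 2 * pi - \<theta>) / t" using t by (simp add: field_simps)
    moreover have "(of_int k * 2 * pi - \<theta>) / t = (- \<theta> / t) + (2 * pi / \<bar>t\<bar>) * of_int (if t > 0 then k else - k)"
      using t by (cases "t > 0") (simp_all add: diff_divide_distrib mult_ac)
    ultimately show ?case by (intro exI[of _ "if t > 0 then k else - k"]) (simp only:)
  qed
  hence "lattice_rv M X" unfolding lattice_rv_def using t by (intro exI[of _ "- \<theta> / t"] exI[of _ "2 * pi / \<bar>t\<bar>"]) auto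
  thus False using nl by simp
qed

section \<open>From the assumptions on the environment to the walk\<close>

locale bpre_fl = bpre M Q \<xi> Z for M :: "'a measure" and Q \<xi> Z +
  fixes chi :: real
  assumes Q_indep: "indep_vars (\<lambda>_. PiM UNIV (\<lambda>_. borel)) Q UNIV"
    and Q_ident: "\<And>n. distr M (PiM UNIV (\<lambda>_. borel)) (Q n) = distr M (PiM UNIV (\<lambda>_. borel)) (Q 0)"
    and fraclin: "AE \<omega> in M. \<forall>n. fractional_linear (Q n \<omega>)"
    and chi: "0 < chi" "chi < 1/2"
    and Q0: "AE \<omega> in M. chi \<le> gf (Q 0 \<omega>) 0 \<and> gf (Q 0 \<omega>) 0 \<le> 1 - chi \<and> off_eta (Q 0 \<omega>) \<ge> chi"
    and X_mean: "(\<integral>\<omega>. off_X (Q 0 \<omega>) \<partial>M) = 0"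
    and X_sq: "integrable M (\<lambda>\<omega>. (off_X (Q 0 \<omega>))\<^sup>2)"
    and X_var: "variance (\<lambda>\<omega>. off_X (Q 0 \<omega>)) > 0"
    and X_nl: "\<not> lattice_rv M (\<lambda>\<omega>. off_X (Q 0 \<omega>))"
begin

definition D :: "(nat \<Rightarrow> real) measure" where "D = distr M (PiM UNIV (\<lambda>_. borel)) (Q 0)"
text \<open>Under assumption A1 the clipping changes nothing almost surely, but it makes the bounds hold for every weight sequence.\<close>
definition clip_X :: "(nat \<Rightarrow> real) \<Rightarrow> real" where "clip_X q = max (off_X q) (ln chi)"
definition clip_eta :: "(nat \<Rightarrow> real) \<Rightarrow> real" where "clip_eta q = max chi (min (1 / chi) (off_eta q))"

lemma sets_D [measurable_cong]: "sets D = sets (PiM UNIV (\<lambda>_. borel))" by (simp add: D_def)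

lemma comp_meas [measurable]: "(\<lambda>q. q k) \<in> borel_measurable (PiM UNIV (\<lambda>_::nat. borel :: real measure))"
  by (rule measurable_component_singleton) simp

lemma off_meas [measurable]:
  "off_X \<in> borel_measurable (PiM UNIV (\<lambda>_. borel))" "off_eta \<in> borel_measurable (PiM UNIV (\<lambda>_. borel))"
proof -
  have [measurable]: "off_mean \<in> borel_measurable (PiM UNIV (\<lambda>_. borel))" unfolding off_mean_def by measurable
  have [measurable]: "off_fm2 \<in> borel_measurable (PiM UNIV (\<lambda>_. borel))" unfolding off_fm2_def by measurable
  show "off_X \<in> borel_measurable (PiM UNIV (\<lambda>_. borel))" unfolding off_X_def by measurable
  show "off_eta \<in> borel_measurable (PiM UNIV (\<lambda>_. borel))" unfolding off_eta_def by measurable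
qed

lemma xe_meas [measurable]: "clip_X \<in> borel_measurable D" "clip_eta \<in> borel_measurable D"
  unfolding clip_X_def clip_eta_def by measurable

text \<open>At s = 0 the fractional-linear identity reads 1 / (1 - Q(0)) = exp (-X) + eta, and the
  left side is at most 1 / chi. Both positive summands inherit this bound: X >= ln chi and eta <= 1
  / chi, which are exactly the clipping levels.\<close>

lemma good: "AE \<omega> in M. \<forall>n. fractional_linear (Q n \<omega>) \<and> chi \<le> Q n \<omega> 0 \<and> Q n \<omega> 0 \<le> 1 - chi \<and> chi \<le> off_eta (Q n \<omega>)
    \<and> clip_X (Q n \<omega>) = off_X (Q n \<omega>) \<and> clip_eta (Q n \<omega>) = off_eta (Q n \<omega>)"
proof -
  have b: "AE \<omega> in M. chi \<le> Q n \<omega> 0 \<and> Q n \<omega> 0 \<le> 1 - chi \<and> chi \<le> off_eta (Q n \<omega>)" for n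
  proof -
    have s: "{q \<in> space (PiM UNIV (\<lambda>_::nat. borel :: real measure)). chi \<le> q 0 \<and> q 0 \<le> 1 - chi \<and> chi \<le> off_eta q} \<in> sets (PiM UNIV (\<lambda>_. borel))"
      by measurable
    show ?thesis using Q0 unfolding gf_0 AE_distr_iff[OF Q_meas s, symmetric] Q_ident[of n] .
  qed
  hence "AE \<omega> in M. \<forall>n. chi \<le> Q n \<omega> 0 \<and> Q n \<omega> 0 \<le> 1 - chi \<and> chi \<le> off_eta (Q n \<omega>)" by (simp add: AE_all_countable)
  thus ?thesis using fraclin
  proof eventually_elim
    case (elim \<omega>)
    show ?case
    proof
      fix n
      have e: "1 / (1 - Q n \<omega> 0) = exp (- off_X (Q n \<omega>)) + off_eta (Q n \<omega>)"
        using elim(2) unfolding fractional_linear_def by (auto simp: gf_0[symmetric] dest!: spec[of _ n])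
      have q: "chi \<le> Q n \<omega> 0" "Q n \<omega> 0 \<le> 1 - chi" "chi \<le> off_eta (Q n \<omega>)" using elim by auto
      have "1 / (1 - Q n \<omega> 0) \<le> 1 / chi" using q chi by (intro divide_left_mono) auto
      hence le: "exp (- off_X (Q n \<omega>)) + off_eta (Q n \<omega>) \<le> 1 / chi" using e by simp
      have "exp (- off_X (Q n \<omega>)) \<le> exp (- ln chi)" using le q chi by (simp add: exp_minus inverse_eq_divide)
      hence "ln chi \<le> off_X (Q n \<omega>)" by simp
      moreover have "off_eta (Q n \<omega>) \<le> 1 / chi" using le exp_gt_zero[of "- off_X (Q n \<omega>)"] by linarith
      ultimately show "fractional_linear (Q n \<omega>) \<and> chi \<le> Q n \<omega> 0 \<and> Q n \<omega> 0 \<le> 1 - chi \<and> chi \<le> off_eta (Q n \<omega>)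
          \<and> clip_X (Q n \<omega>) = off_X (Q n \<omega>) \<and> clip_eta (Q n \<omega>) = off_eta (Q n \<omega>)"
        using elim q by (auto simp: clip_X_def clip_eta_def)
    qed
  qed
qed

lemma good_0: "AE \<omega> in M. chi \<le> Q 0 \<omega> 0 \<and> Q 0 \<omega> 0 \<le> 1 - chi \<and> clip_X (Q 0 \<omega>) = off_X (Q 0 \<omega>)"
  using good by eventually_elim auto

lemma int_D:
  fixes f :: "(nat \<Rightarrow> real) \<Rightarrow> 'c :: {banach, second_countable_topology}"
  assumes "f \<in> borel_measurable D" shows "(\<integral>q. f q \<partial>D) = (\<integral>\<omega>. f (Q 0 \<omega>) \<partial>M)" "integrable D f \<longleftrightarrow> integrable M (\<lambda>\<omega>. f (Q 0 \<omega>))"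
proof -
  have f: "f \<in> borel_measurable (PiM UNIV (\<lambda>_. borel))" using assms by (simp add: measurable_cong_sets[OF sets_D refl])
  show "(\<integral>q. f q \<partial>D) = (\<integral>\<omega>. f (Q 0 \<omega>) \<partial>M)" unfolding D_def by (rule integral_distr[OF Q_meas f])
  show "integrable D f \<longleftrightarrow> integrable M (\<lambda>\<omega>. f (Q 0 \<omega>))" unfolding D_def by (rule integrable_distr_eq[OF Q_meas f])
qed

lemma Q0_meas' [measurable]: "Q n \<in> M \<rightarrow>\<^sub>M D" using Q_meas by (simp add: measurable_cong_sets[OF refl sets_D])

lemma off_XQ_meas [measurable]: "(\<lambda>\<omega>. off_X (Q n \<omega>)) \<in> borel_measurable M"
  by (rule measurable_compose[OF Q_meas off_meas(1)])

lemma clipped_affine_walk: "affine_walk D clip_X (\<integral>q. (clip_X q)\<^sup>2 \<partial>D) (- ln chi) clip_eta chi (1 / chi)"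
proof -
  interpret DP: prob_space D unfolding D_def by (rule prob_space_distr[OF Q_meas])
  have sq: "AE \<omega> in M. (clip_X (Q 0 \<omega>))\<^sup>2 = (off_X (Q 0 \<omega>))\<^sup>2" using good_0 by eventually_elim simp
  have sqi: "(\<integral>q. (clip_X q)\<^sup>2 \<partial>D) = (\<integral>\<omega>. (off_X (Q 0 \<omega>))\<^sup>2 \<partial>M)"
    unfolding int_D(1)[of "\<lambda>q. (clip_X q)\<^sup>2", simplified] by (rule integral_cong_AE) (use sq in auto)
  show ?thesis
  proof
    show "clip_X \<in> borel_measurable D" "clip_eta \<in> borel_measurable D" by measurable
    show "- (- ln chi) \<le> clip_X q" for q by (simp add: clip_X_def)
    show "integrable D (\<lambda>q. (clip_X q)\<^sup>2)"
      unfolding int_D(2)[of "\<lambda>q. (clip_X q)\<^sup>2", simplified] by (rule iffD2[OF integrable_cong_AE X_sq]) (use sq in auto)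
    show "(\<integral>q. clip_X q \<partial>D) = 0"
    proof -
      have "(\<integral>q. clip_X q \<partial>D) = (\<integral>\<omega>. off_X (Q 0 \<omega>) \<partial>M)"
        unfolding int_D(1)[of clip_X, simplified] by (rule integral_cong_AE) (use good_0 in auto)
      thus ?thesis using X_mean by simp
    qed
    show "0 < (\<integral>q. (clip_X q)\<^sup>2 \<partial>D)" using X_var unfolding sqi X_mean by simp
    show "cmod (\<integral>q. iexp (t * clip_X q) \<partial>D) < 1" if "t \<noteq> 0" for t
    proof -
      have "(\<integral>q. iexp (t * clip_X q) \<partial>D) = (\<integral>\<omega>. iexp (t * clip_X (Q 0 \<omega>)) \<partial>M)" by (rule int_D(1)) measurable
      also have "\<dots> = (\<integral>\<omega>. iexp (t * off_X (Q 0 \<omega>)) \<partial>M)" by (rule integral_cong_AE) (use good_0 in auto)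
      finally show ?thesis using nonlattice_char[OF off_XQ_meas X_nl that] by simp
    qed
    show "chi \<le> clip_eta q" "clip_eta q \<le> 1 / chi" for q using chi by (auto simp: clip_eta_def field_simps min_def power2_eq_square[symmetric] power_le_one)
  qed (use chi in auto)
qed

sublocale W: affine_walk D clip_X "\<integral>q. (clip_X q)\<^sup>2 \<partial>D" "- ln chi" clip_eta chi "1 / chi" by (rule clipped_affine_walk)

text \<open>The probability that j individuals sharing one random offspring law all remain
  childless. Its geometric decay in j is what later dominates the sum over population sizes.\<close>

definition kill_moment :: "nat \<Rightarrow> real" where "kill_moment j = (\<integral>\<omega>. Q 0 \<omega> 0 ^ j \<partial>M)"

lemma kill_moment_int: "integrable M (\<lambda>\<omega>. Q 0 \<omega> 0 ^ j)"
proof (rule integrable_const_bound[where B = 1])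
  show "AE \<omega> in M. norm (Q 0 \<omega> 0 ^ j) \<le> 1" using Q_bounds[of _ 0 0] by (intro AE_I2) (auto simp: power_le_one)
qed measurable

lemma kill_moment_bounds: "0 < kill_moment j" "kill_moment j \<le> (1 - chi) ^ j"
proof -
  have e: "AE \<omega> in M. chi ^ j \<le> Q 0 \<omega> 0 ^ j" "AE \<omega> in M. Q 0 \<omega> 0 ^ j \<le> (1 - chi) ^ j"
    using good_0 by (eventually_elim, use chi in \<open>auto intro!: power_mono\<close>)+
  have "(\<integral>\<omega>. chi ^ j \<partial>M) \<le> kill_moment j" unfolding kill_moment_def by (rule integral_mono_AE[OF _ kill_moment_int e(1)]) simp
  thus "0 < kill_moment j" using chi by (simp add: prob_space less_le_trans[OF zero_less_power[OF chi(1), of j]])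
  have "kill_moment j \<le> (\<integral>\<omega>. (1 - chi) ^ j \<partial>M)" unfolding kill_moment_def by (rule integral_mono_AE[OF kill_moment_int _ e(2)]) simp
  thus "kill_moment j \<le> (1 - chi) ^ j" by (simp add: prob_space)
qed

lemma env_distr: "distr M (PiM UNIV (\<lambda>_. PiM UNIV (\<lambda>_. borel))) (\<lambda>\<omega> n. Q n \<omega>) = PiM UNIV (\<lambda>_::nat. D)"
proof -
  have "distr M (PiM UNIV (\<lambda>_. PiM UNIV (\<lambda>_. borel))) (\<lambda>\<omega>. \<lambda>n\<in>UNIV. Q n \<omega>) = PiM UNIV (\<lambda>n. distr M (PiM UNIV (\<lambda>_. borel)) (Q n))"
    using Q_indep by (subst (asm) indep_vars_iff_distr_eq_PiM) (use Q_meas in auto)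
  moreover have "(\<lambda>n. distr M (PiM UNIV (\<lambda>_. borel)) (Q n)) = (\<lambda>_. D)" unfolding D_def by (rule ext) (rule Q_ident)
  ultimately show ?thesis by (simp only: restrict_UNIV)
qed

text \<open>Indices start at 0, so Z n is governed by Q 0, ..., Q (n - 1) and the passage to n + 1
  by Q n, which is independent of them; the two expectations factor.\<close>

lemma last_generation_law:
  assumes n: "n \<ge> 1"
  shows "measure M {\<omega> \<in> space M. Z n \<omega> = Suc j \<and> Z (Suc n) \<omega> = 0} = kill_moment (Suc j) * W.survival_weight j n"
proof -
  define G where "G \<theta> = exp (- W.walk \<theta> n) * fl_weight j (exp (- W.walk \<theta> n)) (W.perpetuity \<theta> n)" for \<theta>
  define h where "h q = q 0 ^ Suc j" for q :: "nat \<Rightarrow> real"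
  have iG: "integrable (PiM UNIV (\<lambda>_. D)) G" unfolding G_def by (rule W.integrable_survival_weight[OF n])
  have hm [measurable]: "h \<in> borel_measurable D" unfolding h_def by measurable
  have ih: "integrable D h" unfolding int_D(2)[OF hm] unfolding h_def by (rule kill_moment_int)
  have Eh: "(\<integral>q. h q \<partial>D) = kill_moment (Suc j)" unfolding int_D(1)[OF hm] unfolding h_def kill_moment_def ..
  have [measurable]: "G \<in> borel_measurable (PiM UNIV (\<lambda>_. D))" using iG by simp
  have fm: "(\<lambda>\<theta>. G \<theta> * h (\<theta> n)) \<in> borel_measurable (PiM UNIV (\<lambda>_. D))" by measurable
  have seq: "sets (PiM UNIV (\<lambda>_::nat. D)) = sets (PiM UNIV (\<lambda>_. PiM UNIV (\<lambda>_. borel)))" by (rule sets_PiM_cong) (auto simp: sets_D)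
  have fm': "(\<lambda>\<theta>. G \<theta> * h (\<theta> n)) \<in> borel_measurable (PiM UNIV (\<lambda>_. PiM UNIV (\<lambda>_. borel)))" using fm by (simp add: measurable_cong_sets[OF seq refl])
  have em: "(\<lambda>\<omega> n. Q n \<omega>) \<in> M \<rightarrow>\<^sub>M PiM UNIV (\<lambda>_. PiM UNIV (\<lambda>_. borel))"
    by (rule measurable_PiM_single') (use Q_meas measurable_space[OF Q_meas] in auto)
  have em': "(\<lambda>\<omega> n. Q n \<omega>) \<in> M \<rightarrow>\<^sub>M PiM UNIV (\<lambda>_. D)" using em by (simp add: measurable_cong_sets[OF refl seq])
  have "measure M {\<omega> \<in> space M. Z n \<omega> = Suc j \<and> Z (Suc n) \<omega> = 0} = (\<integral>\<omega>. zlaw n (\<lambda>m. Q m \<omega>) (Suc j) * Q n \<omega> 0 ^ Suc j \<partial>M)"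
    by (rule extinct_next_law)
  also have "\<dots> = (\<integral>\<omega>. G (\<lambda>m. Q m \<omega>) * h (Q n \<omega>) \<partial>M)"
  proof (rule integral_cong_AE)
    show "(\<lambda>\<omega>. G (\<lambda>m. Q m \<omega>) * h (Q n \<omega>)) \<in> borel_measurable M"
      using measurable_compose[OF em' fm] by simp
    show "AE \<omega> in M. zlaw n (\<lambda>m. Q m \<omega>) (Suc j) * Q n \<omega> 0 ^ Suc j = G (\<lambda>m. Q m \<omega>) * h (Q n \<omega>)"
      using good AE_space
    proof eventually_elim
      case (elim \<omega>)
      have S: "W.walk (\<lambda>m. Q m \<omega>) k = (\<Sum>l<k. off_X (Q l \<omega>))" for k using elim(1) by (simp add: W.walk_def pS_def)
      have B: "W.perpetuity (\<lambda>m. Q m \<omega>) n = (\<Sum>k<n. off_eta (Q k \<omega>) * exp (- (\<Sum>l<k. off_X (Q l \<omega>))))"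
        unfolding W.perpetuity_def S using elim(1) by simp
      have "zlaw n (\<lambda>m. Q m \<omega>) (Suc j) = G (\<lambda>m. Q m \<omega>)"
        unfolding G_def S B
        by (subst zlaw_explicit[of "\<lambda>m. Q m \<omega>" n "Suc j"]) (use Q_law[OF elim(2)] elim(1) n chi in \<open>auto intro: less_le_trans\<close>)
      thus ?case by (simp add: h_def)
    qed
  qed measurable
  also have "\<dots> = (\<integral>\<theta>. G \<theta> * h (\<theta> n) \<partial>distr M (PiM UNIV (\<lambda>_. PiM UNIV (\<lambda>_. borel))) (\<lambda>\<omega> n. Q n \<omega>))"
    by (rule integral_distr[OF em fm', symmetric])
  also have "\<dots> = (\<integral>\<theta>. G \<theta> * h (\<theta> n) \<partial>PiM UNIV (\<lambda>_. D))" unfolding env_distr ..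
  also have "\<dots> = (\<integral>\<theta>. G \<theta> \<partial>PiM UNIV (\<lambda>_. D)) * (\<integral>q. h q \<partial>D)"
    by (rule W.E_indep_mult(2)[OF iG ih]) (simp add: G_def W.walk_comb_left W.perpetuity_comb_left)
  also have "\<dots> = kill_moment (Suc j) * W.survival_weight j n" unfolding Eh by (simp add: W.survival_weight_def G_def)
  finally show ?thesis .
qed

definition last_size :: "nat \<Rightarrow> nat \<Rightarrow> real" where "last_size n y = measure M {\<omega> \<in> space M. Z n \<omega> = y \<and> extinction_time Z \<omega> = enat (Suc n)}"

lemma last_size_eq: "n \<ge> 1 \<Longrightarrow> last_size n y = (case y of 0 \<Rightarrow> 0 | Suc j \<Rightarrow> kill_moment (Suc j) * W.survival_weight j n)"
proof (cases y)
  case (Suc j)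
  assume n: "n \<ge> 1"
  have "{\<omega> \<in> space M. Z n \<omega> = Suc j \<and> extinction_time Z \<omega> = enat (Suc n)} = {\<omega> \<in> space M. Z n \<omega> = Suc j \<and> Z (Suc n) \<omega> = 0}"
    by (auto simp: extinction_time_iff)
  thus ?thesis unfolding last_size_def Suc using last_generation_law[OF n, of j] by simp
next
  case 0
  have e: "{\<omega> \<in> space M. Z n \<omega> = 0 \<and> extinction_time Z \<omega> = enat (Suc n)} = {}" by (auto simp: extinction_time_iff)
  show ?thesis unfolding last_size_def 0 e by simp
qed

lemma ext_sets [measurable]: "Measurable.pred M (\<lambda>\<omega>. extinction_time Z \<omega> = enat (Suc n))"
  unfolding extinction_time_iff by measurable

lemma last_size_sums: "last_size n sums measure M {\<omega> \<in> space M. extinction_time Z \<omega> = enat (Suc n)}"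
proof -
  have "{\<omega> \<in> space M. extinction_time Z \<omega> = enat (Suc n)} = (\<Union>y. {\<omega> \<in> space M. Z n \<omega> = y \<and> extinction_time Z \<omega> = enat (Suc n)})" by auto
  moreover have "(\<lambda>y. measure M {\<omega> \<in> space M. Z n \<omega> = y \<and> extinction_time Z \<omega> = enat (Suc n)}) sums
      measure M (\<Union>y. {\<omega> \<in> space M. Z n \<omega> = y \<and> extinction_time Z \<omega> = enat (Suc n)})"
    by (rule finite_measure_UNION) (auto simp: disjoint_family_on_def)
  ultimately show ?thesis unfolding last_size_def[symmetric] by simp
qed

lemma last_size_finite: "finite Y \<Longrightarrow> measure M {\<omega> \<in> space M. Z n \<omega> \<in> Y \<and> extinction_time Z \<omega> = enat (Suc n)} = (\<Sum>y\<in>Y. last_size n y)"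
proof -
  assume Y: "finite Y"
  have "{\<omega> \<in> space M. Z n \<omega> \<in> Y \<and> extinction_time Z \<omega> = enat (Suc n)} = (\<Union>y\<in>Y. {\<omega> \<in> space M. Z n \<omega> = y \<and> extinction_time Z \<omega> = enat (Suc n)})" by auto
  also have "measure M \<dots> = (\<Sum>y\<in>Y. last_size n y)" unfolding last_size_def
    by (rule finite_measure_finite_Union[OF Y]) (auto simp: disjoint_family_on_def)
  finally show ?thesis .
qed

text \<open>The limit is taken for each population size separately and then summed by Tannery's
  theorem: \<open>survival_weight\<close> is bounded uniformly in its index at scale n^(3/2), and
  \<open>kill_moment\<close> adds a geometric factor, so no mass escapes to infinity.\<close>

lemma tail_limits:
  obtains P c where "\<And>y. (\<lambda>n. r32 n * last_size n y) \<longlonglongrightarrow> P y" "P 0 = 0" "\<And>y. 0 < P (Suc y)" "P sums c" "0 < c"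
    "(\<lambda>n. r32 n * measure M {\<omega> \<in> space M. extinction_time Z \<omega> = enat (Suc n)}) \<longlonglongrightarrow> c"
proof -
  obtain p C where p: "\<And>i. (\<lambda>n. r32 n * W.survival_weight i n) \<longlonglongrightarrow> p i" "\<And>i. 0 < p i" "\<And>i n. n \<ge> 1 \<Longrightarrow> r32 n * W.survival_weight i n \<le> C" "\<And>i n. 0 \<le> r32 n * W.survival_weight i n"
    using W.survival_weight_asymp by blast
  define P where "P y = (case y of 0 \<Rightarrow> 0 | Suc j \<Rightarrow> kill_moment (Suc j) * p j)" for y
  have r0: "r32 0 = 0" by (simp add: r32_def)
  have h: "r32 n * last_size n y = (case y of 0 \<Rightarrow> 0 | Suc j \<Rightarrow> kill_moment (Suc j) * (r32 n * W.survival_weight j n))" for n y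
    by (cases "n \<ge> 1") (auto simp: last_size_eq r0 not_le split: nat.split)
  have lim: "(\<lambda>n. r32 n * last_size n y) \<longlonglongrightarrow> P y" for y
  proof (cases y)
    case (Suc j)
    show ?thesis unfolding h P_def Suc nat.case by (intro tendsto_mult tendsto_const p)
  qed (simp add: h P_def)
  have C: "C \<ge> 0" using p(3)[of 1 0] p(4)[of 1 0] by linarith
  define H where "H y = C * (1 - chi) ^ y" for y
  have sH: "summable H" unfolding H_def using chi by (intro summable_mult summable_geometric) auto
  have bd: "norm (r32 n * last_size n y) \<le> H y" for n y
  proof (cases y)
    case 0
    thus ?thesis using C by (simp add: h H_def)
  next
    case (Suc j)
    have u: "0 \<le> r32 n * W.survival_weight j n" "r32 n * W.survival_weight j n \<le> C"
    proof -
      show "0 \<le> r32 n * W.survival_weight j n" by (rule p)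
      show "r32 n * W.survival_weight j n \<le> C"
      proof (cases "n = 0")
        case True
        show ?thesis unfolding True r0 using C by simp
      qed (rule p(3), simp)
    qed
    have "norm (r32 n * last_size n y) = kill_moment (Suc j) * (r32 n * W.survival_weight j n)" unfolding h Suc nat.case using u kill_moment_bounds(1)[of "Suc j"] by simp
    also have "\<dots> \<le> (1 - chi) ^ Suc j * C" using u kill_moment_bounds[of "Suc j"] chi by (intro mult_mono) auto
    finally show ?thesis by (simp add: H_def Suc mult_ac)
  qed
  define c where "c = suminf P"
  have t: "(\<lambda>n. suminf (\<lambda>y. r32 n * last_size n y)) \<longlonglongrightarrow> c" unfolding c_def by (rule tannery3[OF sH bd lim])
  have e: "suminf (\<lambda>y. r32 n * last_size n y) = r32 n * measure M {\<omega> \<in> space M. extinction_time Z \<omega> = enat (Suc n)}" for n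
    by (rule sums_unique[symmetric]) (intro sums_mult last_size_sums)
  have P0: "0 \<le> P y" for y unfolding P_def using p(2) kill_moment_bounds(1) by (auto split: nat.split intro: mult_nonneg_nonneg less_imp_le)
  have Ppos: "0 < P (Suc y)" for y unfolding P_def using p(2) kill_moment_bounds(1) by simp
  have "P y \<le> H y" for y
    by (rule LIMSEQ_le_const2[OF lim]) (intro exI[of _ 0] allI impI order_trans[OF abs_ge_self bd[unfolded real_norm_def]])
  hence sP: "summable P" using P0 by (intro summable_comparison_test'[OF sH, of 0]) auto
  have "0 < c" unfolding c_def by (rule suminf_pos2[OF sP P0 Ppos])
  thus ?thesis using that[of P c] lim Ppos summable_sums[OF sP] t unfolding e c_def by (simp add: P_def)
qed

text \<open>The limit law is P / c. It is a probability law on the integers because the total mass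
  converges to the sum of the limits, which is the finiteness of Y; it is non-degenerate because
  every positive integer has positive mass.\<close>

theorem conditional_limit:
  "\<exists>c>0. (\<lambda>n. measure M {\<omega> \<in> space M. extinction_time Z \<omega> = enat (Suc n)}) \<sim>[sequentially] (\<lambda>n. c * real n powr (-3/2)) \<and>
      (\<exists>\<nu> :: nat pmf. (\<forall>y. pmf \<nu> y < 1) \<and>
         weak_conv_m
           (\<lambda>n. distr (uniform_measure M {\<omega> \<in> space M. extinction_time Z \<omega> = enat (Suc n)}) borel (\<lambda>\<omega>. real (Z n \<omega>)))
           (distr (measure_pmf \<nu>) borel real))"
proof -
  obtain P c where P: "\<And>y. (\<lambda>n. r32 n * last_size n y) \<longlonglongrightarrow> P y" "P 0 = 0" "\<And>y. 0 < P (Suc y)" "P sums c" "0 < c"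
    and T: "(\<lambda>n. r32 n * measure M {\<omega> \<in> space M. extinction_time Z \<omega> = enat (Suc n)}) \<longlonglongrightarrow> c" using tail_limits by blast
  define t where "t n = measure M {\<omega> \<in> space M. extinction_time Z \<omega> = enat (Suc n)}" for n
  have rp: "real n powr (-3/2) = 1 / r32 n" if "n \<ge> 1" for n
  proof -
    have "real n powr (3/2) = real n powr (1 + 1/2)" by simp
    also have "\<dots> = r32 n" unfolding powr_add using that by (simp add: powr_half_sqrt r32_def)
    finally show ?thesis using powr_minus_divide[of "real n" "3/2"] by simp
  qed
  have as: "t \<sim>[sequentially] (\<lambda>n. c * real n powr (-3/2))"
  proof (rule asymp_equivI')
    have "(\<lambda>n. r32 n * t n / c) \<longlonglongrightarrow> c / c" using T unfolding t_def by (intro tendsto_divide tendsto_const) (use P in auto)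
    hence "(\<lambda>n. r32 n * t n / c) \<longlonglongrightarrow> 1" using P by simp
    moreover have "\<forall>\<^sub>F n in sequentially. r32 n * t n / c = t n / (c * real n powr (-3/2))"
      using eventually_ge_at_top[of 1] by eventually_elim (simp only: rp, simp)
    ultimately show "(\<lambda>n. t n / (c * real n powr (-3/2))) \<longlonglongrightarrow> 1" by (rule Lim_transform_eventually)
  qed
  define f where "f y = P y / c" for y
  have f0: "0 \<le> f y" for y using P by (cases y) (auto simp: f_def less_imp_le)
  have fs: "f sums 1" using sums_divide[OF P(4), of c] P(5) by (simp add: f_def[abs_def])
  define \<nu> where "\<nu> = embed_pmf f"
  have nu: "pmf \<nu> y = f y" for y unfolding \<nu>_def
  proof (rule pmf_embed_pmf)
    show "(\<integral>\<^sup>+y. ennreal (f y) \<partial>count_space UNIV) = 1"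
      unfolding nn_integral_count_space_nat using suminf_ennreal_eq[OF f0 fs] by simp
  qed (rule f0)
  have lt1: "pmf \<nu> y < 1" for y
  proof -
    \<comment> \<open>A second atom different from \<open>y\<close>: its positive mass forces that
      of \<open>y\<close> below 1.\<close>
    define y' where "y' = (if y = 1 then 2 else 1 :: nat)"
    have y': "y \<noteq> y'" "f y' > 0" using P(3)[of "y' - 1"] P(5) by (auto simp: y'_def f_def numeral_2_eq_2 split: if_splits)
    have "sum f {y, y'} \<le> suminf f" by (rule sum_le_suminf[OF sums_summable[OF fs]]) (use f0 in auto)
    thus ?thesis using y' sums_unique[OF fs] by (simp add: nu)
  qed
  have "weak_conv_m (\<lambda>n. distr (uniform_measure M {\<omega> \<in> space M. extinction_time Z \<omega> = enat (Suc n)}) borel (\<lambda>\<omega>. real (Z n \<omega>))) (distr (measure_pmf \<nu>) borel real)"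
    unfolding weak_conv_m_def weak_conv_def
  proof (intro allI impI)
    fix x :: real
    \<comment> \<open>A distribution function on the nonnegative integers is a finite sum of point
      masses, so convergence of the masses gives convergence at every x, continuity point or
      not.\<close>
    define Y where "Y = {y::nat. real y \<le> x}"
    have Y: "finite Y"
    proof (rule finite_subset)
      show "Y \<subseteq> {..nat \<lfloor>x\<rfloor>}" unfolding Y_def by (auto simp: le_nat_floor)
    qed simp
    have 1: "cdf (distr (uniform_measure M {\<omega> \<in> space M. extinction_time Z \<omega> = enat (Suc n)}) borel (\<lambda>\<omega>. real (Z n \<omega>))) x = (\<Sum>y\<in>Y. last_size n y) / t n" for n
    proof -
      have "cdf (distr (uniform_measure M {\<omega> \<in> space M. extinction_time Z \<omega> = enat (Suc n)}) borel (\<lambda>\<omega>. real (Z n \<omega>))) x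
         = measure (uniform_measure M {\<omega> \<in> space M. extinction_time Z \<omega> = enat (Suc n)}) {\<omega> \<in> space M. Z n \<omega> \<in> Y}"
      proof -
        have m: "(\<lambda>\<omega>. real (Z n \<omega>)) \<in> borel_measurable (uniform_measure M {\<omega> \<in> space M. extinction_time Z \<omega> = enat (Suc n)})"
          by (subst measurable_cong_sets[OF sets_uniform_measure refl]) (rule measurable_compose[OF Z_meas], simp)
        show ?thesis unfolding cdf_def by (subst measure_distr[OF m]) (auto simp: Y_def intro!: arg_cong2[where f = measure])
      qed
      also have "\<dots> = \<P>(\<omega> in M. Z n \<omega> \<in> Y \<bar> extinction_time Z \<omega> = enat (Suc n))"
        using measure_uniform_measure_eq_cond_prob[of "\<lambda>\<omega>. Z n \<omega> \<in> Y" "\<lambda>\<omega>. extinction_time Z \<omega> = enat (Suc n)"] by simp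
      also have "\<dots> = (\<Sum>y\<in>Y. last_size n y) / t n" unfolding cond_prob_def last_size_finite[OF Y] t_def ..
      finally show ?thesis .
    qed
    have 2: "cdf (distr (measure_pmf \<nu>) borel real) x = (\<Sum>y\<in>Y. f y)"
    proof -
      have "cdf (distr (measure_pmf \<nu>) borel real) x = measure (measure_pmf \<nu>) Y"
        unfolding cdf_def by (subst measure_distr) (auto simp: Y_def intro!: arg_cong2[where f = measure])
      thus ?thesis using Y by (simp add: measure_measure_pmf_finite nu)
    qed
    have "(\<lambda>n. (\<Sum>y\<in>Y. r32 n * last_size n y) / (r32 n * t n)) \<longlonglongrightarrow> (\<Sum>y\<in>Y. P y) / c"
      using P(5) T unfolding t_def by (intro tendsto_divide tendsto_sum P(1)) auto
    moreover have "\<forall>\<^sub>F n in sequentially. (\<Sum>y\<in>Y. r32 n * last_size n y) / (r32 n * t n) = (\<Sum>y\<in>Y. last_size n y) / t n"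
      using eventually_ge_at_top[of 1] by eventually_elim (use r32_pos in \<open>simp add: sum_distrib_left[symmetric] less_imp_neq[symmetric]\<close>)
    ultimately have "(\<lambda>n. (\<Sum>y\<in>Y. last_size n y) / t n) \<longlonglongrightarrow> (\<Sum>y\<in>Y. P y) / c" by (rule Lim_transform_eventually)
    thus "(\<lambda>n. cdf (distr (uniform_measure M {\<omega> \<in> space M. extinction_time Z \<omega> = enat (Suc n)}) borel (\<lambda>\<omega>. real (Z n \<omega>))) x)
       \<longlonglongrightarrow> cdf (distr (measure_pmf \<nu>) borel real) x"
      unfolding 1 2 f_def sum_divide_distrib .
  qed
  thus ?thesis using P(5) as lt1 unfolding t_def by blast
qed

end

theorem theorem1:
  fixes M :: "'a measure"
    and Q :: "nat \<Rightarrow> 'a \<Rightarrow> (nat \<Rightarrow> real)"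
    and \<xi> :: "nat \<Rightarrow> nat \<Rightarrow> 'a \<Rightarrow> nat"
    and Z :: "nat \<Rightarrow> 'a \<Rightarrow> nat"
    and chi :: real
  assumes prob: "prob_space M"
    and Q_meas: "\<And>n. Q n \<in> M \<rightarrow>\<^sub>M PiM UNIV (\<lambda>_. borel)"
    and Q_law: "\<And>n \<omega>. \<omega> \<in> space M \<Longrightarrow> is_offspring_law (Q n \<omega>)"
    and Q_indep: "prob_space.indep_vars M (\<lambda>_. PiM UNIV (\<lambda>_. borel)) Q UNIV"
    and Q_ident: "\<And>n. distr M (PiM UNIV (\<lambda>_. borel)) (Q n) = distr M (PiM UNIV (\<lambda>_. borel)) (Q 0)"
    and xi_meas: "\<And>n i. \<xi> n i \<in> M \<rightarrow>\<^sub>M count_space UNIV"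
    and xi_cond: "\<And>F k B. finite F \<Longrightarrow> B \<in> sets (PiM UNIV (\<lambda>_. PiM UNIV (\<lambda>_. borel))) \<Longrightarrow>
        measure M ({\<omega> \<in> space M. (\<lambda>n. Q n \<omega>) \<in> B} \<inter>
                   {\<omega> \<in> space M. \<forall>p\<in>F. \<xi> (fst p) (snd p) \<omega> = k p})
        = (\<integral>\<omega>. indicator {\<omega> \<in> space M. (\<lambda>n. Q n \<omega>) \<in> B} \<omega> *
                 (\<Prod>p\<in>F. Q (fst p) \<omega> (k p)) \<partial>M)"
    and Z0: "\<And>\<omega>. Z 0 \<omega> = 1"
    and ZSuc: "\<And>n \<omega>. Z (Suc n) \<omega> = (\<Sum>i<Z n \<omega>. \<xi> n i \<omega>)"
    and fraclin: "AE \<omega> in M. \<forall>n. fractional_linear (Q n \<omega>)"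
    and A1: "0 < chi" "chi < 1/2"
      "AE \<omega> in M. chi \<le> gf (Q 0 \<omega>) 0 \<and> gf (Q 0 \<omega>) 0 \<le> 1 - chi \<and> off_eta (Q 0 \<omega>) \<ge> chi"
    and A2: "integrable M (\<lambda>\<omega>. off_X (Q 0 \<omega>))"
      "(\<integral>\<omega>. off_X (Q 0 \<omega>) \<partial>M) = 0"
      "integrable M (\<lambda>\<omega>. (off_X (Q 0 \<omega>))\<^sup>2)"
      "prob_space.variance M (\<lambda>\<omega>. off_X (Q 0 \<omega>)) > 0"
      "\<not> lattice_rv M (\<lambda>\<omega>. off_X (Q 0 \<omega>))"
    and A3: "\<exists>\<epsilon>>0. \<exists>a::nat. a \<ge> 1 \<and>
      (\<integral>\<^sup>+\<omega>. ennreal ((log_plus (zeta a (Q 0 \<omega>))) powr (2 + \<epsilon>)) \<partial>M) < \<infinity>"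
  shows "\<exists>c>0.
      (\<lambda>n. measure M {\<omega> \<in> space M. extinction_time Z \<omega> = enat (Suc n)})
        \<sim>[sequentially] (\<lambda>n. c * real n powr (-3/2)) \<and>
      (\<exists>\<nu> :: nat pmf. (\<forall>y. pmf \<nu> y < 1) \<and>
         weak_conv_m
           (\<lambda>n. distr (uniform_measure M {\<omega> \<in> space M. extinction_time Z \<omega> = enat (Suc n)})
                   borel (\<lambda>\<omega>. real (Z n \<omega>)))
           (distr (measure_pmf \<nu>) borel real))"
proof -
  interpret prob_space M by (rule prob)
  have xi_law: "measure M {\<omega> \<in> space M. \<forall>p\<in>F. \<xi> (fst p) (snd p) \<omega> = k p} = (\<integral>\<omega>. (\<Prod>p\<in>F. Q (fst p) \<omega> (k p)) \<partial>M)"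
    if "finite F" for F k
  proof -
    \<comment> \<open>Taking the whole space as the environment event turns the conditional law of
      the offspring numbers into the averaged one.\<close>
    have "UNIV \<in> sets (PiM UNIV (\<lambda>_::nat. PiM UNIV (\<lambda>_::nat. borel :: real measure)))"
      using sets.top[of "PiM UNIV (\<lambda>_::nat. PiM UNIV (\<lambda>_::nat. borel :: real measure))"] by (simp add: space_PiM)
    from xi_cond[OF that this, of k]
    have "measure M {\<omega> \<in> space M. \<forall>p\<in>F. \<xi> (fst p) (snd p) \<omega> = k p} = (\<integral>\<omega>. indicator (space M) \<omega> * (\<Prod>p\<in>F. Q (fst p) \<omega> (k p)) \<partial>M)"
      by (simp add: Int_absorb1 subset_eq)
    also have "\<dots> = (\<integral>\<omega>. (\<Prod>p\<in>F. Q (fst p) \<omega> (k p)) \<partial>M)"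
      by (rule Bochner_Integration.integral_cong) auto
    finally show ?thesis .
  qed
  have "bpre_fl M Q \<xi> Z chi"
    by unfold_locales (use Q_meas Q_law xi_meas xi_law Z0 ZSuc Q_indep Q_ident fraclin A1 A2 in auto)
  thus ?thesis by (rule bpre_fl.conditional_limit)
qed

end
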